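(* Let $f(t)=t^{1/3}\big(1+\ln(t)\sin^2(\sqrt t)\big)$ for $t\ge e$. There exists $\phi_f\in C^2([e,\infty[,\mathbb R)$ with $\phi_f(t)\to0$ as $t\to\infty$ such that, for any $s>0$ and any initial condition $u(t_0)\in\mathcal H^s\setminus\{0\}$ with $t_0=e$, there exists a constant $c_0>1$ such that the solution $u(t)$ of $$\frac1{\mathrm i}\partial_tu=\frac12\big(D^2+(1+\phi_f(t))X^2\big)u$$ satisfies $c_0^{-1}f(t)^{s/2}\le\|u(t)\|_s\le c_0f(t)^{s/2}$ for all $t\ge t_0$. In particular, $$\liminf_{t\to\infty}\frac{\|u(t)\|_{s}}{t^{s/6}}\in[c_0^{-1},c_0],\qquad \limsup_{t\to\infty}\frac{\|u(t)\|_{s}}{t^{s/6}\ln(t)^{s/2}}\in[c_0^{-1},c_0].$$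
   Context: On $\mathbb R$: $D=-\mathrm i\frac{d}{dx}$, $X$ is multiplication by $x$, $\mathcal T=\frac12(D^2+X^2)$, $\mathcal H^s=\{u\in L^2(\mathbb R):\mathcal T^{s/2}u\in L^2\}$ with norm $\|u\|_s=(\|\mathcal T^{s/2}u\|_{L^2}^2+\|u\|_{L^2}^2)^{1/2}$. *)

theory Defs
  imports "HOL-Analysis.Analysis"
begin

text \<open>Physicists' Hermite polynomials and normalized Hermite functions h_n,
  the eigenfunctions of T = (D^2 + X^2)/2 with eigenvalues n + 1/2.\<close>

fun hermite_poly :: "nat \<Rightarrow> real \<Rightarrow> real" where
  "hermite_poly 0 x = 1"
| "hermite_poly (Suc 0) x = 2 * x"
| "hermite_poly (Suc (Suc n)) x = 2 * x * hermite_poly (Suc n) x - 2 * real (Suc n) * hermite_poly n x"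

definition hermite_fun :: "nat \<Rightarrow> real \<Rightarrow> real" where
  "hermite_fun n x = hermite_poly n x * exp (- (x^2) / 2) / sqrt (2 ^ n * fact n * sqrt pi)"

definition L2 :: "(real \<Rightarrow> complex) \<Rightarrow> bool" where
  "L2 g \<longleftrightarrow> g \<in> borel_measurable lborel \<and> integrable lborel (\<lambda>x. (cmod (g x))^2)"

definition L2_norm_sq :: "(real \<Rightarrow> complex) \<Rightarrow> real" where
  "L2_norm_sq g = (\<integral>x. (cmod (g x))^2 \<partial>lborel)"

definition hcoef :: "(real \<Rightarrow> complex) \<Rightarrow> nat \<Rightarrow> complex" where
  "hcoef g n = (\<integral>x. g x * complex_of_real (hermite_fun n x) \<partial>lborel)"

text \<open>||T^(s/2) g||_{L2}^2, via the spectral decomposition of T (functional calculus).\<close>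
definition T_pow_norm_sq :: "real \<Rightarrow> (real \<Rightarrow> complex) \<Rightarrow> real" where
  "T_pow_norm_sq s g = (\<Sum>n. (real n + 1/2) powr s * (cmod (hcoef g n))^2)"

definition in_Hs :: "real \<Rightarrow> (real \<Rightarrow> complex) \<Rightarrow> bool" where
  "in_Hs s g \<longleftrightarrow> L2 g \<and> summable (\<lambda>n. (real n + 1/2) powr s * (cmod (hcoef g n))^2)"

definition Hs_norm :: "real \<Rightarrow> (real \<Rightarrow> complex) \<Rightarrow> real" where
  "Hs_norm s g = sqrt (T_pow_norm_sq s g + L2_norm_sq g)"

definition test_fun :: "(real \<Rightarrow> real) \<Rightarrow> bool" where
  "test_fun \<phi> \<longleftrightarrow> (\<forall>k x. ((deriv ^^ k) \<phi>) differentiable (at x)) \<and>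
                    (\<exists>R. \<forall>x. \<bar>x\<bar> > R \<longrightarrow> \<phi> x = 0)"

text \<open>Weak (distributional) solution u \<in> C([t0,\<infinity>), L2) of
  (1/i) \<partial>_t u = 1/2 (D^2 + (1 + a(t)) X^2) u, u(t0) = u0.\<close>
definition is_solution ::
  "(real \<Rightarrow> real) \<Rightarrow> real \<Rightarrow> (real \<Rightarrow> complex) \<Rightarrow> (real \<Rightarrow> real \<Rightarrow> complex) \<Rightarrow> bool" where
  "is_solution a t0 u0 u \<longleftrightarrow>
     (\<forall>t\<ge>t0. L2 (u t)) \<and>
     (AE x in lborel. u t0 x = u0 x) \<and>
     (\<forall>t\<ge>t0. ((\<lambda>\<tau>. L2_norm_sq (\<lambda>x. u \<tau> x - u t x)) \<longlongrightarrow> 0) (at t within {t0..})) \<and>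
     (\<forall>\<phi>. test_fun \<phi> \<longrightarrow> (\<forall>t\<ge>t0.
        ((\<lambda>\<tau>. \<integral>x. u \<tau> x * complex_of_real (\<phi> x) \<partial>lborel) has_vector_derivative
          (\<i> * (\<integral>x. u t x * complex_of_real
                 ((- deriv (deriv \<phi>) x + (1 + a t) * x^2 * \<phi> x) / 2) \<partial>lborel)))
        (at t within {t0..})))"

definition f_rate :: "real \<Rightarrow> real" where
  "f_rate t = t powr (1/3) * (1 + ln t * (sin (sqrt t))^2)"

end

theory Submission
  imports Defs "HOL-Probability.Probability" "HOL-Complex_Analysis.Complex_Analysis" "HOL-Real_Asymp.Real_Asymp"
begin

text \<open>
  If \<open>\<rho>\<close> solves the Ermakov--Pinney equation \<open>\<rho>'' = 1 / \<rho> ^ 3 - (1 + \<phi>) \<rho>\<close> and \<open>\<theta>' = 1 / \<rho>\<^sup>2\<close>, the Hermite functions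
  dilated by \<open>\<rho>\<close> and multiplied by a quadratic phase form, for each \<open>t\<close>, an orthonormal basis of exact solutions.
  Every weak solution therefore has constant coefficients in this moving basis. The ladder operators of the
  moving basis are combinations of the fixed ones of size \<open>\<surd>E\<close>, \<open>E = \<rho>\<^sup>2 + \<rho>'\<^sup>2 + 1 / \<rho>\<^sup>2\<close>, and interpolation gives
  \<open>\<parallel>u(t)\<parallel>\<^sub>s \<lesssim> E powr (s/2)\<close>. Conversely, were the mass of \<open>u(t)\<close> concentrated on Hermite modes far below \<open>E\<close>, then
  the fixed coefficient sequence of \<open>u\<close> would be almost annihilated by a phase-rotated position operator, whose
  three-term recurrence has no square-summable solution except 0.

  As \<open>\<rho>\<close> is the modulus of a complex solution of \<open>y'' + (1 + \<phi>) y = 0\<close>, \<open>E\<close> is the sum of squares of a normalised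
  fundamental system and its derivative. The perturbation is designed backwards: \<open>\<phi>\<close> is such that
  \<open>amp * cos\<close> solves the oscillator, where \<open>amp\<^sup>2\<close> is comparable to \<open>f\<close>, and reduction of order shows
  that the second solution is not larger. The limit inferior is bounded above along \<open>t = (n \<pi>)\<^sup>2\<close>,
  the limit superior is bounded below along \<open>t = (n \<pi> + \<pi>/2)\<^sup>2\<close>.
\<close>

subsection \<open>The space of square-integrable functions\<close>

text \<open>Why such a perturbation can tend to 0: to leading order \<open>phi\<close> is
  \<open>2 * h0 t * sin (2 * t)\<close>, a parametric resonance at twice the unit frequency. On
  average it makes the amplitude grow at the exponential rate \<open>h0 / 2\<close>, where
  \<open>h0\<close> is the logarithmic derivative of the target. This derivative is O(ln t / sqrt
  t), because the target oscillates in the variable sqrt t. The factor t^(1/3) keeps the second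
  solution harmless: the remainder in the reduction of order is of size (ln t)^2 / t, not integrable
  by itself, and division by amp^2 supplies the missing power. On the side of the equation the
  obstacle is the weak notion of solution. The lower bound must hold for every nonzero datum without
  extra regularity; it rests on the conserved mass alone.\<close>

definition ip :: "(real \<Rightarrow> complex) \<Rightarrow> (real \<Rightarrow> complex) \<Rightarrow> complex" where
  "ip g h = (\<integral>x. g x * cnj (h x) \<partial>lborel)"

definition l2n :: "(real \<Rightarrow> complex) \<Rightarrow> real" where
  "l2n g = sqrt (L2_norm_sq g)"

lemma borel_measurable_cnj [measurable (raw)]:
  "f \<in> borel_measurable M \<Longrightarrow> (\<lambda>x. cnj (f x)) \<in> borel_measurable M"
  by (rule borel_measurable_continuous_on[of cnj]) (auto intro: continuous_intros)

lemma L2_measurable: "L2 g \<Longrightarrow> g \<in> borel_measurable lborel"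
  by (simp add: L2_def)

lemma L2_norm_sq_nonneg [simp]: "L2_norm_sq g \<ge> 0"
  by (simp add: L2_norm_sq_def)

lemma l2n_nonneg [simp]: "l2n g \<ge> 0"
  by (simp add: l2n_def)

lemma l2n_sq: "(l2n g)\<^sup>2 = L2_norm_sq g"
  by (simp add: l2n_def)

lemma L2_bound:
  assumes "L2 g" "h \<in> borel_measurable lborel" "\<And>x. cmod (h x) \<le> C * cmod (g x)"
  shows "L2 h"
proof -
  have "integrable lborel (\<lambda>x. (cmod (h x))\<^sup>2)"
  proof (rule Bochner_Integration.integrable_bound)
    show "integrable lborel (\<lambda>x. C\<^sup>2 * (cmod (g x))\<^sup>2)"
      using assms(1) by (simp add: L2_def)
    show "AE x in lborel. norm ((cmod (h x))\<^sup>2) \<le> norm (C\<^sup>2 * (cmod (g x))\<^sup>2)"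
      using assms(3) by (auto intro!: AE_I2 power_mono simp flip: power_mult_distrib)
  qed (use assms(2) in measurable)
  then show ?thesis using assms(2) by (simp add: L2_def)
qed

lemma L2_zero [simp]: "L2 (\<lambda>x. 0)"
  by (simp add: L2_def)

lemma L2_add:
  assumes "L2 g" "L2 h" shows "L2 (\<lambda>x. g x + h x)"
proof -
  have [measurable]: "g \<in> borel_measurable lborel" "h \<in> borel_measurable lborel"
    using assms by (auto simp: L2_def)
  have "integrable lborel (\<lambda>x. (cmod (g x + h x))\<^sup>2)"
  proof (rule Bochner_Integration.integrable_bound)
    show "integrable lborel (\<lambda>x. 2 * (cmod (g x))\<^sup>2 + 2 * (cmod (h x))\<^sup>2)"
      using assms by (simp add: L2_def)
    have "(cmod (a + b))\<^sup>2 \<le> 2 * (cmod a)\<^sup>2 + 2 * (cmod b)\<^sup>2" for a b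
    proof -
      have "(cmod (a + b))\<^sup>2 \<le> (cmod a + cmod b)\<^sup>2"
        by (intro power_mono norm_triangle_ineq) auto
      also have "\<dots> \<le> 2 * (cmod a)\<^sup>2 + 2 * (cmod b)\<^sup>2"
        using zero_le_power2[of "cmod a - cmod b"] by (simp add: power2_eq_square algebra_simps)
      finally show ?thesis .
    qed
    then show "AE x in lborel. norm ((cmod (g x + h x))\<^sup>2)
        \<le> norm (2 * (cmod (g x))\<^sup>2 + 2 * (cmod (h x))\<^sup>2)"
      by (auto intro!: AE_I2)
  qed measurable
  then show ?thesis by (simp add: L2_def)
qed

lemma L2_scale: "L2 g \<Longrightarrow> L2 (\<lambda>x. c * g x)"
  by (rule L2_bound[of g _ "cmod c"]) (auto simp: L2_def norm_mult)

lemma L2_diff: "L2 g \<Longrightarrow> L2 h \<Longrightarrow> L2 (\<lambda>x. g x - h x)"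
  using L2_add[of g "\<lambda>x. (-1) * h x"] L2_scale[of h "-1"] by simp

lemma L2_sum: "(\<And>i. i \<in> A \<Longrightarrow> L2 (g i)) \<Longrightarrow> L2 (\<lambda>x. \<Sum>i\<in>A. g i x)"
  by (induction A rule: infinite_finite_induct) (auto intro: L2_add)

lemma L2_cnj: "L2 g \<Longrightarrow> L2 (\<lambda>x. cnj (g x))"
  by (rule L2_bound[of g _ 1]) (auto simp: L2_def)

lemma L2_norm_sq_AE_cong:
  assumes "g \<in> borel_measurable lborel" "h \<in> borel_measurable lborel" "AE x in lborel. g x = h x"
  shows "L2_norm_sq g = L2_norm_sq h"
  unfolding L2_norm_sq_def using assms by (intro integral_cong_AE) auto

lemma ip_AE_cong:
  assumes "g \<in> borel_measurable lborel" "h \<in> borel_measurable lborel" "AE x in lborel. g x = h x"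
    and "k \<in> borel_measurable lborel"
  shows "ip g k = ip h k"
  unfolding ip_def using assms by (intro integral_cong_AE) auto

lemma integrable_L2_mult:
  assumes "L2 g" "L2 h" shows "integrable lborel (\<lambda>x. g x * h x)"
proof (rule Bochner_Integration.integrable_bound)
  show "integrable lborel (\<lambda>x. (cmod (g x))\<^sup>2 + (cmod (h x))\<^sup>2)"
    using assms by (simp add: L2_def)
  have "cmod a * cmod b \<le> (cmod a)\<^sup>2 + (cmod b)\<^sup>2" for a b
  proof -
    have "2 * (cmod a * cmod b) \<le> (cmod a)\<^sup>2 + (cmod b)\<^sup>2"
      using sum_squares_bound[of "cmod a" "cmod b"] by (simp add: mult.assoc)
    moreover have "0 \<le> cmod a * cmod b" by simp
    ultimately show ?thesis by linarith
  qed
  then show "AE x in lborel. norm (g x * h x) \<le> norm ((cmod (g x))\<^sup>2 + (cmod (h x))\<^sup>2)"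
    by (auto intro!: AE_I2 simp: norm_mult)
  show "(\<lambda>x. g x * h x) \<in> borel_measurable lborel"
    using assms by (auto simp: L2_def)
qed

lemma integrable_ip: "L2 g \<Longrightarrow> L2 h \<Longrightarrow> integrable lborel (\<lambda>x. g x * cnj (h x))"
  by (intro integrable_L2_mult L2_cnj)

lemma ip_cnj: "ip h g = cnj (ip g h)"
proof -
  have "ip h g = (\<integral>x. cnj (g x * cnj (h x)) \<partial>lborel)"
    by (simp add: ip_def mult.commute)
  also have "\<dots> = cnj (ip g h)"
    unfolding ip_def by (simp del: complex_cnj_mult)
  finally show ?thesis .
qed

lemma ip_add_left: "L2 g \<Longrightarrow> L2 g' \<Longrightarrow> L2 h \<Longrightarrow> ip (\<lambda>x. g x + g' x) h = ip g h + ip g' h"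
  unfolding ip_def by (simp add: integrable_ip distrib_right)

lemma ip_diff_left: "L2 g \<Longrightarrow> L2 g' \<Longrightarrow> L2 h \<Longrightarrow> ip (\<lambda>x. g x - g' x) h = ip g h - ip g' h"
  unfolding ip_def by (simp add: integrable_ip left_diff_distrib)

lemma ip_scale_left: "ip (\<lambda>x. c * g x) h = c * ip g h"
  unfolding ip_def by (simp add: mult.assoc)

lemma ip_scale_right: "ip g (\<lambda>x. c * h x) = cnj c * ip g h"
  by (simp add: ip_cnj[of g] ip_scale_left)

lemma ip_add_right: "L2 g \<Longrightarrow> L2 h \<Longrightarrow> L2 h' \<Longrightarrow> ip g (\<lambda>x. h x + h' x) = ip g h + ip g h'"
  by (simp add: ip_cnj[of g] ip_add_left)

lemma ip_diff_right: "L2 g \<Longrightarrow> L2 h \<Longrightarrow> L2 h' \<Longrightarrow> ip g (\<lambda>x. h x - h' x) = ip g h - ip g h'"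
  by (simp add: ip_cnj[of g] ip_diff_left)

lemma ip_zero_left [simp]: "ip (\<lambda>x. 0) h = 0"
  by (simp add: ip_def)

lemma ip_sum_left:
  "(\<And>i. i \<in> A \<Longrightarrow> L2 (g i)) \<Longrightarrow> L2 h \<Longrightarrow> ip (\<lambda>x. \<Sum>i\<in>A. g i x) h = (\<Sum>i\<in>A. ip (g i) h)"
  by (induction A rule: infinite_finite_induct) (auto simp: ip_add_left L2_sum)

lemma ip_sum_right:
  "(\<And>i. i \<in> A \<Longrightarrow> L2 (g i)) \<Longrightarrow> L2 h \<Longrightarrow> ip h (\<lambda>x. \<Sum>i\<in>A. g i x) = (\<Sum>i\<in>A. ip h (g i))"
  by (simp add: ip_cnj[of h] ip_sum_left)

lemma ip_self: "ip g g = of_real (L2_norm_sq g)"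
proof -
  have "ip g g = (\<integral>x. complex_of_real ((cmod (g x))\<^sup>2) \<partial>lborel)"
    unfolding ip_def by (simp only: complex_norm_square)
  then show ?thesis unfolding L2_norm_sq_def by (simp only: integral_complex_of_real)
qed

lemma L2_norm_sq_diff:
  assumes "L2 g" "L2 h"
  shows "L2_norm_sq (\<lambda>x. g x - h x) = L2_norm_sq g - 2 * Re (ip g h) + L2_norm_sq h"
proof -
  have "of_real (L2_norm_sq (\<lambda>x. g x - h x)) = ip g g - ip g h - (ip h g - ip h h)"
    unfolding ip_self[symmetric] using assms by (simp add: ip_diff_left ip_diff_right L2_diff)
  also have "\<dots> = of_real (L2_norm_sq g - 2 * Re (ip g h) + L2_norm_sq h)"
    using ip_cnj[of h g] by (auto simp: ip_self complex_eq_iff)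
  finally show ?thesis using of_real_eq_iff by blast
qed

lemma L2_norm_sq_add:
  assumes "L2 g" "L2 h"
  shows "L2_norm_sq (\<lambda>x. g x + h x) = L2_norm_sq g + 2 * Re (ip g h) + L2_norm_sq h"
proof -
  have "of_real (L2_norm_sq (\<lambda>x. g x + h x)) = ip g g + ip g h + (ip h g + ip h h)"
    unfolding ip_self[symmetric] using assms by (simp add: ip_add_left ip_add_right L2_add)
  also have "\<dots> = of_real (L2_norm_sq g + 2 * Re (ip g h) + L2_norm_sq h)"
    using ip_cnj[of h g] by (auto simp: ip_self complex_eq_iff)
  finally show ?thesis using of_real_eq_iff by blast
qed

lemma L2_norm_sq_scale: "L2_norm_sq (\<lambda>x. c * g x) = (cmod c)\<^sup>2 * L2_norm_sq g"
  unfolding L2_norm_sq_def by (simp add: norm_mult power_mult_distrib)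

lemma L2_norm_sq_minus: "L2_norm_sq (\<lambda>x. g x - h x) = L2_norm_sq (\<lambda>x. h x - g x)"
  by (simp add: L2_norm_sq_def norm_minus_commute)

lemma l2n_scale: "l2n (\<lambda>x. c * g x) = cmod c * l2n g"
  by (simp add: l2n_def L2_norm_sq_scale real_sqrt_mult)

lemma L2_norm_sq_eq_0:
  assumes "L2 g" shows "L2_norm_sq g = 0 \<longleftrightarrow> (AE x in lborel. g x = 0)"
  unfolding L2_norm_sq_def using assms
  by (subst integral_nonneg_eq_0_iff_AE) (auto simp: L2_def)

lemma cauchy_schwarz_sq:
  assumes "L2 g" "L2 h"
  shows "(cmod (ip g h))\<^sup>2 \<le> L2_norm_sq g * L2_norm_sq h"
proof (cases "L2_norm_sq h = 0")
  case True
  then have "AE x in lborel. g x * cnj (h x) = 0"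
    using L2_norm_sq_eq_0[OF assms(2)] by auto
  then have "ip g h = 0" unfolding ip_def by (rule integral_eq_zero_AE)
  then show ?thesis by simp
next
  case False
  define a where "a = L2_norm_sq h"
  define c where "c = ip g h"
  have a: "a > 0" using False by (simp add: a_def less_le)
  have c2: "Re c * Re c + Im c * Im c = cmod c * cmod c"
    using cmod_power2[of c] by (simp add: power2_eq_square)
  have "0 \<le> L2_norm_sq (\<lambda>x. of_real a * g x - c * h x)" by simp
  also have "\<dots> = a\<^sup>2 * L2_norm_sq g - 2 * (a * (cmod c)\<^sup>2) + (cmod c)\<^sup>2 * a"
    using assms
    by (subst L2_norm_sq_diff)
       (auto simp: L2_scale L2_norm_sq_scale ip_scale_left ip_scale_right c_def[symmetric] a_def
         c2 power2_eq_square)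
  finally have "0 \<le> a * (a * L2_norm_sq g - (cmod c)\<^sup>2)"
    by (simp add: power2_eq_square algebra_simps)
  then have "(cmod c)\<^sup>2 \<le> a * L2_norm_sq g" using a by (simp add: zero_le_mult_iff)
  then show ?thesis by (simp add: a_def c_def mult.commute)
qed

lemma cauchy_schwarz: "L2 g \<Longrightarrow> L2 h \<Longrightarrow> cmod (ip g h) \<le> l2n g * l2n h"
  using real_sqrt_le_mono[OF cauchy_schwarz_sq] by (simp add: l2n_def real_sqrt_mult)

lemma l2n_triangle:
  assumes "L2 g" "L2 h" shows "l2n (\<lambda>x. g x + h x) \<le> l2n g + l2n h"
proof (rule power2_le_imp_le)
  have "Re (ip g h) \<le> l2n g * l2n h"
    using complex_Re_le_cmod cauchy_schwarz[OF assms] order_trans by blast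
  then show "(l2n (\<lambda>x. g x + h x))\<^sup>2 \<le> (l2n g + l2n h)\<^sup>2"
    using assms by (simp add: l2n_sq L2_norm_sq_add power2_sum)
qed simp

lemma l2n_minus: "l2n (\<lambda>x. g x - h x) = l2n (\<lambda>x. h x - g x)"
  unfolding l2n_def by (subst L2_norm_sq_minus) (rule refl)

lemma l2n_triangle_diff:
  assumes "L2 g" "L2 h" "L2 k"
  shows "l2n (\<lambda>x. g x - k x) \<le> l2n (\<lambda>x. g x - h x) + l2n (\<lambda>x. h x - k x)"
  using l2n_triangle[OF L2_diff[OF assms(1,2)] L2_diff[OF assms(2,3)]] by simp

lemma ip_continuous_left:
  assumes "\<And>n. L2 (S n)" "L2 g" "L2 h" "(\<lambda>n. l2n (\<lambda>x. S n x - g x)) \<longlonglongrightarrow> 0"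
  shows "(\<lambda>n. ip (S n) h) \<longlonglongrightarrow> ip g h"
proof (rule LIM_zero_cancel, rule Lim_null_comparison)
  show "\<forall>\<^sub>F n in sequentially. norm (ip (S n) h - ip g h) \<le> l2n (\<lambda>x. S n x - g x) * l2n h"
    using assms cauchy_schwarz[OF L2_diff] by (auto simp flip: ip_diff_left)
  show "(\<lambda>n. l2n (\<lambda>x. S n x - g x) * l2n h) \<longlonglongrightarrow> 0"
    using tendsto_mult[OF assms(4) tendsto_const, of "l2n h"] by simp
qed

text \<open>Fatou's lemma applied to the squared moduli. It gives membership in L2 and the norm
  bound at once, for a limit that is known only pointwise almost everywhere.\<close>

lemma L2_Fatou:
  assumes "\<And>k. L2 (T k)" "h \<in> borel_measurable lborel" "AE x in lborel. (\<lambda>k. T k x) \<longlonglongrightarrow> h x"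
    and "\<And>k. L2_norm_sq (T k) \<le> C"
  shows "L2 h \<and> L2_norm_sq h \<le> C"
proof -
  have C: "C \<ge> 0" using assms(4)[of 0] L2_norm_sq_nonneg order_trans by blast
  have T [measurable]: "T k \<in> borel_measurable lborel" for k using assms(1) by (simp add: L2_def)
  have "(\<integral>\<^sup>+ x. ennreal ((cmod (h x))\<^sup>2) \<partial>lborel)
      = (\<integral>\<^sup>+ x. liminf (\<lambda>k. ennreal ((cmod (T k x))\<^sup>2)) \<partial>lborel)"
    using assms(3)
    by (intro nn_integral_cong_AE, eventually_elim)
       (auto intro!: lim_imp_Liminf[symmetric] tendsto_ennrealI tendsto_intros)
  also have "\<dots> \<le> liminf (\<lambda>k. \<integral>\<^sup>+ x. ennreal ((cmod (T k x))\<^sup>2) \<partial>lborel)"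
    by (intro nn_integral_liminf) measurable
  also have "\<dots> \<le> liminf (\<lambda>k. ennreal C)"
  proof (intro Liminf_mono always_eventually allI)
    fix k
    show "(\<integral>\<^sup>+ x. ennreal ((cmod (T k x))\<^sup>2) \<partial>lborel) \<le> ennreal C"
      using assms(1)[of k] assms(4)[of k]
      by (subst nn_integral_eq_integral) (auto simp: L2_def L2_norm_sq_def intro: ennreal_leI)
  qed
  also have "\<dots> = ennreal C" by (simp add: Liminf_const)
  finally have le: "(\<integral>\<^sup>+ x. ennreal ((cmod (h x))\<^sup>2) \<partial>lborel) \<le> ennreal C" .
  have int: "integrable lborel (\<lambda>x. (cmod (h x))\<^sup>2)"
    using assms(2) le_less_trans[OF le, of \<infinity>] by (intro integrableI_bounded) auto
  moreover have "L2_norm_sq h \<le> C"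
    using le C unfolding L2_norm_sq_def
    by (subst (asm) nn_integral_eq_integral[OF int]) (auto simp: ennreal_le_iff)
  ultimately show ?thesis using assms(2) by (simp add: L2_def)
qed

text \<open>The Riesz-Fischer argument: a subsequence with fast decaying differences converges
  almost everywhere, and Fatou's lemma turns the pointwise limit into a limit in norm.\<close>

lemma L2_complete:
  assumes L2: "\<And>n. L2 (S n)"
    and cauchy: "\<And>\<epsilon>. \<epsilon> > 0 \<Longrightarrow> \<exists>N. \<forall>m\<ge>N. \<forall>n\<ge>N. L2_norm_sq (\<lambda>x. S m x - S n x) < \<epsilon>"
  shows "\<exists>g. L2 g \<and> (\<lambda>n. L2_norm_sq (\<lambda>x. S n x - g x)) \<longlonglongrightarrow> 0"
proof -
  have [measurable]: "S n \<in> borel_measurable lborel" for n using L2 by (simp add: L2_def)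
  have "\<exists>N. \<forall>m\<ge>N. \<forall>n\<ge>N. L2_norm_sq (\<lambda>x. S m x - S n x) < (1/4)^k" for k :: nat
    by (rule cauchy) simp
  then obtain N where N: "\<And>k m n. m \<ge> N k \<Longrightarrow> n \<ge> N k \<Longrightarrow> L2_norm_sq (\<lambda>x. S m x - S n x) < (1/4)^k"
    by metis
  \<comment> \<open>Summing the \<open>N i\<close> makes the indices monotone and at least
    \<open>N k\<close>, although \<open>N\<close> itself need not be increasing.\<close>
  define r where "r k = (\<Sum>i\<le>k. N i) + k" for k
  have rN: "r k \<ge> N k" for k
    unfolding r_def using member_le_sum[of k "{..k}" N] by simp
  have r1: "r (Suc k) \<ge> r k" for k by (simp add: r_def)
  define D where "D k x = S (r (Suc k)) x - S (r k) x" for k x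
  have [measurable]: "D k \<in> borel_measurable lborel" for k unfolding D_def by measurable
  \<comment> \<open>The bound (1/4)^k leaves room for a weight 2^k: the weighted series of integrals
    still converges. At a point where the weighted series of squares is finite, \<open>D k x\<close>
    decays like 2^(-k/2) and is therefore summable.\<close>
  have D: "L2_norm_sq (D k) \<le> (1/4)^k" for k
    unfolding D_def by (intro less_imp_le N order_trans[OF rN r1] rN)
  have L2D: "L2 (D k)" for k unfolding D_def by (intro L2_diff L2)
  have "(\<integral>\<^sup>+ x. (\<Sum>k. ennreal (2^k * (cmod (D k x))\<^sup>2)) \<partial>lborel)
      = (\<Sum>k. \<integral>\<^sup>+ x. ennreal (2^k * (cmod (D k x))\<^sup>2) \<partial>lborel)"
    by (rule nn_integral_suminf) measurable
  also have "\<dots> \<le> (\<Sum>k. ennreal ((1/2)^k))"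
  proof (intro suminf_le)
    fix k
    have "(\<integral>\<^sup>+ x. ennreal (2^k * (cmod (D k x))\<^sup>2) \<partial>lborel) = ennreal (2^k * L2_norm_sq (D k))"
      using L2D[of k] by (subst nn_integral_eq_integral) (auto simp: L2_def L2_norm_sq_def)
    also have "\<dots> \<le> ennreal (2^k * (1/4)^k)"
      using D by (intro ennreal_leI mult_left_mono) auto
    also have "\<dots> = ennreal ((1/2)^k)" by (simp flip: power_mult_distrib)
    finally show "(\<integral>\<^sup>+ x. ennreal (2^k * (cmod (D k x))\<^sup>2) \<partial>lborel) \<le> ennreal ((1/2)^k)" .
  qed auto
  also have "\<dots> < \<infinity>"
    by (subst suminf_ennreal2) (auto simp: summable_geometric)
  finally have fin: "(\<integral>\<^sup>+ x. (\<Sum>k. ennreal (2^k * (cmod (D k x))\<^sup>2)) \<partial>lborel) \<noteq> \<infinity>" by simp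
  have "AE x in lborel. (\<Sum>k. ennreal (2^k * (cmod (D k x))\<^sup>2)) \<noteq> \<infinity>"
    by (rule nn_integral_noteq_infinite[OF _ fin]) measurable
  then have conv: "AE x in lborel. convergent (\<lambda>k. S (r k) x)"
  proof eventually_elim
    case (elim x)
    then have "summable (\<lambda>k. 2^k * (cmod (D k x))\<^sup>2)"
      by (intro summable_suminf_not_top) auto
    then have "bounded (range (\<lambda>k. 2^k * (cmod (D k x))\<^sup>2))"
      using summable_imp_bounded by blast
    then obtain B where B: "\<And>k. norm (2^k * (cmod (D k x))\<^sup>2) \<le> B"
      unfolding bounded_iff by blast
    have bd: "norm (D k x) \<le> sqrt B * (sqrt (1/2))^k" for k
    proof -
      have "(cmod (D k x))\<^sup>2 \<le> B * (1/2)^k"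
        using B[of k] by (simp add: field_simps power_divide)
      then have "cmod (D k x) \<le> sqrt (B * (1/2)^k)" by (rule real_le_rsqrt)
      then show ?thesis by (simp only: real_sqrt_mult real_sqrt_power)
    qed
    have "sqrt (1/2) < (1::real)" using real_sqrt_less_mono[of "1/2" 1] by simp
    then have "summable (\<lambda>k. sqrt B * (sqrt (1/2))^k)"
      by (intro summable_mult summable_geometric) auto
    then have "summable (\<lambda>k. D k x)"
      by (rule summable_comparison_test'[where N=0]) (rule bd)
    then have "convergent (\<lambda>n. \<Sum>k<n. D k x)" by (simp add: summable_iff_convergent)
    moreover have "(\<Sum>k<n. D k x) = S (r n) x - S (r 0) x" for n
      unfolding D_def by (rule sum_lessThan_telescope)
    ultimately have "convergent (\<lambda>n. S (r n) x - S (r 0) x)" by simp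
    then show ?case using convergent_diff_const_right_iff by blast
  qed
  define g where "g x = lim (\<lambda>k. S (r k) x)" for x
  have gm [measurable]: "g \<in> borel_measurable lborel" unfolding g_def by measurable
  have gl: "AE x in lborel. (\<lambda>k. S (r k) x) \<longlonglongrightarrow> g x"
    using conv by eventually_elim (simp add: g_def convergent_LIMSEQ_iff)
  \<comment> \<open>The Cauchy bound between \<open>S m\<close> and the later members of the
    subsequence passes to their limit \<open>g\<close>.\<close>
  have key: "L2 (\<lambda>x. S m x - g x) \<and> L2_norm_sq (\<lambda>x. S m x - g x) \<le> (1/4)^k" if "m \<ge> r k" for m k
  proof (rule L2_Fatou[where T = "\<lambda>j x. S m x - S (r (j + k)) x"])
    show "AE x in lborel. (\<lambda>j. S m x - S (r (j + k)) x) \<longlonglongrightarrow> S m x - g x"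
      using gl
    proof eventually_elim
      case (elim x)
      then show ?case using LIMSEQ_ignore_initial_segment[OF elim, of k] by (intro tendsto_intros) auto
    qed
    have "r (j + k) \<ge> r k" for j
    proof (induction j)
      case (Suc j)
      then show ?case using r1[of "j + k"] by simp
    qed simp
    then show "L2_norm_sq (\<lambda>x. S m x - S (r (j + k)) x) \<le> (1/4)^k" for j
      by (intro less_imp_le[OF N[OF order_trans[OF rN that] order_trans[OF rN]]])
  qed (auto intro: L2_diff L2)
  have "L2 g"
    using L2_diff[OF L2[of "r 0"] conjunct1[OF key[of 0 "r 0"]]] by simp
  moreover have "(\<lambda>n. L2_norm_sq (\<lambda>x. S n x - g x)) \<longlonglongrightarrow> 0"
  proof (rule LIMSEQ_I)
    fix e :: real assume "e > 0"
    then obtain k where k: "(1/4)^k < e" using real_arch_pow_inv[of e "1/4"] by auto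
    show "\<exists>no. \<forall>n\<ge>no. norm (L2_norm_sq (\<lambda>x. S n x - g x) - 0) < e"
    proof (intro exI[of _ "r k"] allI impI)
      fix n assume "n \<ge> r k"
      then show "norm (L2_norm_sq (\<lambda>x. S n x - g x) - 0) < e"
        using key[of k n] k by simp
    qed
  qed
  ultimately show ?thesis by blast
qed

subsection \<open>Orthonormal bases\<close>

text \<open>Completeness is required as triviality of the orthogonal complement, which is the form
  that a moment argument delivers. Convergence of the expansion and Parseval's identity are
  consequences.\<close>

locale onb =
  fixes e :: "nat \<Rightarrow> real \<Rightarrow> complex"
  assumes L2e: "L2 (e n)"
    and orth: "ip (e m) (e n) = (if m = n then 1 else 0)"
    and complete: "L2 g \<Longrightarrow> (\<And>n. ip g (e n) = 0) \<Longrightarrow> AE x in lborel. g x = 0"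
begin

lemma L2_comb: "L2 (\<lambda>x. \<Sum>n\<in>A. c n * e n x)"
  by (intro L2_sum L2_scale L2e)

lemma ip_comb: "finite A \<Longrightarrow> ip (\<lambda>x. \<Sum>n\<in>A. c n * e n x) (e m) = (if m \<in> A then c m else 0)"
proof -
  assume A: "finite A"
  have "ip (\<lambda>x. \<Sum>n\<in>A. c n * e n x) (e m) = (\<Sum>n\<in>A. c n * ip (e n) (e m))"
    by (subst ip_sum_left) (simp_all add: L2_scale L2e ip_scale_left)
  also have "\<dots> = (\<Sum>n\<in>A. if n = m then c n else 0)"
    by (intro sum.cong) (simp_all add: orth)
  also have "\<dots> = (if m \<in> A then c m else 0)" using A by (rule sum.delta)
  finally show ?thesis .
qed

lemma norm_comb:
  assumes "finite A" shows "L2_norm_sq (\<lambda>x. \<Sum>n\<in>A. c n * e n x) = (\<Sum>n\<in>A. (cmod (c n))\<^sup>2)"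
proof -
  have "complex_of_real (L2_norm_sq (\<lambda>x. \<Sum>n\<in>A. c n * e n x)) = (\<Sum>m\<in>A. cnj (c m) * c m)"
    unfolding ip_self[symmetric] using assms
    by (subst ip_sum_right) (auto simp: L2_scale L2e L2_comb ip_scale_right ip_comb)
  also have "\<dots> = of_real (\<Sum>n\<in>A. (cmod (c n))\<^sup>2)"
    by (simp only: of_real_sum complex_norm_square mult.commute)
  finally show ?thesis using of_real_eq_iff by blast
qed

lemma norm_diff_proj:
  assumes "L2 g" "finite A"
  shows "L2_norm_sq (\<lambda>x. g x - (\<Sum>n\<in>A. ip g (e n) * e n x))
    = L2_norm_sq g - (\<Sum>n\<in>A. (cmod (ip g (e n)))\<^sup>2)"
proof -
  have "ip g (\<lambda>x. \<Sum>n\<in>A. ip g (e n) * e n x) = (\<Sum>n\<in>A. cnj (ip g (e n)) * ip g (e n))"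
    by (subst ip_sum_right) (auto simp: assms L2_scale L2e ip_scale_right)
  also have "\<dots> = of_real (\<Sum>n\<in>A. (cmod (ip g (e n)))\<^sup>2)"
    by (simp only: of_real_sum complex_norm_square mult.commute)
  finally have "Re (ip g (\<lambda>x. \<Sum>n\<in>A. ip g (e n) * e n x)) = (\<Sum>n\<in>A. (cmod (ip g (e n)))\<^sup>2)" by simp
  then show ?thesis
    by (simp add: L2_norm_sq_diff[OF assms(1) L2_comb] norm_comb[OF assms(2)])
qed

lemma bessel: "L2 g \<Longrightarrow> finite A \<Longrightarrow> (\<Sum>n\<in>A. (cmod (ip g (e n)))\<^sup>2) \<le> L2_norm_sq g"
  using norm_diff_proj[of g A] L2_norm_sq_nonneg[of "\<lambda>x. g x - (\<Sum>n\<in>A. ip g (e n) * e n x)"] by simp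

lemma riesz_fischer_lim:
  assumes "summable (\<lambda>n. (cmod (c n))\<^sup>2)"
  shows "\<exists>g. L2 g \<and> (\<forall>n. ip g (e n) = c n) \<and>
    (\<lambda>N. L2_norm_sq (\<lambda>x. (\<Sum>n<N. c n * e n x) - g x)) \<longlonglongrightarrow> 0"
proof -
  define S where "S N x = (\<Sum>n<N. c n * e n x)" for N x
  have L2S: "L2 (S N)" for N unfolding S_def by (rule L2_comb)
  have diff: "L2_norm_sq (\<lambda>x. S m x - S n x) = (\<Sum>k=n..<m. (cmod (c k))\<^sup>2)" if "n \<le> m" for m n
  proof -
    have "S m x - S n x = (\<Sum>k=n..<m. c k * e k x)" for x
      unfolding S_def lessThan_atLeast0 using that by (simp add: sum_diff_nat_ivl)
    then show ?thesis by (simp add: norm_comb)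
  qed
  have sym: "L2_norm_sq (\<lambda>x. S m x - S n x) = L2_norm_sq (\<lambda>x. S n x - S m x)" for m n
    by (rule L2_norm_sq_minus)
  have "\<exists>g. L2 g \<and> (\<lambda>n. L2_norm_sq (\<lambda>x. S n x - g x)) \<longlonglongrightarrow> 0"
  proof (rule L2_complete[OF L2S])
    fix \<epsilon> :: real assume "\<epsilon> > 0"
    then obtain N where N: "\<And>m n. m \<ge> N \<Longrightarrow> norm (\<Sum>k=m..<n. (cmod (c k))\<^sup>2) < \<epsilon>"
      using assms[unfolded summable_Cauchy, rule_format, OF \<open>\<epsilon> > 0\<close>] by blast
    show "\<exists>N. \<forall>m\<ge>N. \<forall>n\<ge>N. L2_norm_sq (\<lambda>x. S m x - S n x) < \<epsilon>"
    proof (intro exI[of _ N] allI impI)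
      fix m n assume mn: "m \<ge> N" "n \<ge> N"
      show "L2_norm_sq (\<lambda>x. S m x - S n x) < \<epsilon>"
      proof (cases "n \<le> m")
        case True then show ?thesis using N[OF mn(2), of m] diff by simp
      next
        case False then show ?thesis using N[OF mn(1), of n] by (subst sym) (simp add: diff)
      qed
    qed
  qed
  then obtain g where g: "L2 g" "(\<lambda>n. L2_norm_sq (\<lambda>x. S n x - g x)) \<longlonglongrightarrow> 0" by blast
  have lim: "(\<lambda>n. l2n (\<lambda>x. S n x - g x)) \<longlonglongrightarrow> 0"
    using tendsto_real_sqrt[OF g(2)] by (simp add: l2n_def)
  have "ip g (e n) = c n" for n
  proof -
    have "(\<lambda>N. ip (S N) (e n)) \<longlonglongrightarrow> ip g (e n)"
      by (rule ip_continuous_left[OF L2S g(1) L2e lim])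
    moreover have "\<forall>\<^sub>F N in sequentially. ip (S N) (e n) = c n"
      using eventually_gt_at_top[of n] by eventually_elim (unfold S_def, subst ip_comb, auto)
    ultimately have "(\<lambda>N. c n) \<longlonglongrightarrow> ip g (e n)"
      by (rule Lim_transform_eventually)
    then show ?thesis by (simp add: LIMSEQ_const_iff)
  qed
  then show ?thesis using g unfolding S_def by blast
qed

lemma summable_coeffs:
  assumes "L2 g" shows "summable (\<lambda>n. (cmod (ip g (e n)))\<^sup>2)"
  by (rule bounded_imp_summable[of _ "L2_norm_sq g"]) (simp_all add: bessel[OF assms])

text \<open>The partial sums converge to some limit with the same coefficients as \<open>g\<close>.
  The difference is orthogonal to the whole system, so completeness identifies the limit with
  \<open>g\<close>.\<close>

lemma expansion:
  assumes "L2 g"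
  shows "(\<lambda>N. L2_norm_sq (\<lambda>x. g x - (\<Sum>n<N. ip g (e n) * e n x))) \<longlonglongrightarrow> 0"
proof -
  define S where "S N x = (\<Sum>n<N. ip g (e n) * e n x)" for N x
  obtain k where k: "L2 k" "\<And>n. ip k (e n) = ip g (e n)"
      "(\<lambda>N. L2_norm_sq (\<lambda>x. S N x - k x)) \<longlonglongrightarrow> 0"
    using riesz_fischer_lim[OF summable_coeffs[OF assms]] unfolding S_def by blast
  have "AE x in lborel. g x - k x = 0"
    by (rule complete) (auto simp: assms k L2_diff ip_diff_left L2e)
  then have ae: "AE x in lborel. S N x - k x = S N x - g x" for N by eventually_elim auto
  have "L2_norm_sq (\<lambda>x. S N x - k x) = L2_norm_sq (\<lambda>x. g x - S N x)" for N
  proof -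
    have "L2 (S N)" unfolding S_def by (rule L2_comb)
    then have "L2_norm_sq (\<lambda>x. S N x - k x) = L2_norm_sq (\<lambda>x. S N x - g x)"
      using assms k(1) by (intro L2_norm_sq_AE_cong[OF _ _ ae] L2_measurable L2_diff)
    then show ?thesis by (simp only: L2_norm_sq_minus[of g])
  qed
  then show ?thesis using k(3) unfolding S_def by simp
qed

lemma parseval:
  assumes "L2 g" shows "(\<lambda>n. (cmod (ip g (e n)))\<^sup>2) sums L2_norm_sq g"
proof -
  have "(\<lambda>N. L2_norm_sq g - (\<Sum>n<N. (cmod (ip g (e n)))\<^sup>2)) \<longlonglongrightarrow> 0"
    using expansion[OF assms] unfolding norm_diff_proj[OF assms finite_lessThan] .
  then have "(\<lambda>N. L2_norm_sq g - (L2_norm_sq g - (\<Sum>n<N. (cmod (ip g (e n)))\<^sup>2))) \<longlonglongrightarrow> L2_norm_sq g - 0"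
    by (intro tendsto_intros)
  then show ?thesis unfolding sums_def by simp
qed

end

subsection \<open>Functions with Gaussian decay\<close>

text \<open>A class closed under sums, products and multiplication by x. One certificate serves for
  integrability, for membership in L2 and for the vanishing of boundary terms.\<close>

definition gdec :: "(real \<Rightarrow> complex) \<Rightarrow> bool" where
  "gdec f \<longleftrightarrow> (\<exists>C c. c > 0 \<and> (\<forall>x. cmod (f x) \<le> C * exp (- (c * x\<^sup>2))))"

lemma gdecI: "c > 0 \<Longrightarrow> (\<And>x. cmod (f x) \<le> C * exp (- (c * x\<^sup>2))) \<Longrightarrow> gdec f"
  unfolding gdec_def by blast

lemma gdec_mono:
  assumes "gdec f" "\<And>x. cmod (g x) \<le> K * cmod (f x)" shows "gdec g"
proof -
  obtain C c where c: "c > 0" "\<And>x. cmod (f x) \<le> C * exp (- (c * x\<^sup>2))"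
    using assms(1) unfolding gdec_def by blast
  have "cmod (g x) \<le> (\<bar>K\<bar> * C) * exp (- (c * x\<^sup>2))" for x
  proof -
    have "cmod (g x) \<le> \<bar>K\<bar> * cmod (f x)"
      using assms(2)[of x] by (rule order_trans) (intro mult_right_mono; simp)
    also have "\<dots> \<le> \<bar>K\<bar> * (C * exp (- (c * x\<^sup>2)))" using c(2) by (intro mult_left_mono) auto
    finally show ?thesis by (simp add: mult.assoc)
  qed
  then show ?thesis by (rule gdecI[OF c(1)])
qed

lemma gdec_zero [simp]: "gdec (\<lambda>x. 0)"
  by (rule gdecI[of 1 _ 0]) auto

lemma gdec_scale: "gdec f \<Longrightarrow> gdec (\<lambda>x. c * f x)"
  by (rule gdec_mono[of f _ "cmod c"]) (auto simp: norm_mult)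

lemma gdec_add:
  assumes "gdec f" "gdec g" shows "gdec (\<lambda>x. f x + g x)"
proof -
  obtain C c where c: "c > 0" "\<And>x. cmod (f x) \<le> C * exp (- (c * x\<^sup>2))"
    using assms(1) unfolding gdec_def by blast
  obtain D d where d: "d > 0" "\<And>x. cmod (g x) \<le> D * exp (- (d * x\<^sup>2))"
    using assms(2) unfolding gdec_def by blast
  have CD: "C \<ge> 0" "D \<ge> 0" using c(2)[of 0] d(2)[of 0] norm_ge_zero[of "f 0"] norm_ge_zero[of "g 0"]
    by (auto intro: order_trans simp del: norm_ge_zero)
  have "cmod (f x + g x) \<le> (C + D) * exp (- (min c d * x\<^sup>2))" for x
  proof -
    have "C * exp (- (c * x\<^sup>2)) \<le> C * exp (- (min c d * x\<^sup>2))"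
      "D * exp (- (d * x\<^sup>2)) \<le> D * exp (- (min c d * x\<^sup>2))"
      using CD by (auto intro!: mult_left_mono mult_right_mono)
    then show ?thesis
      using norm_triangle_ineq[of "f x" "g x"] c(2)[of x] d(2)[of x] by (simp add: distrib_right)
  qed
  then show ?thesis by (rule gdecI[rotated]) (use c d in auto)
qed

lemma gdec_diff: "gdec f \<Longrightarrow> gdec g \<Longrightarrow> gdec (\<lambda>x. f x - g x)"
  using gdec_add[of f "\<lambda>x. (-1) * g x"] gdec_scale[of g "-1"] by simp

text \<open>Half of the Gaussian rate is given up to absorb the factor, since \<bar>x\<bar> is at
  most (1 + 2/c) exp((c/2) x^2).\<close>

lemma gdec_times_x:
  assumes "gdec f" shows "gdec (\<lambda>x. of_real x * f x)"
proof -
  obtain C c where c: "c > 0" "\<And>x. cmod (f x) \<le> C * exp (- (c * x\<^sup>2))"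
    using assms(1) unfolding gdec_def by blast
  have C: "C \<ge> 0" using c(2)[of 0] norm_ge_zero[of "f 0"] by (auto intro: order_trans simp del: norm_ge_zero)
  have "cmod (of_real x * f x) \<le> (C * (1 + 2/c)) * exp (- ((c/2) * x\<^sup>2))" for x
  proof -
    have "\<bar>x\<bar> \<le> 1 + x\<^sup>2"
      using zero_le_power2[of "\<bar>x\<bar> - 1"] by (simp add: power2_eq_square algebra_simps)
    also have "\<dots> \<le> (1 + 2/c) * (1 + (c/2) * x\<^sup>2)"
      using c(1) by (simp add: field_simps)
    also have "\<dots> \<le> (1 + 2/c) * exp ((c/2) * x\<^sup>2)"
      using c(1) by (intro mult_left_mono exp_ge_add_one_self) auto
    finally have x: "\<bar>x\<bar> \<le> (1 + 2/c) * exp ((c/2) * x\<^sup>2)" .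
    have "cmod (of_real x * f x) \<le> ((1 + 2/c) * exp ((c/2) * x\<^sup>2)) * (C * exp (- (c * x\<^sup>2)))"
      unfolding norm_mult norm_of_real using x c by (intro mult_mono) auto
    also have "\<dots> = (C * (1 + 2/c)) * (exp ((c/2) * x\<^sup>2) * exp (- (c * x\<^sup>2)))"
      by simp
    also have "exp ((c/2) * x\<^sup>2) * exp (- (c * x\<^sup>2)) = exp (- ((c/2) * x\<^sup>2))"
      unfolding exp_add[symmetric] by (simp add: field_simps)
    finally show ?thesis .
  qed
  then show ?thesis using c(1) by (intro gdecI[of "c/2"]) auto
qed

lemma gdec_mult:
  assumes "gdec f" "gdec g" shows "gdec (\<lambda>x. f x * g x)"
proof -
  obtain D d where d: "d > 0" "\<And>x. cmod (g x) \<le> D * exp (- (d * x\<^sup>2))"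
    using assms(2) unfolding gdec_def by blast
  have D: "D \<ge> 0" using d(2)[of 0] norm_ge_zero[of "g 0"] by (auto intro: order_trans simp del: norm_ge_zero)
  have "cmod (g x) \<le> D" for x
  proof -
    have "D * exp (- (d * x\<^sup>2)) \<le> D * 1" using d(1) D by (intro mult_left_mono) auto
    then show ?thesis using d(2)[of x] by simp
  qed
  then have "cmod (f x * g x) \<le> D * cmod (f x)" for x
    unfolding norm_mult by (subst mult.commute) (rule mult_right_mono, auto)
  then show ?thesis by (rule gdec_mono[OF assms(1)])
qed

lemma gdec_cnj: "gdec f \<Longrightarrow> gdec (\<lambda>x. cnj (f x))"
  by (rule gdec_mono[of f _ 1]) auto

lemma integrable_gaussian:
  assumes "c > 0" shows "integrable lborel (\<lambda>x::real. exp (- (c * x\<^sup>2)))"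
proof -
  \<comment> \<open>The standard deviation whose normal density is proportional to the given
    Gaussian, so that integrability is inherited from the probability library.\<close>
  define \<sigma> where "\<sigma> = sqrt (1 / (2 * c))"
  have s: "\<sigma> > 0" "2 * \<sigma>\<^sup>2 = 1 / c" using assms by (auto simp: \<sigma>_def)
  have "exp (- (c * x\<^sup>2)) = sqrt (2 * pi * \<sigma>\<^sup>2) * normal_density 0 \<sigma> x" for x
  proof -
    have "- (x - 0)\<^sup>2 / (2 * \<sigma>\<^sup>2) = - (c * x\<^sup>2)" unfolding s(2) by simp
    then show ?thesis using s(1) by (simp add: normal_density_def)
  qed
  then show ?thesis using integrable_normal_density[OF s(1)] by simp
qed

lemma gdec_integrable:
  assumes "gdec f" "f \<in> borel_measurable lborel" shows "integrable lborel f"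
proof -
  obtain C c where c: "c > 0" "\<And>x. cmod (f x) \<le> C * exp (- (c * x\<^sup>2))"
    using assms(1) unfolding gdec_def by blast
  have "cmod (f x) \<le> norm (C * exp (- (c * x\<^sup>2)))" for x
    using c(2)[of x] by (rule order_trans) simp
  then show ?thesis
    by (intro Bochner_Integration.integrable_bound[OF integrable_mult_right[OF integrable_gaussian[OF c(1)], of C] assms(2)])
       auto
qed

lemma gdec_L2:
  assumes "gdec f" "f \<in> borel_measurable lborel" shows "L2 f"
proof -
  have "integrable lborel (\<lambda>x. f x * cnj (f x))"
    using assms by (intro gdec_integrable gdec_mult gdec_cnj) auto
  from integrable_norm[OF this] show ?thesis
    using assms(2) by (simp add: L2_def norm_mult power2_eq_square)
qed

lemma gdec_tendsto:
  assumes "gdec f" shows "(\<lambda>n. f (real n)) \<longlonglongrightarrow> 0" "(\<lambda>n. f (- real n)) \<longlonglongrightarrow> 0"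
proof -
  obtain C c where c: "c > 0" "\<And>x. cmod (f x) \<le> C * exp (- (c * x\<^sup>2))"
    using assms(1) unfolding gdec_def by blast
  have "(\<lambda>n. C * exp (- (c * (real n)\<^sup>2))) \<longlonglongrightarrow> C * 0"
    using c(1) by (intro tendsto_mult tendsto_const) real_asymp
  then have lim: "(\<lambda>n. C * exp (- (c * (real n)\<^sup>2))) \<longlonglongrightarrow> 0" by simp
  show "(\<lambda>n. f (real n)) \<longlonglongrightarrow> 0"
    by (rule Lim_null_comparison[OF _ lim]) (use c(2) in auto)
  show "(\<lambda>n. f (- real n)) \<longlonglongrightarrow> 0"
    by (rule Lim_null_comparison[OF _ lim]) (use c(2)[of "- real n" for n] in auto)
qed

text \<open>The fundamental theorem on [-n, n] combined with dominated convergence; decay of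
  \<open>F\<close> kills the boundary values and decay of \<open>F'\<close> provides the
  majorant.\<close>

lemma integral_deriv_eq_0:
  fixes F :: "real \<Rightarrow> complex"
  assumes F: "\<And>x. (F has_vector_derivative F' x) (at x)" and "continuous_on UNIV F'" "gdec F" "gdec F'"
  shows "(\<integral>x. F' x \<partial>lborel) = 0"
proof -
  have m: "F' \<in> borel_measurable lborel" using assms(2) borel_measurable_continuous_onI by auto
  have "(\<lambda>n. \<integral>x. indicator {- real n..real n} x *\<^sub>R F' x \<partial>lborel) \<longlonglongrightarrow> (\<integral>x. F' x \<partial>lborel)"
  proof (rule integral_dominated_convergence)
    show "integrable lborel (\<lambda>x. cmod (F' x))" using gdec_integrable[OF assms(4) m] by simp
    show "AE x in lborel. (\<lambda>n. indicator {- real n..real n} x *\<^sub>R F' x) \<longlonglongrightarrow> F' x"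
    proof (rule AE_I2)
      fix x
      have "\<forall>\<^sub>F n in sequentially. real n \<ge> \<bar>x\<bar>"
        using filterlim_real_sequentially by (simp add: filterlim_at_top)
      then have "\<forall>\<^sub>F n in sequentially. indicator {- real n..real n} x *\<^sub>R F' x = F' x"
        by eventually_elim (auto simp: indicator_def)
      then show "(\<lambda>n. indicator {- real n..real n} x *\<^sub>R F' x) \<longlonglongrightarrow> F' x"
        by (rule tendsto_eventually)
    qed
  qed (use m in \<open>auto intro!: AE_I2 simp: indicator_def\<close>)
  moreover have "(\<integral>x. indicator {- real n..real n} x *\<^sub>R F' x \<partial>lborel) = F (real n) - F (- real n)" for n
    using F assms(2)
    by (intro integral_FTC_Icc) (auto intro: has_vector_derivative_at_within continuous_on_subset)
  moreover have "(\<lambda>n. F (real n) - F (- real n)) \<longlonglongrightarrow> 0 - 0"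
    by (intro tendsto_diff gdec_tendsto assms)
  ultimately show ?thesis using LIMSEQ_unique by fastforce
qed

lemma has_vector_derivative_continuous_on:
  assumes "\<And>x. (f has_vector_derivative f' x) (at x)" shows "continuous_on A f"
  using assms by (meson continuous_at_imp_continuous_on has_vector_derivative_continuous)

lemma integration_by_parts_gdec:
  fixes f g :: "real \<Rightarrow> complex"
  assumes f: "\<And>x. (f has_vector_derivative f' x) (at x)" "continuous_on UNIV f'"
    and g: "\<And>x. (g has_vector_derivative g' x) (at x)" "continuous_on UNIV g'"
    and dec: "gdec (\<lambda>x. f x * g x)" "gdec (\<lambda>x. f' x * g x)" "gdec (\<lambda>x. f x * g' x)"
  shows "(\<integral>x. f' x * g x \<partial>lborel) = - (\<integral>x. f x * g' x \<partial>lborel)"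
proof -
  have c: "continuous_on UNIV f" "continuous_on UNIV g"
    using f(1) g(1) by (auto intro: has_vector_derivative_continuous_on)
  have [measurable]: "f \<in> borel_measurable borel" "g \<in> borel_measurable borel"
    "f' \<in> borel_measurable borel" "g' \<in> borel_measurable borel"
    using c f(2) g(2) by (auto intro: borel_measurable_continuous_onI)
  have "(\<integral>x. f x * g' x + f' x * g x \<partial>lborel) = 0"
    using f(2) g(2) c
    by (intro integral_deriv_eq_0[where F = "\<lambda>x. f x * g x"] has_vector_derivative_mult f(1) g(1) dec gdec_add)
       (auto intro!: continuous_intros)
  moreover have "integrable lborel (\<lambda>x. f x * g' x)" "integrable lborel (\<lambda>x. f' x * g x)"
    using dec by (auto intro!: gdec_integrable)
  ultimately show ?thesis by (simp add: eq_neg_iff_add_eq_0 add.commute)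
qed

subsection \<open>Hermite functions\<close>

text \<open>One formula for all n: at n = 0 the truncated index \<open>n - 1\<close> is again 0, but
  the factor \<open>real n\<close> removes that term. The same convention, with
  \<open>sqrt (real n)\<close> in front of index \<open>n - 1\<close>, is used in every ladder
  relation below.\<close>

lemma hermite_poly_Suc: "hermite_poly (Suc n) x = 2 * x * hermite_poly n x - 2 * real n * hermite_poly (n - 1) x"
  by (cases n) auto

lemma hermite_poly_deriv:
  "(hermite_poly n has_real_derivative 2 * real n * hermite_poly (n - 1) x) (at x)"
proof (induction n x rule: hermite_poly.induct)
  case (1 x)
  have "hermite_poly 0 = (\<lambda>x. 1)" by auto
  then show ?case by simp
next
  case (2 x)
  have "hermite_poly (Suc 0) = (\<lambda>x. 2 * x)" by auto
  then show ?case by (auto intro!: derivative_eq_intros)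
next
  case (3 n x)
  have "hermite_poly (Suc (Suc n)) = (\<lambda>x. 2 * x * hermite_poly (Suc n) x - 2 * real (Suc n) * hermite_poly n x)"
    by auto
  moreover have "((\<lambda>x. 2 * x * hermite_poly (Suc n) x - 2 * real (Suc n) * hermite_poly n x)
      has_real_derivative 2 * hermite_poly (Suc n) x + 2 * x * (2 * real (Suc n) * hermite_poly n x)
        - 2 * real (Suc n) * (2 * real n * hermite_poly (n - 1) x)) (at x)"
    using 3 by (auto intro!: derivative_eq_intros)
  moreover have "2 * hermite_poly (Suc n) x + 2 * x * (2 * real (Suc n) * hermite_poly n x)
        - 2 * real (Suc n) * (2 * real n * hermite_poly (n - 1) x)
      = 2 * real (Suc (Suc n)) * hermite_poly (Suc n) x"
    unfolding hermite_poly_Suc[of n] by (simp add: algebra_simps)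
  ultimately show ?case by simp
qed

definition hnorm :: "nat \<Rightarrow> real" where "hnorm n = sqrt (2 ^ n * fact n * sqrt pi)"

lemma hnorm_pos: "hnorm n > 0" by (simp add: hnorm_def)

lemma hnorm_Suc: "hnorm (Suc n) = sqrt 2 * sqrt (real (Suc n)) * hnorm n"
  unfolding hnorm_def by (simp only: real_sqrt_mult[symmetric]) (simp add: algebra_simps)

lemma hermite_fun_eq: "hermite_fun n x = hermite_poly n x * exp (- (x^2) / 2) / hnorm n"
  by (simp add: hermite_fun_def hnorm_def)

lemma hermite_fun_poly_ratio:
  "2 * real n * hermite_poly (n - 1) x * exp (- (x^2) / 2) / hnorm n = sqrt 2 * sqrt (real n) * hermite_fun (n - 1) x"
proof (cases n)
  case (Suc m)
  define k where "k = sqrt 2 * sqrt (real (Suc m))"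
  have "2 * real (Suc m) = k * k" unfolding k_def by (simp add: algebra_simps)
  moreover have "k > 0" by (simp add: k_def)
  ultimately show ?thesis using hnorm_pos[of m]
    unfolding Suc hermite_fun_eq hnorm_Suc k_def[symmetric] by (simp add: field_simps)
qed simp

text \<open>The normalised three-term recurrence. In operator language it says that sqrt 2 times
  position is the sum of the lowering and the raising operator.\<close>

lemma hermite_fun_x:
  "sqrt 2 * x * hermite_fun n x = sqrt (real n) * hermite_fun (n - 1) x + sqrt (real (Suc n)) * hermite_fun (Suc n) x"
proof -
  define k where "k = sqrt (2::real)"
  have k: "k \<noteq> 0" by (simp add: k_def)
  have "sqrt (real (Suc n)) * hermite_fun (Suc n) x
      = hermite_poly (Suc n) x * exp (- (x^2) / 2) / (sqrt 2 * hnorm n)"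
    by (simp add: hermite_fun_eq hnorm_Suc field_simps)
  also have "\<dots> = (2 * x * hermite_fun n x - 2 * real n * hermite_poly (n - 1) x * exp (- (x^2) / 2) / hnorm n) / sqrt 2"
    unfolding hermite_poly_Suc hermite_fun_eq k_def[symmetric] using k hnorm_pos[of n]
    by (simp add: divide_simps) (simp add: algebra_simps)
  also have "\<dots> = (2 * x * hermite_fun n x - sqrt 2 * sqrt (real n) * hermite_fun (n - 1) x) / sqrt 2"
    by (simp only: hermite_fun_poly_ratio)
  also have "\<dots> = sqrt 2 * x * hermite_fun n x - sqrt (real n) * hermite_fun (n - 1) x"
  proof -
    have "2 * x * hermite_fun n x = k * (k * x * hermite_fun n x)"
      by (simp add: k_def mult.assoc[symmetric])
    then show ?thesis using k unfolding k_def[symmetric] by (simp only: diff_divide_distrib) simp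
  qed
  finally show ?thesis by simp
qed

lemma hermite_fun_deriv_aux:
  "(hermite_fun n has_real_derivative (sqrt 2 * sqrt (real n) * hermite_fun (n - 1) x - x * hermite_fun n x)) (at x)"
proof -
  have "((\<lambda>x. hermite_poly n x * exp (- (x^2) / 2) / hnorm n) has_real_derivative
      (2 * real n * hermite_poly (n - 1) x * exp (- (x^2) / 2) + hermite_poly n x * (exp (- (x^2) / 2) * (- x))) / hnorm n) (at x)"
    using hnorm_pos[of n] by (auto intro!: derivative_eq_intros hermite_poly_deriv)
  moreover have "hermite_fun n = (\<lambda>x. hermite_poly n x * exp (- (x^2) / 2) / hnorm n)"
    by (auto simp: hermite_fun_eq)
  moreover have "(2 * real n * hermite_poly (n - 1) x * exp (- (x^2) / 2) + hermite_poly n x * (exp (- (x^2) / 2) * (- x))) / hnorm n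
     = sqrt 2 * sqrt (real n) * hermite_fun (n - 1) x - x * hermite_fun n x"
  proof -
    have "(2 * real n * hermite_poly (n - 1) x * exp (- (x^2) / 2) + hermite_poly n x * (exp (- (x^2) / 2) * (- x))) / hnorm n
      = 2 * real n * hermite_poly (n - 1) x * exp (- (x^2) / 2) / hnorm n - x * (hermite_poly n x * exp (- (x^2) / 2) / hnorm n)"
      by (simp add: diff_divide_distrib algebra_simps)
    then show ?thesis by (simp only: hermite_fun_poly_ratio hermite_fun_eq[symmetric])
  qed
  ultimately show ?thesis by simp
qed

text \<open>The derivative of a Hermite function in ladder form, lowering minus raising over sqrt 2.
  With this form, decay and continuity of the derivative come directly from the Hermite functions
  themselves.\<close>

definition hfd :: "nat \<Rightarrow> real \<Rightarrow> real" where
  "hfd n x = (sqrt (real n) * hermite_fun (n - 1) x - sqrt (real (Suc n)) * hermite_fun (Suc n) x) / sqrt 2"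

lemma hermite_fun_deriv: "(hermite_fun n has_real_derivative hfd n x) (at x)"
proof -
  have "sqrt 2 * (sqrt 2 * sqrt (real n) * hermite_fun (n - 1) x - x * hermite_fun n x)
    = 2 * (sqrt (real n) * hermite_fun (n - 1) x) - sqrt 2 * x * hermite_fun n x"
    by (simp add: algebra_simps)
  also have "\<dots> = sqrt (real n) * hermite_fun (n - 1) x - sqrt (real (Suc n)) * hermite_fun (Suc n) x"
    unfolding hermite_fun_x by simp
  finally have "sqrt 2 * sqrt (real n) * hermite_fun (n - 1) x - x * hermite_fun n x = hfd n x"
    unfolding hfd_def by (simp add: field_simps)
  then show ?thesis using hermite_fun_deriv_aux[of n x] by simp
qed

text \<open>The eigenvalue equation of the harmonic oscillator. \<open>A\<close> and
  \<open>B\<close> express the derivatives of the two neighbours through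
  \<open>hermite_fun n\<close> and through x times the neighbours; the latter recombine by the
  three-term recurrence.\<close>

lemma hermite_fun_second_deriv: "(hfd n has_real_derivative (x\<^sup>2 - (2 * real n + 1)) * hermite_fun n x) (at x)"
proof -
  define s where "s = sqrt (2::real)"
  have s: "s * s = 2" "s \<noteq> 0" by (simp_all add: s_def)
  have s2: "s * (s * z) = 2 * z" for z by (simp add: mult.assoc[symmetric] s)
  have "(hfd n has_real_derivative (sqrt (real n) * hfd (n - 1) x - sqrt (real (Suc n)) * hfd (Suc n) x) / sqrt 2) (at x)"
    unfolding hfd_def[of n, abs_def] by (intro DERIV_cdivide DERIV_diff DERIV_cmult hermite_fun_deriv)
  moreover have "(sqrt (real n) * hfd (n - 1) x - sqrt (real (Suc n)) * hfd (Suc n) x) / sqrt 2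
      = (x\<^sup>2 - (2 * real n + 1)) * hermite_fun n x"
  proof -
    have A: "sqrt (real n) * hfd (n - 1) x = (s * real n * hermite_fun n x - sqrt (real n) * x * hermite_fun (n - 1) x) * (-1)"
    proof (cases n)
      case (Suc m)
      have "s * hfd m x = s * x * hermite_fun m x - 2 * (sqrt (real (Suc m)) * hermite_fun (Suc m) x)"
        using hermite_fun_x[of x m] by (simp add: hfd_def s_def)
      then have "s * (hfd m x) = s * (x * hermite_fun m x - s * (sqrt (real (Suc m)) * hermite_fun (Suc m) x))"
        by (simp add: right_diff_distrib s2 mult.assoc)
      then have "hfd m x = x * hermite_fun m x - s * (sqrt (real (Suc m)) * hermite_fun (Suc m) x)"
        using s(2) by simp
      then have "sqrt (real (Suc m)) * hfd m x = sqrt (real (Suc m)) * x * hermite_fun m x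
          - s * (sqrt (real (Suc m)) * sqrt (real (Suc m))) * hermite_fun (Suc m) x"
        by (simp only:) (simp add: algebra_simps del: real_sqrt_mult_self)
      then show ?thesis using Suc by simp
    qed simp
    have B: "sqrt (real (Suc n)) * hfd (Suc n) x = s * real (Suc n) * hermite_fun n x - sqrt (real (Suc n)) * x * hermite_fun (Suc n) x"
    proof -
      have "s * hfd (Suc n) x = 2 * (sqrt (real (Suc n)) * hermite_fun n x) - s * x * hermite_fun (Suc n) x"
        using hermite_fun_x[of x "Suc n"] by (simp add: hfd_def s_def)
      then have "s * hfd (Suc n) x = s * (s * (sqrt (real (Suc n)) * hermite_fun n x) - x * hermite_fun (Suc n) x)"
        using s by (simp add: algebra_simps)
      then have "hfd (Suc n) x = s * (sqrt (real (Suc n)) * hermite_fun n x) - x * hermite_fun (Suc n) x"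
        using s(2) by simp
      then have "sqrt (real (Suc n)) * hfd (Suc n) x = s * (sqrt (real (Suc n)) * sqrt (real (Suc n))) * hermite_fun n x
          - sqrt (real (Suc n)) * x * hermite_fun (Suc n) x"
        by (simp only:) (simp add: algebra_simps del: real_sqrt_mult_self)
      then show ?thesis by simp
    qed
    have "sqrt (real n) * hfd (n - 1) x - sqrt (real (Suc n)) * hfd (Suc n) x
      = x * (s * x * hermite_fun n x) - s * (2 * real n + 1) * hermite_fun n x"
      unfolding A B s_def hermite_fun_x by (simp add: algebra_simps)
    also have "\<dots> = s * ((x\<^sup>2 - (2 * real n + 1)) * hermite_fun n x)"
      by (simp add: algebra_simps power2_eq_square)
    finally show ?thesis using s(2) by (simp add: s_def[symmetric])
  qed
  ultimately show ?thesis by simp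
qed

definition hc :: "nat \<Rightarrow> real \<Rightarrow> complex" where "hc n x = complex_of_real (hermite_fun n x)"

lemma hcoef_eq_ip: "hcoef g n = ip g (hc n)"
  by (simp add: hcoef_def ip_def hc_def)

lemma hc_x: "of_real (sqrt 2) * of_real x * hc n x
    = of_real (sqrt (real n)) * hc (n - 1) x + of_real (sqrt (real (Suc n))) * hc (Suc n) x"
  using arg_cong[OF hermite_fun_x[of x n], of complex_of_real] by (simp only: hc_def of_real_mult of_real_add)

lemma hc_deriv: "(hc n has_vector_derivative of_real (hfd n x)) (at x)"
  unfolding hc_def[abs_def] by (rule has_vector_derivative_of_real[OF hermite_fun_deriv])

lemma hc_cnj [simp]: "cnj (hc n x) = hc n x"
  by (simp add: hc_def)

lemma hermite_fun_continuous: "continuous_on A (hermite_fun n)"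
  using hermite_fun_deriv DERIV_isCont continuous_at_imp_continuous_on by blast

lemma hc_continuous: "continuous_on A (hc n)"
  unfolding hc_def[abs_def] by (intro continuous_intros hermite_fun_continuous)

lemma hfd_continuous: "continuous_on A (hfd n)"
  unfolding hfd_def[abs_def] by (intro continuous_intros hermite_fun_continuous) auto

lemma hc_measurable [measurable]: "hc n \<in> borel_measurable borel"
  using hc_continuous borel_measurable_continuous_onI by blast

text \<open>Strong induction: the recurrence expresses the next function through x times the
  previous one and the one before it, and Gaussian decay survives both operations.\<close>

lemma gdec_hc: "gdec (hc n)"
proof (induction n rule: less_induct)
  case (less n)
  show ?case
  proof (cases n)
    case 0
    show ?thesis
      by (rule gdecI[of "1/2" _ "1 / hnorm 0"]) (use hnorm_pos[of 0] in \<open>auto simp: 0 hc_def hermite_fun_eq norm_divide\<close>)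
  next
    case (Suc m)
    have "hc (Suc m) = (\<lambda>x. of_real (1 / sqrt (real (Suc m))) *
        (of_real (sqrt 2) * (of_real x * hc m x) - of_real (sqrt (real m)) * hc (m - 1) x))"
    proof
      fix x
      show "hc (Suc m) x = of_real (1 / sqrt (real (Suc m))) *
        (of_real (sqrt 2) * (of_real x * hc m x) - of_real (sqrt (real m)) * hc (m - 1) x)"
        using hc_x[of x m] by (simp add: mult.assoc del: of_nat_Suc)
    qed
    moreover have "gdec (hc (m - 1))" "gdec (hc m)" using less Suc by auto
    ultimately show ?thesis using Suc by (simp only:) (intro gdec_scale gdec_diff gdec_times_x)
  qed
qed

lemma L2_hc: "L2 (hc n)"
  by (intro gdec_L2 gdec_hc) simp

lemma hc_hfd: "of_real (hfd n x)
    = of_real (sqrt (real n) / sqrt 2) * hc (n - 1) x - of_real (sqrt (real (Suc n)) / sqrt 2) * hc (Suc n) x"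
  by (simp add: hfd_def hc_def diff_divide_distrib)

lemma gdec_hfd: "gdec (\<lambda>x. of_real (hfd n x))"
  unfolding hc_hfd by (intro gdec_diff gdec_scale gdec_hc)

text \<open>The square of the ground state is the normal density of variance 1/2.\<close>

lemma ip_hc_0: "ip (hc 0) (hc 0) = 1"
proof -
  define \<sigma> where "\<sigma> = 1 / sqrt (2::real)"
  have s: "\<sigma> > 0" "\<sigma>\<^sup>2 = 1/2" by (auto simp: \<sigma>_def power_divide)
  have "hermite_fun 0 x * hermite_fun 0 x = normal_density 0 \<sigma> x" for x
  proof -
    have "hermite_fun 0 x * hermite_fun 0 x = (exp (- (x^2) / 2) * exp (- (x^2) / 2)) / (hnorm 0 * hnorm 0)"
      by (simp add: hermite_fun_eq)
    also have "exp (- (x^2) / 2) * exp (- (x^2) / 2) = exp (- x\<^sup>2)"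
      unfolding exp_add[symmetric] by simp
    also have "hnorm 0 * hnorm 0 = sqrt pi" by (simp add: hnorm_def)
    finally show ?thesis by (simp add: normal_density_def s(2))
  qed
  then have "ip (hc 0) (hc 0) = (\<integral>x. complex_of_real (normal_density 0 \<sigma> x) \<partial>lborel)"
    unfolding ip_def hc_cnj unfolding hc_def of_real_mult[symmetric] by simp
  then show ?thesis using integral_normal_density[OF s(1), of 0] by (simp only: integral_complex_of_real) simp
qed

text \<open>Lowering and raising are adjoint to each other: they are (x + d/dx) / sqrt 2 and (x -
  d/dx) / sqrt 2, and integration by parts moves the derivative.\<close>

lemma ip_hc_ladder: "of_real (sqrt (real m)) * ip (hc (m - 1)) (hc n) = of_real (sqrt (real (Suc n))) * ip (hc m) (hc (Suc n))"
proof -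
  let ?s = "complex_of_real (sqrt 2)"
  have s: "?s * ?s = 2" by (simp flip: of_real_mult)
  have a: "of_real (sqrt (real m)) * hc (m - 1) x * 2 = ?s * (of_real x * hc m x + of_real (hfd m x))" for x
    using hc_x[of x m] s by (simp add: hc_hfd field_simps)
  have b: "of_real (sqrt (real (Suc n))) * hc (Suc n) x * 2 = ?s * (of_real x * hc n x - of_real (hfd n x))" for x
    using hc_x[of x n] s by (simp add: hc_hfd field_simps)
  have ibp: "(\<integral>x. of_real (hfd m x) * hc n x \<partial>lborel) = - (\<integral>x. hc m x * of_real (hfd n x) \<partial>lborel)"
    by (intro integration_by_parts_gdec hc_deriv gdec_mult gdec_hc gdec_hfd continuous_intros hfd_continuous)
  have int: "integrable lborel (\<lambda>x. of_real x * hc m x * hc n x)"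
    "integrable lborel (\<lambda>x. of_real (hfd m x) * hc n x)" "integrable lborel (\<lambda>x. hc m x * of_real (hfd n x))"
    using hfd_continuous[of UNIV, THEN borel_measurable_continuous_onI]
    by (auto intro!: gdec_integrable gdec_mult gdec_hc gdec_hfd gdec_times_x)
  have "2 * (of_real (sqrt (real m)) * ip (hc (m - 1)) (hc n))
      = (\<integral>x. of_real (sqrt (real m)) * hc (m - 1) x * 2 * hc n x \<partial>lborel)"
    unfolding ip_def hc_cnj integral_mult_right_zero[symmetric] by (intro Bochner_Integration.integral_cong) (auto simp: algebra_simps)
  also have "\<dots> = (\<integral>x. ?s * (of_real x * hc m x * hc n x + of_real (hfd m x) * hc n x) \<partial>lborel)"
    unfolding a by (simp add: algebra_simps)
  also have "\<dots> = ?s * ((\<integral>x. of_real x * hc m x * hc n x \<partial>lborel) - (\<integral>x. hc m x * of_real (hfd n x) \<partial>lborel))"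
    unfolding integral_mult_right_zero by (simp add: int Bochner_Integration.integral_add ibp)
  also have "\<dots> = (\<integral>x. ?s * (of_real x * hc m x * hc n x - hc m x * of_real (hfd n x)) \<partial>lborel)"
    unfolding integral_mult_right_zero by (simp add: int Bochner_Integration.integral_diff)
  also have "\<dots> = (\<integral>x. hc m x * (of_real (sqrt (real (Suc n))) * hc (Suc n) x * 2) \<partial>lborel)"
    unfolding b by (simp add: algebra_simps)
  also have "\<dots> = 2 * (of_real (sqrt (real (Suc n))) * ip (hc m) (hc (Suc n)))"
    unfolding ip_def hc_cnj integral_mult_right_zero[symmetric] by (intro Bochner_Integration.integral_cong) (auto simp: algebra_simps)
  finally show ?thesis by simp
qed

text \<open>Adjointness lowers both indices together until one of them is 0. There the factor
  \<open>sqrt 0\<close> shows that the ground state is orthogonal to every higher state.\<close>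

lemma hc_orth: "ip (hc m) (hc n) = (if m = n then 1 else 0)"
proof (induction m arbitrary: n)
  case 0
  show ?case using ip_hc_0 ip_hc_ladder[of 0] by (cases n) (auto simp del: of_nat_Suc)
next
  case (Suc m)
  show ?case
  proof (cases n)
    case 0
    then show ?thesis using ip_hc_ladder[of 0 m] ip_cnj[of "hc (Suc m)" "hc 0"] by (simp del: of_nat_Suc)
  next
    case (Suc k)
    have "of_real (sqrt (real (Suc k))) * ip (hc (Suc m)) (hc (Suc k)) = of_real (sqrt (real (Suc m))) * ip (hc m) (hc k)"
      using ip_hc_ladder[of "Suc m" k] by simp
    then show ?thesis unfolding Suc Suc.IH by (auto simp del: of_nat_Suc split: if_splits)
  qed
qed

subsection \<open>Completeness of the Hermite functions\<close>

lemma gdec_times_x_pow: "gdec f \<Longrightarrow> gdec (\<lambda>x. of_real x ^ k * f x)"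
  by (induction k) (auto simp: mult.assoc intro: gdec_times_x)

lemma L2_real_part: "L2 g \<Longrightarrow> L2 (\<lambda>x. complex_of_real (Re (g x)))" "L2 g \<Longrightarrow> L2 (\<lambda>x. complex_of_real (Im (g x)))"
  by (rule L2_bound[of g _ 1]; auto simp: L2_def abs_Re_le_cmod abs_Im_le_cmod)+

text \<open>Provides the majorant for the exponential series in the completeness proof. Completing
  the square bounds the exponent by t^2 - x^2/4, so Gaussian decay is retained.\<close>

lemma exp_abs_gaussian_L2: "L2 (\<lambda>x. complex_of_real (exp (\<bar>t\<bar> * \<bar>x\<bar>) * hermite_fun 0 x))"
proof (rule gdec_L2)
  show "gdec (\<lambda>x. complex_of_real (exp (\<bar>t\<bar> * \<bar>x\<bar>) * hermite_fun 0 x))"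
  proof (rule gdecI[of "1/4" _ "exp (t\<^sup>2) / hnorm 0"])
    fix x :: real
    have "\<bar>t\<bar> * \<bar>x\<bar> + (- (x^2) / 2) \<le> t\<^sup>2 + - (1 / 4 * x\<^sup>2)"
      using zero_le_power2[of "\<bar>x\<bar> / 2 - \<bar>t\<bar>"] by (simp add: power2_eq_square algebra_simps)
    then have "exp (\<bar>t\<bar> * \<bar>x\<bar>) * exp (- (x^2) / 2) \<le> exp (t\<^sup>2) * exp (- (1 / 4 * x\<^sup>2))"
      unfolding exp_add[symmetric] by simp
    then have "exp (\<bar>t\<bar> * \<bar>x\<bar>) * exp (- (x^2) / 2) / hnorm 0 \<le> exp (t\<^sup>2) * exp (- (1 / 4 * x\<^sup>2)) / hnorm 0"
      using hnorm_pos[of 0] by (intro divide_right_mono) auto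
    then show "cmod (complex_of_real (exp (\<bar>t\<bar> * \<bar>x\<bar>) * hermite_fun 0 x)) \<le> exp (t\<^sup>2) / hnorm 0 * exp (- (1 / 4 * x\<^sup>2))"
      unfolding norm_of_real hermite_fun_eq using hnorm_pos[of 0] by (simp add: abs_mult)
  qed simp
  show "(\<lambda>x. complex_of_real (exp (\<bar>t\<bar> * \<bar>x\<bar>) * hermite_fun 0 x)) \<in> borel_measurable lborel"
    by (auto intro!: borel_measurable_continuous_onI continuous_intros hermite_fun_continuous)
qed

text \<open>The three-term recurrence trades one power of x for the two neighbouring Hermite
  functions, so the induction on the power must run over all indices at once.\<close>

lemma moments_zero:
  assumes g: "L2 g" "\<And>n. ip g (hc n) = 0"
  shows "(\<integral>x. g x * (of_real x ^ k * hc n x) \<partial>lborel) = 0"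
proof (induction k arbitrary: n)
  case 0
  then show ?case using g(2)[of n] by (simp add: ip_def)
next
  case (Suc k)
  let ?s = "complex_of_real (sqrt 2)"
  have int: "integrable lborel (\<lambda>x. g x * (of_real x ^ k * hc m x))" for m
    by (intro integrable_L2_mult g gdec_L2 gdec_times_x_pow gdec_hc) auto
  have "?s * (\<integral>x. g x * (of_real x ^ Suc k * hc n x) \<partial>lborel)
      = (\<integral>x. g x * (of_real x ^ k * (?s * of_real x * hc n x)) \<partial>lborel)"
    unfolding integral_mult_right_zero[symmetric]
    by (intro Bochner_Integration.integral_cong) (auto simp: algebra_simps)
  also have "\<dots> = (\<integral>x. of_real (sqrt (real n)) * (g x * (of_real x ^ k * hc (n - 1) x))
       + of_real (sqrt (real (Suc n))) * (g x * (of_real x ^ k * hc (Suc n) x)) \<partial>lborel)"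
    unfolding hc_x by (intro Bochner_Integration.integral_cong) (auto simp: algebra_simps)
  also have "\<dots> = 0"
    by (subst Bochner_Integration.integral_add) (auto simp: Suc.IH intro!: integrable_mult_right int)
  finally show ?case by simp
qed

text \<open>All moments of \<open>G\<close>, the product of \<open>r\<close> with the ground state,
  vanish. Expanding the exponential under the integral shows that the Fourier transform of
  \<open>G\<close> vanishes, and uniqueness of characteristic functions yields \<open>G\<close> = 0
  almost everywhere.\<close>

lemma real_hermite_complete:
  fixes r :: "real \<Rightarrow> real"
  assumes g: "L2 (\<lambda>x. complex_of_real (r x))" "\<And>n. ip (\<lambda>x. complex_of_real (r x)) (hc n) = 0"
  shows "AE x in lborel. r x = 0"
proof -
  define G where "G x = r x * hermite_fun 0 x" for x
  have h0: "hermite_fun 0 x > 0" for x using hnorm_pos[of 0] by (simp add: hermite_fun_eq)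
  have "(\<lambda>x. Re (complex_of_real (r x))) \<in> borel_measurable lborel"
    using L2_measurable[OF g(1)] by measurable
  then have rm [measurable]: "r \<in> borel_measurable borel" by simp
  have [measurable]: "hermite_fun 0 \<in> borel_measurable borel"
    by (intro borel_measurable_continuous_onI hermite_fun_continuous)
  have Gm [measurable]: "G \<in> borel_measurable borel" unfolding G_def by measurable
  have "integrable lborel (\<lambda>x. complex_of_real (r x) * hc 0 x)"
    using g(1) L2_hc by (rule integrable_L2_mult)
  then have Gi: "integrable lborel G"
    unfolding hc_def of_real_mult[symmetric] G_def[symmetric] using integrable_Re by fastforce
  have char0: "(\<integral>x. iexp (t * x) * complex_of_real (G x) \<partial>lborel) = 0" for t
  proof -
    define z where "z x = \<i> * complex_of_real (t * x)" for x
    have "(\<lambda>N. \<integral>x. (\<Sum>k<N. z x ^ k / fact k) * complex_of_real (G x) \<partial>lborel)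
        \<longlonglongrightarrow> (\<integral>x. exp (z x) * complex_of_real (G x) \<partial>lborel)"
    proof (rule integral_dominated_convergence)
      show "integrable lborel (\<lambda>x. cmod (complex_of_real (r x) * complex_of_real (exp (\<bar>t\<bar> * \<bar>x\<bar>) * hermite_fun 0 x)))"
        by (intro integrable_norm integrable_L2_mult g(1) exp_abs_gaussian_L2)
      show "AE x in lborel. (\<lambda>N. (\<Sum>k<N. z x ^ k / fact k) * complex_of_real (G x)) \<longlonglongrightarrow> exp (z x) * complex_of_real (G x)"
        using exp_converges[of "z x" for x]
        by (intro AE_I2 tendsto_mult tendsto_const) (auto simp: sums_def scaleR_conv_of_real divide_inverse mult.commute)
      show "AE x in lborel. norm ((\<Sum>k<N. z x ^ k / fact k) * complex_of_real (G x))
          \<le> cmod (complex_of_real (r x) * complex_of_real (exp (\<bar>t\<bar> * \<bar>x\<bar>) * hermite_fun 0 x))" for N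
      proof (rule AE_I2)
        fix x
        have "cmod (\<Sum>k<N. z x ^ k / fact k) \<le> (\<Sum>k<N. (\<bar>t\<bar> * \<bar>x\<bar>) ^ k / fact k)"
          by (rule sum_norm_le) (simp add: norm_divide norm_power z_def norm_mult abs_mult)
        also have "\<dots> \<le> (\<Sum>k. (\<bar>t\<bar> * \<bar>x\<bar>) ^ k / fact k)"
          using summable_exp_generic[of "\<bar>t\<bar> * \<bar>x\<bar>"]
          by (intro sum_le_suminf) (auto simp: divide_inverse mult.commute)
        also have "\<dots> = exp (\<bar>t\<bar> * \<bar>x\<bar>)"
          by (simp add: exp_def divide_inverse mult.commute)
        finally have "cmod (\<Sum>k<N. z x ^ k / fact k) \<le> exp (\<bar>t\<bar> * \<bar>x\<bar>)" .
        then have "cmod (\<Sum>k<N. z x ^ k / fact k) * \<bar>G x\<bar> \<le> exp (\<bar>t\<bar> * \<bar>x\<bar>) * \<bar>G x\<bar>"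
          by (rule mult_right_mono) simp
        then show "norm ((\<Sum>k<N. z x ^ k / fact k) * complex_of_real (G x))
          \<le> cmod (complex_of_real (r x) * complex_of_real (exp (\<bar>t\<bar> * \<bar>x\<bar>) * hermite_fun 0 x))"
          by (simp add: norm_mult G_def abs_mult algebra_simps)
      qed
    qed (auto simp: z_def)
    moreover have "(\<integral>x. (\<Sum>k<N. z x ^ k / fact k) * complex_of_real (G x) \<partial>lborel) = 0" for N
    proof -
      have int: "integrable lborel (\<lambda>x. complex_of_real (r x) * (of_real x ^ k * hc 0 x))" for k
        by (intro integrable_L2_mult g gdec_L2 gdec_times_x_pow gdec_hc) auto
      have "(\<integral>x. (\<Sum>k<N. z x ^ k / fact k) * complex_of_real (G x) \<partial>lborel)
        = (\<integral>x. (\<Sum>k<N. ((\<i> * of_real t) ^ k / fact k) * (complex_of_real (r x) * (of_real x ^ k * hc 0 x))) \<partial>lborel)"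
        by (intro Bochner_Integration.integral_cong refl)
           (auto simp: sum_distrib_right z_def G_def hc_def power_mult_distrib intro!: sum.cong)
      also have "\<dots> = (\<Sum>k<N. ((\<i> * of_real t) ^ k / fact k) * (\<integral>x. complex_of_real (r x) * (of_real x ^ k * hc 0 x) \<partial>lborel))"
        by (subst Bochner_Integration.integral_sum) (auto intro!: integrable_mult_right int)
      also have "\<dots> = 0" by (simp add: moments_zero[OF g])
      finally show ?thesis .
    qed
    ultimately show ?thesis unfolding z_def by (simp add: LIMSEQ_const_iff)
  qed
  \<comment> \<open>Levy's theorem concerns probability measures, whereas \<open>G\<close> is
    signed. Its positive and negative parts have equal transforms and are compared as two
    densities.\<close>
  define P where "P x = max 0 (G x)" for x
  define M where "M x = max 0 (- G x)" for x
  have [measurable]: "P \<in> borel_measurable borel" "M \<in> borel_measurable borel"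
    unfolding P_def M_def by measurable
  have int: "integrable lborel P" "integrable lborel M"
    unfolding P_def M_def using Gi by auto
  have GPM: "G x = P x - M x" for x by (auto simp: P_def M_def)
  have nn: "P x \<ge> 0" "M x \<ge> 0" for x by (auto simp: P_def M_def)
  have inti: "integrable lborel (\<lambda>x. iexp (t * x) * complex_of_real (P x))"
    "integrable lborel (\<lambda>x. iexp (t * x) * complex_of_real (M x))" for t
    by (rule Bochner_Integration.integrable_bound[OF int(1)], auto simp: norm_mult)
       (rule Bochner_Integration.integrable_bound[OF int(2)], auto simp: norm_mult)
  have eq: "(\<integral>x. iexp (t * x) * complex_of_real (P x) \<partial>lborel) = (\<integral>x. iexp (t * x) * complex_of_real (M x) \<partial>lborel)" for t
  proof -
    have "(\<integral>x. iexp (t * x) * complex_of_real (G x) \<partial>lborel)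
      = (\<integral>x. iexp (t * x) * complex_of_real (P x) - iexp (t * x) * complex_of_real (M x) \<partial>lborel)"
      by (simp add: GPM right_diff_distrib)
    then show ?thesis using char0[of t] inti[of t] by (simp add: Bochner_Integration.integral_diff)
  qed
  \<comment> \<open>Frequency 0 shows that both parts have the same mass \<open>m\<close>. They can
    be normalised unless \<open>m\<close> = 0, and in that case both vanish almost
    everywhere.\<close>
  define m where "m = (\<integral>x. P x \<partial>lborel)"
  have "complex_of_real m = of_real (\<integral>x. M x \<partial>lborel)"
    using eq[of 0] by (simp add: m_def integral_complex_of_real)
  then have mM: "m = (\<integral>x. M x \<partial>lborel)" by simp
  have "AE x in lborel. G x = 0"
  proof (cases "m = 0")
    case True
    have "AE x in lborel. P x = 0" "AE x in lborel. M x = 0"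
      using True mM integral_nonneg_eq_0_iff_AE[OF int(1)] integral_nonneg_eq_0_iff_AE[OF int(2)] nn
      by (auto simp: m_def)
    then show ?thesis by eventually_elim (simp add: GPM)
  next
    case False
    have "m \<ge> 0" unfolding m_def using nn by (intro Bochner_Integration.integral_nonneg) auto
    then have m: "m > 0" using False by simp
    define MP where "MP = density lborel (\<lambda>x. ennreal (P x / m))"
    define MM where "MM = density lborel (\<lambda>x. ennreal (M x / m))"
    have prob: "real_distribution (density lborel (\<lambda>x. ennreal (Q x / m)))"
      if "integrable lborel Q" "\<And>x. Q x \<ge> 0" "(\<integral>x. Q x \<partial>lborel) = m" for Q :: "real \<Rightarrow> real"
    proof -
      have [measurable]: "Q \<in> borel_measurable borel" using borel_measurable_integrable[OF that(1)] by simp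
      have "(\<integral>\<^sup>+x. ennreal (Q x / m) \<partial>lborel) = ennreal (\<integral>x. Q x / m \<partial>lborel)"
        using that m by (intro nn_integral_eq_integral) auto
      also have "\<dots> = 1" using that m by simp
      finally have "prob_space (density lborel (\<lambda>x. ennreal (Q x / m)))"
        by (intro prob_spaceI) (simp add: emeasure_density)
      then interpret prob_space "density lborel (\<lambda>x. ennreal (Q x / m))" .
      show ?thesis by unfold_locales simp
    qed
    have charQ: "char (density lborel (\<lambda>x. ennreal (Q x / m))) t = (\<integral>x. iexp (t * x) * complex_of_real (Q x) \<partial>lborel) / of_real m"
      if [measurable]: "Q \<in> borel_measurable borel" and "\<And>x. Q x \<ge> 0" for Q :: "real \<Rightarrow> real" and t
    proof -
      have "char (density lborel (\<lambda>x. ennreal (Q x / m))) t = (\<integral>x. (Q x / m) *\<^sub>R iexp (t * x) \<partial>lborel)"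
        unfolding char_def using that m by (intro integral_density) (auto intro!: AE_I2)
      also have "\<dots> = (\<integral>x. iexp (t * x) * complex_of_real (Q x) / of_real m \<partial>lborel)"
        by (intro Bochner_Integration.integral_cong) (auto simp: scaleR_conv_of_real)
      finally show ?thesis by simp
    qed
    have "MP = MM"
      unfolding MP_def MM_def
    proof (rule Levy_uniqueness)
      show "char (density lborel (\<lambda>x. ennreal (P x / m))) = char (density lborel (\<lambda>x. ennreal (M x / m)))"
        by (rule ext) (simp only: charQ[OF \<open>P \<in> borel_measurable borel\<close> nn(1)] charQ[OF \<open>M \<in> borel_measurable borel\<close> nn(2)] eq)
    qed (use prob int nn m_def mM in auto)
    then have "AE x in lborel. ennreal (P x / m) = ennreal (M x / m)"
      unfolding MP_def MM_def by (intro sigma_finite_measure.density_unique[OF sigma_finite_lborel]) auto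
    then show ?thesis
      by eventually_elim (use m nn in \<open>auto simp: GPM ennreal_inj\<close>)
  qed
  then show ?thesis
  proof eventually_elim
    case (elim x) then show ?case using h0[of x] by (simp add: G_def)
  qed
qed

text \<open>The Hermite functions are real, so the coefficients of the real and of the imaginary
  part vanish separately.\<close>

lemma hermite_complete:
  assumes g: "L2 g" "\<And>n. ip g (hc n) = 0"
  shows "AE x in lborel. g x = 0"
proof -
  have *: "ip g (hc n) = ip (\<lambda>x. complex_of_real (Re (g x))) (hc n) + \<i> * ip (\<lambda>x. complex_of_real (Im (g x))) (hc n)" for n
  proof -
    have "ip g (hc n) = ip (\<lambda>x. complex_of_real (Re (g x)) + \<i> * complex_of_real (Im (g x))) (hc n)"
      by (simp add: complex_eq[symmetric])
    then show ?thesis using L2_real_part[OF g(1)]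
      by (simp add: ip_add_left L2_scale L2_hc ip_scale_left)
  qed
  have r: "ip (\<lambda>x. complex_of_real (f x)) (hc n) \<in> \<real>" for f n
    unfolding ip_def hc_cnj unfolding hc_def of_real_mult[symmetric] by (simp only: integral_complex_of_real Reals_of_real)
  have "ip (\<lambda>x. complex_of_real (Re (g x))) (hc n) = 0 \<and> ip (\<lambda>x. complex_of_real (Im (g x))) (hc n) = 0" for n
    using *[of n] g(2)[of n] r[of "\<lambda>x. Re (g x)" n] r[of "\<lambda>x. Im (g x)" n]
    by (auto elim!: Reals_cases simp: complex_eq_iff)
  then have "AE x in lborel. Re (g x) = 0" "AE x in lborel. Im (g x) = 0"
    using L2_real_part[OF g(1)] by (auto intro: real_hermite_complete)
  then show ?thesis by eventually_elim (simp add: complex_eq_iff)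
qed

lemma onb_hc: "onb hc"
  by unfold_locales (auto intro: L2_hc hermite_complete simp: hc_orth)

subsection \<open>A moving orthonormal basis of exact solutions\<close>

lemma polar_deriv:
  fixes B :: "real \<Rightarrow> complex"
  assumes "(w has_real_derivative w') (at t within S)" "(B has_vector_derivative B') (at t within S)"
  shows "((\<lambda>t. exp (\<i> * of_real (w t)) * B t) has_vector_derivative
    exp (\<i> * of_real (w t)) * (\<i> * of_real w' * B t + B')) (at t within S)"
proof -
  have "((\<lambda>t. \<i> * of_real (w t)) has_vector_derivative \<i> * of_real w') (at t within S)"
    by (intro has_vector_derivative_mult_right has_vector_derivative_of_real assms)
  from field_vector_diff_chain_within[OF this, of exp "exp (\<i> * of_real (w t))"]
  have "((\<lambda>t. exp (\<i> * of_real (w t))) has_vector_derivative \<i> * of_real w' * exp (\<i> * of_real (w t))) (at t within S)"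
    using DERIV_exp has_field_derivative_at_within by (force simp: o_def)
  from has_vector_derivative_mult[OF this assms(2)] show ?thesis
    by (simp add: algebra_simps)
qed

text \<open>The initial values make the moving basis coincide with the Hermite basis at
  \<open>t0\<close>. All derivatives are taken within \<open>{t0..}\<close>, matching the one-sided
  derivative in the notion of solution.\<close>

locale osc =
  fixes a \<rho> \<rho>' \<theta> :: "real \<Rightarrow> real" and t0 :: real
  assumes rho_pos: "t \<ge> t0 \<Longrightarrow> \<rho> t > 0"
    and rho_deriv: "t \<ge> t0 \<Longrightarrow> (\<rho> has_real_derivative \<rho>' t) (at t within {t0..})"
    and rho'_deriv: "t \<ge> t0 \<Longrightarrow> (\<rho>' has_real_derivative 1 / (\<rho> t) ^ 3 - (1 + a t) * \<rho> t) (at t within {t0..})"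
    and theta_deriv: "t \<ge> t0 \<Longrightarrow> (\<theta> has_real_derivative 1 / (\<rho> t)\<^sup>2) (at t within {t0..})"
    and a_cont: "continuous_on {t0..} a"
    and init: "\<rho> t0 = 1" "\<rho>' t0 = 0" "\<theta> t0 = 0"
begin

text \<open>The signs follow from the form (1/i) d/dt u = H u of the equation, in which energy E
  evolves by the phase exp(+ i E t). Hence the phase is the complex conjugate of the one customary
  for i d/dt u = H u.\<close>

definition om :: "nat \<Rightarrow> real \<Rightarrow> real \<Rightarrow> real" where
  "om n t x = (real n + 1/2) * \<theta> t - (\<rho>' t / \<rho> t) / 2 * x\<^sup>2"

definition am :: "nat \<Rightarrow> real \<Rightarrow> real \<Rightarrow> real" where
  "am n t x = hermite_fun n (x / \<rho> t) / sqrt (\<rho> t)"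

definition Psi :: "nat \<Rightarrow> real \<Rightarrow> real \<Rightarrow> complex" where
  "Psi n t x = exp (\<i> * of_real (om n t x)) * of_real (am n t x)"

definition amx :: "nat \<Rightarrow> real \<Rightarrow> real \<Rightarrow> real" where
  "amx n t x = hfd n (x / \<rho> t) / (\<rho> t * sqrt (\<rho> t))"

definition amxx :: "nat \<Rightarrow> real \<Rightarrow> real \<Rightarrow> real" where
  "amxx n t x = ((x / \<rho> t)\<^sup>2 - (2 * real n + 1)) * hermite_fun n (x / \<rho> t) / ((\<rho> t)\<^sup>2 * sqrt (\<rho> t))"

definition PsiX :: "nat \<Rightarrow> real \<Rightarrow> real \<Rightarrow> complex" where
  "PsiX n t x = exp (\<i> * of_real (om n t x)) *
     (\<i> * of_real (- (\<rho>' t / \<rho> t) * x) * of_real (am n t x) + of_real (amx n t x))"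

definition PsiXX :: "nat \<Rightarrow> real \<Rightarrow> real \<Rightarrow> complex" where
  "PsiXX n t x = exp (\<i> * of_real (om n t x)) *
     (\<i> * of_real (- (\<rho>' t / \<rho> t) * x) * (\<i> * of_real (- (\<rho>' t / \<rho> t) * x) * of_real (am n t x) + of_real (amx n t x))
      + (\<i> * of_real (- (\<rho>' t / \<rho> t)) * of_real (am n t x) + \<i> * of_real (- (\<rho>' t / \<rho> t) * x) * of_real (amx n t x) + of_real (amxx n t x)))"

text \<open>Defined as the right-hand side of the Schroedinger equation applied to
  \<open>Psi\<close>. That it is also the time derivative is a separate fact, and together they say
  that \<open>Psi\<close> is an exact solution.\<close>

definition PsiT :: "nat \<Rightarrow> real \<Rightarrow> real \<Rightarrow> complex" where
  "PsiT n t x = \<i> / 2 * (- PsiXX n t x + of_real ((1 + a t) * x\<^sup>2) * Psi n t x)"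

text \<open>The complex solution y of y'' + (1 + a) y = 0 with y(t0) = 1 and y'(t0) = \<i>, in polar
  form; \<open>nu\<close> is its derivative. They become the coefficients of position and momentum
  in the moving ladder.\<close>

definition mu :: "real \<Rightarrow> complex" where "mu t = of_real (\<rho> t) * exp (\<i> * of_real (\<theta> t))"

definition nu :: "real \<Rightarrow> complex" where
  "nu t = (of_real (\<rho>' t) + \<i> / of_real (\<rho> t)) * exp (\<i> * of_real (\<theta> t))"

lemma om_x: "((\<lambda>x. om n t x) has_real_derivative - (\<rho>' t / \<rho> t) * x) (at x)"
  unfolding om_def
  by (rule DERIV_cong[OF DERIV_diff[OF DERIV_const DERIV_cmult[OF DERIV_power[OF DERIV_ident]]]]) simp

lemma am_x:
  assumes "t \<ge> t0" shows "((\<lambda>x. am n t x) has_real_derivative amx n t x) (at x)"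
  unfolding am_def amx_def
  by (rule DERIV_cong[OF DERIV_cdivide[OF DERIV_chain2[OF hermite_fun_deriv DERIV_cdivide[OF DERIV_ident]]]]) simp

lemma amx_x:
  assumes "t \<ge> t0" shows "((\<lambda>x. amx n t x) has_real_derivative amxx n t x) (at x)"
  unfolding amx_def amxx_def
  by (rule DERIV_cong[OF DERIV_cdivide[OF DERIV_chain2[OF hermite_fun_second_deriv DERIV_cdivide[OF DERIV_ident]]]])
     (simp add: power2_eq_square)

lemma Psi_x_deriv:
  assumes "t \<ge> t0" shows "(Psi n t has_vector_derivative PsiX n t x) (at x)"
  unfolding Psi_def[abs_def] PsiX_def
  by (intro polar_deriv om_x has_vector_derivative_of_real am_x assms)

lemma PsiX_x_deriv:
  assumes "t \<ge> t0" shows "(PsiX n t has_vector_derivative PsiXX n t x) (at x)"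
proof -
  have "((\<lambda>x. \<i> * of_real (- (\<rho>' t / \<rho> t) * x) * of_real (am n t x) + complex_of_real (amx n t x)) has_vector_derivative
     (\<i> * of_real (- (\<rho>' t / \<rho> t) * x)) * of_real (amx n t x) + (\<i> * of_real (- (\<rho>' t / \<rho> t))) * of_real (am n t x) + of_real (amxx n t x)) (at x)"
    by (intro has_vector_derivative_add has_vector_derivative_mult has_vector_derivative_mult_right
        has_vector_derivative_of_real am_x amx_x assms DERIV_cmult_Id)
  then have "((\<lambda>x. \<i> * of_real (- (\<rho>' t / \<rho> t) * x) * of_real (am n t x) + complex_of_real (amx n t x)) has_vector_derivative
     \<i> * of_real (- (\<rho>' t / \<rho> t)) * of_real (am n t x) + \<i> * of_real (- (\<rho>' t / \<rho> t) * x) * of_real (amx n t x) + of_real (amxx n t x)) (at x)"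
    by (simp add: add.commute)
  then show ?thesis unfolding PsiX_def[abs_def] PsiXX_def by (intro polar_deriv om_x)
qed

definition omt :: "nat \<Rightarrow> real \<Rightarrow> real \<Rightarrow> real" where
  "omt n t x = (real n + 1/2) / (\<rho> t)\<^sup>2 - (1 / (\<rho> t) ^ 4 - (1 + a t) - (\<rho>' t / \<rho> t)\<^sup>2) / 2 * x\<^sup>2"

definition amt :: "nat \<Rightarrow> real \<Rightarrow> real \<Rightarrow> real" where
  "amt n t x = - (\<rho>' t / (2 * \<rho> t)) * am n t x - (\<rho>' t * x / \<rho> t) * amx n t x"

lemma om_t:
  assumes t: "t \<ge> t0" shows "((\<lambda>t. om n t x) has_real_derivative omt n t x) (at t within {t0..})"
proof -
  have r: "\<rho> t \<noteq> 0" using rho_pos[OF t] by simp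
  have "((\<lambda>t. om n t x) has_real_derivative (real n + 1/2) * (1 / (\<rho> t)\<^sup>2)
      - ((1 / (\<rho> t) ^ 3 - (1 + a t) * \<rho> t) * \<rho> t - \<rho>' t * \<rho>' t) / (\<rho> t * \<rho> t) / 2 * x\<^sup>2) (at t within {t0..})"
    unfolding om_def
    by (intro DERIV_diff DERIV_cmult DERIV_cmult_right DERIV_cdivide DERIV_divide theta_deriv rho_deriv rho'_deriv t r)
  moreover have "((1 / (\<rho> t) ^ 3 - (1 + a t) * \<rho> t) * \<rho> t - \<rho>' t * \<rho>' t) / (\<rho> t * \<rho> t)
      = 1 / (\<rho> t) ^ 4 - (1 + a t) - (\<rho>' t / \<rho> t)\<^sup>2"
    using r by (simp add: field_simps power2_eq_square power3_eq_cube power4_eq_xxxx)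
  ultimately show ?thesis by (simp add: omt_def)
qed

lemma am_t:
  assumes t: "t \<ge> t0" shows "((\<lambda>t. am n t x) has_real_derivative amt n t x) (at t within {t0..})"
proof -
  have r: "\<rho> t \<noteq> 0" "\<rho> t > 0" using rho_pos[OF t] by simp_all
  have 1: "((\<lambda>t. x / \<rho> t) has_real_derivative - (x * \<rho>' t) / (\<rho> t * \<rho> t)) (at t within {t0..})"
    using DERIV_divide[OF DERIV_const[of x] rho_deriv[OF t] r(1)] by simp
  have 2: "((\<lambda>t. sqrt (\<rho> t)) has_real_derivative \<rho>' t / (2 * sqrt (\<rho> t))) (at t within {t0..})"
    using DERIV_chain2[OF DERIV_real_sqrt[OF r(2)] rho_deriv[OF t]] by (simp add: field_simps)
  have "((\<lambda>t. am n t x) has_real_derivative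
      (hfd n (x / \<rho> t) * (- (x * \<rho>' t) / (\<rho> t * \<rho> t)) * sqrt (\<rho> t) - hermite_fun n (x / \<rho> t) * (\<rho>' t / (2 * sqrt (\<rho> t))))
        / (sqrt (\<rho> t) * sqrt (\<rho> t))) (at t within {t0..})"
    unfolding am_def using r by (intro DERIV_divide DERIV_chain2[OF hermite_fun_deriv 1] 2) auto
  moreover have "(hfd n (x / \<rho> t) * (- (x * \<rho>' t) / (\<rho> t * \<rho> t)) * sqrt (\<rho> t) - hermite_fun n (x / \<rho> t) * (\<rho>' t / (2 * sqrt (\<rho> t))))
        / (sqrt (\<rho> t) * sqrt (\<rho> t)) = amt n t x"
  proof -
    define s where "s = sqrt (\<rho> t)"
    have s: "s \<noteq> 0" "\<rho> t = s * s" using r by (auto simp: s_def)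
    show ?thesis unfolding amt_def am_def amx_def s_def[symmetric]
      unfolding s(2) using s(1) by (simp add: field_simps)
  qed
  ultimately show ?thesis by simp
qed

text \<open>After removal of the common phase the equation splits: \<open>re\<close> is the phase
  (Hamilton-Jacobi) equation for \<open>om\<close> and \<open>im\<close> the transport equation for
  \<open>am\<close>. The Ermakov-Pinney equation is hidden in \<open>omt\<close>, whose x^2
  coefficient cancels the potential.\<close>

lemma PsiT_eq:
  assumes t: "t \<ge> t0"
  shows "PsiT n t x = exp (\<i> * of_real (om n t x)) * (\<i> * of_real (omt n t x) * of_real (am n t x) + of_real (amt n t x))"
proof -
  have r: "\<rho> t \<noteq> 0" using rho_pos[OF t] by simp
  define g where "g = \<rho>' t / \<rho> t"
  define u where "u = 1 / (\<rho> t)\<^sup>2"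
  define v where "v = 1 / (\<rho> t) ^ 4"
  have xx: "amxx n t x = (v * x\<^sup>2 - (2 * real n + 1) * u) * am n t x"
    using r by (simp add: amxx_def am_def u_def v_def power_divide field_simps power2_eq_square power4_eq_xxxx)
  have om: "omt n t x = (real n + 1/2) * u - (v - (1 + a t) - g\<^sup>2) / 2 * x\<^sup>2"
    by (simp add: omt_def g_def u_def v_def)
  have re: "omt n t x * am n t x = - (amxx n t x - g\<^sup>2 * x\<^sup>2 * am n t x) / 2 + (1 + a t) * x\<^sup>2 * am n t x / 2"
    unfolding xx om by (simp add: field_simps)
  have im: "amt n t x = - (g * am n t x) / 2 - g * x * amx n t x"
    by (simp add: amt_def g_def)
  have "\<i> / 2 * (- (\<i> * of_real (- g * x) * (\<i> * of_real (- g * x) * of_real (am n t x) + of_real (amx n t x))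
      + (\<i> * of_real (- g) * of_real (am n t x) + \<i> * of_real (- g * x) * of_real (amx n t x) + of_real (amxx n t x)))
      + of_real ((1 + a t) * x\<^sup>2) * of_real (am n t x))
    = \<i> * of_real (omt n t x * am n t x) + of_real (amt n t x)"
    unfolding re im by (simp add: complex_eq_iff power2_eq_square field_simps)
  also have "\<dots> = \<i> * of_real (omt n t x) * of_real (am n t x) + of_real (amt n t x)" by simp
  finally have eq: "\<i> / 2 * (- (\<i> * of_real (- g * x) * (\<i> * of_real (- g * x) * of_real (am n t x) + of_real (amx n t x))
      + (\<i> * of_real (- g) * of_real (am n t x) + \<i> * of_real (- g * x) * of_real (amx n t x) + of_real (amxx n t x)))
      + of_real ((1 + a t) * x\<^sup>2) * of_real (am n t x))
    = \<i> * of_real (omt n t x) * of_real (am n t x) + of_real (amt n t x)" .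
  have gen: "\<i> / 2 * (- (E * B) + c * (E * m)) = E * (\<i> / 2 * (- B + c * m))" for E B c m :: complex
    by (simp add: algebra_simps)
  show ?thesis unfolding PsiT_def PsiXX_def Psi_def gen eq[unfolded g_def] ..
qed

lemma Psi_t_deriv:
  assumes "t \<ge> t0" shows "((\<lambda>t. Psi n t x) has_vector_derivative PsiT n t x) (at t within {t0..})"
  unfolding Psi_def[abs_def] PsiT_eq[OF assms]
  by (intro polar_deriv om_t am_t has_vector_derivative_of_real assms)

lemma phase_up: "exp (\<i> * of_real (om (Suc n) t x)) = exp (\<i> * of_real (\<theta> t)) * exp (\<i> * of_real (om n t x))"
  unfolding exp_add[symmetric] by (simp add: om_def algebra_simps)

lemma exp_theta_cnj: "cnj (exp (\<i> * of_real (\<theta> t))) * exp (\<i> * of_real (\<theta> t)) = 1"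
  by (simp add: exp_cnj exp_add[symmetric])

lemma Psi_up: "cnj (exp (\<i> * of_real (\<theta> t))) * Psi (Suc n) t x = exp (\<i> * of_real (om n t x)) * of_real (am (Suc n) t x)"
  unfolding Psi_def phase_up using exp_theta_cnj[of t] by (simp add: mult.assoc[symmetric])

lemma Psi_down: "exp (\<i> * of_real (\<theta> t)) * (of_real (sqrt (real n)) * Psi (n - 1) t x)
    = exp (\<i> * of_real (om n t x)) * of_real (sqrt (real n) * am (n - 1) t x)"
  by (cases n) (simp_all add: Psi_def phase_up)

lemma am_ladder:
  assumes "t \<ge> t0"
  shows "sqrt 2 * x * am n t x = \<rho> t * (sqrt (real n) * am (n - 1) t x + sqrt (real (Suc n)) * am (Suc n) t x)"
    "sqrt 2 * amx n t x = (sqrt (real n) * am (n - 1) t x - sqrt (real (Suc n)) * am (Suc n) t x) / \<rho> t"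
proof -
  have r: "\<rho> t > 0" by (rule rho_pos[OF assms])
  have "sqrt 2 * x * am n t x = \<rho> t * (sqrt 2 * (x / \<rho> t) * hermite_fun n (x / \<rho> t)) / sqrt (\<rho> t)"
    using r by (simp add: am_def)
  also have "\<dots> = \<rho> t * (sqrt (real n) * am (n - 1) t x + sqrt (real (Suc n)) * am (Suc n) t x)"
    unfolding hermite_fun_x by (simp add: am_def add_divide_distrib algebra_simps)
  finally show "sqrt 2 * x * am n t x = \<rho> t * (sqrt (real n) * am (n - 1) t x + sqrt (real (Suc n)) * am (Suc n) t x)" .
  show "sqrt 2 * amx n t x = (sqrt (real n) * am (n - 1) t x - sqrt (real (Suc n)) * am (Suc n) t x) / \<rho> t"
  proof -
    have "sqrt 2 * hfd n y = sqrt (real n) * hermite_fun (n - 1) y - sqrt (real (Suc n)) * hermite_fun (Suc n) y" for y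
      by (simp add: hfd_def)
    then have "sqrt 2 * amx n t x = (sqrt (real n) * hermite_fun (n - 1) (x / \<rho> t)
        - sqrt (real (Suc n)) * hermite_fun (Suc n) (x / \<rho> t)) / (\<rho> t * sqrt (\<rho> t))"
      by (simp only: amx_def times_divide_eq_right)
    then show ?thesis by (simp add: am_def diff_divide_distrib mult.commute)
  qed
qed

text \<open>Neighbouring members differ in phase by exp(\<i> \<theta>), and this factor is absorbed
  into \<open>mu\<close>. In the moving basis position is again a sum of a lowering and a raising
  operator, now with complex coefficients.\<close>

lemma Psi_x:
  assumes "t \<ge> t0"
  shows "of_real (sqrt 2) * of_real x * Psi n t x
    = mu t * (of_real (sqrt (real n)) * Psi (n - 1) t x) + cnj (mu t) * (of_real (sqrt (real (Suc n))) * Psi (Suc n) t x)"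
proof -
  let ?e = "exp (\<i> * of_real (om n t x))"
  have "of_real (sqrt 2) * of_real x * Psi n t x = ?e * of_real (sqrt 2 * x * am n t x)"
    by (simp add: Psi_def)
  also have "\<dots> = of_real (\<rho> t) * (?e * of_real (sqrt (real n) * am (n - 1) t x))
      + of_real (\<rho> t) * of_real (sqrt (real (Suc n))) * (?e * of_real (am (Suc n) t x))"
    unfolding am_ladder(1)[OF assms] of_real_mult of_real_add by (simp only: algebra_simps)
  also have "\<dots> = mu t * (of_real (sqrt (real n)) * Psi (n - 1) t x) + cnj (mu t) * (of_real (sqrt (real (Suc n))) * Psi (Suc n) t x)"
    unfolding Psi_up[symmetric] Psi_down[symmetric] mu_def complex_cnj_mult complex_cnj_complex_of_real
    by (simp only: mult_ac)
  finally show ?thesis .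
qed

lemma Psi_dx:
  assumes "t \<ge> t0"
  shows "of_real (sqrt 2) * PsiX n t x
    = - \<i> * nu t * (of_real (sqrt (real n)) * Psi (n - 1) t x) - \<i> * cnj (nu t) * (of_real (sqrt (real (Suc n))) * Psi (Suc n) t x)"
proof -
  let ?e = "exp (\<i> * of_real (om n t x))"
  have r: "\<rho> t \<noteq> 0" using rho_pos[OF assms] by simp
  let ?p = "sqrt (real n) * am (n - 1) t x" and ?q = "sqrt (real (Suc n)) * am (Suc n) t x"
  have "of_real (sqrt 2) * PsiX n t x = ?e * (- \<i> * of_real (\<rho>' t / \<rho> t) * of_real (sqrt 2 * x * am n t x) + of_real (sqrt 2 * amx n t x))"
    by (simp add: PsiX_def algebra_simps)
  also have "\<dots> = ?e * (- \<i> * (of_real (\<rho>' t) + \<i> / of_real (\<rho> t)) * of_real ?p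
      - \<i> * cnj (of_real (\<rho>' t) + \<i> / of_real (\<rho> t)) * of_real ?q)"
    unfolding am_ladder[OF assms] using r by (simp add: field_simps complex_eq_iff)
  also have "\<dots> = - \<i> * (of_real (\<rho>' t) + \<i> / of_real (\<rho> t)) * (?e * of_real ?p)
      - \<i> * cnj (of_real (\<rho>' t) + \<i> / of_real (\<rho> t)) * (of_real (sqrt (real (Suc n))) * (?e * of_real (am (Suc n) t x)))"
    unfolding of_real_mult by (simp only: algebra_simps)
  also have "\<dots> = - \<i> * nu t * (of_real (sqrt (real n)) * Psi (n - 1) t x) - \<i> * cnj (nu t) * (of_real (sqrt (real (Suc n))) * Psi (Suc n) t x)"
    unfolding Psi_up[symmetric] Psi_down[symmetric] nu_def complex_cnj_mult
    by (simp only: mult_ac)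
  finally show ?thesis .
qed

lemma Psi_init: "Psi n t0 = hc n"
  by (rule ext) (simp add: Psi_def om_def am_def init hc_def)

lemma norm_Psi: "cmod (Psi n t x) = \<bar>am n t x\<bar>"
  by (simp add: Psi_def norm_mult)

lemma rho_cont: "continuous_on {t0..} \<rho>" and rho'_cont: "continuous_on {t0..} \<rho>'" and theta_cont: "continuous_on {t0..} \<theta>"
  using rho_deriv rho'_deriv theta_deriv by (auto intro!: DERIV_continuous_on)

lemma gdec_rescale:
  assumes "gdec f" "r > 0" shows "gdec (\<lambda>x. f (x / r))"
proof -
  obtain C c where c: "c > 0" "\<And>x. cmod (f x) \<le> C * exp (- (c * x\<^sup>2))"
    using assms(1) unfolding gdec_def by blast
  show ?thesis
    by (rule gdecI[of "c / r\<^sup>2" _ C]) (use c assms(2) in \<open>auto simp: power_divide dest: spec[of _ "_ / r"]\<close>, metis power_divide times_divide_eq_left times_divide_eq_right)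
qed

lemma gdec_Psi:
  assumes "t \<ge> t0" shows "gdec (Psi n t)"
proof (rule gdec_mono[OF gdec_rescale[OF gdec_hc rho_pos[OF assms]]])
  fix x
  show "cmod (Psi n t x) \<le> (1 / sqrt (\<rho> t)) * cmod (hc n (x / \<rho> t))"
    using rho_pos[OF assms] by (simp add: norm_Psi am_def hc_def)
qed

lemma Psi_continuous: "t \<ge> t0 \<Longrightarrow> continuous_on A (Psi n t)"
  by (rule has_vector_derivative_continuous_on[OF Psi_x_deriv])

text \<open>The coefficients of d/dx in the moving basis. Through them every spatial derivative
  becomes a finite combination of basis members, which settles its decay and smoothness.\<close>

definition lo :: "nat \<Rightarrow> real \<Rightarrow> complex" where
  "lo n t = - (\<i> * nu t * of_real (sqrt (real n))) / of_real (sqrt 2)"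

definition hi :: "nat \<Rightarrow> real \<Rightarrow> complex" where
  "hi n t = - (\<i> * cnj (nu t) * of_real (sqrt (real (Suc n)))) / of_real (sqrt 2)"

lemma PsiX_eq:
  assumes "t \<ge> t0"
  shows "PsiX n t = (\<lambda>x. lo n t * Psi (n - 1) t x + hi n t * Psi (Suc n) t x)"
proof
  fix x
  have "complex_of_real (sqrt 2) * lo n t = - (\<i> * nu t * of_real (sqrt (real n)))"
    "complex_of_real (sqrt 2) * hi n t = - (\<i> * cnj (nu t) * of_real (sqrt (real (Suc n))))"
    by (simp_all add: lo_def hi_def)
  then have "complex_of_real (sqrt 2) * (lo n t * Psi (n - 1) t x + hi n t * Psi (Suc n) t x)
      = of_real (sqrt 2) * PsiX n t x"
    unfolding Psi_dx[OF assms] by (simp only: distrib_left mult.assoc[symmetric]) (simp add: mult.assoc)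
  then show "PsiX n t x = lo n t * Psi (n - 1) t x + hi n t * Psi (Suc n) t x" by simp
qed

lemma gdec_PsiX: "t \<ge> t0 \<Longrightarrow> gdec (PsiX n t)"
  unfolding PsiX_eq by (intro gdec_add gdec_scale gdec_Psi)

text \<open>Obtained from uniqueness of the derivative by differentiating the ladder form of
  \<open>PsiX\<close>, which spares any algebra with the explicit formula.\<close>

lemma PsiXX_eq:
  assumes "t \<ge> t0"
  shows "PsiXX n t = (\<lambda>x. lo n t * PsiX (n - 1) t x + hi n t * PsiX (Suc n) t x)"
proof
  fix x
  have "(PsiX n t has_vector_derivative lo n t * PsiX (n - 1) t x + hi n t * PsiX (Suc n) t x) (at x)"
    unfolding PsiX_eq[OF assms, of n]
    by (intro has_vector_derivative_add has_vector_derivative_mult_right Psi_x_deriv assms)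
  then show "PsiXX n t x = lo n t * PsiX (n - 1) t x + hi n t * PsiX (Suc n) t x"
    using PsiX_x_deriv[OF assms] vector_derivative_unique_at by blast
qed

lemma gdec_PsiXX: "t \<ge> t0 \<Longrightarrow> gdec (PsiXX n t)"
  unfolding PsiXX_eq by (intro gdec_add gdec_scale gdec_PsiX)

lemma PsiX_continuous: "t \<ge> t0 \<Longrightarrow> continuous_on A (PsiX n t)"
  by (rule has_vector_derivative_continuous_on[OF PsiX_x_deriv])

lemma PsiXX_continuous: "t \<ge> t0 \<Longrightarrow> continuous_on A (PsiXX n t)"
  unfolding PsiXX_eq by (intro continuous_intros PsiX_continuous)

lemma Psi_measurable [measurable]: "t \<ge> t0 \<Longrightarrow> Psi n t \<in> borel_measurable borel"
  by (intro borel_measurable_continuous_onI Psi_continuous)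

lemma PsiX_measurable [measurable]: "t \<ge> t0 \<Longrightarrow> PsiX n t \<in> borel_measurable borel"
  by (intro borel_measurable_continuous_onI PsiX_continuous)

lemma PsiXX_measurable [measurable]: "t \<ge> t0 \<Longrightarrow> PsiXX n t \<in> borel_measurable borel"
  by (intro borel_measurable_continuous_onI PsiXX_continuous)

lemma L2_Psi: "t \<ge> t0 \<Longrightarrow> L2 (Psi n t)"
  by (intro gdec_L2 gdec_Psi) auto

lemma L2_PsiX: "t \<ge> t0 \<Longrightarrow> L2 (PsiX n t)"
  by (intro gdec_L2 gdec_PsiX) auto

lemma L2_PsiXX: "t \<ge> t0 \<Longrightarrow> L2 (PsiXX n t)"
  by (intro gdec_L2 gdec_PsiXX) auto

lemma gdec_PsiT: "t \<ge> t0 \<Longrightarrow> gdec (PsiT n t)"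
proof -
  assume t: "t \<ge> t0"
  have "PsiT n t = (\<lambda>x. (\<i> / 2) * ((-1) * PsiXX n t x + of_real (1 + a t) * (of_real x * (of_real x * Psi n t x))))"
    by (rule ext) (simp add: PsiT_def power2_eq_square)
  moreover have "gdec (\<lambda>x. (\<i> / 2) * ((-1) * PsiXX n t x + of_real (1 + a t) * (of_real x * (of_real x * Psi n t x))))"
    using gdec_scale[OF gdec_add[OF gdec_scale[OF gdec_PsiXX[OF t]] gdec_scale[OF gdec_times_x[OF gdec_times_x[OF gdec_Psi[OF t]]]]]] .
  ultimately show ?thesis by simp
qed

lemma PsiT_measurable [measurable]: "t \<ge> t0 \<Longrightarrow> PsiT n t \<in> borel_measurable borel"
  unfolding PsiT_def[abs_def] by measurable

lemma L2_PsiT: "t \<ge> t0 \<Longrightarrow> L2 (PsiT n t)"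
  by (intro gdec_L2 gdec_PsiT) auto

end

section \<open>Differentiation of curves with values in L2\<close>

lemma vector_derivative_quotient:
  fixes f :: "real \<Rightarrow> complex"
  shows "(f has_vector_derivative f') (at t within S) \<longleftrightarrow>
    ((\<lambda>\<tau>. (f \<tau> - f t) / of_real (\<tau> - t)) \<longlongrightarrow> f') (at t within S)"
proof -
  have "(f has_vector_derivative f') (at t within S) \<longleftrightarrow>
      ((\<lambda>y. (1 / norm (y - t)) *\<^sub>R (f y - (f t + (y - t) *\<^sub>R f'))) \<longlongrightarrow> 0) (at t within S)"
    unfolding has_vector_derivative_def has_derivative_within by (simp add: bounded_linear_scaleR_left)
  also have "\<dots> \<longleftrightarrow> ((\<lambda>y. norm ((1 / norm (y - t)) *\<^sub>R (f y - (f t + (y - t) *\<^sub>R f')))) \<longlongrightarrow> 0) (at t within S)"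
    by (simp only: tendsto_norm_zero_iff)
  also have "\<dots> \<longleftrightarrow> ((\<lambda>y. norm ((f y - f t) / of_real (y - t) - f')) \<longlongrightarrow> 0) (at t within S)"
  proof (intro tendsto_cong)
    have "norm ((1 / norm (y - t)) *\<^sub>R (f y - (f t + (y - t) *\<^sub>R f'))) = norm ((f y - f t) / of_real (y - t) - f')"
      if "y \<noteq> t" for y
    proof -
      have "(f y - f t) / of_real (y - t) - f' = (f y - (f t + (y - t) *\<^sub>R f')) / of_real (y - t)"
        using that by (simp add: field_simps scaleR_conv_of_real)
      show ?thesis unfolding \<open>(f y - f t) / of_real (y - t) - f' = _\<close> by (simp add: norm_divide del: of_real_diff)
    qed
    then show "\<forall>\<^sub>F y in at t within S. norm ((1 / norm (y - t)) *\<^sub>R (f y - (f t + (y - t) *\<^sub>R f'))) = norm ((f y - f t) / of_real (y - t) - f')"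
      by (auto simp: eventually_at_filter)
  qed
  also have "\<dots> \<longleftrightarrow> ((\<lambda>\<tau>. (f \<tau> - f t) / of_real (\<tau> - t)) \<longlongrightarrow> f') (at t within S)"
    by (simp only: tendsto_norm_zero_iff LIM_zero_iff)
  finally show ?thesis .
qed

lemma vector_mvt_bound:
  fixes f :: "real \<Rightarrow> complex"
  assumes "convex S" "\<And>x. x \<in> S \<Longrightarrow> (f has_vector_derivative f' x) (at x within S)"
    and "\<And>x. x \<in> S \<Longrightarrow> cmod (f' x) \<le> B" "x \<in> S" "y \<in> S"
  shows "cmod (f x - f y) \<le> B * \<bar>x - y\<bar>"
proof -
  have "norm (f x - f y) \<le> B * norm (x - y)"
  proof (rule differentiable_bound[OF assms(1)])
    show "(f has_derivative (\<lambda>h. h *\<^sub>R f' x)) (at x within S)" if "x \<in> S" for x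
      using assms(2)[OF that] by (simp add: has_vector_derivative_def)
    show "onorm (\<lambda>h. h *\<^sub>R f' x) \<le> B" if "x \<in> S" for x
    proof (rule onorm_le)
      fix h :: real
      show "norm (h *\<^sub>R f' x) \<le> B * norm h"
        using mult_left_mono[OF assms(3)[OF that], of "\<bar>h\<bar>"] by (simp add: mult.commute)
    qed
  qed (use assms in auto)
  then show ?thesis by simp
qed

lemma L2_tendsto_product:
  assumes L2: "\<And>\<tau>. \<tau> \<in> S \<Longrightarrow> L2 (u \<tau>)" "\<And>\<tau>. \<tau> \<in> S \<Longrightarrow> L2 (q \<tau>)" "L2 v" "L2 r" and t: "t \<in> S"
    and u: "((\<lambda>\<tau>. l2n (\<lambda>x. u \<tau> x - v x)) \<longlongrightarrow> 0) (at t within S)"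
    and q: "((\<lambda>\<tau>. l2n (\<lambda>x. q \<tau> x - r x)) \<longlongrightarrow> 0) (at t within S)"
  shows "((\<lambda>\<tau>. ip (u \<tau>) (q \<tau>)) \<longlongrightarrow> ip v r) (at t within S)"
proof (rule LIM_zero_cancel, rule Lim_null_comparison)
  let ?U = "\<lambda>\<tau>. l2n (\<lambda>x. u \<tau> x - v x)" and ?Q = "\<lambda>\<tau>. l2n (\<lambda>x. q \<tau> x - r x)"
  have "cmod (ip (u \<tau>) (q \<tau>) - ip v r) \<le> ?U \<tau> * (?Q \<tau> + l2n r) + l2n v * ?Q \<tau>" if "\<tau> \<in> S" for \<tau>
  proof -
    have "ip (u \<tau>) (q \<tau>) - ip v r = ip (\<lambda>x. u \<tau> x - v x) (q \<tau>) + ip v (\<lambda>x. q \<tau> x - r x)"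
      using L2 that by (simp add: ip_diff_left ip_diff_right)
    also have "cmod \<dots> \<le> ?U \<tau> * l2n (q \<tau>) + l2n v * ?Q \<tau>"
      using L2 that by (intro order_trans[OF norm_triangle_ineq] add_mono cauchy_schwarz L2_diff)
    also have "l2n (q \<tau>) \<le> ?Q \<tau> + l2n r"
      using l2n_triangle[OF L2_diff[OF L2(2)[OF that] L2(4)] L2(4)] by simp
    finally show ?thesis by (simp add: mult_left_mono)
  qed
  then show "\<forall>\<^sub>F \<tau> in at t within S. norm (ip (u \<tau>) (q \<tau>) - ip v r) \<le> ?U \<tau> * (?Q \<tau> + l2n r) + l2n v * ?Q \<tau>"
    by (auto simp: eventually_at_filter)
  have "((\<lambda>\<tau>. ?U \<tau> * (?Q \<tau> + l2n r) + l2n v * ?Q \<tau>) \<longlongrightarrow> 0 * (0 + l2n r) + l2n v * 0) (at t within S)"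
    by (intro tendsto_intros u q)
  then show "((\<lambda>\<tau>. ?U \<tau> * (?Q \<tau> + l2n r) + l2n v * ?Q \<tau>) \<longlongrightarrow> 0) (at t within S)" by simp
qed

lemma ip_product_rule:
  assumes L2: "\<And>\<tau>. \<tau> \<in> S \<Longrightarrow> L2 (u \<tau>)" "\<And>\<tau>. \<tau> \<in> S \<Longrightarrow> L2 (F \<tau>)" "L2 F'" and t: "t \<in> S"
    and u: "((\<lambda>\<tau>. l2n (\<lambda>x. u \<tau> x - u t x)) \<longlongrightarrow> 0) (at t within S)"
    and F: "((\<lambda>\<tau>. l2n (\<lambda>x. (F \<tau> x - F t x) / of_real (\<tau> - t) - F' x)) \<longlongrightarrow> 0) (at t within S)"
    and d: "((\<lambda>\<tau>. ip (u \<tau>) (F t)) has_vector_derivative d) (at t within S)"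
  shows "((\<lambda>\<tau>. ip (u \<tau>) (F \<tau>)) has_vector_derivative (d + ip (u t) F')) (at t within S)"
proof -
  have L2q: "L2 (\<lambda>x. (F \<tau> x - F t x) / of_real (\<tau> - t))" if "\<tau> \<in> S" for \<tau>
    using L2_scale[OF L2_diff[OF L2(2)[OF that] L2(2)[OF t]], of "1 / of_real (\<tau> - t)"] by simp
  have "((\<lambda>\<tau>. ip (u \<tau>) (\<lambda>x. (F \<tau> x - F t x) / of_real (\<tau> - t))) \<longlongrightarrow> ip (u t) F') (at t within S)"
    by (rule L2_tendsto_product[OF L2(1) L2q _ L2(3) t u F]) (use L2 t in auto)
  then have "((\<lambda>\<tau>. (ip (u \<tau>) (F t) - ip (u t) (F t)) / of_real (\<tau> - t) + ip (u \<tau>) (\<lambda>x. (F \<tau> x - F t x) / of_real (\<tau> - t))) \<longlongrightarrow> d + ip (u t) F') (at t within S)"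
    using d unfolding vector_derivative_quotient by (intro tendsto_add)
  moreover have "(ip (u \<tau>) (F t) - ip (u t) (F t)) / of_real (\<tau> - t) + ip (u \<tau>) (\<lambda>x. (F \<tau> x - F t x) / of_real (\<tau> - t))
      = (ip (u \<tau>) (F \<tau>) - ip (u t) (F t)) / of_real (\<tau> - t)" if "\<tau> \<in> S" for \<tau>
  proof -
    have "ip (u \<tau>) (\<lambda>x. (F \<tau> x - F t x) / of_real (\<tau> - t)) = ip (u \<tau>) (\<lambda>x. (1 / of_real (\<tau> - t)) * (F \<tau> x - F t x))"
      by simp
    also have "\<dots> = (ip (u \<tau>) (F \<tau>) - ip (u \<tau>) (F t)) / of_real (\<tau> - t)"
      unfolding ip_scale_right using L2 that t by (simp add: ip_diff_right)
    finally show ?thesis by (simp add: diff_divide_distrib)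
  qed
  ultimately show ?thesis unfolding vector_derivative_quotient
    by (elim Lim_transform_eventually) (auto simp: eventually_at_filter)
qed

lemma L2_deriv_imp_cont:
  assumes L2: "\<And>\<tau>. \<tau> \<in> S \<Longrightarrow> L2 (F \<tau>)" "L2 F'" and t: "t \<in> S"
    and F: "((\<lambda>\<tau>. l2n (\<lambda>x. (F \<tau> x - F t x) / of_real (\<tau> - t) - F' x)) \<longlongrightarrow> 0) (at t within S)"
  shows "((\<lambda>\<tau>. l2n (\<lambda>x. F \<tau> x - F t x)) \<longlongrightarrow> 0) (at t within S)"
proof (rule Lim_null_comparison)
  let ?Q = "\<lambda>\<tau>. l2n (\<lambda>x. (F \<tau> x - F t x) / of_real (\<tau> - t) - F' x)"
  have "l2n (\<lambda>x. F \<tau> x - F t x) \<le> \<bar>\<tau> - t\<bar> * (?Q \<tau> + l2n F')" if "\<tau> \<in> S" "\<tau> \<noteq> t" for \<tau>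
  proof -
    let ?q = "\<lambda>x. (F \<tau> x - F t x) / of_real (\<tau> - t)"
    have q: "L2 ?q"
      using L2_scale[OF L2_diff[OF L2(1)[OF that(1)] L2(1)[OF t]], of "1 / of_real (\<tau> - t)"] by simp
    have "l2n (\<lambda>x. F \<tau> x - F t x) = l2n (\<lambda>x. of_real (\<tau> - t) * ?q x)" using that by simp
    also have "\<dots> = \<bar>\<tau> - t\<bar> * l2n ?q" by (simp only: l2n_scale norm_of_real)
    also have "l2n ?q \<le> ?Q \<tau> + l2n F'"
      using l2n_triangle[OF L2_diff[OF q L2(2)] L2(2)] by simp
    finally show ?thesis by (simp add: mult_left_mono)
  qed
  then show "\<forall>\<^sub>F \<tau> in at t within S. norm (l2n (\<lambda>x. F \<tau> x - F t x)) \<le> \<bar>\<tau> - t\<bar> * (?Q \<tau> + l2n F')"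
    by (auto simp: eventually_at_filter)
  have "((\<lambda>\<tau>. \<bar>\<tau> - t\<bar> * (?Q \<tau> + l2n F')) \<longlongrightarrow> \<bar>t - t\<bar> * (0 + l2n F')) (at t within S)"
    by (intro tendsto_intros F)
  then show "((\<lambda>\<tau>. \<bar>\<tau> - t\<bar> * (?Q \<tau> + l2n F')) \<longlongrightarrow> 0) (at t within S)" by simp
qed

context osc
begin

text \<open>The inverse of the unitary map that dilates by \<rho> and multiplies by the quadratic
  phase. It carries \<open>Psi n t\<close> back to \<open>hc n\<close> up to a constant
  phase.\<close>

definition unscale :: "real \<Rightarrow> (real \<Rightarrow> complex) \<Rightarrow> real \<Rightarrow> complex" where
  "unscale t g y = of_real (sqrt (\<rho> t)) * exp (\<i> * of_real ((\<rho>' t / \<rho> t) / 2 * (\<rho> t * y)\<^sup>2)) * g (\<rho> t * y)"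

lemma L2_unscale:
  assumes t: "t \<ge> t0" and g: "L2 g" shows "L2 (unscale t g)"
proof -
  have r: "\<rho> t \<noteq> 0" using rho_pos[OF t] by simp
  have [measurable]: "g \<in> borel_measurable borel" using g by (simp add: L2_def)
  have "integrable lborel (\<lambda>y. \<rho> t * (cmod (g (0 + \<rho> t * y)))\<^sup>2)"
    using g lborel_integrable_real_affine[OF _ r, of "\<lambda>x. (cmod (g x))\<^sup>2" 0] by (simp add: L2_def)
  moreover have "(cmod (unscale t g y))\<^sup>2 = \<rho> t * (cmod (g (0 + \<rho> t * y)))\<^sup>2" for y
    using rho_pos[OF t] by (simp add: unscale_def norm_mult power_mult_distrib)
  moreover have "unscale t g \<in> borel_measurable lborel"
    unfolding unscale_def[abs_def] by measurable
  ultimately show ?thesis by (simp add: L2_def)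
qed

lemma ip_Psi_unscale:
  assumes t: "t \<ge> t0"
  shows "ip g (Psi n t) = exp (- (\<i> * of_real ((real n + 1/2) * \<theta> t))) * ip (unscale t g) (hc n)"
proof -
  have r: "\<rho> t \<noteq> 0" "\<rho> t > 0" using rho_pos[OF t] by simp_all
  have "ip g (Psi n t) = \<bar>\<rho> t\<bar> *\<^sub>R (\<integral>y. g (0 + \<rho> t * y) * cnj (Psi n t (0 + \<rho> t * y)) \<partial>lborel)"
    unfolding ip_def by (rule lborel_integral_real_affine[OF r(1)])
  also have "\<dots> = (\<integral>y. of_real (\<rho> t) * (g (\<rho> t * y) * cnj (Psi n t (\<rho> t * y))) \<partial>lborel)"
    using r by (simp add: scaleR_conv_of_real)
  also have "\<dots> = (\<integral>y. exp (- (\<i> * of_real ((real n + 1/2) * \<theta> t))) * (unscale t g y * cnj (hc n y)) \<partial>lborel)"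
  proof (intro Bochner_Integration.integral_cong refl)
    fix y
    define s where "s = sqrt (\<rho> t)"
    have s: "s * s = \<rho> t" "s \<noteq> 0" using r by (auto simp: s_def)
    have "\<rho> t * (hermite_fun n y / s) = s * hermite_fun n y"
      unfolding s(1)[symmetric] using s(2) by simp
    then have 1: "complex_of_real (\<rho> t) * of_real (hermite_fun n y / s) = of_real s * of_real (hermite_fun n y)"
      by (simp only: of_real_mult[symmetric])
    have 2: "cnj (exp (\<i> * of_real (om n t (\<rho> t * y)))) = exp (- (\<i> * of_real ((real n + 1/2) * \<theta> t))) * exp (\<i> * of_real ((\<rho>' t / \<rho> t) / 2 * (\<rho> t * y)\<^sup>2))"
      unfolding exp_cnj exp_add[symmetric] om_def by (simp add: algebra_simps)
    have "cnj (Psi n t (\<rho> t * y)) = exp (- (\<i> * of_real ((real n + 1/2) * \<theta> t))) * exp (\<i> * of_real ((\<rho>' t / \<rho> t) / 2 * (\<rho> t * y)\<^sup>2)) * of_real (hermite_fun n y / s)"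
      unfolding Psi_def complex_cnj_mult 2 using r by (simp add: am_def s_def)
    then have "of_real (\<rho> t) * (g (\<rho> t * y) * cnj (Psi n t (\<rho> t * y)))
      = g (\<rho> t * y) * (exp (- (\<i> * of_real ((real n + 1/2) * \<theta> t))) * exp (\<i> * of_real ((\<rho>' t / \<rho> t) / 2 * (\<rho> t * y)\<^sup>2))) * (of_real (\<rho> t) * of_real (hermite_fun n y / s))"
      by (simp only: mult_ac)
    also have "\<dots> = exp (- (\<i> * of_real ((real n + 1/2) * \<theta> t))) * (unscale t g y * cnj (hc n y))"
      unfolding 1 unfolding unscale_def hc_cnj unfolding hc_def s_def by (simp only: mult_ac)
    finally show "of_real (\<rho> t) * (g (\<rho> t * y) * cnj (Psi n t (\<rho> t * y)))
      = exp (- (\<i> * of_real ((real n + 1/2) * \<theta> t))) * (unscale t g y * cnj (hc n y))" .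
  qed
  finally show ?thesis by (simp add: ip_def)
qed

lemma unscale_Psi:
  assumes t: "t \<ge> t0"
  shows "unscale t (Psi m t) = (\<lambda>y. exp (\<i> * of_real ((real m + 1/2) * \<theta> t)) * hc m y)"
proof
  fix y
  have r: "\<rho> t \<noteq> 0" "\<rho> t > 0" using rho_pos[OF t] by simp_all
  have "exp (\<i> * of_real ((\<rho>' t / \<rho> t) / 2 * (\<rho> t * y)\<^sup>2)) * exp (\<i> * of_real (om m t (\<rho> t * y))) = exp (\<i> * of_real ((real m + 1/2) * \<theta> t))"
    unfolding exp_add[symmetric] om_def by (simp add: algebra_simps)
  moreover have "complex_of_real (sqrt (\<rho> t)) * of_real (am m t (\<rho> t * y)) = hc m y"
    using r by (simp add: am_def hc_def)
  moreover have "unscale t (Psi m t) y = (exp (\<i> * of_real ((\<rho>' t / \<rho> t) / 2 * (\<rho> t * y)\<^sup>2)) * exp (\<i> * of_real (om m t (\<rho> t * y))))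
      * (of_real (sqrt (\<rho> t)) * of_real (am m t (\<rho> t * y)))"
    unfolding unscale_def Psi_def by (simp only: mult_ac)
  ultimately show "unscale t (Psi m t) y = exp (\<i> * of_real ((real m + 1/2) * \<theta> t)) * hc m y" by simp
qed

text \<open>Orthonormality and completeness are transported from the Hermite functions by
  \<open>unscale\<close>; for completeness the null set is moved back by the dilation.\<close>

lemma onb_Psi:
  assumes t: "t \<ge> t0" shows "onb (\<lambda>n. Psi n t)"
proof
  show "L2 (Psi n t)" for n by (rule L2_Psi[OF t])
  show "ip (Psi m t) (Psi n t) = (if m = n then 1 else 0)" for m n
    unfolding ip_Psi_unscale[OF t] unscale_Psi[OF t] ip_scale_left hc_orth
    by (simp add: mult.assoc[symmetric] exp_add[symmetric])
  fix g assume g: "L2 g" "\<And>n. ip g (Psi n t) = 0"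
  have r: "\<rho> t \<noteq> 0" "\<rho> t > 0" using rho_pos[OF t] by simp_all
  have gm [measurable]: "g \<in> borel_measurable borel" using g(1) by (simp add: L2_def)
  have "AE y in lborel. unscale t g y = 0"
    using g(2) by (intro onb.complete[OF onb_hc] L2_unscale t g(1)) (simp add: ip_Psi_unscale[OF t])
  then have "AE y in lborel. g (\<rho> t * y) = 0"
    by eventually_elim (use r in \<open>simp add: unscale_def\<close>)
  then have "AE x in lborel. g (\<rho> t * (0 + (1 / \<rho> t) * x)) = 0"
    using r by (intro AE_borel_affine) auto
  then show "AE x in lborel. g x = 0" using r by simp
qed

lemma bounded_on_compact:
  assumes "continuous_on {t0..} (f :: real \<Rightarrow> real)"
  shows "\<exists>K. \<forall>t\<in>{t0..T}. \<bar>f t\<bar> \<le> K"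
proof -
  have "compact (f ` {t0..T})"
    using assms by (intro compact_continuous_image continuous_on_subset[OF assms]) auto
  from compact_imp_bounded[OF this] obtain K where "\<forall>y\<in>f ` {t0..T}. norm y \<le> K"
    unfolding bounded_iff by blast
  then have "\<forall>t\<in>{t0..T}. \<bar>f t\<bar> \<le> K" by auto
  then show ?thesis ..
qed

text \<open>A single Gaussian majorant on a compact time interval, needed for dominated convergence
  of the difference quotients in time.\<close>

lemma Psi_unif:
  "\<exists>C c. c > 0 \<and> (\<forall>t\<in>{t0..T}. \<forall>x. cmod (Psi n t x) \<le> C * exp (- (c * x\<^sup>2)) \<and> cmod (PsiT n t x) \<le> C * exp (- (c * x\<^sup>2)))"
proof -
  have ne: "\<forall>t\<in>{t0..}. \<rho> t \<noteq> 0" using rho_pos by fastforce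
  note c = rho_cont rho'_cont a_cont
  have b1: "\<exists>K. \<forall>t\<in>{t0..T}. \<bar>\<rho> t\<bar> \<le> K"
    by (rule bounded_on_compact) (intro continuous_intros c; use ne in auto)
  have b2: "\<exists>K. \<forall>t\<in>{t0..T}. \<bar>(real n + 1/2) / (\<rho> t)\<^sup>2\<bar> \<le> K"
    by (rule bounded_on_compact) (intro continuous_intros c; use ne in auto)
  have b3: "\<exists>K. \<forall>t\<in>{t0..T}. \<bar>(1 / (\<rho> t) ^ 4 - (1 + a t) - (\<rho>' t / \<rho> t)\<^sup>2) / 2\<bar> \<le> K"
    by (rule bounded_on_compact) (intro continuous_intros c; use ne in auto)
  have b4: "\<exists>K. \<forall>t\<in>{t0..T}. \<bar>\<rho>' t / (2 * \<rho> t)\<bar> \<le> K"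
    by (rule bounded_on_compact) (intro continuous_intros c; use ne in auto)
  have b5: "\<exists>K. \<forall>t\<in>{t0..T}. \<bar>\<rho>' t\<bar> \<le> K"
    by (rule bounded_on_compact) (intro continuous_intros c; use ne in auto)
  have b6: "\<exists>K. \<forall>t\<in>{t0..T}. \<bar>1 / sqrt (\<rho> t)\<bar> \<le> K"
    by (rule bounded_on_compact) (intro continuous_intros c; use ne in auto)
  have b7: "\<exists>K. \<forall>t\<in>{t0..T}. \<bar>1 / (\<rho> t * sqrt (\<rho> t))\<bar> \<le> K"
    by (rule bounded_on_compact) (intro continuous_intros c; use ne in auto)
  obtain K1 where K1: "\<forall>t\<in>{t0..T}. \<bar>\<rho> t\<bar> \<le> K1"
    using b1 ..
  obtain K2 where K2: "\<forall>t\<in>{t0..T}. \<bar>(real n + 1/2) / (\<rho> t)\<^sup>2\<bar> \<le> K2"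
    using b2 ..
  obtain K3 where K3: "\<forall>t\<in>{t0..T}. \<bar>(1 / (\<rho> t) ^ 4 - (1 + a t) - (\<rho>' t / \<rho> t)\<^sup>2) / 2\<bar> \<le> K3"
    using b3 ..
  obtain K4 where K4: "\<forall>t\<in>{t0..T}. \<bar>\<rho>' t / (2 * \<rho> t)\<bar> \<le> K4"
    using b4 ..
  obtain K5 where K5: "\<forall>t\<in>{t0..T}. \<bar>\<rho>' t\<bar> \<le> K5"
    using b5 ..
  obtain K6 where K6: "\<forall>t\<in>{t0..T}. \<bar>1 / sqrt (\<rho> t)\<bar> \<le> K6"
    using b6 ..
  obtain K7 where K7: "\<forall>t\<in>{t0..T}. \<bar>1 / (\<rho> t * sqrt (\<rho> t))\<bar> \<le> K7"
    using b7 ..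
  define K where "K = max 1 (max K1 (max K2 (max K3 (max K4 (max K5 (max K6 K7))))))"
  have Kge: "K \<ge> 1" "K1 \<le> K" "K2 \<le> K" "K3 \<le> K" "K4 \<le> K" "K5 \<le> K" "K6 \<le> K" "K7 \<le> K"
    unfolding K_def by (simp_all only: le_max_iff_disj order_refl simp_thms)
  have K: "\<bar>\<rho> t\<bar> \<le> K" "\<bar>(real n + 1/2) / (\<rho> t)\<^sup>2\<bar> \<le> K"
    "\<bar>(1 / (\<rho> t) ^ 4 - (1 + a t) - (\<rho>' t / \<rho> t)\<^sup>2) / 2\<bar> \<le> K"
    "\<bar>\<rho>' t / (2 * \<rho> t)\<bar> \<le> K" "\<bar>\<rho>' t\<bar> \<le> K"
    "\<bar>1 / sqrt (\<rho> t)\<bar> \<le> K" "\<bar>1 / (\<rho> t * sqrt (\<rho> t))\<bar> \<le> K" if "t \<in> {t0..T}" for t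
    using order_trans[OF bspec[OF K1 that] Kge(2)] order_trans[OF bspec[OF K2 that] Kge(3)]
      order_trans[OF bspec[OF K3 that] Kge(4)] order_trans[OF bspec[OF K4 that] Kge(5)]
      order_trans[OF bspec[OF K5 that] Kge(6)] order_trans[OF bspec[OF K6 that] Kge(7)]
      order_trans[OF bspec[OF K7 that] Kge(8)] .
  \<comment> \<open>The three terms are the only profiles that arise in \<open>Psi\<close> and
    \<open>PsiT\<close>: the Hermite function, y^2 times it, and y times its derivative, where y = x
    / \<rho>. All coefficients are at most a power of \<open>K\<close> not above the fourth.\<close>
  have g: "gdec (\<lambda>y. complex_of_real (2 * \<bar>hermite_fun n y\<bar>) + (of_real (\<bar>hermite_fun n y\<bar> * y\<^sup>2) + of_real (\<bar>y\<bar> * \<bar>hfd n y\<bar>)))"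
  proof (intro gdec_add)
    show "gdec (\<lambda>y. complex_of_real (2 * \<bar>hermite_fun n y\<bar>))"
      by (rule gdec_mono[OF gdec_hc[of n], of _ 2]) (simp add: hc_def)
    show "gdec (\<lambda>y. complex_of_real (\<bar>hermite_fun n y\<bar> * y\<^sup>2))"
      by (rule gdec_mono[OF gdec_times_x[OF gdec_times_x[OF gdec_hc[of n]]], of _ 1])
         (simp add: hc_def norm_mult abs_mult power2_eq_square mult_ac del: abs_mult_self_eq)
    show "gdec (\<lambda>y. complex_of_real (\<bar>y\<bar> * \<bar>hfd n y\<bar>))"
      by (rule gdec_mono[OF gdec_times_x[OF gdec_hfd[of n]], of _ 1]) (simp add: norm_mult)
  qed
  then obtain C c where c: "c > 0" "\<And>y. cmod (complex_of_real (2 * \<bar>hermite_fun n y\<bar>) + (of_real (\<bar>hermite_fun n y\<bar> * y\<^sup>2) + of_real (\<bar>y\<bar> * \<bar>hfd n y\<bar>))) \<le> C * exp (- (c * y\<^sup>2))"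
    unfolding gdec_def by blast
  have F: "2 * \<bar>hermite_fun n y\<bar> + (\<bar>hermite_fun n y\<bar> * y\<^sup>2 + \<bar>y\<bar> * \<bar>hfd n y\<bar>) \<le> C * exp (- (c * y\<^sup>2))" for y
    using c(2)[of y] unfolding of_real_add[symmetric] norm_of_real by (rule order_trans[OF abs_ge_self])
  have C: "C \<ge> 0"
  proof -
    have "0 \<le> 2 * \<bar>hermite_fun n 0\<bar> + (\<bar>hermite_fun n 0\<bar> * 0\<^sup>2 + \<bar>0\<bar> * \<bar>hfd n 0\<bar>)" by simp
    then show ?thesis using F[of 0] by simp
  qed
  show ?thesis
  proof (intro exI conjI ballI allI)
    show "c / K\<^sup>2 > 0" using c Kge(1) by simp
    fix t x assume t: "t \<in> {t0..T}"
    then have t': "t \<ge> t0" by simp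
    define y where "y = x / \<rho> t"
    have r: "\<rho> t > 0" by (rule rho_pos[OF t'])
    have x: "x = \<rho> t * y" using r by (simp add: y_def)
    have "c * y\<^sup>2 \<ge> c / K\<^sup>2 * x\<^sup>2"
    proof -
      have "(\<rho> t)\<^sup>2 \<le> K\<^sup>2" using K(1)[OF t] r by (intro power_mono) auto
      then have "(\<rho> t)\<^sup>2 / K\<^sup>2 \<le> 1" using Kge(1) by simp
      then have "((\<rho> t)\<^sup>2 / K\<^sup>2) * (c * y\<^sup>2) \<le> 1 * (c * y\<^sup>2)"
        using c by (intro mult_right_mono) auto
      then show ?thesis unfolding x by (simp add: power_mult_distrib mult_ac)
    qed
    then have e: "C * exp (- (c * y\<^sup>2)) \<le> C * exp (- (c / K\<^sup>2 * x\<^sup>2))"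
      using C by (intro mult_left_mono) auto
    let ?h = "\<bar>hermite_fun n y\<bar>" and ?h' = "\<bar>hfd n y\<bar>"
    have am: "\<bar>am n t x\<bar> \<le> K * ?h" "\<bar>amx n t x\<bar> \<le> K * ?h'"
      using mult_right_mono[OF K(6)[OF t], of ?h] mult_right_mono[OF K(7)[OF t], of ?h']
      by (auto simp: am_def amx_def y_def abs_mult)
    have Kn: "K * z \<le> K ^ 4 * z" "K\<^sup>2 * z \<le> K ^ 4 * z" if "z \<ge> 0" for z
      using that Kge(1) power_increasing[of 1 4 K] power_increasing[of 2 4 K] by (auto intro!: mult_right_mono)
    have "cmod (Psi n t x) \<le> K * ?h" using am(1) by (simp add: norm_Psi)
    also have "\<dots> \<le> K ^ 4 * ?h" by (rule Kn) simp
    also have "\<dots> \<le> K ^ 4 * (2 * ?h + (?h * y\<^sup>2 + \<bar>y\<bar> * ?h'))"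
      using Kge(1) by (intro mult_left_mono) auto
    also have "\<dots> \<le> K ^ 4 * (C * exp (- (c / K\<^sup>2 * x\<^sup>2)))"
      using Kge(1) order_trans[OF F[of y] e] by (intro mult_left_mono) auto
    finally show "cmod (Psi n t x) \<le> (K ^ 4 * C) * exp (- (c / K\<^sup>2 * x\<^sup>2))" by (simp add: mult.assoc)
    have xy: "\<bar>x\<bar> \<le> K * \<bar>y\<bar>"
      unfolding x abs_mult using K(1)[OF t] by (intro mult_right_mono) auto
    have x2: "x\<^sup>2 \<le> K\<^sup>2 * y\<^sup>2"
      using power_mono[OF xy, of 2] by (simp add: power_mult_distrib)
    have "\<bar>omt n t x\<bar> \<le> K + K * x\<^sup>2"
    proof -
      have "\<bar>omt n t x\<bar> \<le> \<bar>(real n + 1/2) / (\<rho> t)\<^sup>2\<bar> + \<bar>(1 / (\<rho> t) ^ 4 - (1 + a t) - (\<rho>' t / \<rho> t)\<^sup>2) / 2 * x\<^sup>2\<bar>"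
        unfolding omt_def by (rule abs_triangle_ineq4)
      also have "\<dots> \<le> K + K * x\<^sup>2"
        unfolding abs_mult using K(2,3)[OF t] by (intro add_mono mult_mono) auto
      finally show ?thesis .
    qed
    also have "\<dots> \<le> K + K * (K\<^sup>2 * y\<^sup>2)" using x2 Kge(1) by simp
    finally have omt: "\<bar>omt n t x\<bar> \<le> K + K ^ 3 * y\<^sup>2" by (simp add: power2_eq_square power3_eq_cube mult.assoc)
    have "\<bar>\<rho>' t * x / \<rho> t\<bar> = \<bar>\<rho>' t\<bar> * \<bar>y\<bar>" using r by (simp add: x abs_mult)
    then have "\<bar>\<rho>' t * x / \<rho> t\<bar> \<le> K * \<bar>y\<bar>" using K(5)[OF t] by (simp add: mult_right_mono)
    then have "\<bar>\<rho>' t * x / \<rho> t\<bar> * \<bar>amx n t x\<bar> \<le> (K * \<bar>y\<bar>) * (K * ?h')"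
      using am(2) Kge(1) by (intro mult_mono) auto
    moreover have "\<bar>\<rho>' t / (2 * \<rho> t)\<bar> * \<bar>am n t x\<bar> \<le> K * (K * ?h)"
      using am K(4)[OF t] Kge(1) by (intro mult_mono) auto
    moreover have "\<bar>amt n t x\<bar> \<le> \<bar>\<rho>' t / (2 * \<rho> t)\<bar> * \<bar>am n t x\<bar> + \<bar>\<rho>' t * x / \<rho> t\<bar> * \<bar>amx n t x\<bar>"
    proof -
      have "\<bar>amt n t x\<bar> \<le> \<bar>- (\<rho>' t / (2 * \<rho> t)) * am n t x\<bar> + \<bar>(\<rho>' t * x / \<rho> t) * amx n t x\<bar>"
        unfolding amt_def by (rule abs_triangle_ineq4)
      then show ?thesis by (simp only: abs_mult abs_minus_cancel)
    qed
    ultimately have amt: "\<bar>amt n t x\<bar> \<le> K * (K * ?h) + (K * \<bar>y\<bar>) * (K * ?h')" by linarith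
    have "cmod (PsiT n t x) \<le> \<bar>omt n t x\<bar> * \<bar>am n t x\<bar> + \<bar>amt n t x\<bar>"
      unfolding PsiT_eq[OF t'] norm_mult norm_exp_i_times
      using norm_triangle_ineq[of "\<i> * of_real (omt n t x) * of_real (am n t x)" "of_real (amt n t x)"]
      by (simp add: norm_mult)
    also have "\<dots> \<le> (K + K ^ 3 * y\<^sup>2) * (K * ?h) + (K * (K * ?h) + (K * \<bar>y\<bar>) * (K * ?h'))"
      using omt am amt Kge(1) by (intro add_mono mult_mono) auto
    also have "\<dots> = K\<^sup>2 * (2 * ?h) + (K ^ 4 * (?h * y\<^sup>2) + K\<^sup>2 * (\<bar>y\<bar> * ?h'))"
    proof -
      have "(K + K ^ 3 * w) * (K * h) + (K * (K * h) + (K * z) * (K * h')) = K\<^sup>2 * (2 * h) + (K ^ 4 * (h * w) + K\<^sup>2 * (z * h'))"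
        for w h z h' by (simp add: algebra_simps power2_eq_square power3_eq_cube power4_eq_xxxx)
      then show ?thesis .
    qed
    also have "\<dots> \<le> K ^ 4 * (2 * ?h) + (K ^ 4 * (?h * y\<^sup>2) + K ^ 4 * (\<bar>y\<bar> * ?h'))"
      using Kn(2)[of "2 * ?h"] Kn(2)[of "\<bar>y\<bar> * ?h'"] by (intro add_mono) auto
    also have "\<dots> = K ^ 4 * (2 * ?h + (?h * y\<^sup>2 + \<bar>y\<bar> * ?h'))" by (simp only: distrib_left)
    also have "\<dots> \<le> K ^ 4 * (C * exp (- (c / K\<^sup>2 * x\<^sup>2)))"
      using Kge(1) order_trans[OF F[of y] e] by (intro mult_left_mono) auto
    finally show "cmod (PsiT n t x) \<le> (K ^ 4 * C) * exp (- (c / K\<^sup>2 * x\<^sup>2))" by (simp add: mult.assoc)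
  qed
qed

text \<open>Pointwise differentiability becomes differentiability in L2: the mean value inequality
  bounds the quotients by the uniform Gaussian majorant. Sequences replace the filter because
  dominated convergence is stated for them.\<close>

lemma Psi_L2_deriv:
  assumes t: "t \<ge> t0"
  shows "((\<lambda>\<tau>. l2n (\<lambda>x. (Psi n \<tau> x - Psi n t x) / of_real (\<tau> - t) - PsiT n t x)) \<longlongrightarrow> 0) (at t within {t0..})"
  unfolding tendsto_at_iff_sequentially o_def
proof (intro allI impI)
  fix X assume X: "\<forall>i. X i \<in> {t0..} - {t}" "X \<longlonglongrightarrow> t"
  then obtain T0 where T0: "\<And>i. \<bar>X i\<bar> \<le> T0"
    using convergent_imp_Bseq[of X] by (auto simp: convergent_def Bseq_def)
  define T where "T = max t T0"
  have T: "X i \<in> {t0..T}" "t \<in> {t0..T}" for i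
    using X(1) T0[of i] t by (auto simp: T_def)
  obtain C c where c: "c > 0" "\<And>t x. t \<in> {t0..T} \<Longrightarrow> cmod (PsiT n t x) \<le> C * exp (- (c * x\<^sup>2))"
    using Psi_unif[of T n] by blast
  let ?q = "\<lambda>i x. (Psi n (X i) x - Psi n t x) / of_real (X i - t) - PsiT n t x"
  have [measurable]: "Psi n (X i) \<in> borel_measurable borel" "Psi n t \<in> borel_measurable borel"
    "PsiT n t \<in> borel_measurable borel" for i
    using T t by auto
  have bound: "cmod (?q i x) \<le> 2 * (C * exp (- (c * x\<^sup>2)))" for i x
  proof -
    have "cmod (Psi n (X i) x - Psi n t x) \<le> C * exp (- (c * x\<^sup>2)) * \<bar>X i - t\<bar>"
    proof (rule vector_mvt_bound[where S = "{t0..T}" and f = "\<lambda>t. Psi n t x" and f' = "\<lambda>t. PsiT n t x"])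
      show "((\<lambda>t. Psi n t x) has_vector_derivative PsiT n s x) (at s within {t0..T})" if "s \<in> {t0..T}" for s
        using Psi_t_deriv[of s n x] that by (auto intro: has_vector_derivative_within_subset)
    qed (use T c in auto)
    then have "cmod ((Psi n (X i) x - Psi n t x) / of_real (X i - t)) \<le> C * exp (- (c * x\<^sup>2))"
      using X(1)[rule_format, of i] by (simp add: norm_divide pos_divide_le_eq del: of_real_diff)
    then show ?thesis
      using norm_triangle_ineq4[of "(Psi n (X i) x - Psi n t x) / of_real (X i - t)" "PsiT n t x"] c(2)[OF T(2), of x] by linarith
  qed
  have "(\<lambda>i. \<integral>x. (cmod (?q i x))\<^sup>2 \<partial>lborel) \<longlonglongrightarrow> (\<integral>x. 0 \<partial>(lborel :: real measure))"
  proof (rule integral_dominated_convergence)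
    have "integrable lborel (\<lambda>x. (2 * C)\<^sup>2 * exp (- (2 * c * x\<^sup>2)))"
      using c(1) by (intro integrable_mult_right integrable_gaussian) auto
    then show "integrable lborel (\<lambda>x. (2 * (C * exp (- (c * x\<^sup>2))))\<^sup>2)"
      by (simp add: power_mult_distrib exp_double[symmetric] mult_ac)
    show "AE x in lborel. (\<lambda>i. (cmod (?q i x))\<^sup>2) \<longlonglongrightarrow> 0"
    proof (rule AE_I2)
      fix x
      have "((\<lambda>\<tau>. (Psi n \<tau> x - Psi n t x) / of_real (\<tau> - t)) \<longlongrightarrow> PsiT n t x) (at t within {t0..})"
        using Psi_t_deriv[OF t, of n x] unfolding vector_derivative_quotient .
      then have "(\<lambda>i. (Psi n (X i) x - Psi n t x) / of_real (X i - t)) \<longlonglongrightarrow> PsiT n t x"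
        using X unfolding tendsto_at_iff_sequentially o_def by blast
      then have "(\<lambda>i. ?q i x) \<longlonglongrightarrow> 0" by (rule LIM_zero)
      then show "(\<lambda>i. (cmod (?q i x))\<^sup>2) \<longlonglongrightarrow> 0"
        using tendsto_power[OF tendsto_norm_zero, of "\<lambda>i. ?q i x" sequentially 2] by simp
    qed
    show "AE x in lborel. norm ((cmod (?q i x))\<^sup>2) \<le> (2 * (C * exp (- (c * x\<^sup>2))))\<^sup>2" for i
      using power_mono[OF bound[of i] norm_ge_zero, of _ 2] by (intro AE_I2) (simp only: real_norm_def abs_power2)
  qed auto
  then have "(\<lambda>i. sqrt (\<integral>x. (cmod (?q i x))\<^sup>2 \<partial>lborel)) \<longlonglongrightarrow> sqrt 0"
    by (intro tendsto_real_sqrt) simp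
  then show "(\<lambda>i. l2n (?q i)) \<longlonglongrightarrow> 0" by (simp add: l2n_def L2_norm_sq_def)
qed

lemma Psi_L2_cont:
  assumes t: "t \<ge> t0"
  shows "((\<lambda>\<tau>. l2n (\<lambda>x. Psi n \<tau> x - Psi n t x)) \<longlongrightarrow> 0) (at t within {t0..})"
  by (rule L2_deriv_imp_cont[OF _ L2_PsiT[OF t] _ Psi_L2_deriv[OF t]]) (use t in \<open>auto intro: L2_Psi\<close>)

section \<open>The overlap matrix between the moving and the fixed basis\<close>

definition Gm :: "real \<Rightarrow> nat \<Rightarrow> nat \<Rightarrow> complex" where "Gm t m n = ip (Psi n t) (hc m)"

text \<open>Multiplication by x is evaluated once on the fixed and once on the moving side of the
  pairing.\<close>

lemma Gm_x:
  assumes t: "t \<ge> t0"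
  shows "of_real (sqrt (real m)) * Gm t (m - 1) n + of_real (sqrt (real (Suc m))) * Gm t (Suc m) n
    = mu t * (of_real (sqrt (real n)) * Gm t m (n - 1)) + cnj (mu t) * (of_real (sqrt (real (Suc n))) * Gm t m (Suc n))"
proof -
  have "of_real (sqrt (real m)) * Gm t (m - 1) n + of_real (sqrt (real (Suc m))) * Gm t (Suc m) n
      = ip (Psi n t) (\<lambda>x. of_real (sqrt (real m)) * hc (m - 1) x + of_real (sqrt (real (Suc m))) * hc (Suc m) x)"
    by (simp only: Gm_def ip_add_right L2_Psi[OF t] L2_scale L2_hc ip_scale_right complex_cnj_complex_of_real)
  also have "\<dots> = ip (\<lambda>x. of_real (sqrt 2) * of_real x * Psi n t x) (hc m)"
    unfolding hc_x[symmetric] ip_def by (intro Bochner_Integration.integral_cong) auto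
  also have "\<dots> = mu t * (of_real (sqrt (real n)) * Gm t m (n - 1)) + cnj (mu t) * (of_real (sqrt (real (Suc n))) * Gm t m (Suc n))"
    unfolding Psi_x[OF t] by (simp only: Gm_def ip_add_left L2_Psi[OF t] L2_scale L2_hc ip_scale_left)
  finally show ?thesis .
qed

text \<open>The counterpart for the derivative, moved from one side to the other by integration by
  parts. Sum and difference with the position identity isolate a single fixed ladder
  operator.\<close>

lemma Gm_dx:
  assumes t: "t \<ge> t0"
  shows "of_real (sqrt (real m)) * Gm t (m - 1) n - of_real (sqrt (real (Suc m))) * Gm t (Suc m) n
    = \<i> * (nu t * (of_real (sqrt (real n)) * Gm t m (n - 1)) + cnj (nu t) * (of_real (sqrt (real (Suc n))) * Gm t m (Suc n)))"
proof -
  have ibp: "(\<integral>x. PsiX n t x * hc m x \<partial>lborel) = - (\<integral>x. Psi n t x * of_real (hfd m x) \<partial>lborel)"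
    by (intro integration_by_parts_gdec hc_deriv Psi_x_deriv gdec_mult gdec_hc gdec_Psi gdec_PsiX gdec_hfd PsiX_continuous t
        continuous_on_of_real hfd_continuous)
  have h: "of_real (sqrt (real m)) * hc (m - 1) x - of_real (sqrt (real (Suc m))) * hc (Suc m) x = of_real (sqrt 2) * of_real (hfd m x)" for x
    by (simp add: hfd_def hc_def)
  have "of_real (sqrt (real m)) * Gm t (m - 1) n - of_real (sqrt (real (Suc m))) * Gm t (Suc m) n
      = ip (Psi n t) (\<lambda>x. of_real (sqrt (real m)) * hc (m - 1) x - of_real (sqrt (real (Suc m))) * hc (Suc m) x)"
    by (simp only: Gm_def ip_diff_right L2_Psi[OF t] L2_scale L2_hc ip_scale_right complex_cnj_complex_of_real)
  also have "\<dots> = of_real (sqrt 2) * (\<integral>x. Psi n t x * of_real (hfd m x) \<partial>lborel)"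
    unfolding h ip_scale_right by (simp add: ip_def)
  also have "\<dots> = - (of_real (sqrt 2) * (\<integral>x. PsiX n t x * hc m x \<partial>lborel))"
    unfolding ibp by simp
  also have "\<dots> = - ip (\<lambda>x. of_real (sqrt 2) * PsiX n t x) (hc m)"
    unfolding ip_scale_left by (simp add: ip_def)
  also have "\<dots> = - (- \<i> * nu t * (of_real (sqrt (real n)) * Gm t m (n - 1)) - \<i> * cnj (nu t) * (of_real (sqrt (real (Suc n))) * Gm t m (Suc n)))"
    unfolding Psi_dx[OF t] by (simp only: Gm_def ip_diff_left L2_Psi[OF t] L2_scale L2_hc ip_scale_left)
  finally show ?thesis by (simp add: algebra_simps)
qed

end

subsection \<open>Smooth functions and cutoffs\<close>

definition smooth :: "(real \<Rightarrow> real) \<Rightarrow> bool" where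
  "smooth f \<longleftrightarrow> (\<forall>k x. ((deriv ^^ k) f) differentiable (at x))"

text \<open>Smoothness asks for differentiability of all iterated derivatives. Exhibiting a class
  closed under differentiation avoids a formula for the k-th derivative.\<close>

lemma smooth_coinduct:
  assumes "f \<in> C" and C: "\<And>g. g \<in> C \<Longrightarrow> (\<forall>x. g differentiable (at x)) \<and> deriv g \<in> C"
  shows "smooth f"
proof -
  have "(deriv ^^ k) f \<in> C" for k
    by (induction k) (use assms in auto)
  then show ?thesis using C by (auto simp: smooth_def)
qed

lemma smooth_deriv: "smooth f \<Longrightarrow> smooth (deriv f)"
proof -
  assume f: "smooth f"
  show ?thesis unfolding smooth_def
  proof (intro allI)
    fix k x
    have "(deriv ^^ Suc k) f differentiable at x" using f unfolding smooth_def by blast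
    then show "(deriv ^^ k) (deriv f) differentiable at x" by (simp only: funpow_Suc_right o_apply)
  qed
qed

lemma smooth_DERIV: "smooth f \<Longrightarrow> (f has_real_derivative deriv f x) (at x)"
proof -
  assume "smooth f"
  from this[unfolded smooth_def, rule_format, of 0] have "((deriv ^^ 0) f) differentiable (at x)" .
  then show ?thesis by (simp add: DERIV_deriv_iff_real_differentiable)
qed

lemma smooth_continuous: "smooth f \<Longrightarrow> continuous_on A f"
  by (intro continuous_at_imp_continuous_on ballI) (rule DERIV_isCont[OF smooth_DERIV])

lemma smooth_coinduct_DERIV:
  assumes "f \<in> C" and C: "\<And>g. g \<in> C \<Longrightarrow> \<exists>g'\<in>C. \<forall>x. (g has_real_derivative g' x) (at x)"
  shows "smooth f"
proof (rule smooth_coinduct[OF assms(1)])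
  fix g assume "g \<in> C"
  then obtain g' where g': "g' \<in> C" "\<And>x. (g has_real_derivative g' x) (at x)" using C by blast
  have "deriv g = g'" using g'(2) DERIV_imp_deriv by blast
  then show "(\<forall>x. g differentiable (at x)) \<and> deriv g \<in> C"
    using g' real_differentiable_def by blast
qed

text \<open>A product of smooth functions is not in a class of plain products after differentiation;
  the algebra generated by the smooth functions is the closed class that the coinduction
  needs.\<close>

inductive smooth_alg :: "(real \<Rightarrow> real) \<Rightarrow> bool" where
  base: "smooth f \<Longrightarrow> smooth_alg f"
| add: "smooth_alg f \<Longrightarrow> smooth_alg g \<Longrightarrow> smooth_alg (\<lambda>x. f x + g x)"
| mult: "smooth_alg f \<Longrightarrow> smooth_alg g \<Longrightarrow> smooth_alg (\<lambda>x. f x * g x)"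

lemma smooth_alg_deriv: "smooth_alg f \<Longrightarrow> \<exists>f'. smooth_alg f' \<and> (\<forall>x. (f has_real_derivative f' x) (at x))"
proof (induction rule: smooth_alg.induct)
  case (base f)
  then show ?case
    by (intro exI[of _ "deriv f"] conjI allI smooth_alg.base[OF smooth_deriv] smooth_DERIV)
next
  case (add f g)
  then obtain f' g' where "smooth_alg f'" "\<And>x. (f has_real_derivative f' x) (at x)"
    "smooth_alg g'" "\<And>x. (g has_real_derivative g' x) (at x)" by blast
  then show ?case by (intro exI[of _ "\<lambda>x. f' x + g' x"]) (auto intro: smooth_alg.add DERIV_add)
next
  case (mult f g)
  then obtain f' g' where d: "smooth_alg f'" "\<And>x. (f has_real_derivative f' x) (at x)"
    "smooth_alg g'" "\<And>x. (g has_real_derivative g' x) (at x)" by blast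
  have "((\<lambda>x. f x * g x) has_real_derivative f' x * g x + g' x * f x) (at x)" for x
    by (rule DERIV_mult[OF d(2) d(4)])
  moreover have "smooth_alg (\<lambda>x. f' x * g x + g' x * f x)"
    using d mult.hyps by (intro smooth_alg.add smooth_alg.mult)
  ultimately show ?case by blast
qed

lemma smooth_alg_smooth: "smooth_alg f \<Longrightarrow> smooth f"
  by (rule smooth_coinduct_DERIV[of f "Collect smooth_alg"]) (use smooth_alg_deriv in blast)+

lemma smooth_mult: "smooth f \<Longrightarrow> smooth g \<Longrightarrow> smooth (\<lambda>x. f x * g x)"
  by (rule smooth_alg_smooth[OF smooth_alg.mult[OF smooth_alg.base smooth_alg.base]])

lemma smooth_affine:
  assumes "smooth f" shows "smooth (\<lambda>x. c * f (a * x + b))"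
proof (rule smooth_coinduct_DERIV[where C = "{\<lambda>x. c * g (a * x + b) | c g. smooth g}"])
  show "(\<lambda>x. c * f (a * x + b)) \<in> {\<lambda>x. c * g (a * x + b) | c g. smooth g}" using assms by blast
  fix h assume "h \<in> {\<lambda>x. c * g (a * x + b) | c g. smooth g}"
  then obtain c g where h: "h = (\<lambda>x. c * g (a * x + b))" "smooth g" by blast
  have "(h has_real_derivative (c * a) * deriv g (a * x + b)) (at x)" for x
    unfolding h(1)
    by (rule DERIV_cong[OF DERIV_cmult[OF DERIV_chain2[OF smooth_DERIV[OF h(2)] DERIV_add[OF DERIV_cmult[OF DERIV_ident] DERIV_const]]]]) simp
  then show "\<exists>h'\<in>{\<lambda>x. c * g (a * x + b) | c g. smooth g}. \<forall>x. (h has_real_derivative h' x) (at x)"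
    using smooth_deriv[OF h(2)] by (intro bexI[of _ "\<lambda>x. (c * a) * deriv g (a * x + b)"]) auto
qed

text \<open>The polynomial parameter closes the family under differentiation, \<open>P\<close> being
  sent to X^2 (P - P'). The member with \<open>P\<close> = 1 is the classical flat function
  exp(-1/x).\<close>

definition flatf :: "real poly \<Rightarrow> real \<Rightarrow> real" where
  "flatf P x = (if x > 0 then poly P (1 / x) * exp (- (1 / x)) else 0)"

lemma poly_exp_tendsto_0: "((\<lambda>y::real. poly P y * exp (- y)) \<longlongrightarrow> 0) at_top"
proof -
  have "((\<lambda>y. \<Sum>i\<le>degree P. coeff P i * (y ^ i / exp y)) \<longlongrightarrow> (\<Sum>i\<le>degree P. coeff P i * 0)) at_top"
    by (intro tendsto_sum tendsto_mult tendsto_const tendsto_power_div_exp_0)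
  moreover have "poly P y * exp (- y) = (\<Sum>i\<le>degree P. coeff P i * (y ^ i / exp y))" for y :: real
    by (simp add: poly_altdef sum_distrib_right exp_minus divide_inverse mult.assoc)
  ultimately show ?thesis by simp
qed

lemma flat_tendsto_0: "((\<lambda>x::real. poly P (1 / x) * exp (- (1 / x))) \<longlongrightarrow> 0) (at_right 0)"
proof -
  have "filterlim (\<lambda>x::real. 1 / x) at_top (at_right 0)"
    using filterlim_inverse_at_top_right by (simp add: divide_inverse)
  from filterlim_compose[OF poly_exp_tendsto_0[of P] this] show ?thesis .
qed

lemma DERIV_transfer_nhds:
  fixes f g :: "real \<Rightarrow> real"
  assumes "(f has_real_derivative d) (at x)" "\<forall>\<^sub>F y in nhds x. f y = g y"
  shows "(g has_real_derivative d) (at x)"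
  using DERIV_cong_ev[OF refl assms(2) refl, of d] assms(1) by simp

lemma flat_deriv: "(flatf P has_real_derivative flatf (monom 1 2 * (P - pderiv P)) x) (at x)"
proof -
  consider "x > 0" | "x < 0" | "x = 0" by linarith
  then show ?thesis
  proof cases
    case 1
    have "((\<lambda>x. poly P (1 / x) * exp (- (1 / x))) has_real_derivative
        (poly (pderiv P) (1 / x) * (- (1 / x\<^sup>2))) * exp (- (1 / x)) + (exp (- (1 / x)) * (1 / x\<^sup>2)) * poly P (1 / x)) (at x)"
      using 1 by (auto intro!: derivative_eq_intros DERIV_chain2[OF poly_DERIV] simp: power2_eq_square)
    moreover have "(poly (pderiv P) (1 / x) * (- (1 / x\<^sup>2))) * exp (- (1 / x)) + (exp (- (1 / x)) * (1 / x\<^sup>2)) * poly P (1 / x)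
        = flatf (monom 1 2 * (P - pderiv P)) x"
      using 1 by (simp add: flatf_def poly_monom power_divide algebra_simps)
    ultimately have "((\<lambda>x. poly P (1 / x) * exp (- (1 / x))) has_real_derivative flatf (monom 1 2 * (P - pderiv P)) x) (at x)"
      by simp
    moreover have "\<forall>\<^sub>F y in nhds x. poly P (1 / y) * exp (- (1 / y)) = flatf P y"
      using 1 eventually_nhds_in_open[of "{0<..}" x] by (auto simp: flatf_def elim!: eventually_mono)
    ultimately show ?thesis by (rule DERIV_transfer_nhds)
  next
    case 2
    have "((\<lambda>x. 0) has_real_derivative flatf (monom 1 2 * (P - pderiv P)) x) (at x)" using 2 by (simp add: flatf_def)
    moreover have "\<forall>\<^sub>F y in nhds x. 0 = flatf P y"
      using 2 eventually_nhds_in_open[of "{..<0}" x] by (auto simp: flatf_def elim!: eventually_mono)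
    ultimately show ?thesis by (rule DERIV_transfer_nhds)
  next
    case 3
    \<comment> \<open>At the origin the difference quotient is again a member of the family, with
      \<open>P\<close> multiplied by X, so it tends to 0 from the right.\<close>
    have "((\<lambda>y. flatf P y / y) \<longlongrightarrow> 0) (at_right 0)"
    proof (rule Lim_transform_eventually[OF flat_tendsto_0[of "monom 1 1 * P"]])
      show "\<forall>\<^sub>F x in at_right 0. poly (monom 1 1 * P) (1 / x) * exp (- (1 / x)) = flatf P x / x"
        by (auto simp: eventually_at_filter flatf_def poly_monom)
    qed
    moreover have "((\<lambda>y. flatf P y / y) \<longlongrightarrow> 0) (at_left 0)"
      by (rule tendsto_eventually) (auto simp: eventually_at_filter flatf_def)
    ultimately have "((\<lambda>y. flatf P y / y) \<longlongrightarrow> 0) (at 0)"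
      by (simp add: filterlim_split_at)
    then show ?thesis unfolding 3 has_field_derivative_iff by (simp add: flatf_def)
  qed
qed

lemma smooth_flat: "smooth (flatf P)"
  by (rule smooth_coinduct_DERIV[where C = "range flatf"]) (use flat_deriv in auto)

text \<open>A product of two flat functions supported on [-1, 1]; each contributes exp(-1) at 0,
  whence the factor \<open>exp 2\<close>. The redundant factors match \<open>smooth_affine\<close>.
  The value 1 is attained at 0 only and not on a neighbourhood, which is enough because the rescaled
  cutoffs converge pointwise to 1.\<close>

definition cutoff :: "real \<Rightarrow> real" where
  "cutoff x = (exp 2 * flatf 1 ((-1) * x + 1)) * (1 * flatf 1 (1 * x + 1))"

lemma smooth_cutoff: "smooth cutoff"
  unfolding cutoff_def[abs_def]
  by (rule smooth_mult[OF smooth_affine[OF smooth_flat] smooth_affine[OF smooth_flat]])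

lemma cutoff_0: "cutoff 0 = 1"
  by (simp add: cutoff_def flatf_def exp_add[symmetric])

lemma cutoff_eq_0: "\<bar>x\<bar> > 1 \<Longrightarrow> cutoff x = 0"
  by (auto simp: cutoff_def flatf_def)

lemma deriv_eq_0_outside:
  assumes "\<And>x. \<bar>x\<bar> > R \<Longrightarrow> f x = 0" "\<bar>x\<bar> > R" shows "deriv f x = (0::real)"
proof (rule DERIV_imp_deriv)
  have "open {x::real. \<bar>x\<bar> > R}" by (intro open_Collect_less continuous_intros)
  then have "\<forall>\<^sub>F y in nhds x. 0 = f y"
    using eventually_nhds_in_open[of "{x. \<bar>x\<bar> > R}" x] assms by (auto elim!: eventually_mono)
  then show "(f has_real_derivative 0) (at x)"
    using DERIV_cong_ev[of x x "\<lambda>_. 0" f 0 0] by simp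
qed

lemma bounded_compact_support:
  fixes f :: "real \<Rightarrow> real"
  assumes "continuous_on UNIV f" "\<And>x. \<bar>x\<bar> > R \<Longrightarrow> f x = (0::real)"
  shows "\<exists>K\<ge>0. \<forall>x. \<bar>f x\<bar> \<le> K"
proof -
  have "compact (f ` {-R..R})"
    using assms(1) by (intro compact_continuous_image) (auto intro: continuous_on_subset)
  from compact_imp_bounded[OF this] obtain K where K: "\<forall>y\<in>f ` {-R..R}. norm y \<le> K"
    unfolding bounded_iff by blast
  have "\<bar>f x\<bar> \<le> \<bar>K\<bar>" for x
  proof (cases "\<bar>x\<bar> > R")
    case False
    then have "x \<in> {-R..R}" by auto
    then have "norm (f x) \<le> K" using K by blast
    then show ?thesis by simp
  qed (simp add: assms(2))
  then show ?thesis by (intro exI[of _ "\<bar>K\<bar>"]) auto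
qed

lemma cutoff_bounds: "\<exists>K\<ge>0. \<forall>x. \<bar>cutoff x\<bar> \<le> K \<and> \<bar>deriv cutoff x\<bar> \<le> K \<and> \<bar>deriv (deriv cutoff) x\<bar> \<le> K"
proof -
  have s: "smooth (deriv cutoff)" "smooth (deriv (deriv cutoff))"
    using smooth_deriv[OF smooth_cutoff] smooth_deriv[OF smooth_deriv[OF smooth_cutoff]] .
  have z1: "deriv cutoff x = 0" if "\<bar>x\<bar> > 1" for x
    using cutoff_eq_0 that by (rule deriv_eq_0_outside)
  have z2: "deriv (deriv cutoff) x = 0" if "\<bar>x\<bar> > 1" for x
    using z1 that by (rule deriv_eq_0_outside)
  obtain K1 where 1: "\<forall>x. \<bar>cutoff x\<bar> \<le> K1"
    using bounded_compact_support[OF smooth_continuous[OF smooth_cutoff] cutoff_eq_0] by auto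
  obtain K2 where 2: "\<forall>x. \<bar>deriv cutoff x\<bar> \<le> K2"
    using bounded_compact_support[OF smooth_continuous[OF s(1)] z1] by auto
  obtain K3 where 3: "\<forall>x. \<bar>deriv (deriv cutoff) x\<bar> \<le> K3"
    using bounded_compact_support[OF smooth_continuous[OF s(2)] z2] by auto
  show ?thesis
    using 1 2 3 by (intro exI[of _ "max 0 (max K1 (max K2 K3))"]) (auto simp: le_max_iff_disj)
qed

lemma test_fun_iff: "test_fun \<phi> \<longleftrightarrow> smooth \<phi> \<and> (\<exists>R. \<forall>x. \<bar>x\<bar> > R \<longrightarrow> \<phi> x = 0)"
  by (simp add: test_fun_def smooth_def)

lemma test_fun_deriv: "test_fun \<phi> \<Longrightarrow> test_fun (deriv \<phi>)"
proof -
  assume "test_fun \<phi>"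
  then obtain R where "smooth \<phi>" "\<And>x. \<bar>x\<bar> > R \<Longrightarrow> \<phi> x = 0" unfolding test_fun_iff by blast
  then show ?thesis unfolding test_fun_iff
    using smooth_deriv deriv_eq_0_outside[of R \<phi>] by blast
qed

lemma gdec_test_fun:
  assumes "test_fun \<phi>" shows "gdec (\<lambda>x. of_real (\<phi> x))"
proof -
  obtain R where s: "smooth \<phi>" and R: "\<And>x. \<bar>x\<bar> > R \<Longrightarrow> \<phi> x = 0" using assms unfolding test_fun_iff by blast
  obtain K where K: "K \<ge> 0" "\<And>x. \<bar>\<phi> x\<bar> \<le> K"
    using bounded_compact_support[OF smooth_continuous[OF s] R] by auto
  have "cmod (of_real (\<phi> x)) \<le> (K * exp (R\<^sup>2)) * exp (- (1 * x\<^sup>2))" for x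
  proof (cases "\<bar>x\<bar> > R")
    case True then show ?thesis using R K(1) by simp
  next
    case False
    then have "x\<^sup>2 \<le> R\<^sup>2" using power_mono[of "\<bar>x\<bar>" R 2] by simp
    then have "1 \<le> exp (R\<^sup>2) * exp (- (1 * x\<^sup>2))" unfolding exp_add[symmetric] by simp
    then have "K * 1 \<le> K * (exp (R\<^sup>2) * exp (- (1 * x\<^sup>2)))" using K(1) by (rule mult_left_mono)
    then show ?thesis using K(2)[of x] by simp
  qed
  then show ?thesis by (rule gdecI[rotated]) simp
qed

lemma test_fun_measurable: "test_fun \<phi> \<Longrightarrow> \<phi> \<in> borel_measurable borel"
  unfolding test_fun_iff by (intro borel_measurable_continuous_onI smooth_continuous) auto

lemma L2_test_fun: "test_fun \<phi> \<Longrightarrow> L2 (\<lambda>x. of_real (\<phi> x))"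
  using test_fun_measurable by (intro gdec_L2 gdec_test_fun) auto

lemma L2_x2_test_fun: "test_fun \<phi> \<Longrightarrow> L2 (\<lambda>x. of_real (x\<^sup>2 * \<phi> x))"
  using test_fun_measurable gdec_L2[OF gdec_times_x[OF gdec_times_x[OF gdec_test_fun]], of \<phi>]
  by (simp add: power2_eq_square mult.assoc)

section \<open>The Hamiltonian on test functions and the weak equation\<close>

definition Hop :: "(real \<Rightarrow> real) \<Rightarrow> real \<Rightarrow> (real \<Rightarrow> real) \<Rightarrow> real \<Rightarrow> complex" where
  "Hop a t \<phi> x = of_real ((- deriv (deriv \<phi>) x + (1 + a t) * x^2 * \<phi> x) / 2)"

lemma Hop_eq: "Hop a t \<phi> x = (- 1 / 2) * of_real (deriv (deriv \<phi>) x) + of_real ((1 + a t) / 2) * of_real (x\<^sup>2 * \<phi> x)"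
  by (simp add: Hop_def field_simps)

lemma L2_Hop: "test_fun \<phi> \<Longrightarrow> L2 (Hop a t \<phi>)"
  unfolding Hop_eq[abs_def] by (intro L2_add L2_scale L2_test_fun L2_x2_test_fun test_fun_deriv)

lemma l2n_Hop:
  assumes "test_fun \<phi>"
  shows "l2n (Hop a t \<phi>) \<le> l2n (\<lambda>x. of_real (deriv (deriv \<phi>) x)) + (1 + \<bar>a t\<bar>) * l2n (\<lambda>x. of_real (x\<^sup>2 * \<phi> x))"
proof -
  have "l2n (Hop a t \<phi>) \<le> l2n (\<lambda>x. (- 1 / 2) * of_real (deriv (deriv \<phi>) x)) + l2n (\<lambda>x. of_real ((1 + a t) / 2) * of_real (x\<^sup>2 * \<phi> x))"
    unfolding Hop_eq[abs_def] by (intro l2n_triangle L2_scale L2_test_fun L2_x2_test_fun test_fun_deriv assms)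
  also have "\<dots> = (1/2) * l2n (\<lambda>x. of_real (deriv (deriv \<phi>) x)) + \<bar>(1 + a t) / 2\<bar> * l2n (\<lambda>x. of_real (x\<^sup>2 * \<phi> x))"
    unfolding l2n_scale norm_of_real by (simp add: norm_divide)
  also have "\<dots> \<le> 1 * l2n (\<lambda>x. of_real (deriv (deriv \<phi>) x)) + (1 + \<bar>a t\<bar>) * l2n (\<lambda>x. of_real (x\<^sup>2 * \<phi> x))"
    by (intro add_mono mult_right_mono) auto
  finally show ?thesis by simp
qed

lemma is_solutionD:
  assumes "is_solution a t0 u0 u"
  shows "t \<ge> t0 \<Longrightarrow> L2 (u t)" "AE x in lborel. u t0 x = u0 x"
    "t \<ge> t0 \<Longrightarrow> ((\<lambda>\<tau>. l2n (\<lambda>x. u \<tau> x - u t x)) \<longlongrightarrow> 0) (at t within {t0..})"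
    "test_fun \<phi> \<Longrightarrow> t \<ge> t0 \<Longrightarrow> ((\<lambda>\<tau>. ip (u \<tau>) (\<lambda>x. of_real (\<phi> x))) has_vector_derivative \<i> * ip (u t) (Hop a t \<phi>)) (at t within {t0..})"
proof -
  note sol = assms[unfolded is_solution_def]
  note cont = sol[THEN conjunct2, THEN conjunct2, THEN conjunct1, rule_format]
  note weak = sol[THEN conjunct2, THEN conjunct2, THEN conjunct2, rule_format]
  show "t \<ge> t0 \<Longrightarrow> L2 (u t)" by (rule sol[THEN conjunct1, rule_format])
  show "AE x in lborel. u t0 x = u0 x" by (rule sol[THEN conjunct2, THEN conjunct1])
  show "((\<lambda>\<tau>. l2n (\<lambda>x. u \<tau> x - u t x)) \<longlongrightarrow> 0) (at t within {t0..})" if "t \<ge> t0"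
    using tendsto_real_sqrt[OF cont[OF that]] by (simp add: l2n_def)
  show "((\<lambda>\<tau>. ip (u \<tau>) (\<lambda>x. of_real (\<phi> x))) has_vector_derivative \<i> * ip (u t) (Hop a t \<phi>)) (at t within {t0..})"
    if "test_fun \<phi>" "t \<ge> t0"
    using weak[OF that] by (simp only: ip_def Hop_def complex_cnj_complex_of_real)
qed

text \<open>The definition of a solution tests against real functions without conjugation, while
  \<open>ip\<close> conjugates its second argument. The imaginary part therefore enters with the
  factor \<open>- \<i>\<close>.\<close>

lemma weak_complex_test:
  assumes sol: "is_solution a t0 u0 u" and t: "t \<ge> t0"
    and F: "test_fun (\<lambda>x. Re (F x))" "test_fun (\<lambda>x. Im (F x))"
    and d: "\<And>x. (F has_vector_derivative F1 x) (at x)" "\<And>x. (F1 has_vector_derivative F2 x) (at x)"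
  shows "((\<lambda>\<tau>. ip (u \<tau>) F) has_vector_derivative
    \<i> * ip (u t) (\<lambda>x. (- F2 x + of_real ((1 + a t) * x\<^sup>2) * F x) / 2)) (at t within {t0..})"
proof -
  let ?R = "\<lambda>x. Re (F x)" and ?I = "\<lambda>x. Im (F x)"
  have dR: "deriv ?R = (\<lambda>x. Re (F1 x))" "deriv ?I = (\<lambda>x. Im (F1 x))"
    using d(1) unfolding has_vector_derivative_complex_iff by (auto intro!: DERIV_imp_deriv)
  have dd: "deriv (deriv ?R) = (\<lambda>x. Re (F2 x))" "deriv (deriv ?I) = (\<lambda>x. Im (F2 x))"
    unfolding dR using d(2) unfolding has_vector_derivative_complex_iff by (auto intro!: DERIV_imp_deriv)
  note W = is_solutionD(4)[OF sol F(1) t] is_solutionD(4)[OF sol F(2) t]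
  have eq: "ip (u \<tau>) F = ip (u \<tau>) (\<lambda>x. of_real (?R x)) + (- \<i>) * ip (u \<tau>) (\<lambda>x. of_real (?I x))" if "\<tau> \<ge> t0" for \<tau>
  proof -
    have "ip (u \<tau>) F = ip (u \<tau>) (\<lambda>x. of_real (?R x) + \<i> * of_real (?I x))"
      by (simp add: complex_eq[symmetric])
    also have "\<dots> = ip (u \<tau>) (\<lambda>x. of_real (?R x)) + ip (u \<tau>) (\<lambda>x. \<i> * of_real (?I x))"
      using is_solutionD(1)[OF sol that] F by (intro ip_add_right L2_scale L2_test_fun)
    finally show ?thesis by (simp add: ip_scale_right)
  qed
  have "\<i> * ip (u t) (Hop a t ?R) + (- \<i>) * (\<i> * ip (u t) (Hop a t ?I))
      = \<i> * ip (u t) (\<lambda>x. (- F2 x + of_real ((1 + a t) * x\<^sup>2) * F x) / 2)"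
  proof -
    have "(- F2 x + of_real ((1 + a t) * x\<^sup>2) * F x) / 2 = Hop a t ?R x + \<i> * Hop a t ?I x" for x
      unfolding Hop_def dd by (simp add: complex_eq_iff)
    then have "ip (u t) (\<lambda>x. (- F2 x + of_real ((1 + a t) * x\<^sup>2) * F x) / 2)
        = ip (u t) (\<lambda>x. Hop a t ?R x + \<i> * Hop a t ?I x)" by presburger
    also have "\<dots> = ip (u t) (Hop a t ?R) + ip (u t) (\<lambda>x. \<i> * Hop a t ?I x)"
      using is_solutionD(1)[OF sol t] F by (intro ip_add_right L2_scale L2_Hop)
    finally have e: "ip (u t) (\<lambda>x. (- F2 x + of_real ((1 + a t) * x\<^sup>2) * F x) / 2)
        = ip (u t) (Hop a t ?R) + cnj \<i> * ip (u t) (Hop a t ?I)" unfolding ip_scale_right .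
    show ?thesis unfolding e by (simp add: algebra_simps)
  qed
  moreover have "((\<lambda>\<tau>. ip (u \<tau>) (\<lambda>x. of_real (?R x)) + (- \<i>) * ip (u \<tau>) (\<lambda>x. of_real (?I x))) has_vector_derivative
      \<i> * ip (u t) (Hop a t ?R) + (- \<i>) * (\<i> * ip (u t) (Hop a t ?I))) (at t within {t0..})"
    by (intro has_vector_derivative_add has_vector_derivative_mult_right W)
  ultimately have "((\<lambda>\<tau>. ip (u \<tau>) (\<lambda>x. of_real (?R x)) + (- \<i>) * ip (u \<tau>) (\<lambda>x. of_real (?I x))) has_vector_derivative
      \<i> * ip (u t) (\<lambda>x. (- F2 x + of_real ((1 + a t) * x\<^sup>2) * F x) / 2)) (at t within {t0..})" by simp
  then show ?thesis by (rule has_vector_derivative_transform[rotated 2]) (use t eq in auto)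
qed

context osc
begin

subsection \<open>Uniqueness of weak solutions\<close>

text \<open>Each derivative of the rescaled cutoff gains a factor 1/R, which is what makes the
  cutoff error disappear.\<close>

definition cutR :: "real \<Rightarrow> real \<Rightarrow> real" where "cutR R x = 1 * cutoff ((1 / R) * x + 0)"
definition cutR1 :: "real \<Rightarrow> real \<Rightarrow> real" where "cutR1 R x = deriv cutoff ((1 / R) * x + 0) / R"
definition cutR2 :: "real \<Rightarrow> real \<Rightarrow> real" where "cutR2 R x = deriv (deriv cutoff) ((1 / R) * x + 0) / R\<^sup>2"

lemma cutR_deriv: "(cutR R has_real_derivative cutR1 R x) (at x)"
  unfolding cutR_def[abs_def] cutR1_def
  by (rule DERIV_cong[OF DERIV_cmult[OF DERIV_chain2[OF smooth_DERIV[OF smooth_cutoff] DERIV_add[OF DERIV_cmult[OF DERIV_ident] DERIV_const]]]]) simp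

lemma cutR1_deriv: "(cutR1 R has_real_derivative cutR2 R x) (at x)"
  unfolding cutR1_def[abs_def] cutR2_def
  by (rule DERIV_cong[OF DERIV_cdivide[OF DERIV_chain2[OF smooth_DERIV[OF smooth_deriv[OF smooth_cutoff]] DERIV_add[OF DERIV_cmult[OF DERIV_ident] DERIV_const]]]])
     (simp add: power2_eq_square)

lemma smooth_cutR: "smooth (cutR R)"
  unfolding cutR_def[abs_def] by (rule smooth_affine[OF smooth_cutoff])

lemma cutR_eq_0: "R > 0 \<Longrightarrow> \<bar>x\<bar> > R \<Longrightarrow> cutR R x = 0"
  unfolding cutR_def by (subst cutoff_eq_0) (auto simp: abs_mult)

lemma cutR_measurable [measurable]: "cutR R \<in> borel_measurable borel" "cutR1 R \<in> borel_measurable borel"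
    "cutR2 R \<in> borel_measurable borel"
proof -
  have 1: "deriv (cutR R) = cutR1 R" and 2: "deriv (cutR1 R) = cutR2 R"
    using DERIV_imp_deriv[OF cutR_deriv] DERIV_imp_deriv[OF cutR1_deriv] by auto
  have s: "smooth (cutR R)" "smooth (cutR1 R)" "smooth (cutR2 R)"
    using smooth_cutR[of R] smooth_deriv[OF smooth_cutR[of R]] smooth_deriv[OF smooth_deriv[OF smooth_cutR[of R]]]
    unfolding 1 2 .
  show "cutR R \<in> borel_measurable borel" "cutR1 R \<in> borel_measurable borel" "cutR2 R \<in> borel_measurable borel"
    using s[THEN smooth_continuous, THEN borel_measurable_continuous_onI] .
qed

text \<open>Finite combinations of the moving basis are closed under d/dx by the ladder form of
  \<open>PsiX\<close>; this is the class for the coinductive proof that the basis members are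
  smooth.\<close>

inductive span_Psi :: "real \<Rightarrow> (real \<Rightarrow> complex) \<Rightarrow> bool" for t where
  base: "span_Psi t (\<lambda>x. c * Psi n t x)"
| add: "span_Psi t f \<Longrightarrow> span_Psi t g \<Longrightarrow> span_Psi t (\<lambda>x. f x + g x)"

lemma span_Psi_deriv:
  assumes t: "t \<ge> t0" and f: "span_Psi t f"
  shows "\<exists>f'. span_Psi t f' \<and> (\<forall>x. (f has_vector_derivative f' x) (at x))"
  using f
proof (induction rule: span_Psi.induct)
  case (base c n)
  have "span_Psi t (\<lambda>x. (c * lo n t) * Psi (n - 1) t x + (c * hi n t) * Psi (Suc n) t x)"
    by (intro span_Psi.add span_Psi.base)
  moreover have "((\<lambda>x. c * Psi n t x) has_vector_derivative (c * lo n t) * Psi (n - 1) t x + (c * hi n t) * Psi (Suc n) t x) (at x)" for x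
    using has_vector_derivative_mult_right[OF Psi_x_deriv[OF t, of n x], of c]
    by (simp add: PsiX_eq[OF t] algebra_simps)
  ultimately show ?case by blast
next
  case (add f g)
  then obtain f' g' where "span_Psi t f'" "\<And>x. (f has_vector_derivative f' x) (at x)"
    "span_Psi t g'" "\<And>x. (g has_vector_derivative g' x) (at x)" by blast
  then show ?case by (intro exI[of _ "\<lambda>x. f' x + g' x"]) (auto intro: span_Psi.add has_vector_derivative_add)
qed

lemma smooth_Re_span:
  assumes t: "t \<ge> t0" and f: "span_Psi t f" shows "smooth (\<lambda>x. Re (f x))"
proof (rule smooth_coinduct_DERIV[where C = "{\<lambda>x. Re (g x) | g. span_Psi t g}"])
  show "(\<lambda>x. Re (f x)) \<in> {\<lambda>x. Re (g x) | g. span_Psi t g}" using f by blast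
  fix h assume "h \<in> {\<lambda>x. Re (g x) | g. span_Psi t g}"
  then obtain g where g: "h = (\<lambda>x. Re (g x))" "span_Psi t g" by blast
  obtain g' where g': "span_Psi t g'" "\<And>x. (g has_vector_derivative g' x) (at x)"
    using span_Psi_deriv[OF t g(2)] by blast
  then show "\<exists>h'\<in>{\<lambda>x. Re (g x) | g. span_Psi t g}. \<forall>x. (h has_real_derivative h' x) (at x)"
    unfolding g(1) has_vector_derivative_complex_iff by (intro bexI[of _ "\<lambda>x. Re (g' x)"]) auto
qed

lemma smooth_Psi:
  assumes t: "t \<ge> t0" shows "smooth (\<lambda>x. Re (Psi n t x))" "smooth (\<lambda>x. Im (Psi n t x))"
  \<comment> \<open>The imaginary part of z is the real part of \<open>- \<i> * z\<close>.\<close>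
  using smooth_Re_span[OF t span_Psi.base[of t 1 n]] smooth_Re_span[OF t span_Psi.base[of t "- \<i>" n]] by simp_all

lemma test_fun_cut_Psi:
  assumes t: "t \<ge> t0" and R: "R > 0"
  shows "test_fun (\<lambda>x. Re (of_real (cutR R x) * Psi n t x))" "test_fun (\<lambda>x. Im (of_real (cutR R x) * Psi n t x))"
proof -
  have "smooth (\<lambda>x. cutR R x * Re (Psi n t x))" "smooth (\<lambda>x. cutR R x * Im (Psi n t x))"
    by (intro smooth_mult[OF smooth_cutR] smooth_Psi[OF t])+
  then show "test_fun (\<lambda>x. Re (of_real (cutR R x) * Psi n t x))" "test_fun (\<lambda>x. Im (of_real (cutR R x) * Psi n t x))"
    unfolding test_fun_iff using cutR_eq_0[OF R] by (auto intro!: exI[of _ R])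
qed

lemma cut_Psi_deriv:
  assumes t: "t \<ge> t0"
  shows "((\<lambda>x. of_real (cutR R x) * Psi n t x) has_vector_derivative
      of_real (cutR R x) * PsiX n t x + of_real (cutR1 R x) * Psi n t x) (at x)"
    "((\<lambda>x. of_real (cutR R x) * PsiX n t x + of_real (cutR1 R x) * Psi n t x) has_vector_derivative
      (of_real (cutR R x) * PsiXX n t x + of_real (cutR1 R x) * PsiX n t x)
      + (of_real (cutR1 R x) * PsiX n t x + of_real (cutR2 R x) * Psi n t x)) (at x)"
  by (intro has_vector_derivative_add has_vector_derivative_mult has_vector_derivative_of_real cutR_deriv cutR1_deriv
      Psi_x_deriv PsiX_x_deriv t)+

lemma L2_bounded_mult:
  assumes "L2 g" "k \<in> borel_measurable borel" "\<And>x. \<bar>k x\<bar> \<le> K"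
  shows "L2 (\<lambda>x. of_real (k x) * g x)" "l2n (\<lambda>x. of_real (k x) * g x) \<le> \<bar>K\<bar> * l2n g"
proof -
  have g: "g \<in> borel_measurable borel" "integrable lborel (\<lambda>x. (cmod (g x))\<^sup>2)" using assms(1) by (auto simp: L2_def)
  have le: "cmod (of_real (k x) * g x) \<le> \<bar>K\<bar> * cmod (g x)" for x
    using assms(3)[of x] by (auto simp: norm_mult intro!: mult_right_mono)
  show L: "L2 (\<lambda>x. of_real (k x) * g x)"
    by (rule L2_bound[OF assms(1) _ le]) (use g assms(2) in measurable)
  have "L2_norm_sq (\<lambda>x. of_real (k x) * g x) \<le> (\<integral>x. \<bar>K\<bar>\<^sup>2 * (cmod (g x))\<^sup>2 \<partial>lborel)"
    unfolding L2_norm_sq_def using L g(2) power_mono[OF le norm_ge_zero, of _ 2]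
    by (intro integral_mono) (auto simp: L2_def power_mult_distrib)
  also have "\<dots> = (\<bar>K\<bar> * l2n g)\<^sup>2" by (simp add: power_mult_distrib l2n_sq) (simp add: L2_norm_sq_def)
  finally show "l2n (\<lambda>x. of_real (k x) * g x) \<le> \<bar>K\<bar> * l2n g"
    unfolding l2n_def[of "\<lambda>x. of_real (k x) * g x"] by (intro real_le_lsqrt) auto
qed

lemma nu_cont: "continuous_on {t0..} nu"
  unfolding nu_def[abs_def] using rho_pos
  by (intro continuous_intros rho_cont rho'_cont theta_cont) force

lemma l2n_Psi: "t \<ge> t0 \<Longrightarrow> l2n (Psi n t) = 1"
proof -
  assume t: "t \<ge> t0"
  have "complex_of_real (L2_norm_sq (Psi n t)) = 1"
    unfolding ip_self[symmetric] using onb.orth[OF onb_Psi[OF t], of n n] by simp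
  then show ?thesis unfolding l2n_def by (simp only: of_real_eq_1_iff real_sqrt_one)
qed

lemma l2n_PsiX_le:
  assumes t: "t \<ge> t0" shows "l2n (PsiX n t) \<le> cmod (nu t) * (sqrt (real n) + sqrt (real (Suc n)))"
proof -
  have "l2n (PsiX n t) \<le> cmod (lo n t) * 1 + cmod (hi n t) * 1"
    unfolding PsiX_eq[OF t]
    using l2n_triangle[OF L2_scale[OF L2_Psi[OF t]] L2_scale[OF L2_Psi[OF t]], of "lo n t" "n - 1" "hi n t" "Suc n"]
    by (simp add: l2n_scale l2n_Psi[OF t])
  also have "\<dots> \<le> cmod (nu t) * sqrt (real n) + cmod (nu t) * sqrt (real (Suc n))"
  proof (intro add_mono)
    have "z / sqrt 2 \<le> z" if "z \<ge> 0" for z :: real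
      using divide_left_mono[of 1 "sqrt 2" z] that by simp
    then show "cmod (lo n t) * 1 \<le> cmod (nu t) * sqrt (real n)" "cmod (hi n t) * 1 \<le> cmod (nu t) * sqrt (real (Suc n))"
      by (simp_all add: lo_def hi_def norm_mult norm_divide)
  qed
  finally show ?thesis by (simp add: distrib_left)
qed

text \<open>If \<open>Psi\<close> itself were a test function, the pairing would be constant, since
  both sides solve the same equation and the Hamiltonian is symmetric. What survives is the
  commutator of -(1/2) d^2/dx^2 with the cutoff, which contains only derivatives of the
  cutoff.\<close>

lemma cut_pairing_deriv:
  assumes sol: "is_solution a t0 u0 u" and t: "t \<ge> t0" and R: "R > 0"
  shows "((\<lambda>\<tau>. ip (u \<tau>) (\<lambda>x. of_real (cutR R x) * Psi n \<tau> x)) has_vector_derivative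
    \<i> * ip (u t) (\<lambda>x. of_real (- cutR1 R x) * PsiX n t x + of_real (- (1/2) * cutR2 R x) * Psi n t x)) (at t within {t0..})"
proof -
  obtain K where K: "K \<ge> 0" "\<And>x. \<bar>cutoff x\<bar> \<le> K" "\<And>x. \<bar>deriv cutoff x\<bar> \<le> K" "\<And>x. \<bar>deriv (deriv cutoff) x\<bar> \<le> K"
    using cutoff_bounds by auto
  have K': "\<bar>cutR R x\<bar> \<le> K" for x using K by (simp add: cutR_def)
  have K1: "\<bar>- cutR1 R x\<bar> \<le> K / R" for x using K(3) R by (simp add: cutR1_def divide_right_mono)
  have K2: "\<bar>- (1/2) * cutR2 R x\<bar> \<le> K / R\<^sup>2" for x
  proof -
    have "\<bar>cutR2 R x\<bar> \<le> K / R\<^sup>2" using K(4) R by (simp add: cutR2_def divide_right_mono)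
    moreover have "\<bar>- (1/2) * cutR2 R x\<bar> \<le> \<bar>cutR2 R x\<bar>" by (simp add: abs_mult)
    ultimately show ?thesis by linarith
  qed
  note m = L2_bounded_mult(1)[OF _ cutR_measurable(1) K']
  let ?F = "\<lambda>t x. of_real (cutR R x) * Psi n t x"
  let ?d = "\<i> * ip (u t) (\<lambda>x. (- ((of_real (cutR R x) * PsiXX n t x + of_real (cutR1 R x) * PsiX n t x)
      + (of_real (cutR1 R x) * PsiX n t x + of_real (cutR2 R x) * Psi n t x)) + of_real ((1 + a t) * x\<^sup>2) * ?F t x) / 2)"
  have 1: "((\<lambda>\<tau>. ip (u \<tau>) (?F t)) has_vector_derivative ?d) (at t within {t0..})"
    by (rule weak_complex_test[OF sol t test_fun_cut_Psi[OF t R] cut_Psi_deriv[OF t]])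
  have L2F: "L2 (?F \<tau>)" if "\<tau> \<ge> t0" for \<tau> by (rule m[OF L2_Psi[OF that]])
  have LT: "L2 (\<lambda>x. of_real (cutR R x) * PsiT n t x)" by (rule m[OF L2_PsiT[OF t]])
  have 2: "((\<lambda>\<tau>. l2n (\<lambda>x. (?F \<tau> x - ?F t x) / of_real (\<tau> - t) - of_real (cutR R x) * PsiT n t x)) \<longlongrightarrow> 0) (at t within {t0..})"
  proof (rule Lim_null_comparison)
    let ?q = "\<lambda>\<tau> x. (Psi n \<tau> x - Psi n t x) / of_real (\<tau> - t) - PsiT n t x"
    have "l2n (\<lambda>x. (?F \<tau> x - ?F t x) / of_real (\<tau> - t) - of_real (cutR R x) * PsiT n t x) \<le> \<bar>K\<bar> * l2n (?q \<tau>)" if "\<tau> \<ge> t0" for \<tau>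
    proof -
      have "L2 (\<lambda>x. (1 / of_real (\<tau> - t)) * (Psi n \<tau> x - Psi n t x) - PsiT n t x)"
        by (intro L2_diff L2_scale L2_Psi L2_PsiT t that)
      then have L: "L2 (?q \<tau>)" by simp
      have eq: "(c * A - c * B) / d - c * P = c * ((A - B) / d - P)" for c A B d P :: complex
        by (simp add: right_diff_distrib diff_divide_distrib)
      show ?thesis unfolding eq by (rule L2_bounded_mult(2)[OF L cutR_measurable(1) K'])
    qed
    then show "\<forall>\<^sub>F \<tau> in at t within {t0..}. norm (l2n (\<lambda>x. (?F \<tau> x - ?F t x) / of_real (\<tau> - t) - of_real (cutR R x) * PsiT n t x)) \<le> \<bar>K\<bar> * l2n (?q \<tau>)"
      by (auto simp: eventually_at_filter)
    show "((\<lambda>\<tau>. \<bar>K\<bar> * l2n (?q \<tau>)) \<longlongrightarrow> 0) (at t within {t0..})"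
      using tendsto_mult[OF tendsto_const Psi_L2_deriv[OF t, of n], of "\<bar>K\<bar>"] by simp
  qed
  have "((\<lambda>\<tau>. ip (u \<tau>) (?F \<tau>)) has_vector_derivative ?d + ip (u t) (\<lambda>x. of_real (cutR R x) * PsiT n t x)) (at t within {t0..})"
    by (rule ip_product_rule[OF _ _ LT _ _ 2 1]) (use is_solutionD[OF sol] L2F t in auto)
  moreover have "?d + ip (u t) (\<lambda>x. of_real (cutR R x) * PsiT n t x)
      = \<i> * ip (u t) (\<lambda>x. of_real (- cutR1 R x) * PsiX n t x + of_real (- (1/2) * cutR2 R x) * Psi n t x)"
  proof -
    let ?A = "\<lambda>x. of_real (- cutR1 R x) * PsiX n t x + of_real (- (1/2) * cutR2 R x) * Psi n t x"
    let ?B = "\<lambda>x. of_real (cutR R x) * PsiT n t x"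
    have LA: "L2 ?A"
      by (intro L2_add L2_bounded_mult(1)[OF L2_PsiX[OF t] _ K1] L2_bounded_mult(1)[OF L2_Psi[OF t] _ K2]) measurable
    have "(- ((of_real (cutR R x) * PsiXX n t x + of_real (cutR1 R x) * PsiX n t x)
      + (of_real (cutR1 R x) * PsiX n t x + of_real (cutR2 R x) * Psi n t x)) + of_real ((1 + a t) * x\<^sup>2) * ?F t x) / 2
      = ?A x + (- \<i>) * ?B x" for x
      unfolding PsiT_def by (simp add: field_simps)
    then have "?d = \<i> * ip (u t) (\<lambda>x. ?A x + (- \<i>) * ?B x)" by presburger
    also have "\<dots> = \<i> * (ip (u t) ?A + cnj (- \<i>) * ip (u t) ?B)"
      by (simp only: ip_add_right[OF is_solutionD(1)[OF sol t] LA L2_scale[OF LT]] ip_scale_right)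
    finally show ?thesis by (simp add: algebra_simps)
  qed
  ultimately show ?thesis by simp
qed

lemma solution_l2n_bounded:
  assumes sol: "is_solution a t0 u0 u"
  shows "\<exists>K\<ge>0. \<forall>t\<in>{t0..T}. l2n (u t) \<le> K"
proof -
  have "continuous_on {t0..} (\<lambda>t. l2n (u t))"
    unfolding continuous_on_def
  proof
    fix t assume t: "t \<in> {t0..}"
    show "((\<lambda>\<tau>. l2n (u \<tau>)) \<longlongrightarrow> l2n (u t)) (at t within {t0..})"
    proof (rule LIM_zero_cancel, rule Lim_null_comparison)
      have "\<bar>l2n (u \<tau>) - l2n (u t)\<bar> \<le> l2n (\<lambda>x. u \<tau> x - u t x)" if "\<tau> \<ge> t0" for \<tau>
        using l2n_triangle[OF L2_diff[of "u \<tau>" "u t"] , of "u t"] l2n_triangle[OF L2_diff[of "u t" "u \<tau>"] , of "u \<tau>"]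
          is_solutionD(1)[OF sol that] is_solutionD(1)[OF sol, of t] t l2n_minus[of "u \<tau>" "u t"] by simp
      then show "\<forall>\<^sub>F \<tau> in at t within {t0..}. norm (l2n (u \<tau>) - l2n (u t)) \<le> l2n (\<lambda>x. u \<tau> x - u t x)"
        by (auto simp: eventually_at_filter)
      show "((\<lambda>\<tau>. l2n (\<lambda>x. u \<tau> x - u t x)) \<longlongrightarrow> 0) (at t within {t0..})"
        using is_solutionD(3)[OF sol, of t] t by simp
    qed
  qed
  from bounded_on_compact[OF this, of T] obtain K where K: "\<forall>t\<in>{t0..T}. \<bar>l2n (u t)\<bar> \<le> K" by blast
  then show ?thesis by (intro exI[of _ "max 0 K"]) auto
qed

lemma cut_tendsto:
  assumes t: "t \<ge> t0" and g: "L2 g"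
  shows "(\<lambda>k. ip g (\<lambda>x. of_real (cutR (real (Suc k)) x) * Psi n t x)) \<longlonglongrightarrow> ip g (Psi n t)"
proof -
  obtain K where K: "K \<ge> 0" "\<And>x. \<bar>cutoff x\<bar> \<le> K" using cutoff_bounds by auto
  have [measurable]: "g \<in> borel_measurable borel" "Psi n t \<in> borel_measurable borel"
    using g t by (auto simp: L2_def)
  show ?thesis unfolding ip_def
proof (rule integral_dominated_convergence)
  show "integrable lborel (\<lambda>x. K * cmod (g x * cnj (Psi n t x)))"
    by (intro integrable_mult_right integrable_norm integrable_ip g L2_Psi t)
  show "AE x in lborel. norm (g x * cnj (of_real (cutR (real (Suc k)) x) * Psi n t x)) \<le> K * cmod (g x * cnj (Psi n t x))" for k
  proof (rule AE_I2)
    fix x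
    have "\<bar>cutR (real (Suc k)) x\<bar> * cmod (g x * cnj (Psi n t x)) \<le> K * cmod (g x * cnj (Psi n t x))"
      using K(2) by (intro mult_right_mono) (auto simp: cutR_def)
    then show "norm (g x * cnj (of_real (cutR (real (Suc k)) x) * Psi n t x)) \<le> K * cmod (g x * cnj (Psi n t x))"
      by (simp add: norm_mult mult_ac)
  qed
  show "AE x in lborel. (\<lambda>k. g x * cnj (of_real (cutR (real (Suc k)) x) * Psi n t x)) \<longlonglongrightarrow> g x * cnj (Psi n t x)"
  proof (rule AE_I2)
    fix x
    have c: "isCont cutoff 0" by (rule DERIV_isCont[OF smooth_DERIV[OF smooth_cutoff]])
    have "(\<lambda>k. inverse (real (Suc k)) * x + 0) \<longlonglongrightarrow> 0 * x + 0"
      by (intro tendsto_add tendsto_mult tendsto_const LIMSEQ_inverse_real_of_nat)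
    then have "(\<lambda>k. (1 / real (Suc k)) * x + 0) \<longlonglongrightarrow> 0"
      by (simp add: inverse_eq_divide)
    from isCont_tendsto_compose[OF c this] have "(\<lambda>k. cutR (real (Suc k)) x) \<longlonglongrightarrow> cutoff 0"
      unfolding cutR_def mult_1 .
    then have "(\<lambda>k. g x * cnj (of_real (cutR (real (Suc k)) x) * Psi n t x)) \<longlonglongrightarrow> g x * cnj (of_real (cutoff 0) * Psi n t x)"
      by (intro tendsto_intros)
    then show "(\<lambda>k. g x * cnj (of_real (cutR (real (Suc k)) x) * Psi n t x)) \<longlonglongrightarrow> g x * cnj (Psi n t x)"
      by (simp add: cutoff_0)
  qed
qed (auto simp: cutR_measurable)
qed

text \<open>The commutator term is O(1/R) uniformly on the time interval, so the mean value
  inequality bounds the change of the cut pairing by a multiple of 1/R. Letting R grow shows that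
  the coefficients in the moving basis are constant.\<close>

theorem solution_coeffs:
  assumes sol: "is_solution a t0 u0 u" and T: "T \<ge> t0" and u0: "L2 u0"
  shows "ip (u T) (Psi n T) = ip u0 (hc n)"
proof -
  obtain K where K: "K \<ge> 0" "\<And>x. \<bar>deriv cutoff x\<bar> \<le> K" "\<And>x. \<bar>deriv (deriv cutoff) x\<bar> \<le> K"
    using cutoff_bounds by auto
  obtain U where U: "U \<ge> 0" "\<And>t. t \<in> {t0..T} \<Longrightarrow> l2n (u t) \<le> U"
    using solution_l2n_bounded[OF sol] by blast
  obtain V where V: "\<And>t. t \<in> {t0..T} \<Longrightarrow> \<bar>cmod (nu t)\<bar> \<le> V"
    using bounded_on_compact[of "\<lambda>t. cmod (nu t)" T] continuous_on_norm[OF nu_cont] by blast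
  define M where "M = U * (K * (V * (sqrt (real n) + sqrt (real (Suc n)))) + K)"
  let ?F = "\<lambda>R t. ip (u t) (\<lambda>x. of_real (cutR R x) * Psi n t x)"
  have bound: "cmod (?F R T - ?F R t0) \<le> (M / R) * \<bar>T - t0\<bar>" if R: "R \<ge> 1" for R
  proof (rule vector_mvt_bound[where S = "{t0..T}"])
    let ?d = "\<lambda>t. \<i> * ip (u t) (\<lambda>x. of_real (- cutR1 R x) * PsiX n t x + of_real (- (1/2) * cutR2 R x) * Psi n t x)"
    fix t assume t: "t \<in> {t0..T}"
    then have t': "t \<ge> t0" by simp
    show "(?F R has_vector_derivative ?d t) (at t within {t0..T})"
      using cut_pairing_deriv[OF sol t', of R n] R by (auto intro: has_vector_derivative_within_subset)
    have K1: "\<bar>- cutR1 R x\<bar> \<le> K / R" for x using K(2) R by (simp add: cutR1_def divide_right_mono)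
    have K2: "\<bar>- (1/2) * cutR2 R x\<bar> \<le> K / R" for x
    proof -
      have "\<bar>cutR2 R x\<bar> \<le> K / R\<^sup>2" using K(3) R by (simp add: cutR2_def divide_right_mono)
      also have "\<dots> \<le> K / R" using R K(1) by (intro divide_left_mono) (auto simp: power2_eq_square)
      finally have "\<bar>cutR2 R x\<bar> \<le> K / R" .
      moreover have "\<bar>- (1/2) * cutR2 R x\<bar> \<le> \<bar>cutR2 R x\<bar>" by (simp add: abs_mult)
      ultimately show ?thesis by linarith
    qed
    note A = L2_bounded_mult[OF L2_PsiX[OF t'] _ K1] and B = L2_bounded_mult[OF L2_Psi[OF t'] _ K2]
    have m: "(\<lambda>x. - cutR1 R x) \<in> borel_measurable borel" "(\<lambda>x. - (1/2) * cutR2 R x) \<in> borel_measurable borel"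
      by measurable
    have KR: "\<bar>K / R\<bar> = K / R" using K R by simp
    have "l2n (\<lambda>x. of_real (- cutR1 R x) * PsiX n t x + of_real (- (1/2) * cutR2 R x) * Psi n t x)
        \<le> K / R * l2n (PsiX n t) + K / R * l2n (Psi n t)"
      using order_trans[OF l2n_triangle[OF A(1)[OF m(1)] B(1)[OF m(2)]] add_mono[OF A(2)[OF m(1)] B(2)[OF m(2)]]]
      unfolding KR .
    also have "\<dots> \<le> K / R * (V * (sqrt (real n) + sqrt (real (Suc n)))) + K / R * 1"
    proof (intro add_mono mult_left_mono)
      have "cmod (nu t) * (sqrt (real n) + sqrt (real (Suc n))) \<le> V * (sqrt (real n) + sqrt (real (Suc n)))"
        using V[OF t] by (intro mult_right_mono) auto
      then show "l2n (PsiX n t) \<le> V * (sqrt (real n) + sqrt (real (Suc n)))"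
        using l2n_PsiX_le[OF t'] order_trans by blast
    qed (use K R l2n_Psi[OF t'] in auto)
    finally have 1: "l2n (\<lambda>x. of_real (- cutR1 R x) * PsiX n t x + of_real (- (1/2) * cutR2 R x) * Psi n t x)
       \<le> K / R * (V * (sqrt (real n) + sqrt (real (Suc n)))) + K / R * 1" .
    have "cmod (?d t) \<le> l2n (u t) * l2n (\<lambda>x. of_real (- cutR1 R x) * PsiX n t x + of_real (- (1/2) * cutR2 R x) * Psi n t x)"
      unfolding norm_mult norm_ii mult_1
      by (intro cauchy_schwarz is_solutionD(1)[OF sol t'] L2_add A(1) B(1) m)
    also have "\<dots> \<le> U * (K / R * (V * (sqrt (real n) + sqrt (real (Suc n)))) + K / R * 1)"
      using U(2)[OF t] U(1) 1 by (intro mult_mono) auto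
    also have "\<dots> = M / R" using R by (simp add: M_def field_simps)
    finally show "cmod (?d t) \<le> M / R" .
  qed (use T in auto)
  have L: "L2 (u T)" "L2 (u t0)" using is_solutionD(1)[OF sol] T by auto
  have "(\<lambda>k. ?F (real (Suc k)) T - ?F (real (Suc k)) t0) \<longlonglongrightarrow> ip (u T) (Psi n T) - ip (u t0) (Psi n t0)"
    by (intro tendsto_diff cut_tendsto T L order_refl)
  moreover have "(\<lambda>k. ?F (real (Suc k)) T - ?F (real (Suc k)) t0) \<longlonglongrightarrow> 0"
  proof (rule Lim_null_comparison)
    show "\<forall>\<^sub>F k in sequentially. norm (?F (real (Suc k)) T - ?F (real (Suc k)) t0) \<le> (M * \<bar>T - t0\<bar>) * inverse (real (Suc k))"
      using bound[of "real (Suc k)" for k] by (intro always_eventually allI) (simp add: divide_inverse mult_ac)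
    show "(\<lambda>k. (M * \<bar>T - t0\<bar>) * inverse (real (Suc k))) \<longlonglongrightarrow> 0"
      using tendsto_mult[OF tendsto_const LIMSEQ_inverse_real_of_nat, of "M * \<bar>T - t0\<bar>"] by simp
  qed
  ultimately have "ip (u T) (Psi n T) = ip (u t0) (Psi n t0)" using LIMSEQ_unique by fastforce
  also have "\<dots> = ip u0 (hc n)"
    unfolding Psi_init using is_solutionD(2)[OF sol] L(2) u0 by (intro ip_AE_cong L2_measurable L2_hc)
  finally show ?thesis .
qed

end

context osc
begin

subsection \<open>Existence of weak solutions\<close>

lemma ip_PsiT_test:
  assumes t: "t \<ge> t0" and \<phi>: "test_fun \<phi>"
  shows "ip (PsiT n t) (\<lambda>x. of_real (\<phi> x)) = \<i> * ip (Psi n t) (Hop a t \<phi>)"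
proof -
  let ?p = "\<lambda>x. complex_of_real (\<phi> x)" and ?p1 = "\<lambda>x. complex_of_real (deriv \<phi> x)"
    and ?p2 = "\<lambda>x. complex_of_real (deriv (deriv \<phi>) x)"
  note \<phi>1 = test_fun_deriv[OF \<phi>] and \<phi>2 = test_fun_deriv[OF test_fun_deriv[OF \<phi>]]
  have sm: "smooth \<phi>" "smooth (deriv \<phi>)" "smooth (deriv (deriv \<phi>))"
    using \<phi> \<phi>1 \<phi>2 by (auto simp: test_fun_iff)
  have c: "continuous_on UNIV ?p1" "continuous_on UNIV ?p2"
    by (intro continuous_on_of_real smooth_continuous sm)+
  have d: "(?p has_vector_derivative ?p1 x) (at x)" "(?p1 has_vector_derivative ?p2 x) (at x)" for x
    by (intro has_vector_derivative_of_real smooth_DERIV sm)+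
  note g = gdec_mult[OF gdec_Psi[OF t] gdec_test_fun[OF \<phi>2]] gdec_mult[OF gdec_PsiX[OF t] gdec_test_fun[OF \<phi>1]]
    gdec_mult[OF gdec_PsiXX[OF t] gdec_test_fun[OF \<phi>]] gdec_mult[OF gdec_PsiX[OF t] gdec_test_fun[OF \<phi>]]
    gdec_mult[OF gdec_Psi[OF t] gdec_test_fun[OF \<phi>1]]
  have "(\<integral>x. PsiXX n t x * ?p x \<partial>lborel) = - (\<integral>x. PsiX n t x * ?p1 x \<partial>lborel)"
    by (rule integration_by_parts_gdec[OF PsiX_x_deriv[OF t] PsiXX_continuous[OF t] d(1) c(1) g(4) g(3) g(2)])
  moreover have "(\<integral>x. PsiX n t x * ?p1 x \<partial>lborel) = - (\<integral>x. Psi n t x * ?p2 x \<partial>lborel)"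
    by (rule integration_by_parts_gdec[OF Psi_x_deriv[OF t] PsiX_continuous[OF t] d(2) c(2) g(5) g(2) g(1)])
  ultimately have ibp: "(\<integral>x. PsiXX n t x * ?p x \<partial>lborel) = (\<integral>x. Psi n t x * ?p2 x \<partial>lborel)" by simp
  have int: "integrable lborel (\<lambda>x. PsiXX n t x * ?p x)" "integrable lborel (\<lambda>x. Psi n t x * ?p2 x)"
    "integrable lborel (\<lambda>x. Psi n t x * of_real (x\<^sup>2 * \<phi> x))"
    by (intro integrable_L2_mult L2_PsiXX L2_Psi L2_test_fun L2_x2_test_fun t \<phi> \<phi>2)+
  have "ip (PsiT n t) ?p = (\<integral>x. (- \<i> / 2) * (PsiXX n t x * ?p x) + (\<i> * of_real ((1 + a t) / 2)) * (Psi n t x * of_real (x\<^sup>2 * \<phi> x)) \<partial>lborel)"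
    unfolding ip_def PsiT_def by (intro Bochner_Integration.integral_cong) (auto simp: field_simps)
  also have "\<dots> = (- \<i> / 2) * (\<integral>x. PsiXX n t x * ?p x \<partial>lborel) + (\<i> * of_real ((1 + a t) / 2)) * (\<integral>x. Psi n t x * of_real (x\<^sup>2 * \<phi> x) \<partial>lborel)"
    by (simp only: Bochner_Integration.integral_add[OF integrable_mult_right[OF int(1)] integrable_mult_right[OF int(3)]] integral_mult_right_zero)
  also have "\<dots> = \<i> * ((- 1 / 2) * (\<integral>x. Psi n t x * ?p2 x \<partial>lborel) + of_real ((1 + a t) / 2) * (\<integral>x. Psi n t x * of_real (x\<^sup>2 * \<phi> x) \<partial>lborel))"
    unfolding ibp by (simp add: field_simps)
  also have "(- 1 / 2) * (\<integral>x. Psi n t x * ?p2 x \<partial>lborel) + of_real ((1 + a t) / 2) * (\<integral>x. Psi n t x * of_real (x\<^sup>2 * \<phi> x) \<partial>lborel)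
      = (\<integral>x. (- 1 / 2) * (Psi n t x * ?p2 x) + of_real ((1 + a t) / 2) * (Psi n t x * of_real (x\<^sup>2 * \<phi> x)) \<partial>lborel)"
    by (simp only: Bochner_Integration.integral_add[OF integrable_mult_right[OF int(2)] integrable_mult_right[OF int(3)]] integral_mult_right_zero)
  also have "\<dots> = ip (Psi n t) (Hop a t \<phi>)"
    unfolding ip_def Hop_eq by (intro Bochner_Integration.integral_cong) (auto simp: algebra_simps)
  finally show ?thesis .
qed

lemma Psi_pairing_deriv:
  assumes t: "t \<ge> t0" and \<phi>: "test_fun \<phi>"
  shows "((\<lambda>\<tau>. ip (Psi n \<tau>) (\<lambda>x. of_real (\<phi> x))) has_vector_derivative \<i> * ip (Psi n t) (Hop a t \<phi>)) (at t within {t0..})"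
proof -
  let ?p = "\<lambda>x. complex_of_real (\<phi> x)"
  let ?q = "\<lambda>\<tau> x. (Psi n \<tau> x - Psi n t x) / of_real (\<tau> - t)"
  have eq: "?q \<tau> = (\<lambda>x. (1 / of_real (\<tau> - t)) * (Psi n \<tau> x - Psi n t x))" for \<tau> by simp
  have q: "L2 (?q \<tau>)" if "\<tau> \<in> {t0..}" for \<tau>
    unfolding eq using that t by (intro L2_scale L2_diff L2_Psi) auto
  have "((\<lambda>\<tau>. ip (?q \<tau>) ?p) \<longlongrightarrow> ip (PsiT n t) ?p) (at t within {t0..})"
    by (rule L2_tendsto_product[OF q _ L2_PsiT[OF t] L2_test_fun[OF \<phi>] _ Psi_L2_deriv[OF t]])
       (use t L2_test_fun[OF \<phi>] in \<open>auto simp: l2n_def L2_norm_sq_def\<close>)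
  then have "((\<lambda>\<tau>. (ip (Psi n \<tau>) ?p - ip (Psi n t) ?p) / of_real (\<tau> - t)) \<longlongrightarrow> ip (PsiT n t) ?p) (at t within {t0..})"
  proof (rule Lim_transform_eventually)
    have "ip (?q \<tau>) ?p = (ip (Psi n \<tau>) ?p - ip (Psi n t) ?p) / of_real (\<tau> - t)" if "\<tau> \<ge> t0" for \<tau>
      unfolding eq ip_scale_left using that t by (simp add: ip_diff_left L2_Psi L2_test_fun[OF \<phi>])
    then show "\<forall>\<^sub>F \<tau> in at t within {t0..}. ip (?q \<tau>) ?p = (ip (Psi n \<tau>) ?p - ip (Psi n t) ?p) / of_real (\<tau> - t)"
      by (auto simp: eventually_at_filter)
  qed
  then show ?thesis unfolding vector_derivative_quotient ip_PsiT_test[OF t \<phi>] .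
qed

text \<open>At each time the solution is the L2 function with the initial coefficients in the moving
  basis. The finite partial sums solve the weak equation, and orthonormality makes their distance to
  the limit independent of time, so continuity and the equation pass to the limit uniformly.\<close>

theorem solution_exists:
  assumes u0: "L2 u0" shows "\<exists>u. is_solution a t0 u0 u"
proof -
  define c where "c n = ip u0 (hc n)" for n
  have sc: "summable (\<lambda>n. (cmod (c n))\<^sup>2)" unfolding c_def by (rule onb.summable_coeffs[OF onb_hc u0])
  have "\<exists>g. L2 g \<and> (\<forall>n. ip g (Psi n t) = c n)" if "t \<ge> t0" for t
    using onb.riesz_fischer_lim[OF onb_Psi[OF that] sc] by blast
  then obtain u where u: "\<And>t. t \<ge> t0 \<Longrightarrow> L2 (u t)" "\<And>t n. t \<ge> t0 \<Longrightarrow> ip (u t) (Psi n t) = c n"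
    by metis
  define v where "v N t x = (\<Sum>n<N. c n * Psi n t x)" for N t x
  \<comment> \<open>The norm of the tail of the coefficients; by Parseval it is the distance of the
    N-th partial sum from the solution at every time.\<close>
  define e where "e N = sqrt ((\<Sum>n. (cmod (c n))\<^sup>2) - (\<Sum>n<N. (cmod (c n))\<^sup>2))" for N
  have e0: "e \<longlonglongrightarrow> 0"
  proof -
    have "(\<lambda>N. (\<Sum>n. (cmod (c n))\<^sup>2) - (\<Sum>n<N. (cmod (c n))\<^sup>2)) \<longlonglongrightarrow> (\<Sum>n. (cmod (c n))\<^sup>2) - (\<Sum>n. (cmod (c n))\<^sup>2)"
      by (intro tendsto_diff tendsto_const summable_LIMSEQ sc)
    from tendsto_real_sqrt[OF this] show ?thesis unfolding e_def by simp
  qed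
  have L2v: "L2 (v N t)" if "t \<ge> t0" for N t
    unfolding v_def using that by (intro L2_sum L2_scale L2_Psi)
  have uv: "l2n (\<lambda>x. u t x - v N t x) = e N" if t: "t \<ge> t0" for N t
  proof -
    have "(\<lambda>n. (cmod (c n))\<^sup>2) sums L2_norm_sq (u t)"
      using onb.parseval[OF onb_Psi[OF t] u(1)[OF t]] by (simp add: u(2)[OF t])
    then have "L2_norm_sq (u t) = (\<Sum>n. (cmod (c n))\<^sup>2)" by (rule sums_unique)
    then show ?thesis
      using onb.norm_diff_proj[OF onb_Psi[OF t] u(1)[OF t], of "{..<N}"]
      by (simp add: l2n_def e_def v_def u(2)[OF t])
  qed
  have "is_solution a t0 u0 u"
    unfolding is_solution_def
  proof (intro conjI allI impI)
    show "L2 (u t)" if "t \<ge> t0" for t using u(1)[OF that] .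
    have "AE x in lborel. u t0 x - u0 x = 0"
    proof (rule hermite_complete)
      show "L2 (\<lambda>x. u t0 x - u0 x)" using u(1) u0 by (intro L2_diff) auto
      show "ip (\<lambda>x. u t0 x - u0 x) (hc n) = 0" for n
        using u(1)[of t0] u0 u(2)[of t0 n] by (simp add: ip_diff_left L2_hc Psi_init c_def)
    qed
    then show "AE x in lborel. u t0 x = u0 x" by simp
  next
    fix t assume t: "t \<ge> t0"
    have "((\<lambda>\<tau>. l2n (\<lambda>x. u \<tau> x - u t x)) \<longlongrightarrow> 0) (at t within {t0..})"
    proof (rule tendstoI)
      fix \<epsilon> :: real assume "\<epsilon> > 0"
      then obtain N where N: "e N < \<epsilon> / 3" "e N \<ge> 0"
        using order_tendstoD(2)[OF e0, of "\<epsilon> / 3"] uv[OF t, symmetric]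
        by (auto simp: eventually_sequentially)
      have "((\<lambda>\<tau>. \<Sum>n<N. cmod (c n) * l2n (\<lambda>x. Psi n \<tau> x - Psi n t x)) \<longlongrightarrow> (\<Sum>n<N. cmod (c n) * 0)) (at t within {t0..})"
        by (intro tendsto_sum tendsto_mult tendsto_const Psi_L2_cont t)
      then have "\<forall>\<^sub>F \<tau> in at t within {t0..}. (\<Sum>n<N. cmod (c n) * l2n (\<lambda>x. Psi n \<tau> x - Psi n t x)) < \<epsilon> / 3"
        using \<open>\<epsilon> > 0\<close> by (intro order_tendstoD(2)) auto
      moreover have "\<forall>\<^sub>F \<tau> in at t within {t0..}. \<tau> \<ge> t0"
        by (auto simp: eventually_at_filter)
      ultimately show "\<forall>\<^sub>F \<tau> in at t within {t0..}. dist (l2n (\<lambda>x. u \<tau> x - u t x)) 0 < \<epsilon>"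
      proof eventually_elim
        case (elim \<tau>)
        have "l2n (\<lambda>x. \<Sum>n<M. c n * (Psi n \<tau> x - Psi n t x)) \<le> (\<Sum>n<M. cmod (c n) * l2n (\<lambda>x. Psi n \<tau> x - Psi n t x))" for M
        proof (induction M)
          case 0 then show ?case by (simp add: l2n_def L2_norm_sq_def)
        next
          case (Suc M)
          have L: "L2 (\<lambda>x. c n * (Psi n \<tau> x - Psi n t x))" for n
            using t elim(2) by (intro L2_scale L2_diff L2_Psi)
          have "l2n (\<lambda>x. \<Sum>n<Suc M. c n * (Psi n \<tau> x - Psi n t x))
            \<le> l2n (\<lambda>x. \<Sum>n<M. c n * (Psi n \<tau> x - Psi n t x)) + l2n (\<lambda>x. c M * (Psi M \<tau> x - Psi M t x))"
            unfolding sum.lessThan_Suc by (intro l2n_triangle L2_sum L)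
          then show ?case using Suc by (simp add: l2n_scale)
        qed
        then have "l2n (\<lambda>x. v N \<tau> x - v N t x) < \<epsilon> / 3"
          using elim(1) unfolding v_def sum_subtractf[symmetric] right_diff_distrib[symmetric] by (rule le_less_trans)
        moreover have "l2n (\<lambda>x. u \<tau> x - u t x) \<le> l2n (\<lambda>x. u \<tau> x - v N \<tau> x) + (l2n (\<lambda>x. v N \<tau> x - v N t x) + l2n (\<lambda>x. v N t x - u t x))"
          using l2n_triangle_diff[OF u(1)[OF elim(2)] L2v[OF elim(2)] u(1)[OF t], of N]
            l2n_triangle_diff[OF L2v[OF elim(2)] L2v[OF t] u(1)[OF t], of N N] by linarith
        ultimately show ?case
          using N uv[OF t, of N] uv[OF elim(2), of N] l2n_minus[of "v N t" "u t"] by simp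
      qed
    qed
    from tendsto_power[OF this, of 2] show "((\<lambda>\<tau>. L2_norm_sq (\<lambda>x. u \<tau> x - u t x)) \<longlongrightarrow> 0) (at t within {t0..})"
      by (simp add: l2n_sq)
  next
    fix \<phi> t assume \<phi>: "test_fun \<phi>" and t: "t \<ge> t0"
    let ?p = "\<lambda>x. complex_of_real (\<phi> x)"
    \<comment> \<open>Uniform convergence of the derivatives is available on a compact interval.
      Ending it after \<open>t\<close> ensures that derivatives within the interval and within
      \<open>{t0..}\<close> agree at \<open>t\<close>.\<close>
    define T where "T = t + 1"
    define f where "f N \<tau> = ip (v N \<tau>) ?p" for N \<tau>
    have f': "(f N has_vector_derivative \<i> * ip (v N \<tau>) (Hop a \<tau> \<phi>)) (at \<tau> within {t0..})" if \<tau>: "\<tau> \<ge> t0" for N \<tau>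
    proof -
      have eq: "(\<Sum>n<N. c n * ip (Psi n s) ?p) = f N s" if "s \<ge> t0" for s
        unfolding f_def v_def using that
        by (subst ip_sum_left) (auto simp: L2_scale L2_Psi L2_test_fun[OF \<phi>] ip_scale_left)
      have "((\<lambda>s. \<Sum>n<N. c n * ip (Psi n s) ?p) has_vector_derivative (\<Sum>n<N. c n * (\<i> * ip (Psi n \<tau>) (Hop a \<tau> \<phi>)))) (at \<tau> within {t0..})"
        by (intro has_vector_derivative_sum has_vector_derivative_mult_right Psi_pairing_deriv \<tau> \<phi>)
      moreover have "(\<Sum>n<N. c n * (\<i> * ip (Psi n \<tau>) (Hop a \<tau> \<phi>))) = \<i> * ip (v N \<tau>) (Hop a \<tau> \<phi>)"
        unfolding v_def using \<tau>
        by (subst ip_sum_left) (auto simp: L2_scale L2_Psi L2_Hop[OF \<phi>] ip_scale_left sum_distrib_left mult_ac)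
      ultimately have "((\<lambda>s. \<Sum>n<N. c n * ip (Psi n s) ?p) has_vector_derivative \<i> * ip (v N \<tau>) (Hop a \<tau> \<phi>)) (at \<tau> within {t0..})"
        by simp
      then show ?thesis by (rule has_vector_derivative_transform[rotated 2]) (use \<tau> eq in auto)
    qed
    obtain A where A: "\<And>s. s \<in> {t0..T} \<Longrightarrow> \<bar>a s\<bar> \<le> A" using bounded_on_compact[OF a_cont, of T] by blast
    define B where "B = l2n (\<lambda>x. of_real (deriv (deriv \<phi>) x)) + (1 + A) * l2n (\<lambda>x. of_real (x\<^sup>2 * \<phi> x))"
    have B: "l2n (Hop a s \<phi>) \<le> B" if "s \<in> {t0..T}" for s
    proof -
      have "(1 + \<bar>a s\<bar>) * l2n (\<lambda>x. of_real (x\<^sup>2 * \<phi> x)) \<le> (1 + A) * l2n (\<lambda>x. of_real (x\<^sup>2 * \<phi> x))"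
        using A[OF that] by (intro mult_right_mono) auto
      then show ?thesis using l2n_Hop[OF \<phi>, of a s] unfolding B_def by linarith
    qed
    have lim: "(\<lambda>N. f N s) \<longlonglongrightarrow> ip (u s) ?p" if s: "s \<ge> t0" for s
      unfolding f_def
    proof (rule ip_continuous_left[OF L2v[OF s] u(1)[OF s] L2_test_fun[OF \<phi>]])
      show "(\<lambda>n. l2n (\<lambda>x. v n s x - u s x)) \<longlonglongrightarrow> 0"
        using e0 unfolding l2n_minus[of "v n s" "u s" for n] uv[OF s] .
    qed
    have "\<exists>g. \<forall>s\<in>{t0..T}. (\<lambda>N. f N s) \<longlonglongrightarrow> g s \<and> (g has_derivative (\<lambda>h. h *\<^sub>R (\<i> * ip (u s) (Hop a s \<phi>)))) (at s within {t0..T})"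
    proof (rule has_derivative_sequence)
      show "(f N has_derivative (\<lambda>h. h *\<^sub>R (\<i> * ip (v N s) (Hop a s \<phi>)))) (at s within {t0..T})" if "s \<in> {t0..T}" for N s
        using has_vector_derivative_within_subset[OF f', of s "{t0..T}" N] that
        unfolding has_vector_derivative_def by auto
      show "(\<lambda>N. f N t0) \<longlonglongrightarrow> ip (u t0) ?p" by (rule lim) simp
      show "t0 \<in> {t0..T}" using t by (simp add: T_def)
      fix \<epsilon> :: real assume \<epsilon>: "\<epsilon> > 0"
      have "(\<lambda>N. e N * B) \<longlonglongrightarrow> 0 * B" by (intro tendsto_mult e0 tendsto_const)
      then have "\<forall>\<^sub>F N in sequentially. e N * B < \<epsilon>" using \<epsilon> by (intro order_tendstoD(2)) auto
      then show "\<forall>\<^sub>F N in sequentially. \<forall>s\<in>{t0..T}. \<forall>h. norm (h *\<^sub>R (\<i> * ip (v N s) (Hop a s \<phi>)) - h *\<^sub>R (\<i> * ip (u s) (Hop a s \<phi>))) \<le> \<epsilon> * norm h"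
      proof eventually_elim
        case (elim N)
        show ?case
        proof (intro ballI allI)
          fix s h assume s: "s \<in> {t0..T}"
          then have s': "s \<ge> t0" by simp
          have "ip (v N s) (Hop a s \<phi>) - ip (u s) (Hop a s \<phi>) = ip (\<lambda>x. v N s x - u s x) (Hop a s \<phi>)"
            by (simp add: ip_diff_left L2v[OF s'] u(1)[OF s'] L2_Hop[OF \<phi>])
          also have "cmod \<dots> \<le> e N * l2n (Hop a s \<phi>)"
            using cauchy_schwarz[OF L2_diff[OF L2v[OF s'] u(1)[OF s']] L2_Hop[OF \<phi>], of N a s] l2n_minus[of "v N s" "u s"] uv[OF s']
            by simp
          also have "\<dots> \<le> e N * B"
            using B[OF s] uv[OF s', of N] l2n_nonneg by (metis mult_left_mono)
          finally have "cmod (ip (v N s) (Hop a s \<phi>) - ip (u s) (Hop a s \<phi>)) \<le> \<epsilon>" using elim by simp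
          then have "\<bar>h\<bar> * cmod (ip (v N s) (Hop a s \<phi>) - ip (u s) (Hop a s \<phi>)) \<le> \<bar>h\<bar> * \<epsilon>"
            by (rule mult_left_mono) simp
          then show "norm (h *\<^sub>R (\<i> * ip (v N s) (Hop a s \<phi>)) - h *\<^sub>R (\<i> * ip (u s) (Hop a s \<phi>))) \<le> \<epsilon> * norm h"
            unfolding scaleR_diff_right[symmetric] right_diff_distrib[symmetric] by (simp add: norm_mult mult.commute)
        qed
      qed
    qed simp
    then obtain g where g: "\<And>s. s \<in> {t0..T} \<Longrightarrow> (\<lambda>N. f N s) \<longlonglongrightarrow> g s"
      "\<And>s. s \<in> {t0..T} \<Longrightarrow> (g has_vector_derivative \<i> * ip (u s) (Hop a s \<phi>)) (at s within {t0..T})"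
      unfolding has_vector_derivative_def by blast
    have gu: "ip (u s) ?p = g s" if "s \<in> {t0..T}" for s
      using LIMSEQ_unique[OF lim g(1)[OF that]] that by simp
    have tT: "t \<in> {t0..T}" using t by (simp add: T_def)
    have "((\<lambda>s. ip (u s) ?p) has_vector_derivative \<i> * ip (u t) (Hop a t \<phi>)) (at t within {t0..T})"
      by (rule has_vector_derivative_transform[OF tT gu g(2)[OF tT]])
    moreover have "at t within {t0..T} = at t within {t0..}"
      by (rule at_within_nhd[of t "{..<t + 1}"]) (auto simp: T_def)
    ultimately show "((\<lambda>\<tau>. \<integral>x. u \<tau> x * complex_of_real (\<phi> x) \<partial>lborel) has_vector_derivative
          (\<i> * (\<integral>x. u t x * complex_of_real ((- deriv (deriv \<phi>) x + (1 + a t) * x^2 * \<phi> x) / 2) \<partial>lborel)))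
        (at t within {t0..})"
      unfolding ip_def Hop_def complex_cnj_complex_of_real by simp
  qed
  then show ?thesis by blast
qed

end

subsection \<open>Interpolation of weighted sequence spaces\<close>

lemma dyadic_interval:
  fixes y :: real assumes "y \<ge> 1" shows "\<exists>p. 2 ^ p \<le> y \<and> y < 2 ^ Suc p"
proof -
  have ex: "\<exists>n. y < 2 ^ n" using real_arch_pow[of 2 y] by auto
  define n where "n = (LEAST n. y < 2 ^ n)"
  have n: "y < 2 ^ n" unfolding n_def by (rule LeastI_ex[OF ex])
  then have "n \<noteq> 0" using assms by (auto intro: gr0I)
  then obtain p where p: "n = Suc p" by (cases n) auto
  have "\<not> y < 2 ^ p" using not_less_Least[of p "\<lambda>n. y < 2 ^ n"] p n_def by auto
  then show ?thesis using n p by (intro exI[of _ p]) auto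
qed

text \<open>The sum over scales decays geometrically on both sides of the scale \<open>p\<close>, so
  its size depends neither on \<open>p\<close> nor on the number of scales.\<close>

lemma dyadic_geometric_sum:
  fixes q :: real assumes "0 < q" "q < 1"
  shows "(\<Sum>j<J. if j \<le> p then q ^ (p - j) else q ^ (j - Suc p)) \<le> 2 / (1 - q)"
proof -
  have g: "(\<Sum>i\<in>A. q ^ i) \<le> 1 / (1 - q)" if "finite A" for A
    using assms that sum_le_suminf[of "\<lambda>i. q ^ i" A] by (simp add: suminf_geometric summable_geometric)
  have "(\<Sum>j<J. if j \<le> p then q ^ (p - j) else q ^ (j - Suc p))
      = (\<Sum>j\<in>{..<J} \<inter> {j. j \<le> p}. q ^ (p - j)) + (\<Sum>j\<in>{..<J} \<inter> - {j. j \<le> p}. q ^ (j - Suc p))"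
    by (subst sum.If_cases) auto
  also have "(\<Sum>j\<in>{..<J} \<inter> {j. j \<le> p}. q ^ (p - j)) = (\<Sum>i\<in>(\<lambda>j. p - j) ` ({..<J} \<inter> {j. j \<le> p}). q ^ i)"
    by (subst sum.reindex) (auto simp: inj_on_def)
  also have "(\<Sum>j\<in>{..<J} \<inter> - {j. j \<le> p}. q ^ (j - Suc p)) = (\<Sum>i\<in>(\<lambda>j. j - Suc p) ` ({..<J} \<inter> - {j. j \<le> p}). q ^ i)"
    by (subst sum.reindex) (auto simp: inj_on_def)
  finally show ?thesis using add_mono[OF g g] by (simp add: add_divide_distrib)
qed

text \<open>At scales below \<open>y\<close> the weights 2^(js) form a growing geometric series,
  dominated by its last terms. At scales above \<open>y\<close> the decay of order \<open>K\<close>,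
  larger than s, overcomes the weight. Both parts are comparable to the single term at scale
  \<open>y\<close>.\<close>

lemma dyadic_weight_sum:
  fixes y s C :: real
  assumes y: "y \<ge> 1" and s: "s > 0" and K: "real K \<ge> s + 1" and C: "C \<ge> 1"
  shows "(\<Sum>j<J. 2 powr (real (Suc j) * s) * (if y \<le> 2 ^ j then C * (y / 2 ^ j) ^ K else 1))
    \<le> (2 powr s * C * (2 / (1 - 2 powr (- min s 1)))) * y powr s"
proof -
  \<comment> \<open>An exponent that serves on both sides: below \<open>y\<close> the available
    decay is s, above it is at least 1.\<close>
  define r where "r = min s 1"
  define q where "q = 2 powr (- r)"
  have r: "r > 0" "r \<le> s" "r \<le> 1" using s by (auto simp: r_def)
  have q: "0 < q" "q < 1" using r by (auto simp: q_def powr_less_one)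
  have qp: "q ^ i = (2 ^ i) powr (- r)" for i
    by (simp add: q_def powr_realpow[symmetric] powr_powr mult.commute)
  obtain p where p: "2 ^ p \<le> y" "y < 2 ^ Suc p" using dyadic_interval[OF y] by blast
  have "2 powr (real (Suc j) * s) * (if y \<le> 2 ^ j then C * (y / 2 ^ j) ^ K else 1)
      \<le> (2 powr s * C * y powr s) * (if j \<le> p then q ^ (p - j) else q ^ (j - Suc p))" for j
  proof -
    have e: "2 powr (real (Suc j) * s) = 2 powr s * (2 ^ j) powr s"
      by (simp add: powr_realpow[symmetric] powr_powr powr_add[symmetric] algebra_simps)
    have a: "(y / 2 ^ j) powr r \<le> (if j \<le> p then 1 else q ^ (j - Suc p))" if "y \<le> 2 ^ j"
    proof (cases "j \<le> p")
      case True
      have "(y / 2 ^ j) powr r \<le> 1 powr r" using that y r by (intro powr_mono2) auto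
      then show ?thesis using True by simp
    next
      case False
      have "(2::real) ^ Suc p * 2 ^ (j - Suc p) = 2 ^ j" using False by (simp add: power_add[symmetric] del: power_Suc)
      then have "y * 2 ^ (j - Suc p) \<le> 2 ^ j" using mult_right_mono[OF less_imp_le[OF p(2)], of "2 ^ (j - Suc p)"] by simp
      then have "y / 2 ^ j \<le> 1 / 2 ^ (j - Suc p)" by (simp add: field_simps)
      then have "(y / 2 ^ j) powr r \<le> (1 / 2 ^ (j - Suc p)) powr r" using r y by (intro powr_mono2) auto
      also have "\<dots> = q ^ (j - Suc p)" unfolding qp by (simp add: powr_divide powr_minus_divide)
      finally show ?thesis using False by simp
    qed
    show ?thesis
    proof (cases "y \<le> 2 ^ j")
      case True
      have yj: "0 < y / 2 ^ j" "y / 2 ^ j \<le> 1" using y True by auto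
      have jp: "j \<ge> p" using order_trans[OF p(1) True] by simp
      have "(y / 2 ^ j) ^ K = (y / 2 ^ j) powr (real K)" using yj by (simp add: powr_realpow)
      also have "\<dots> \<le> (y / 2 ^ j) powr (s + r)" using yj K r by (intro powr_mono') auto
      also have "\<dots> = (y powr s / (2 ^ j) powr s) * (y / 2 ^ j) powr r" using y by (simp add: powr_add powr_divide)
      finally have "(2 ^ j) powr s * (y / 2 ^ j) ^ K \<le> y powr s * (y / 2 ^ j) powr r"
        by (simp add: field_simps)
      also have "\<dots> \<le> y powr s * (if j \<le> p then q ^ (p - j) else q ^ (j - Suc p))"
        using a[OF True] jp by (intro mult_left_mono) (auto split: if_splits)
      finally have "(2 powr s * C) * ((2 ^ j) powr s * (y / 2 ^ j) ^ K) \<le> (2 powr s * C) * (y powr s * (if j \<le> p then q ^ (p - j) else q ^ (j - Suc p)))"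
        using C by (intro mult_left_mono) auto
      then show ?thesis unfolding e using True by (simp add: mult_ac)
    next
      case False
      have "(2::real) ^ j < 2 ^ Suc p" using False p(2) by simp
      then have jp: "j \<le> p" using power_less_imp_less_exp[of "2::real" j "Suc p"] by simp
      have "(2::real) ^ j * 2 ^ (p - j) = 2 ^ p" using jp by (simp add: power_add[symmetric])
      then have "2 ^ j / y \<le> 1 / 2 ^ (p - j)" using p(1) y by (simp add: field_simps)
      moreover have "2 ^ j / y \<le> 1" using False y by simp
      ultimately have "(2 ^ j / y) powr s \<le> (1 / 2 ^ (p - j)) powr r"
        using y r order_trans[OF powr_mono'[of r s "2 ^ j / y"] powr_mono2[of r "2 ^ j / y" "1 / 2 ^ (p - j)"]] by simp
      also have "\<dots> = q ^ (p - j)" unfolding qp by (simp add: powr_divide powr_minus_divide)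
      finally have "(2 ^ j) powr s \<le> y powr s * q ^ (p - j)" using y by (simp add: powr_divide field_simps)
      also have "\<dots> \<le> C * (y powr s * q ^ (p - j))"
        using C q mult_right_mono[OF C, of "y powr s * q ^ (p - j)"] by simp
      finally have "2 powr s * (2 ^ j) powr s \<le> 2 powr s * (C * (y powr s * q ^ (p - j)))" by (intro mult_left_mono) auto
      then show ?thesis unfolding e using False jp by (simp add: mult_ac)
    qed
  qed
  then have "(\<Sum>j<J. 2 powr (real (Suc j) * s) * (if y \<le> 2 ^ j then C * (y / 2 ^ j) ^ K else 1))
    \<le> (\<Sum>j<J. (2 powr s * C * y powr s) * (if j \<le> p then q ^ (p - j) else q ^ (j - Suc p)))"
    by (rule sum_mono)
  also have "\<dots> \<le> (2 powr s * C * y powr s) * (2 / (1 - q))"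
    unfolding sum_distrib_left[symmetric] using C by (intro mult_left_mono dyadic_geometric_sum q) auto
  finally show ?thesis by (simp add: q_def r_def mult_ac)
qed

text \<open>The blocks are shifted by one because the weight is attached to m + 1: membership in
  block j means that m + 1 lies between 2^j and 2^(j+1), the upper end excluded.\<close>

lemma dyadic_blocks:
  fixes b :: "nat \<Rightarrow> real"
  assumes "\<And>m. b m \<ge> 0" "s > 0"
  shows "(\<Sum>m<2 ^ J - 1. real (Suc m) powr s * b m) \<le> (\<Sum>j<J. 2 powr (real (Suc j) * s) * (\<Sum>m\<in>{2 ^ j - 1..<2 ^ Suc j - 1}. b m))"
proof (induction J)
  case (Suc J)
  have le: "(2::nat) ^ J - 1 \<le> 2 ^ Suc J - 1" by (intro diff_le_mono power_increasing) auto
  have "(\<Sum>m<2 ^ Suc J - 1. real (Suc m) powr s * b m) = (\<Sum>m<2 ^ J - 1. real (Suc m) powr s * b m) + (\<Sum>m\<in>{2 ^ J - 1..<2 ^ Suc J - 1}. real (Suc m) powr s * b m)"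
    unfolding lessThan_atLeast0 by (rule sum.atLeastLessThan_concat[symmetric]) (use le in auto)
  also have "(\<Sum>m\<in>{2 ^ J - 1..<2 ^ Suc J - 1}. real (Suc m) powr s * b m) \<le> (\<Sum>m\<in>{2 ^ J - 1..<2 ^ Suc J - 1}. 2 powr (real (Suc J) * s) * b m)"
  proof (intro sum_mono mult_right_mono assms)
    fix m :: nat assume "m \<in> {2 ^ J - 1..<2 ^ Suc J - 1}"
    then have "Suc m \<le> 2 ^ Suc J" by auto
    then have "real (Suc m) \<le> 2 ^ Suc J" using of_nat_mono[of "Suc m" "2 ^ Suc J", where 'a = real] by simp
    then have "real (Suc m) powr s \<le> (2 ^ Suc J) powr s" using assms(2) by (intro powr_mono2) auto
    also have "\<dots> = 2 powr (real (Suc J) * s)" by (simp only: powr_realpow[symmetric] powr_powr zero_less_numeral)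
    finally show "real (Suc m) powr s \<le> 2 powr (real (Suc J) * s)" .
  qed
  finally show ?case using Suc.IH by (simp add: sum_distrib_left)
qed simp

text \<open>Real interpolation by hand. Hypothesis \<open>H\<close> bounds the mass of
  \<open>b\<close> at scale 2^j by high regularity on the low part of \<open>a\<close> and by mass
  alone on the high part; \<open>L\<close> is the factor by which frequencies may be spread.
  Multiplying by the weights and exchanging the sums leaves the scalar estimate
  \<open>dyadic_weight_sum\<close>.\<close>

lemma interpolation:
  fixes a b :: "nat \<Rightarrow> real"
  assumes a: "\<And>n. a n \<ge> 0" and b: "\<And>m. b m \<ge> 0" and L: "L \<ge> 1" and s: "s > 0" and K: "real K \<ge> s + 1" and C: "C \<ge> 1"
    and sa: "summable a" and ss: "summable (\<lambda>n. real (Suc n) powr s * a n)"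
    and H: "\<And>j. (\<Sum>m\<in>{2 ^ j - 1..<2 ^ Suc j - 1}. b m) \<le> (\<Sum>n. (if real (Suc n) * L \<le> 2 ^ j then C * (real (Suc n) * L / 2 ^ j) ^ K else 1) * a n)"
  shows "(\<Sum>m<M. real (Suc m) powr s * b m)
    \<le> (2 powr s * C * (2 / (1 - 2 powr (- min s 1)))) * L powr s * (\<Sum>n. real (Suc n) powr s * a n)"
proof -
  define w where "w j n = (if real (Suc n) * L \<le> 2 ^ j then C * (real (Suc n) * L / 2 ^ j) ^ K else 1)" for j n
  define D where "D = 2 powr s * C * (2 / (1 - 2 powr (- min s 1)))"
  have wC: "w j n \<le> C" "w j n \<ge> 0" for j n
  proof -
    have "(real (Suc n) * L / 2 ^ j) ^ K \<le> 1" if "real (Suc n) * L \<le> 2 ^ j"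
      using that L by (intro power_le_one) auto
    then show "w j n \<le> C" using C mult_left_mono[of "(real (Suc n) * L / 2 ^ j) ^ K" 1 C] by (auto simp: w_def)
    show "w j n \<ge> 0" using C L by (auto simp: w_def)
  qed
  have sw: "summable (\<lambda>n. w j n * a n)" for j
    by (rule summable_comparison_test'[OF summable_mult[OF sa, of C], of 0])
       (use wC a in \<open>auto simp: abs_mult intro!: mult_right_mono\<close>)
  obtain J where J: "M \<le> 2 ^ J - (1::nat)"
  proof -
    have "M < 2 ^ M" by (rule less_exp)
    then have "M \<le> 2 ^ M - (1::nat)" by linarith
    then show ?thesis by (rule that)
  qed
  have "(\<Sum>m<M. real (Suc m) powr s * b m) \<le> (\<Sum>m<2 ^ J - 1. real (Suc m) powr s * b m)"
    using J b by (intro sum_mono2) auto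
  also have "\<dots> \<le> (\<Sum>j<J. 2 powr (real (Suc j) * s) * (\<Sum>m\<in>{2 ^ j - 1..<2 ^ Suc j - 1}. b m))"
    by (rule dyadic_blocks[OF b s])
  also have "\<dots> \<le> (\<Sum>j<J. 2 powr (real (Suc j) * s) * (\<Sum>n. w j n * a n))"
    unfolding w_def by (intro sum_mono mult_left_mono H) auto
  also have "\<dots> = (\<Sum>j<J. \<Sum>n. 2 powr (real (Suc j) * s) * (w j n * a n))"
    by (intro sum.cong refl suminf_mult[symmetric] sw)
  also have "\<dots> = (\<Sum>n. \<Sum>j<J. 2 powr (real (Suc j) * s) * (w j n * a n))"
    by (intro suminf_sum[symmetric] summable_mult sw)
  also have "\<dots> \<le> (\<Sum>n. D * L powr s * (real (Suc n) powr s * a n))"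
  proof (intro suminf_le summable_sum summable_mult sw ss)
    fix n
    have y: "real (Suc n) * L \<ge> 1" using L mult_mono[of 1 "real (Suc n)" 1 L] by simp
    have "(\<Sum>j<J. 2 powr (real (Suc j) * s) * (w j n * a n)) = (\<Sum>j<J. 2 powr (real (Suc j) * s) * w j n) * a n"
      by (simp add: sum_distrib_right mult.assoc)
    also have "\<dots> \<le> (D * (real (Suc n) * L) powr s) * a n"
      unfolding w_def D_def by (intro mult_right_mono a dyadic_weight_sum y s K C)
    also have "\<dots> = D * L powr s * (real (Suc n) powr s * a n)"
      using L by (simp add: powr_mult mult_ac)
    finally show "(\<Sum>j<J. 2 powr (real (Suc j) * s) * (w j n * a n)) \<le> D * L powr s * (real (Suc n) powr s * a n)" .
  qed
  also have "\<dots> = D * L powr s * (\<Sum>n. real (Suc n) powr s * a n)" by (rule suminf_mult[OF ss])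
  finally show ?thesis by (simp add: D_def)
qed

subsection \<open>Approximate kernels of the position operator\<close>

lemma odd_harmonic_unbounded: "\<exists>K. (\<Sum>k<K. 1 / real (2 * k + 1)) \<ge> (B :: real)"
proof (rule ccontr)
  assume "\<not> ?thesis"
  then have B: "(\<Sum>k<K. 1 / real (2 * k + 1)) \<le> B" for K by (simp add: not_le less_imp_le)
  have "(\<Sum>k\<le>n. 1 / real (2 * k + 1)) \<le> B" for n
    using B[of "Suc n"] unfolding lessThan_Suc_atMost .
  then have "summable (\<lambda>k. 1 / real (2 * k + 1))"
    by (intro bounded_imp_summable[where B = B]) auto
  then have "summable (\<lambda>k. 2 * (1 / real (2 * k + 1)))" by (rule summable_mult)
  then have "summable (\<lambda>k. inverse (real (Suc k)))"
    by (rule summable_comparison_test'[where N = 0]) (simp add: field_simps)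
  then have "summable (\<lambda>k. inverse (real k))" by (subst (asm) summable_Suc_iff)
  then show False using not_summable_harmonic[where 'a=real] by simp
qed

text \<open>With \<tau> = 0 the recurrence determines the even entries from \<open>r 0\<close> and
  keeps them above \<open>r 0 / sqrt (2k + 1)\<close>; the odd harmonic series diverges, so a
  bounded sum of squares forces \<open>r 0\<close> = 0. Since finitely many steps suffice to exceed
  any bound, the conclusion is stable under a small error. The scale \<open>q\<close> keeps the
  statement homogeneous.\<close>

lemma recurrence_small:
  fixes \<delta> :: real
  assumes "\<delta> > 0"
  shows "\<exists>\<tau>0>0. \<forall>r q \<tau>. (\<forall>n. r n \<ge> 0) \<longrightarrow> q \<ge> 0 \<longrightarrow> \<tau> \<ge> 0 \<longrightarrow> \<tau> \<le> \<tau>0 \<longrightarrow> (\<forall>N. (\<Sum>n<N. (r n)\<^sup>2) \<le> q\<^sup>2)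
    \<longrightarrow> (\<forall>n. \<bar>sqrt (real (Suc n)) * r (Suc n) - sqrt (real n) * r (n - 1)\<bar> \<le> \<tau> * q) \<longrightarrow> (\<forall>n\<le>n0. r n \<le> \<delta> * q)"
proof -
  obtain K where K: "(\<Sum>k<K. 1 / real (2 * k + 1)) \<ge> 16 / \<delta>\<^sup>2" using odd_harmonic_unbounded by blast
  define H where "H = (\<Sum>k<K. 1 / real (2 * k + 1))"
  have Hp: "H \<ge> 16 / \<delta>\<^sup>2" "H > 0"
    using K assms unfolding H_def by (auto intro: less_le_trans[of 0 "16 / \<delta>\<^sup>2"])
  \<comment> \<open>The first entry keeps the error accumulated over the indices up to
    \<open>n0\<close> below \<delta>/2; the second keeps the error over the \<open>K\<close> steps
    of the even chain of order 1 after summation of the squares.\<close>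
  define \<tau>0 where "\<tau>0 = min (\<delta> / (2 * real (n0 + 1))) (1 / real (K + 1) ^ 2)"
  have pos: "\<tau>0 > 0" using assms by (simp add: \<tau>0_def)
  have main: "\<forall>n\<le>n0. r n \<le> \<delta> * q"
    if r: "\<forall>n. r n \<ge> 0" and q: "q \<ge> 0" and \<tau>: "\<tau> \<ge> 0" "\<tau> \<le> \<tau>0" and S: "\<forall>N. (\<Sum>n<N. (r n)\<^sup>2) \<le> q\<^sup>2"
      and rec: "\<forall>n. \<bar>sqrt (real (Suc n)) * r (Suc n) - sqrt (real n) * r (n - 1)\<bar> \<le> \<tau> * q" for r q \<tau>
  proof -
    have \<tau>q: "\<tau> * q \<ge> 0" using \<tau> q by simp
    have up: "r (Suc n) \<le> r (n - 1) + \<tau> * q" if "n \<ge> 1" for n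
    proof -
      have "sqrt (real (Suc n)) * r (Suc n) \<le> sqrt (real n) * r (n - 1) + \<tau> * q"
        using rec[rule_format, of n] by linarith
      also have "\<dots> \<le> sqrt (real (Suc n)) * r (n - 1) + sqrt (real (Suc n)) * (\<tau> * q)"
        using r \<tau>q mult_right_mono[of 1 "sqrt (real (Suc n))" "\<tau> * q"] by (intro add_mono mult_right_mono) auto
      finally have "sqrt (real (Suc n)) * r (Suc n) \<le> sqrt (real (Suc n)) * (r (n - 1) + \<tau> * q)" by (simp add: distrib_left)
      then show ?thesis by (simp del: of_nat_Suc)
    qed
    \<comment> \<open>At n = 0 the lower neighbour has coefficient 0, so the odd chain starts from
      an error term and not from free data.\<close>
    have r1: "r 1 \<le> \<tau> * q" using rec[rule_format, of 0] by simp
    have rn: "r n \<le> r 0 + real n * (\<tau> * q)" for n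
    proof (induction n rule: less_induct)
      case (less n)
      consider "n = 0" | "n = 1" | m where "n = Suc m" "m \<ge> 1" by (cases n) (auto simp: Suc_le_eq)
      then show ?case
      proof cases
        case 2 then show ?thesis using r1 r[rule_format, of 0] by simp
      next
        case 3
        have "r n \<le> r (m - 1) + \<tau> * q" using up[OF 3(2)] 3 by simp
        also have "r (m - 1) \<le> r 0 + real (m - 1) * (\<tau> * q)" using less[of "m - 1"] 3 by auto
        also have "r 0 + real (m - 1) * (\<tau> * q) + \<tau> * q = r 0 + (real (m - 1) + 1) * (\<tau> * q)" by (simp add: algebra_simps)
        also have "\<dots> \<le> r 0 + real n * (\<tau> * q)" using 3 \<tau>q by (intro add_left_mono mult_right_mono) auto
        finally show ?thesis by simp
      qed simp
    qed
    \<comment> \<open>One step multiplies by sqrt((2k+1)/(2k+2)), which turns the bound with 2k+1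
      into one with 2k+2; weakening this to 2k+3 closes the induction.\<close>
    have lo: "r (2 * k) \<ge> r 0 / sqrt (real (2 * k + 1)) - real k * (\<tau> * q)" for k
    proof (induction k)
      case (Suc k)
      define A where "A = sqrt (real (2 * k + 1))"
      define B where "B = sqrt (real (2 * k + 2))"
      have AB: "A > 0" "B \<ge> 1" "A \<le> B" "B \<le> sqrt (real (2 * Suc k + 1))" by (auto simp: A_def B_def)
      have "B * r (2 * k + 2) \<ge> A * r (2 * k) - \<tau> * q"
        using rec[rule_format, of "2 * k + 1"] unfolding A_def B_def by (simp add: algebra_simps)
      moreover have "A * r (2 * k) \<ge> A * (r 0 / A - real k * (\<tau> * q))"
        using Suc AB unfolding A_def by (intro mult_left_mono) auto
      moreover have "A * (r 0 / A - real k * (\<tau> * q)) = r 0 - A * (real k * (\<tau> * q))" using AB by (simp add: right_diff_distrib)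
      moreover have "A * (real k * (\<tau> * q)) \<le> B * (real k * (\<tau> * q))" using AB \<tau>q by (intro mult_right_mono) auto
      moreover have "\<tau> * q \<le> B * (\<tau> * q)" using AB \<tau>q mult_right_mono[of 1 B "\<tau> * q"] by simp
      ultimately have "B * r (2 * k + 2) \<ge> r 0 - B * (real k * (\<tau> * q)) - B * (\<tau> * q)" by linarith
      also have "r 0 - B * (real k * (\<tau> * q)) - B * (\<tau> * q) = B * (r 0 / B - real (Suc k) * (\<tau> * q))"
        using AB by (simp add: field_simps)
      finally have "r (2 * k + 2) \<ge> r 0 / B - real (Suc k) * (\<tau> * q)" using AB by simp
      moreover have "r 0 / sqrt (real (2 * Suc k + 1)) \<le> r 0 / B"
        using AB r by (intro divide_left_mono) (auto intro!: mult_pos_pos)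
      ultimately show ?case by simp
    qed simp
    have "(r 0)\<^sup>2 * H = (\<Sum>k<K. (r 0 / sqrt (real (2 * k + 1)))\<^sup>2)"
      unfolding H_def sum_distrib_left by (intro sum.cong) (auto simp: power_divide)
    also have "\<dots> \<le> (\<Sum>k<K. 2 * (r (2 * k))\<^sup>2 + 2 * (real K * (\<tau> * q))\<^sup>2)"
    proof (rule sum_mono)
      fix k assume "k \<in> {..<K}"
      then have "real k * (\<tau> * q) \<le> real K * (\<tau> * q)" using \<tau>q by (intro mult_right_mono) auto
      then have "r 0 / sqrt (real (2 * k + 1)) \<le> r (2 * k) + real K * (\<tau> * q)" using lo[of k] by linarith
      then have "(r 0 / sqrt (real (2 * k + 1)))\<^sup>2 \<le> (r (2 * k) + real K * (\<tau> * q))\<^sup>2"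
        using r by (intro power_mono) auto
      also have "\<dots> \<le> 2 * (r (2 * k))\<^sup>2 + 2 * (real K * (\<tau> * q))\<^sup>2"
        using zero_le_power2[of "r (2 * k) - real K * (\<tau> * q)"] by (simp add: power2_sum power2_diff)
      finally show "(r 0 / sqrt (real (2 * k + 1)))\<^sup>2 \<le> 2 * (r (2 * k))\<^sup>2 + 2 * (real K * (\<tau> * q))\<^sup>2" .
    qed
    also have "\<dots> = 2 * (\<Sum>k<K. (r (2 * k))\<^sup>2) + 2 * real K * (real K * (\<tau> * q))\<^sup>2"
      by (simp add: sum.distrib sum_distrib_left)
    also have "(\<Sum>k<K. (r (2 * k))\<^sup>2) \<le> q\<^sup>2"
    proof -
      have "(\<Sum>k<K. (r (2 * k))\<^sup>2) = (\<Sum>n\<in>(\<lambda>k. 2 * k) ` {..<K}. (r n)\<^sup>2)"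
        by (subst sum.reindex) (auto simp: inj_on_def)
      also have "\<dots> \<le> (\<Sum>n<2 * K. (r n)\<^sup>2)" by (intro sum_mono2) auto
      also have "\<dots> \<le> q\<^sup>2" using S by blast
      finally show ?thesis .
    qed
    also have "2 * real K * (real K * (\<tau> * q))\<^sup>2 \<le> 2 * q\<^sup>2"
    proof -
      have "\<tau> * (real (K + 1))\<^sup>2 \<le> 1"
        using \<tau>(2) mult_right_mono[of \<tau> "1 / real (K + 1) ^ 2" "(real (K + 1))\<^sup>2"] by (simp add: \<tau>0_def)
      moreover have "\<tau> * (real K * real K) \<le> \<tau> * (real (K + 1))\<^sup>2"
        using \<tau> by (intro mult_left_mono) (auto simp: power2_eq_square intro!: mult_mono)
      ultimately have 1: "\<tau> * (real K * real K) \<le> 1" by linarith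
      have 2: "real K * \<tau> \<le> 1"
      proof (cases "K = 0")
        case False
        then have "real K * \<tau> * 1 \<le> real K * \<tau> * real K" using \<tau> by (intro mult_left_mono) auto
        then show ?thesis using 1 by (simp add: mult_ac)
      qed simp
      have "real K * (real K * (\<tau> * q))\<^sup>2 = (real K * \<tau>) * (\<tau> * (real K * real K)) * q\<^sup>2"
        by (simp add: power2_eq_square mult_ac)
      also have "\<dots> \<le> (1 * 1) * q\<^sup>2" using 1 2 \<tau> by (intro mult_right_mono mult_mono) auto
      finally show ?thesis by simp
    qed
    finally have "(r 0)\<^sup>2 * H \<le> 4 * q\<^sup>2" by simp
    moreover have "(r 0)\<^sup>2 * (16 / \<delta>\<^sup>2) \<le> (r 0)\<^sup>2 * H" using Hp by (intro mult_left_mono) auto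
    ultimately have "(r 0)\<^sup>2 * (16 / \<delta>\<^sup>2) \<le> 4 * q\<^sup>2" by linarith
    then have "((r 0)\<^sup>2 * (16 / \<delta>\<^sup>2)) * (\<delta>\<^sup>2 / 16) \<le> (4 * q\<^sup>2) * (\<delta>\<^sup>2 / 16)"
      by (rule mult_right_mono) simp
    moreover have "((r 0)\<^sup>2 * (16 / \<delta>\<^sup>2)) * (\<delta>\<^sup>2 / 16) = (r 0)\<^sup>2" using assms by simp
    moreover have "(4 * q\<^sup>2) * (\<delta>\<^sup>2 / 16) = (\<delta> / 2 * q)\<^sup>2" by (simp add: power2_eq_square)
    ultimately have "(r 0)\<^sup>2 \<le> (\<delta> / 2 * q)\<^sup>2" by linarith
    then have r0: "r 0 \<le> \<delta> / 2 * q" by (rule power2_le_imp_le) (use assms q in simp)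
    show ?thesis
    proof (intro allI impI)
      fix n assume n: "n \<le> n0"
      have "real n * \<tau> \<le> real (n0 + 1) * (\<delta> / (2 * real (n0 + 1)))"
        using n \<tau> assms by (intro mult_mono) (auto simp: \<tau>0_def)
      also have "\<dots> = \<delta> / 2"
      proof -
        have gen: "z * (\<delta> / (2 * z)) = \<delta> / 2" if "z > 0" for z :: real using that by simp
        show ?thesis by (rule gen) simp
      qed
      finally have "real n * \<tau> * q \<le> \<delta> / 2 * q" using q by (rule mult_right_mono)
      then show "r n \<le> \<delta> * q" using rn[of n] r0 by (simp add: mult_ac)
    qed
  qed
  show ?thesis
  proof (intro exI conjI allI impI)
    show "\<tau>0 > 0" by (rule pos)
    fix r :: "nat \<Rightarrow> real" and q \<tau> n
    assume "\<forall>n. r n \<ge> 0" "q \<ge> 0" "\<tau> \<ge> 0" "\<tau> \<le> \<tau>0" "\<forall>N. (\<Sum>n<N. (r n)\<^sup>2) \<le> q\<^sup>2"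
      "\<forall>n. \<bar>sqrt (real (Suc n)) * r (Suc n) - sqrt (real n) * r (n - 1)\<bar> \<le> \<tau> * q" "n \<le> n0"
    then show "r n \<le> \<delta> * q" using main[of r q \<tau>] by simp
  qed
qed

context osc
begin

subsection \<open>Sobolev norms along the flow\<close>

definition En :: "real \<Rightarrow> real" where "En t = (cmod (mu t))\<^sup>2 + (cmod (nu t))\<^sup>2"

lemma norm_mu_sq: "(cmod (mu t))\<^sup>2 = (\<rho> t)\<^sup>2"
  by (simp add: mu_def norm_mult)

lemma norm_nu_sq: "(cmod (nu t))\<^sup>2 = (\<rho>' t)\<^sup>2 + (1 / \<rho> t)\<^sup>2"
proof -
  have "of_real (\<rho>' t) + \<i> / of_real (\<rho> t) = Complex (\<rho>' t) (1 / \<rho> t)" by (simp add: complex_eq_iff)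
  then show ?thesis by (simp add: nu_def norm_mult cmod_power2)
qed

lemma En_ge_1:
  assumes t: "t \<ge> t0" shows "En t \<ge> 1"
proof -
  have r: "\<rho> t > 0" by (rule rho_pos[OF t])
  have "0 \<le> (\<rho> t - 1 / \<rho> t)\<^sup>2" by simp
  also have "\<dots> = (\<rho> t)\<^sup>2 + (1 / \<rho> t)\<^sup>2 - 2" using r by (simp add: power2_diff)
  finally show ?thesis unfolding En_def norm_mu_sq norm_nu_sq using zero_le_power2[of "\<rho>' t"] by linarith
qed

text \<open>Bogoliubov coefficients: \<open>al\<close> and \<open>be\<close> express the fixed
  raising operator through the moving lowering and raising operators. Both are of size sqrt En at
  most.\<close>

definition al :: "real \<Rightarrow> complex" where "al t = (mu t + \<i> * nu t) / 2"
definition be :: "real \<Rightarrow> complex" where "be t = (cnj (mu t) + \<i> * cnj (nu t)) / 2"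

lemma al_be_bound: "(cmod (al t))\<^sup>2 \<le> En t" "(cmod (be t))\<^sup>2 \<le> En t"
proof -
  have *: "(cmod ((a + \<i> * b) / 2))\<^sup>2 \<le> (cmod a)\<^sup>2 + (cmod b)\<^sup>2" for a b
  proof -
    have "cmod (a + \<i> * b) \<le> cmod a + cmod b" by (rule order_trans[OF norm_triangle_ineq]) (simp add: norm_mult)
    then have "(cmod (a + \<i> * b))\<^sup>2 \<le> (cmod a + cmod b)\<^sup>2" by (intro power_mono) auto
    also have "\<dots> \<le> 2 * (cmod a)\<^sup>2 + 2 * (cmod b)\<^sup>2"
      using zero_le_power2[of "cmod a - cmod b"] by (simp add: power2_sum power2_diff)
    finally have "(cmod (a + \<i> * b))\<^sup>2 \<le> 2 * (cmod a)\<^sup>2 + 2 * (cmod b)\<^sup>2" .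
    moreover have "(cmod ((a + \<i> * b) / 2))\<^sup>2 = (cmod (a + \<i> * b))\<^sup>2 / 4" by (simp add: norm_divide power_divide)
    moreover have "0 \<le> (cmod a)\<^sup>2" "0 \<le> (cmod b)\<^sup>2" by simp_all
    ultimately show ?thesis by linarith
  qed
  show "(cmod (al t))\<^sup>2 \<le> En t" using *[of "mu t" "nu t"] by (simp add: al_def En_def)
  show "(cmod (be t))\<^sup>2 \<le> En t" using *[of "cnj (mu t)" "cnj (nu t)"] by (simp add: be_def En_def)
qed

lemma Gm_a:
  assumes t: "t \<ge> t0"
  shows "of_real (sqrt (real m)) * Gm t (m - 1) n
    = al t * (of_real (sqrt (real n)) * Gm t m (n - 1)) + be t * (of_real (sqrt (real (Suc n))) * Gm t m (Suc n))"
proof -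
  have gen: "X = (a + \<i> * b) / 2 * P + (a' + \<i> * b') / 2 * Q"
    if "X + Y = a * P + a' * Q" "X - Y = \<i> * (b * P + b' * Q)" for X Y a b a' b' P Q :: complex
  proof -
    have "2 * X = (X + Y) + (X - Y)" by simp
    also have "\<dots> = 2 * ((a + \<i> * b) / 2 * P + (a' + \<i> * b') / 2 * Q)" unfolding that by (simp add: field_simps)
    finally show ?thesis by (rule mult_left_cancel[of "2::complex", THEN iffD1, rotated]) simp
  qed
  show ?thesis unfolding al_def be_def by (rule gen[OF Gm_x[OF t] Gm_dx[OF t]])
qed

definition comb :: "real \<Rightarrow> (nat \<Rightarrow> complex) \<Rightarrow> nat \<Rightarrow> real \<Rightarrow> complex" where
  "comb t c N x = (\<Sum>n<N. c n * Psi n t x)"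

lemma L2_comb_Psi: "t \<ge> t0 \<Longrightarrow> L2 (comb t c N)"
  unfolding comb_def[abs_def] by (intro L2_sum L2_scale L2_Psi)

lemma ip_comb_hc: "t \<ge> t0 \<Longrightarrow> ip (comb t c N) (hc m) = (\<Sum>n<N. c n * Gm t m n)"
  unfolding comb_def[abs_def] Gm_def
  by (subst ip_sum_left) (auto simp: L2_scale L2_Psi L2_hc ip_scale_left)

text \<open>The fixed raising operator acting on coefficient sequences in the moving basis. It
  enlarges a finite support by one index.\<close>

definition Aop :: "real \<Rightarrow> (nat \<Rightarrow> complex) \<Rightarrow> nat \<Rightarrow> complex" where
  "Aop t c k = al t * (of_real (sqrt (real (Suc k))) * c (Suc k)) + be t * (of_real (sqrt (real k)) * c (k - 1))"

lemma Aop_support: "(\<And>n. n \<ge> N \<Longrightarrow> c n = 0) \<Longrightarrow> n \<ge> Suc N \<Longrightarrow> Aop t c n = 0"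
  by (simp add: Aop_def)

lemma Aop_comb:
  assumes t: "t \<ge> t0" and c: "\<And>n. n \<ge> N \<Longrightarrow> c n = 0"
  shows "of_real (sqrt (real m)) * ip (comb t c N) (hc (m - 1)) = ip (comb t (Aop t c) (Suc N)) (hc m)"
proof -
  let ?g = "\<lambda>n. of_real (sqrt (real n)) * c n * Gm t m (n - 1)"
  let ?h = "\<lambda>n. of_real (sqrt (real (Suc n))) * c n * Gm t m (Suc n)"
  have "(\<Sum>n<N. ?g n) = (\<Sum>n<Suc (Suc N). ?g n)" using c by simp
  also have "\<dots> = (\<Sum>k<Suc N. ?g (Suc k))" by (subst sum.lessThan_Suc_shift) simp
  finally have 1: "(\<Sum>n<N. ?g n) = (\<Sum>k<Suc N. ?g (Suc k))" .
  have 2: "(\<Sum>k<Suc N. of_real (sqrt (real k)) * c (k - 1) * Gm t m k) = (\<Sum>n<N. ?h n)"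
    by (subst sum.lessThan_Suc_shift) simp
  have "of_real (sqrt (real m)) * ip (comb t c N) (hc (m - 1)) = (\<Sum>n<N. c n * (of_real (sqrt (real m)) * Gm t (m - 1) n))"
    unfolding ip_comb_hc[OF t] sum_distrib_left by (intro sum.cong) auto
  also have "\<dots> = al t * (\<Sum>n<N. ?g n) + be t * (\<Sum>n<N. ?h n)"
    unfolding Gm_a[OF t] sum_distrib_left sum.distrib[symmetric] by (intro sum.cong) (auto simp: algebra_simps)
  also have "\<dots> = ip (comb t (Aop t c) (Suc N)) (hc m)"
    unfolding 1 2[symmetric] ip_comb_hc[OF t] sum_distrib_left sum.distrib[symmetric] Aop_def
    by (intro sum.cong) (auto simp: algebra_simps)
  finally show ?thesis .
qed

text \<open>Each application costs one power of the weight and one factor \<open>En\<close>. The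
  factor \<open>2 ^ K\<close> pays for the index shift, because (n + 2)^K is at most 2^K (n +
  1)^K.\<close>

lemma Aop_weight:
  assumes t: "t \<ge> t0" and c: "\<And>n. n \<ge> N \<Longrightarrow> c n = 0"
  shows "(\<Sum>k<Suc N. real (Suc k) ^ K * (cmod (Aop t c k))\<^sup>2) \<le> 4 * 2 ^ K * En t * (\<Sum>n<N. real (Suc n) ^ Suc K * (cmod (c n))\<^sup>2)"
proof -
  let ?W = "\<Sum>n<N. real (Suc n) ^ Suc K * (cmod (c n))\<^sup>2"
  have E: "En t \<ge> 0" using En_ge_1[OF t] by simp
  have pt: "(cmod (Aop t c k))\<^sup>2 \<le> 2 * En t * (real (Suc k) * (cmod (c (Suc k)))\<^sup>2 + real k * (cmod (c (k - 1)))\<^sup>2)" for k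
  proof -
    let ?x = "cmod (al t) * (sqrt (real (Suc k)) * cmod (c (Suc k)))" and ?y = "cmod (be t) * (sqrt (real k) * cmod (c (k - 1)))"
    have "cmod (Aop t c k) \<le> ?x + ?y"
      unfolding Aop_def by (rule order_trans[OF norm_triangle_ineq]) (simp add: norm_mult)
    then have "(cmod (Aop t c k))\<^sup>2 \<le> (?x + ?y)\<^sup>2" by (intro power_mono) auto
    also have "\<dots> \<le> 2 * ?x\<^sup>2 + 2 * ?y\<^sup>2" using zero_le_power2[of "?x - ?y"] by (simp only: power2_sum power2_diff)
    also have "?x\<^sup>2 = (cmod (al t))\<^sup>2 * (real (Suc k) * (cmod (c (Suc k)))\<^sup>2)" by (simp only: power_mult_distrib) simp
    also have "?y\<^sup>2 = (cmod (be t))\<^sup>2 * (real k * (cmod (c (k - 1)))\<^sup>2)" by (simp only: power_mult_distrib) simp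
    also have "2 * ((cmod (al t))\<^sup>2 * (real (Suc k) * (cmod (c (Suc k)))\<^sup>2)) + 2 * ((cmod (be t))\<^sup>2 * (real k * (cmod (c (k - 1)))\<^sup>2))
      \<le> 2 * (En t * (real (Suc k) * (cmod (c (Suc k)))\<^sup>2)) + 2 * (En t * (real k * (cmod (c (k - 1)))\<^sup>2))"
      using al_be_bound by (intro add_mono mult_left_mono mult_right_mono) auto
    finally show ?thesis by (simp add: algebra_simps)
  qed
  have "(\<Sum>k<Suc N. real (Suc k) ^ K * (cmod (Aop t c k))\<^sup>2)
      \<le> (\<Sum>k<Suc N. real (Suc k) ^ K * (2 * En t * (real (Suc k) * (cmod (c (Suc k)))\<^sup>2 + real k * (cmod (c (k - 1)))\<^sup>2)))"
    by (intro sum_mono mult_left_mono pt) auto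
  also have "\<dots> = 2 * En t * ((\<Sum>k<Suc N. real (Suc k) ^ Suc K * (cmod (c (Suc k)))\<^sup>2) + (\<Sum>k<Suc N. real (Suc k) ^ K * (real k * (cmod (c (k - 1)))\<^sup>2)))"
    unfolding sum_distrib_left sum.distrib[symmetric] by (intro sum.cong) (auto simp: algebra_simps)
  also have "\<dots> \<le> 2 * En t * (?W + 2 ^ K * ?W)"
  proof (intro mult_left_mono add_mono)
    have "(\<Sum>k<Suc N. real (Suc k) ^ Suc K * (cmod (c (Suc k)))\<^sup>2) \<le> (\<Sum>k<Suc N. real (Suc (Suc k)) ^ Suc K * (cmod (c (Suc k)))\<^sup>2)"
      by (intro sum_mono mult_right_mono power_mono) auto
    also have "\<dots> \<le> (\<Sum>k<Suc (Suc N). real (Suc k) ^ Suc K * (cmod (c k))\<^sup>2)"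
      by (subst (2) sum.lessThan_Suc_shift) simp
    also have "\<dots> = ?W" using c by simp
    finally show "(\<Sum>k<Suc N. real (Suc k) ^ Suc K * (cmod (c (Suc k)))\<^sup>2) \<le> ?W" .
    have "(\<Sum>k<Suc N. real (Suc k) ^ K * (real k * (cmod (c (k - 1)))\<^sup>2)) = (\<Sum>n<N. real (Suc (Suc n)) ^ K * (real (Suc n) * (cmod (c n))\<^sup>2))"
      by (subst sum.lessThan_Suc_shift) simp
    also have "\<dots> \<le> (\<Sum>n<N. (2 * real (Suc n)) ^ K * (real (Suc n) * (cmod (c n))\<^sup>2))"
      by (intro sum_mono mult_right_mono power_mono) auto
    also have "\<dots> = 2 ^ K * ?W"
      unfolding sum_distrib_left by (intro sum.cong) (auto simp: power_mult_distrib mult_ac simp del: of_nat_Suc)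
    finally show "(\<Sum>k<Suc N. real (Suc k) ^ K * (real k * (cmod (c (k - 1)))\<^sup>2)) \<le> 2 ^ K * ?W" .
  qed (use E in auto)
  also have "\<dots> \<le> 2 * En t * (2 ^ K * ?W + 2 ^ K * ?W)"
  proof (intro mult_left_mono add_mono)
    have "?W \<ge> 0" by (intro sum_nonneg) auto
    then show "?W \<le> 2 ^ K * ?W" using mult_right_mono[of 1 "2 ^ K" ?W] by simp
  qed (use E in auto)
  finally show ?thesis by (simp add: algebra_simps)
qed

text \<open>Induction on the order. The squared modulus of the m-th fixed coefficient times m + 1 is
  that of coefficient m + 1 after the raising operator, so one power of the weight is traded for one
  application of \<open>Aop\<close>. Restriction to finite combinations removes all questions of
  convergence.\<close>

lemma high_regularity:
  "\<exists>C\<ge>1. \<forall>t\<ge>t0. \<forall>c N. (\<forall>n\<ge>N. c n = 0) \<longrightarrow> (\<forall>M. (\<Sum>m<M. real (Suc m) ^ K * (cmod (ip (comb t c N) (hc m)))\<^sup>2)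
     \<le> C * En t ^ K * (\<Sum>n<N. real (Suc n) ^ K * (cmod (c n))\<^sup>2))"
proof (induction K)
  case 0
  have "(\<Sum>m<M. (cmod (ip (comb t c N) (hc m)))\<^sup>2) \<le> (\<Sum>n<N. (cmod (c n))\<^sup>2)" if t: "t \<ge> t0" for t c N M
    using onb.bessel[OF onb_hc L2_comb_Psi[OF t], of "{..<M}" c N] onb.norm_comb[OF onb_Psi[OF t], of "{..<N}" c]
    by (simp add: comb_def[abs_def])
  then show ?case by (intro exI[of _ 1]) auto
next
  case (Suc K)
  then obtain C where C: "C \<ge> 1" and IH: "\<And>t c N M. t \<ge> t0 \<Longrightarrow> (\<forall>n\<ge>N. c n = 0) \<Longrightarrow>
      (\<Sum>m<M. real (Suc m) ^ K * (cmod (ip (comb t c N) (hc m)))\<^sup>2) \<le> C * En t ^ K * (\<Sum>n<N. real (Suc n) ^ K * (cmod (c n))\<^sup>2)"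
    by blast
  show ?case
  proof (intro exI[of _ "C * (4 * 2 ^ K)"] conjI allI impI)
    have "(1::real) \<le> 2 ^ K" by simp
    then have "(1::real) \<le> 4 * 2 ^ K" by linarith
    then show "1 \<le> C * (4 * 2 ^ K)" using C mult_mono[of 1 C 1 "4 * 2 ^ K"] by simp
    fix t N M and c :: "nat \<Rightarrow> complex" assume t: "t \<ge> t0" and c: "\<forall>n\<ge>N. c n = 0"
    have E: "En t \<ge> 0" using En_ge_1[OF t] by simp
    have "(\<Sum>m<M. real (Suc m) ^ Suc K * (cmod (ip (comb t c N) (hc m)))\<^sup>2)
        = (\<Sum>m<M. real (Suc m) ^ K * (cmod (ip (comb t (Aop t c) (Suc N)) (hc (Suc m))))\<^sup>2)"
    proof (intro sum.cong refl)
      fix m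
      have "ip (comb t (Aop t c) (Suc N)) (hc (Suc m)) = of_real (sqrt (real (Suc m))) * ip (comb t c N) (hc m)"
        using Aop_comb[OF t, of N c "Suc m"] c by simp
      then have "(cmod (ip (comb t (Aop t c) (Suc N)) (hc (Suc m))))\<^sup>2 = real (Suc m) * (cmod (ip (comb t c N) (hc m)))\<^sup>2"
        by (simp only: norm_mult power_mult_distrib norm_of_real) simp
      then show "real (Suc m) ^ Suc K * (cmod (ip (comb t c N) (hc m)))\<^sup>2 = real (Suc m) ^ K * (cmod (ip (comb t (Aop t c) (Suc N)) (hc (Suc m))))\<^sup>2"
        by simp
    qed
    also have "\<dots> \<le> (\<Sum>m<M. real (Suc (Suc m)) ^ K * (cmod (ip (comb t (Aop t c) (Suc N)) (hc (Suc m))))\<^sup>2)"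
      by (intro sum_mono mult_right_mono power_mono) auto
    also have "\<dots> \<le> (\<Sum>m<Suc M. real (Suc m) ^ K * (cmod (ip (comb t (Aop t c) (Suc N)) (hc m)))\<^sup>2)"
      unfolding sum.lessThan_Suc_shift[of _ M] by simp
    also have "\<dots> \<le> C * En t ^ K * (\<Sum>n<Suc N. real (Suc n) ^ K * (cmod (Aop t c n))\<^sup>2)"
      by (rule IH[OF t]) (use Aop_support[of N c] c in auto)
    also have "\<dots> \<le> C * En t ^ K * (4 * 2 ^ K * En t * (\<Sum>n<N. real (Suc n) ^ Suc K * (cmod (c n))\<^sup>2))"
      using C E c by (intro mult_left_mono Aop_weight[OF t]) auto
    finally show "(\<Sum>m<M. real (Suc m) ^ Suc K * (cmod (ip (comb t c N) (hc m)))\<^sup>2)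
       \<le> C * (4 * 2 ^ K) * En t ^ Suc K * (\<Sum>n<N. real (Suc n) ^ Suc K * (cmod (c n))\<^sup>2)"
      by (simp add: mult_ac)
  qed
qed

text \<open>The function is split at the moving modes n for which (n + 1) En reaches 2^j. The low
  part is estimated by \<open>high_regularity\<close>, divided by the weight 2^(jK) of the block,
  and the high part by Bessel's inequality. The division by 2 on the left compensates (x + y)^2
  \<le> 2 (x^2 + y^2).\<close>

lemma block_bound:
  assumes t: "t \<ge> t0" and u: "L2 u" and C: "C \<ge> 1"
    and HR: "\<And>c N M. (\<forall>n\<ge>N. c n = 0) \<Longrightarrow> (\<Sum>m<M. real (Suc m) ^ K * (cmod (ip (comb t c N) (hc m)))\<^sup>2)
     \<le> C * En t ^ K * (\<Sum>n<N. real (Suc n) ^ K * (cmod (c n))\<^sup>2)"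
  shows "(\<Sum>m\<in>{2 ^ j - 1..<2 ^ Suc j - 1}. (cmod (ip u (hc m)))\<^sup>2 / 2)
    \<le> (\<Sum>n. (if real (Suc n) * En t \<le> 2 ^ j then C * (real (Suc n) * En t / 2 ^ j) ^ K else 1) * (cmod (ip u (Psi n t)))\<^sup>2)"
proof -
  define c where "c n = ip u (Psi n t)" for n
  define c' where "c' n = (if real (Suc n) * En t \<le> 2 ^ j then c n else 0)" for n
  \<comment> \<open>Since \<open>En\<close> is at least 1, no mode from index 2^j on belongs to the
    low part, so the low part is a finite combination.\<close>
  define N :: nat where "N = 2 ^ j"
  define B where "B = {2 ^ j - 1..<2 ^ Suc j - (1::nat)}"
  have E: "En t \<ge> 1" by (rule En_ge_1[OF t])
  have c'0: "c' n = 0" if "n \<ge> N" for n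
  proof -
    have "(2::real) ^ j = real N" by (simp add: N_def)
    also have "\<dots> < real (Suc n)" using that by simp
    also have "\<dots> \<le> real (Suc n) * En t" using E mult_left_mono[of 1 "En t" "real (Suc n)"] by simp
    finally show ?thesis by (simp add: c'_def)
  qed
  let ?v = "comb t c' N"
  have L2v: "L2 ?v" by (rule L2_comb_Psi[OF t])
  have "(2 ^ j) ^ K * (\<Sum>m\<in>B. (cmod (ip ?v (hc m)))\<^sup>2) \<le> (\<Sum>m\<in>B. real (Suc m) ^ K * (cmod (ip ?v (hc m)))\<^sup>2)"
    unfolding sum_distrib_left
  proof (intro sum_mono mult_right_mono power_mono)
    fix m assume "m \<in> B"
    then have "2 ^ j \<le> Suc m" by (auto simp: B_def)
    then show "(2::real) ^ j \<le> real (Suc m)" using of_nat_mono[of "2 ^ j" "Suc m", where 'a = real] by simp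
  qed auto
  also have "\<dots> \<le> (\<Sum>m<2 ^ Suc j - 1. real (Suc m) ^ K * (cmod (ip ?v (hc m)))\<^sup>2)"
    by (intro sum_mono2) (auto simp: B_def)
  also have "\<dots> \<le> C * En t ^ K * (\<Sum>n<N. real (Suc n) ^ K * (cmod (c' n))\<^sup>2)"
    by (rule HR) (use c'0 in auto)
  finally have "(2 ^ j) ^ K * (\<Sum>m\<in>B. (cmod (ip ?v (hc m)))\<^sup>2) \<le> (\<Sum>n<N. C * En t ^ K * (real (Suc n) ^ K * (cmod (c' n))\<^sup>2))"
    by (simp only: sum_distrib_left)
  also have "\<dots> = (2 ^ j) ^ K * (\<Sum>n<N. C * (real (Suc n) * En t / 2 ^ j) ^ K * (cmod (c' n))\<^sup>2)"
    unfolding sum_distrib_left by (intro sum.cong) (auto simp: power_mult_distrib power_divide field_simps simp del: of_nat_Suc)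
  finally have "(\<Sum>m\<in>B. (cmod (ip ?v (hc m)))\<^sup>2) \<le> (\<Sum>n<N. C * (real (Suc n) * En t / 2 ^ j) ^ K * (cmod (c' n))\<^sup>2)" by simp
  also have "\<dots> = (\<Sum>n. C * (real (Suc n) * En t / 2 ^ j) ^ K * (cmod (c' n))\<^sup>2)"
    by (rule suminf_finite[symmetric]) (use c'0 in auto)
  finally have low: "(\<Sum>m\<in>B. (cmod (ip ?v (hc m)))\<^sup>2) \<le> (\<Sum>n. C * (real (Suc n) * En t / 2 ^ j) ^ K * (cmod (c' n))\<^sup>2)" .
  have slow: "summable (\<lambda>n. C * (real (Suc n) * En t / 2 ^ j) ^ K * (cmod (c' n))\<^sup>2)"
    by (rule summable_finite[of "{..<N}"]) (use c'0 in auto)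
  have coef: "ip (\<lambda>x. u x - ?v x) (Psi n t) = c n - c' n" for n
  proof -
    have "ip ?v (Psi n t) = c' n"
      using onb.ip_comb[OF onb_Psi[OF t], of "{..<N}" c' n] c'0[of n] by (simp add: comb_def[abs_def])
    then show ?thesis using ip_diff_left[OF u L2v L2_Psi[OF t], of n] by (simp add: c_def)
  qed
  have "(\<Sum>m\<in>B. (cmod (ip (\<lambda>x. u x - ?v x) (hc m)))\<^sup>2) \<le> L2_norm_sq (\<lambda>x. u x - ?v x)"
    by (rule onb.bessel[OF onb_hc L2_diff[OF u L2v]]) (simp add: B_def)
  also have sums: "(\<lambda>n. (cmod (c n - c' n))\<^sup>2) sums L2_norm_sq (\<lambda>x. u x - ?v x)"
    using onb.parseval[OF onb_Psi[OF t] L2_diff[OF u L2v]] unfolding coef .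
  then have "L2_norm_sq (\<lambda>x. u x - ?v x) = (\<Sum>n. (cmod (c n - c' n))\<^sup>2)" by (rule sums_unique)
  finally have high: "(\<Sum>m\<in>B. (cmod (ip (\<lambda>x. u x - ?v x) (hc m)))\<^sup>2) \<le> (\<Sum>n. (cmod (c n - c' n))\<^sup>2)" .
  have shigh: "summable (\<lambda>n. (cmod (c n - c' n))\<^sup>2)" using sums by (rule sums_summable)
  have "(\<Sum>m\<in>B. (cmod (ip u (hc m)))\<^sup>2 / 2) \<le> (\<Sum>m\<in>B. (cmod (ip ?v (hc m)))\<^sup>2 + (cmod (ip (\<lambda>x. u x - ?v x) (hc m)))\<^sup>2)"
  proof (rule sum_mono)
    fix m
    have "ip u (hc m) = ip ?v (hc m) + ip (\<lambda>x. u x - ?v x) (hc m)"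
      by (simp add: ip_diff_left[OF u L2v L2_hc])
    then have "cmod (ip u (hc m)) \<le> cmod (ip ?v (hc m)) + cmod (ip (\<lambda>x. u x - ?v x) (hc m))" (is "_ \<le> ?x + ?y")
      using norm_triangle_ineq[of "ip ?v (hc m)" "ip (\<lambda>x. u x - ?v x) (hc m)"] by simp
    then have "(cmod (ip u (hc m)))\<^sup>2 \<le> (?x + ?y)\<^sup>2" by (intro power_mono) auto
    also have "\<dots> \<le> 2 * (?x\<^sup>2 + ?y\<^sup>2)" using zero_le_power2[of "?x - ?y"] by (simp add: power2_sum power2_diff)
    finally show "(cmod (ip u (hc m)))\<^sup>2 / 2 \<le> ?x\<^sup>2 + ?y\<^sup>2" by simp
  qed
  also have "\<dots> \<le> (\<Sum>n. C * (real (Suc n) * En t / 2 ^ j) ^ K * (cmod (c' n))\<^sup>2) + (\<Sum>n. (cmod (c n - c' n))\<^sup>2)"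
    unfolding sum.distrib by (intro add_mono low high)
  also have "\<dots> = (\<Sum>n. C * (real (Suc n) * En t / 2 ^ j) ^ K * (cmod (c' n))\<^sup>2 + (cmod (c n - c' n))\<^sup>2)"
    by (rule suminf_add[OF slow shigh])
  also have "\<dots> = (\<Sum>n. (if real (Suc n) * En t \<le> 2 ^ j then C * (real (Suc n) * En t / 2 ^ j) ^ K else 1) * (cmod (c n))\<^sup>2)"
    by (intro suminf_cong) (simp add: c'_def)
  finally show ?thesis unfolding B_def c_def .
qed

text \<open>Interpolation with an integer order \<open>K\<close> above s + 1 and \<open>L\<close> =
  \<open>En t\<close>. The weights n + 1/2 and n + 1 differ by a factor of at most 2, which accounts
  for \<open>2 powr s\<close> in the constant.\<close>

lemma Hs_upper:
  assumes s: "s > 0"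
  shows "\<exists>D>0. \<forall>t\<ge>t0. \<forall>u. L2 u \<longrightarrow> summable (\<lambda>n. (real n + 1/2) powr s * (cmod (ip u (Psi n t)))\<^sup>2) \<longrightarrow>
    summable (\<lambda>m. (real m + 1/2) powr s * (cmod (ip u (hc m)))\<^sup>2) \<and>
    (\<Sum>m. (real m + 1/2) powr s * (cmod (ip u (hc m)))\<^sup>2)
      \<le> D * En t powr s * (\<Sum>n. (real n + 1/2) powr s * (cmod (ip u (Psi n t)))\<^sup>2)"
proof -
  obtain K :: nat where K: "real K \<ge> s + 1" using real_arch_simple by blast
  obtain C where C: "C \<ge> 1" and HR: "\<And>t c N M. t \<ge> t0 \<Longrightarrow> (\<forall>n\<ge>N. c n = 0) \<Longrightarrow>
      (\<Sum>m<M. real (Suc m) ^ K * (cmod (ip (comb t c N) (hc m)))\<^sup>2) \<le> C * En t ^ K * (\<Sum>n<N. real (Suc n) ^ K * (cmod (c n))\<^sup>2)"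
    using high_regularity[of K] by blast
  define D0 where "D0 = 2 powr s * C * (2 / (1 - 2 powr (- min s 1)))"
  have "2 powr (- min s 1) < 1" using s by (auto intro: powr_less_one)
  then have D0: "D0 > 0" using C by (simp add: D0_def)
  define D where "D = 2 * D0 * 2 powr s"
  have "D > 0" using D0 by (simp add: D_def)
  moreover have "summable (\<lambda>m. (real m + 1/2) powr s * (cmod (ip u (hc m)))\<^sup>2) \<and>
    (\<Sum>m. (real m + 1/2) powr s * (cmod (ip u (hc m)))\<^sup>2) \<le> D * En t powr s * (\<Sum>n. (real n + 1/2) powr s * (cmod (ip u (Psi n t)))\<^sup>2)"
    if t: "t \<ge> t0" and u: "L2 u" and S: "summable (\<lambda>n. (real n + 1/2) powr s * (cmod (ip u (Psi n t)))\<^sup>2)" for t u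
  proof -
    let ?a = "\<lambda>n. (cmod (ip u (Psi n t)))\<^sup>2" and ?b = "\<lambda>m. (cmod (ip u (hc m)))\<^sup>2"
    have cmp: "real (Suc n) powr s \<le> 2 powr s * (real n + 1/2) powr s" for n
    proof -
      have "real (Suc n) powr s \<le> (2 * (real n + 1/2)) powr s" using s by (intro powr_mono2) auto
      also have "\<dots> = 2 powr s * (real n + 1/2) powr s" by (subst powr_mult) auto
      finally show ?thesis .
    qed
    have S': "summable (\<lambda>n. real (Suc n) powr s * ?a n)"
    proof (rule summable_comparison_test'[OF summable_mult[OF S, of "2 powr s"], of 0])
      show "norm (real (Suc n) powr s * ?a n) \<le> 2 powr s * ((real n + 1/2) powr s * ?a n)" for n
        using mult_right_mono[OF cmp[of n], of "?a n"] by (simp add: abs_mult mult.assoc)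
    qed
    have le: "(\<Sum>n. real (Suc n) powr s * ?a n) \<le> 2 powr s * (\<Sum>n. (real n + 1/2) powr s * ?a n)"
    proof -
      have "(\<Sum>n. real (Suc n) powr s * ?a n) \<le> (\<Sum>n. 2 powr s * ((real n + 1/2) powr s * ?a n))"
        using mult_right_mono[OF cmp, of "?a n" n for n] by (intro suminf_le S' summable_mult S) (simp add: mult.assoc)
      also have "\<dots> = 2 powr s * (\<Sum>n. (real n + 1/2) powr s * ?a n)" by (rule suminf_mult[OF S])
      finally show ?thesis .
    qed
    have bound: "(\<Sum>m<M. (real m + 1/2) powr s * ?b m) \<le> D * En t powr s * (\<Sum>n. (real n + 1/2) powr s * ?a n)" for M
    proof -
      have "(\<Sum>m<M. (real m + 1/2) powr s * ?b m) \<le> (\<Sum>m<M. 2 * (real (Suc m) powr s * (?b m / 2)))"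
      proof (rule sum_mono)
        fix m
        have "(real m + 1/2) powr s \<le> real (Suc m) powr s" using s by (intro powr_mono2) auto
        then show "(real m + 1/2) powr s * ?b m \<le> 2 * (real (Suc m) powr s * (?b m / 2))" by (simp add: mult_right_mono)
      qed
      also have "\<dots> = 2 * (\<Sum>m<M. real (Suc m) powr s * (?b m / 2))" by (rule sum_distrib_left[symmetric])
      also have "\<dots> \<le> 2 * (D0 * En t powr s * (\<Sum>n. real (Suc n) powr s * ?a n))"
        unfolding D0_def
      proof (intro mult_left_mono interpolation)
        show "(\<Sum>m\<in>{2 ^ j - 1..<2 ^ Suc j - 1}. ?b m / 2) \<le> (\<Sum>n. (if real (Suc n) * En t \<le> 2 ^ j then C * (real (Suc n) * En t / 2 ^ j) ^ K else 1) * ?a n)" for j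
          by (rule block_bound[OF t u C HR[OF t]])
      qed (use En_ge_1[OF t] s K C S' onb.summable_coeffs[OF onb_Psi[OF t] u] in auto)
      also have "\<dots> \<le> 2 * (D0 * En t powr s * (2 powr s * (\<Sum>n. (real n + 1/2) powr s * ?a n)))"
        using D0 by (intro mult_left_mono le) auto
      finally show ?thesis by (simp add: D_def mult_ac)
    qed
    have "summable (\<lambda>m. (real m + 1/2) powr s * ?b m)"
    proof (rule bounded_imp_summable)
      show "(\<Sum>m\<le>M. (real m + 1/2) powr s * ?b m) \<le> D * En t powr s * (\<Sum>n. (real n + 1/2) powr s * ?a n)" for M
        using bound[of "Suc M"] unfolding lessThan_Suc_atMost .
    qed simp
    then show ?thesis using bound by (intro conjI suminf_le_const)
  qed
  ultimately show ?thesis by blast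
qed

text \<open>Let \<open>w\<close> be the projection of \<open>u\<close> to the first \<open>N\<close>
  fixed modes. Position and derivative applied to \<open>w\<close> have norm O(sqrt N) times that of
  \<open>w\<close>, whereas in the moving basis one of the two ladders has a coefficient of size
  sqrt En. For \<open>N\<close> much smaller than \<open>En\<close> the moving coefficients of
  \<open>w\<close> therefore nearly satisfy the homogeneous recurrence, their first entries are
  small, and \<open>w\<close> is almost orthogonal to \<open>u\<close>.\<close>

lemma low_mass:
  assumes sc: "summable (\<lambda>n. (cmod (c n))\<^sup>2)" and Q: "Q = (\<Sum>n. (cmod (c n))\<^sup>2)" "Q > 0"
  shows "\<exists>\<epsilon>>0. \<forall>t\<ge>t0. \<forall>u. L2 u \<longrightarrow> (\<forall>n. ip u (Psi n t) = c n) \<longrightarrow>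
    (\<forall>N. real N \<le> \<epsilon> * En t \<longrightarrow> (\<Sum>m<N. (cmod (ip u (hc m)))\<^sup>2) \<le> Q / 4)"
proof -
  have "(\<lambda>N. Q - (\<Sum>n<N. (cmod (c n))\<^sup>2)) \<longlonglongrightarrow> Q - Q"
    unfolding Q(1) by (intro tendsto_diff tendsto_const summable_LIMSEQ sc)
  then have "\<forall>\<^sub>F N in sequentially. Q - (\<Sum>n<N. (cmod (c n))\<^sup>2) < Q / 16"
    using Q(2) by (intro order_tendstoD(2)) auto
  then obtain n0 where n0: "Q - (\<Sum>n<n0. (cmod (c n))\<^sup>2) < Q / 16" by (auto simp: eventually_sequentially)
  \<comment> \<open>The added 1 only keeps \<open>A\<close> positive. With \<open>n0\<close> chosen
    so that the tail of \<open>c\<close> has norm below sqrt Q / 4 and with \<delta> below, the two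
    parts of the pairing contribute sqrt Q / 4 each.\<close>
  define A where "A = (\<Sum>n<n0. cmod (c n)) + 1"
  have A: "A > 0" unfolding A_def by (intro add_nonneg_pos sum_nonneg) auto
  define \<delta> where "\<delta> = sqrt Q / (4 * A)"
  have d: "\<delta> > 0" using A Q by (simp add: \<delta>_def)
  obtain \<tau>0 where \<tau>0: "\<tau>0 > 0" "\<And>r q \<tau>. (\<forall>n. r n \<ge> 0) \<Longrightarrow> q \<ge> 0 \<Longrightarrow> \<tau> \<ge> 0 \<Longrightarrow> \<tau> \<le> \<tau>0 \<Longrightarrow> (\<forall>N. (\<Sum>n<N. (r n)\<^sup>2) \<le> q\<^sup>2)
    \<Longrightarrow> (\<forall>n. \<bar>sqrt (real (Suc n)) * r (Suc n) - sqrt (real n) * r (n - 1)\<bar> \<le> \<tau> * q) \<Longrightarrow> (\<forall>n\<le>n0. r n \<le> \<delta> * q)"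
    using recurrence_small[OF d, of n0] by blast
  \<comment> \<open>The relative error of the recurrence satisfies \<tau>^2 = 4 N /
    \<bar>lam\<bar>^2, at most 8 \<epsilon> once \<bar>lam\<bar>^2 is at least En / 2.\<close>
  define \<epsilon> where "\<epsilon> = \<tau>0\<^sup>2 / 8"
  have "\<epsilon> > 0" using \<tau>0 by (simp add: \<epsilon>_def)
  moreover have "(\<Sum>m<N. (cmod (ip u (hc m)))\<^sup>2) \<le> Q / 4"
    if t: "t \<ge> t0" and u: "L2 u" and c: "\<And>n. ip u (Psi n t) = c n" and N: "real N \<le> \<epsilon> * En t" for t u N
  proof -
    define d where "d m = ip u (hc m)" for m
    define q where "q = sqrt (\<Sum>m<N. (cmod (d m))\<^sup>2)"
    have q2: "q\<^sup>2 = (\<Sum>m<N. (cmod (d m))\<^sup>2)" unfolding q_def by (simp add: sum_nonneg)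
    have q0: "q \<ge> 0" by (simp add: q_def sum_nonneg)
    define w where "w x = (\<Sum>m<N. d m * hc m x)" for x
    have L2w: "L2 w" unfolding w_def[abs_def] by (intro L2_sum L2_scale L2_hc)
    have nw: "L2_norm_sq w = q\<^sup>2" unfolding w_def[abs_def] q2 by (rule onb.norm_comb[OF onb_hc]) simp
    have lw: "l2n w = q" using nw q0 by (simp add: l2n_def)
    define w' where "w' n = ip w (Psi n t)" for n
    have w'G: "w' n = (\<Sum>m<N. d m * cnj (Gm t m n))" for n
      unfolding w'_def w_def[abs_def] Gm_def
      by (subst ip_sum_left) (auto simp: L2_scale L2_hc L2_Psi[OF t] ip_scale_left ip_cnj[of "hc _"])
    \<comment> \<open>A sign \<sigma> = 1 gives position and \<sigma> = -1 the derivative, so that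
      both are treated at once.\<close>
    have shift: "(\<Sum>m<N. d m * (of_real (sqrt (real m)) * g (m - 1) + \<sigma> * (of_real (sqrt (real (Suc m))) * g (Suc m))))
       = ip (\<lambda>x. (\<Sum>m<N. d m * (of_real (sqrt (real m)) * hc (m - 1) x + \<sigma> * (of_real (sqrt (real (Suc m))) * hc (Suc m) x)))) (Psi n t)"
      if "\<And>m. g m = ip (hc m) (Psi n t)" for g \<sigma> n
    proof -
      have "ip (\<lambda>x. (\<Sum>m<N. d m * (of_real (sqrt (real m)) * hc (m - 1) x + \<sigma> * (of_real (sqrt (real (Suc m))) * hc (Suc m) x)))) (Psi n t)
        = (\<Sum>m<N. ip (\<lambda>x. d m * (of_real (sqrt (real m)) * hc (m - 1) x + \<sigma> * (of_real (sqrt (real (Suc m))) * hc (Suc m) x))) (Psi n t))"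
        by (rule ip_sum_left[OF L2_scale[OF L2_add[OF L2_scale[OF L2_hc] L2_scale[OF L2_scale[OF L2_hc]]]] L2_Psi[OF t]])
      then show ?thesis
        by (simp only: ip_scale_left ip_add_left[OF L2_scale[OF L2_hc] L2_scale[OF L2_scale[OF L2_hc]] L2_Psi[OF t]] that)
    qed
    have nbound: "l2n (\<lambda>x. (\<Sum>m<N. d m * (of_real (sqrt (real m)) * hc (m - 1) x + \<sigma> * (of_real (sqrt (real (Suc m))) * hc (Suc m) x)))) \<le> 2 * sqrt (real N) * q"
      if \<sigma>: "cmod \<sigma> = 1" for \<sigma>
    proof -
      let ?f = "\<lambda>x. \<Sum>m<N. (d m * of_real (sqrt (real m))) * hc (m - 1) x" and ?g = "\<lambda>x. \<Sum>m<N. (\<sigma> * d m * of_real (sqrt (real (Suc m)))) * hc (Suc m) x"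
      have L: "L2 ?f" "L2 ?g" by (intro L2_sum L2_scale L2_hc)+
      have 1: "l2n ?f \<le> sqrt (real N) * q"
      proof (cases N)
        case (Suc N')
        have "?f = (\<lambda>x. \<Sum>m<N'. (d (Suc m) * of_real (sqrt (real (Suc m)))) * hc m x)"
          unfolding Suc by (subst sum.lessThan_Suc_shift) simp
        then have "L2_norm_sq ?f = (\<Sum>m<N'. (cmod (d (Suc m) * of_real (sqrt (real (Suc m)))))\<^sup>2)"
          using onb.norm_comb[OF onb_hc, of "{..<N'}" "\<lambda>m. d (Suc m) * of_real (sqrt (real (Suc m)))"] by simp
        also have "\<dots> \<le> (\<Sum>m<N'. real N * (cmod (d (Suc m)))\<^sup>2)"
          using Suc by (intro sum_mono) (auto simp: norm_mult power_mult_distrib mult.commute intro!: mult_right_mono)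
        also have "\<dots> \<le> (\<Sum>m<Suc N'. real N * (cmod (d m))\<^sup>2)"
          by (subst sum.lessThan_Suc_shift) simp
        also have "\<dots> = (sqrt (real N) * q)\<^sup>2" by (simp add: power_mult_distrib q2 Suc sum_distrib_left[symmetric] del: sum.lessThan_Suc of_nat_Suc)
        finally show ?thesis unfolding l2n_def[of ?f] using q0 by (intro real_le_lsqrt) auto
      qed (use q0 in \<open>simp add: l2n_def L2_norm_sq_def\<close>)
      have 2: "l2n ?g \<le> sqrt (real N) * q"
      proof -
        have "?g = (\<lambda>x. \<Sum>m\<in>Suc ` {..<N}. (\<sigma> * d (m - 1) * of_real (sqrt (real m))) * hc m x)"
          by (subst sum.reindex) auto
        then have "L2_norm_sq ?g = (\<Sum>m\<in>Suc ` {..<N}. (cmod (\<sigma> * d (m - 1) * of_real (sqrt (real m))))\<^sup>2)"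
          using onb.norm_comb[OF onb_hc, of "Suc ` {..<N}" "\<lambda>m. \<sigma> * d (m - 1) * of_real (sqrt (real m))"] by simp
        also have "\<dots> = (\<Sum>m<N. (cmod (\<sigma> * d m * of_real (sqrt (real (Suc m)))))\<^sup>2)"
          by (subst sum.reindex) auto
        also have "\<dots> \<le> (\<Sum>m<N. real N * (cmod (d m))\<^sup>2)"
          using \<sigma> by (intro sum_mono) (auto simp: norm_mult power_mult_distrib mult.commute intro!: mult_right_mono)
        also have "\<dots> = (sqrt (real N) * q)\<^sup>2" by (simp add: power_mult_distrib q2 sum_distrib_left)
        finally show ?thesis unfolding l2n_def[of ?g] using q0 by (intro real_le_lsqrt) auto
      qed
      have "(\<lambda>x. (\<Sum>m<N. d m * (of_real (sqrt (real m)) * hc (m - 1) x + \<sigma> * (of_real (sqrt (real (Suc m))) * hc (Suc m) x)))) = (\<lambda>x. ?f x + ?g x)"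
        unfolding sum.distrib[symmetric] by (intro ext sum.cong) (auto simp: algebra_simps)
      then show ?thesis using l2n_triangle[OF L] 1 2 by simp
    qed
    have pair: "cmod (ip (\<lambda>x. (\<Sum>m<N. d m * (of_real (sqrt (real m)) * hc (m - 1) x + \<sigma> * (of_real (sqrt (real (Suc m))) * hc (Suc m) x)))) (Psi n t)) \<le> 2 * sqrt (real N) * q"
      if \<sigma>: "cmod \<sigma> = 1" for \<sigma> n
    proof -
      have "L2 (\<lambda>x. (\<Sum>m<N. d m * (of_real (sqrt (real m)) * hc (m - 1) x + \<sigma> * (of_real (sqrt (real (Suc m))) * hc (Suc m) x))))"
        by (intro L2_sum L2_scale L2_add L2_hc)
      from order_trans[OF cauchy_schwarz[OF this L2_Psi[OF t, of n]]] nbound[OF \<sigma>] show ?thesis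
        unfolding l2n_Psi[OF t] by simp
    qed
    have Gc: "cnj (Gm t m n) = ip (hc m) (Psi n t)" for m n unfolding Gm_def by (rule ip_cnj[symmetric])
    have recx: "cmod (cnj (mu t) * (of_real (sqrt (real n)) * w' (n - 1)) + mu t * (of_real (sqrt (real (Suc n))) * w' (Suc n))) \<le> 2 * sqrt (real N) * q" for n
    proof -
      have "cnj (mu t) * (of_real (sqrt (real n)) * w' (n - 1)) + mu t * (of_real (sqrt (real (Suc n))) * w' (Suc n))
        = (\<Sum>m<N. d m * cnj (mu t * (of_real (sqrt (real n)) * Gm t m (n - 1)) + cnj (mu t) * (of_real (sqrt (real (Suc n))) * Gm t m (Suc n))))"
        unfolding w'G sum_distrib_left sum.distrib[symmetric] by (intro sum.cong) (auto simp: algebra_simps)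
      also have "\<dots> = (\<Sum>m<N. d m * (of_real (sqrt (real m)) * cnj (Gm t (m - 1) n) + 1 * (of_real (sqrt (real (Suc m))) * cnj (Gm t (Suc m) n))))"
        unfolding Gm_x[OF t, symmetric] by simp
      finally show ?thesis using shift[of "\<lambda>m. cnj (Gm t m n)" n 1, OF Gc] pair[of 1 n] by simp
    qed
    have recp: "cmod (cnj (nu t) * (of_real (sqrt (real n)) * w' (n - 1)) + nu t * (of_real (sqrt (real (Suc n))) * w' (Suc n))) \<le> 2 * sqrt (real N) * q" for n
    proof -
      have "- \<i> * (cnj (nu t) * (of_real (sqrt (real n)) * w' (n - 1)) + nu t * (of_real (sqrt (real (Suc n))) * w' (Suc n)))
        = (\<Sum>m<N. d m * cnj (\<i> * (nu t * (of_real (sqrt (real n)) * Gm t m (n - 1)) + cnj (nu t) * (of_real (sqrt (real (Suc n))) * Gm t m (Suc n)))))"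
        unfolding w'G sum_distrib_left sum.distrib[symmetric] by (intro sum.cong) (auto simp: algebra_simps)
      also have "\<dots> = (\<Sum>m<N. d m * (of_real (sqrt (real m)) * cnj (Gm t (m - 1) n) + (- 1) * (of_real (sqrt (real (Suc m))) * cnj (Gm t (Suc m) n))))"
        unfolding Gm_dx[OF t, symmetric] by simp
      finally have "cmod (- \<i> * (cnj (nu t) * (of_real (sqrt (real n)) * w' (n - 1)) + nu t * (of_real (sqrt (real (Suc n))) * w' (Suc n)))) \<le> 2 * sqrt (real N) * q"
        using shift[of "\<lambda>m. cnj (Gm t m n)" n "- 1", OF Gc] pair[of "- 1" n] by simp
      then show ?thesis unfolding norm_mult by simp
    qed
    have E1: "En t \<ge> 1" by (rule En_ge_1[OF t])
    \<comment> \<open>Of the two coefficients \<open>mu\<close> and \<open>nu\<close>, at least one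
      carries half of \<open>En\<close>. Which one it is depends on the time, but both satisfy a
      recurrence of the same shape.\<close>
    obtain lam where lam: "(cmod lam)\<^sup>2 \<ge> En t / 2"
      "\<And>n. cmod (cnj lam * (of_real (sqrt (real n)) * w' (n - 1)) + lam * (of_real (sqrt (real (Suc n))) * w' (Suc n))) \<le> 2 * sqrt (real N) * q"
    proof (cases "(cmod (mu t))\<^sup>2 \<ge> En t / 2")
      case True then show ?thesis using recx by (intro that[of "mu t"]) auto
    next
      case False
      have gen: "B \<ge> (A + B) / 2" if "\<not> A \<ge> (A + B) / 2" for A B :: real using that by (simp add: field_simps)
      have "(cmod (nu t))\<^sup>2 \<ge> En t / 2"
        using gen[OF False[unfolded En_def]] by (simp only: En_def)
      then show ?thesis using recp by (intro that[of "nu t"]) auto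
    qed
    have lpos: "cmod lam > 0"
    proof -
      have "(cmod lam)\<^sup>2 > 0" using lam(1) E1 by linarith
      then show ?thesis by (simp add: zero_less_power2)
    qed
    define \<tau> where "\<tau> = 2 * sqrt (real N) / cmod lam"
    have "\<tau>\<^sup>2 = 4 * real N / (cmod lam)\<^sup>2" by (simp add: \<tau>_def power_divide power_mult_distrib)
    also have "\<dots> \<le> 4 * (\<epsilon> * En t) / (En t / 2)"
      using N lam(1) E1 by (intro frac_le) auto
    also have "\<dots> = \<tau>0\<^sup>2" using E1 by (simp add: \<epsilon>_def)
    finally have "\<tau>\<^sup>2 \<le> \<tau>0\<^sup>2" .
    then have \<tau>le: "\<tau> \<le> \<tau>0" by (rule power2_le_imp_le) (use \<tau>0(1) in simp)
    have small: "\<forall>n\<le>n0. cmod (w' n) \<le> \<delta> * q"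
    proof (rule \<tau>0(2))
      show "\<tau> \<ge> 0" using lpos by (simp add: \<tau>_def)
      show "\<forall>N. (\<Sum>n<N. (cmod (w' n))\<^sup>2) \<le> q\<^sup>2"
      proof
        fix N
        show "(\<Sum>n<N. (cmod (w' n))\<^sup>2) \<le> q\<^sup>2"
          using onb.bessel[OF onb_Psi[OF t] L2w, of "{..<N}"] by (simp only: w'_def nw finite_lessThan)
      qed
      \<comment> \<open>The coefficients \<open>lam\<close> and \<open>cnj lam\<close> differ only
        in phase. Passing to moduli by the reverse triangle inequality removes the rotation and
        leaves the scalar recurrence.\<close>
      show "\<forall>n. \<bar>sqrt (real (Suc n)) * cmod (w' (Suc n)) - sqrt (real n) * cmod (w' (n - 1))\<bar> \<le> \<tau> * q"
      proof
        fix n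
        have "cmod lam * \<bar>sqrt (real (Suc n)) * cmod (w' (Suc n)) - sqrt (real n) * cmod (w' (n - 1))\<bar>
          = \<bar>cmod (lam * (of_real (sqrt (real (Suc n))) * w' (Suc n))) - cmod (- (cnj lam * (of_real (sqrt (real n)) * w' (n - 1))))\<bar>"
          unfolding norm_minus_cancel norm_mult norm_of_real complex_mod_cnj right_diff_distrib[symmetric] abs_mult by simp
        also have "\<dots> \<le> cmod (lam * (of_real (sqrt (real (Suc n))) * w' (Suc n)) - - (cnj lam * (of_real (sqrt (real n)) * w' (n - 1))))"
          by (rule norm_triangle_ineq3)
        also have "\<dots> = cmod (cnj lam * (of_real (sqrt (real n)) * w' (n - 1)) + lam * (of_real (sqrt (real (Suc n))) * w' (Suc n)))"
          by (simp add: add.commute)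
        also have "\<dots> \<le> 2 * sqrt (real N) * q" by (rule lam(2))
        finally show "\<bar>sqrt (real (Suc n)) * cmod (w' (Suc n)) - sqrt (real n) * cmod (w' (n - 1))\<bar> \<le> \<tau> * q"
          using lpos by (simp add: \<tau>_def field_simps)
      qed
    qed (use q0 \<tau>le in simp_all)
    \<comment> \<open>For a projection the squared norm equals the pairing with \<open>u\<close>.
      The pairing is then evaluated in the moving basis, where the first \<open>n0\<close>
      coefficients of \<open>u\<close> meet the small entries of \<open>w'\<close>.\<close>
    have "ip u w = of_real (q\<^sup>2)"
    proof -
      have "ip u w = (\<Sum>m<N. cnj (d m) * d m)"
        unfolding w_def[abs_def] by (subst ip_sum_right) (auto simp: L2_scale L2_hc u ip_scale_right d_def)
      also have "\<dots> = of_real (\<Sum>m<N. (cmod (d m))\<^sup>2)"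
        by (simp only: of_real_sum complex_norm_square mult.commute)
      finally show ?thesis by (simp add: q2)
    qed
    then have "q\<^sup>2 = cmod (ip u w)" by (simp add: norm_power)
    also have "ip u w = ip (\<lambda>x. \<Sum>n<n0. c n * Psi n t x) w + ip (\<lambda>x. u x - (\<Sum>n<n0. c n * Psi n t x)) w"
      by (subst ip_diff_left) (auto intro!: L2_sum L2_scale L2_Psi t u L2w)
    also have "cmod \<dots> \<le> A * (\<delta> * q) + sqrt Q / 4 * q"
    proof (intro order_trans[OF norm_triangle_ineq] add_mono)
      have "ip (\<lambda>x. \<Sum>n<n0. c n * Psi n t x) w = (\<Sum>n<n0. c n * cnj (w' n))"
        unfolding w'_def by (subst ip_sum_left) (auto simp: L2_scale L2_Psi[OF t] L2w ip_scale_left ip_cnj[of "Psi _ _" w])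
      also have "cmod \<dots> \<le> (\<Sum>n<n0. cmod (c n) * (\<delta> * q))"
        using small by (intro sum_norm_le) (auto simp: norm_mult intro!: mult_left_mono)
      also have "\<dots> \<le> A * (\<delta> * q)"
        unfolding sum_distrib_right[symmetric] A_def using d_def \<open>\<delta> > 0\<close> q0 by (intro mult_right_mono) auto
      finally show "cmod (ip (\<lambda>x. \<Sum>n<n0. c n * Psi n t x) w) \<le> A * (\<delta> * q)" .
      have "L2_norm_sq (\<lambda>x. u x - (\<Sum>n<n0. c n * Psi n t x)) = L2_norm_sq u - (\<Sum>n<n0. (cmod (c n))\<^sup>2)"
        using onb.norm_diff_proj[OF onb_Psi[OF t] u, of "{..<n0}"] by (simp add: c)
      also have "L2_norm_sq u = Q"
        using onb.parseval[OF onb_Psi[OF t] u] unfolding c Q(1) by (rule sums_unique)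
      finally have "l2n (\<lambda>x. u x - (\<Sum>n<n0. c n * Psi n t x)) \<le> sqrt (Q / 16)"
        unfolding l2n_def using n0 by simp
      also have "sqrt (Q / 16) = sqrt Q / 4" by (simp add: real_sqrt_divide)
      finally have "l2n (\<lambda>x. u x - (\<Sum>n<n0. c n * Psi n t x)) * l2n w \<le> sqrt Q / 4 * q"
        unfolding lw using q0 by (rule mult_right_mono)
      then show "cmod (ip (\<lambda>x. u x - (\<Sum>n<n0. c n * Psi n t x)) w) \<le> sqrt Q / 4 * q"
        using cauchy_schwarz[OF L2_diff[OF u L2_comb_Psi[OF t, of c n0, unfolded comb_def[abs_def]]] L2w] by linarith
    qed
    also have "A * (\<delta> * q) + sqrt Q / 4 * q = (sqrt Q / 2) * q" using A by (simp add: \<delta>_def field_simps)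
    finally have "q * q \<le> (sqrt Q / 2) * q" by (simp add: power2_eq_square)
    then have "q \<le> sqrt Q / 2" using q0 Q(2) by (cases "q = 0") auto
    then have "q\<^sup>2 \<le> (sqrt Q / 2)\<^sup>2" using q0 by (intro power_mono) auto
    then show ?thesis using Q(2) unfolding q2 d_def by (simp add: power_divide)
  qed
  ultimately show ?thesis by blast
qed

end

text \<open>The upper bound transfers the weighted sum of the constant moving coefficients to the
  fixed basis. For the lower bound at least three quarters of the mass sit on fixed modes beyond a
  multiple of \<open>En\<close>, where each carries a weight of order En^s.\<close>

theorem (in osc) Hs_bounds:
  assumes s: "s > 0" and u0: "in_Hs s u0" and Q0: "L2_norm_sq u0 \<noteq> 0"
  shows "\<exists>\<kappa>>0. \<exists>D>0. \<forall>u. is_solution a t0 u0 u \<longrightarrow> (\<forall>t\<ge>t0. in_Hs s (u t) \<and>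
    \<kappa> * En t powr (s/2) \<le> Hs_norm s (u t) \<and> Hs_norm s (u t) \<le> D * En t powr (s/2))"
proof -
  define c where "c n = ip u0 (hc n)" for n
  define Q where "Q = L2_norm_sq u0"
  have Q: "Q > 0" using Q0 by (simp add: Q_def less_le)
  have L2u0: "L2 u0" and S: "summable (\<lambda>n. (real n + 1/2) powr s * (cmod (c n))\<^sup>2)"
    using u0 by (auto simp: in_Hs_def hcoef_eq_ip c_def)
  define X where "X = (\<Sum>n. (real n + 1/2) powr s * (cmod (c n))\<^sup>2)"
  have X: "X \<ge> 0" unfolding X_def by (intro suminf_nonneg S) auto
  have sumsQ: "(\<lambda>n. (cmod (c n))\<^sup>2) sums Q"
    unfolding c_def Q_def by (rule onb.parseval[OF onb_hc L2u0])
  from Hs_upper[OF s] obtain D where D: "D > 0" and up: "\<forall>t\<ge>t0. \<forall>u. L2 u \<longrightarrow> summable (\<lambda>n. (real n + 1/2) powr s * (cmod (ip u (Psi n t)))\<^sup>2) \<longrightarrow>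
    summable (\<lambda>m. (real m + 1/2) powr s * (cmod (ip u (hc m)))\<^sup>2) \<and>
    (\<Sum>m. (real m + 1/2) powr s * (cmod (ip u (hc m)))\<^sup>2)
      \<le> D * En t powr s * (\<Sum>n. (real n + 1/2) powr s * (cmod (ip u (Psi n t)))\<^sup>2)"
    by (elim exE conjE)
  from low_mass[OF sums_summable[OF sumsQ] sums_unique[OF sumsQ] Q] obtain \<epsilon> where e: "\<epsilon> > 0"
    and low: "\<forall>t\<ge>t0. \<forall>u. L2 u \<longrightarrow> (\<forall>n. ip u (Psi n t) = c n) \<longrightarrow>
      (\<forall>N. real N \<le> \<epsilon> * En t \<longrightarrow> (\<Sum>m<N. (cmod (ip u (hc m)))\<^sup>2) \<le> Q / 4)"
    by (elim exE conjE)
  \<comment> \<open>The halving of \<epsilon> makes up for rounding \<epsilon> En down to an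
    integer; the factor Q / 2 is available both from the high modes and from the plain L2
    norm.\<close>
  define k where "k = (Q / 2) * (\<epsilon> / 2) powr s"
  have k: "k > 0" using Q e by (simp add: k_def)
  have half: "sqrt (z powr s) = z powr (s/2)" if "z > 0" for z :: real
    using that by (simp add: powr_half_sqrt[symmetric] powr_powr)
  have main: "in_Hs s (u t) \<and> sqrt k * En t powr (s/2) \<le> Hs_norm s (u t) \<and> Hs_norm s (u t) \<le> sqrt (D * X + Q) * En t powr (s/2)"
    if sol: "is_solution a t0 u0 u" and t: "t \<ge> t0" for u t
  proof -
    have L2u: "L2 (u t)" by (rule is_solutionD(1)[OF sol t])
    have cu: "ip (u t) (Psi n t) = c n" for n unfolding c_def by (rule solution_coeffs[OF sol t L2u0])
    have E: "En t \<ge> 1" by (rule En_ge_1[OF t])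
    have E1: "En t powr s \<ge> 1" using E s ge_one_powr_ge_zero by auto
    let ?b = "\<lambda>m. (cmod (ip (u t) (hc m)))\<^sup>2"
    have U: "summable (\<lambda>m. (real m + 1/2) powr s * ?b m)" "(\<Sum>m. (real m + 1/2) powr s * ?b m) \<le> D * En t powr s * X"
      using up[rule_format, OF t L2u, unfolded cu, OF S] unfolding X_def by (rule conjunct1, rule conjunct2)
    have T: "T_pow_norm_sq s (u t) = (\<Sum>m. (real m + 1/2) powr s * ?b m)"
      by (simp add: T_pow_norm_sq_def hcoef_eq_ip)
    have nQ: "L2_norm_sq (u t) = Q"
    proof (rule sums_unique2)
      show "(\<lambda>n. (cmod (c n))\<^sup>2) sums L2_norm_sq (u t)"
        using onb.parseval[OF onb_Psi[OF t] L2u] unfolding cu .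
    qed (rule sumsQ)
    have inH: "in_Hs s (u t)" using L2u U(1) by (simp add: in_Hs_def hcoef_eq_ip)
    have "T_pow_norm_sq s (u t) + L2_norm_sq (u t) \<le> D * En t powr s * X + Q * En t powr s"
    proof -
      have "Q * 1 \<le> Q * En t powr s" using E1 Q by (intro mult_left_mono) auto
      then show ?thesis unfolding T nQ using add_mono[OF U(2)] by simp
    qed
    also have "\<dots> = (D * X + Q) * En t powr s" by (simp add: algebra_simps)
    finally have "Hs_norm s (u t) \<le> sqrt ((D * X + Q) * En t powr s)"
      unfolding Hs_norm_def by (rule real_sqrt_le_mono)
    then have upper: "Hs_norm s (u t) \<le> sqrt (D * X + Q) * En t powr (s/2)"
      using half[of "En t"] E by (simp add: real_sqrt_mult)
    have T0: "T_pow_norm_sq s (u t) \<ge> 0" unfolding T by (intro suminf_nonneg U) auto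
    have "k * En t powr s \<le> T_pow_norm_sq s (u t) + L2_norm_sq (u t)"
    \<comment> \<open>If \<epsilon> En is below 1 there is no admissible positive \<open>N\<close>,
      but then \<open>En\<close> is bounded and the conserved L2 norm alone is large enough.\<close>
    proof (cases "\<epsilon> * En t \<ge> 1")
      case False
      have "(\<epsilon> / 2) powr s * En t powr s = (\<epsilon> / 2 * En t) powr s" using e E by (subst powr_mult) auto
      also have "\<dots> \<le> 1 powr s" using False e E s by (intro powr_mono2) auto
      finally have "(Q / 2) * ((\<epsilon> / 2) powr s * En t powr s) \<le> (Q / 2) * 1" using Q by (intro mult_left_mono) auto
      moreover have "k * En t powr s = (Q / 2) * ((\<epsilon> / 2) powr s * En t powr s)" by (simp add: k_def)
      ultimately show ?thesis using Q T0 unfolding nQ by linarith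
    next
      case True
      define N where "N = nat \<lfloor>\<epsilon> * En t\<rfloor>"
      have N: "real N \<le> \<epsilon> * En t" "\<epsilon> * En t < real N + 1" "N \<ge> 1"
        using True unfolding N_def by (auto simp: le_nat_iff)
      then have N2: "\<epsilon> / 2 * En t \<le> real N" by linarith
      have lm: "(\<Sum>m<N. ?b m) \<le> Q / 4" by (rule low[rule_format, OF t L2u cu N(1)])
      have sb: "?b sums Q" using onb.parseval[OF onb_hc L2u] unfolding nQ .
      have fin: "(\<lambda>m. if m \<in> {..<N} then ?b m else 0) sums (\<Sum>m<N. ?b m)" by (rule sums_If_finite_set) simp
      have "(\<lambda>m. real N powr s * (?b m - (if m \<in> {..<N} then ?b m else 0))) sums (real N powr s * (Q - (\<Sum>m<N. ?b m)))"
        by (intro sums_mult sums_diff sb fin)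
      then have "real N powr s * (Q - (\<Sum>m<N. ?b m)) \<le> T_pow_norm_sq s (u t)"
        unfolding T
      proof (rule sums_le[rotated 1])
        show "(\<lambda>m. (real m + 1/2) powr s * ?b m) sums (\<Sum>m. (real m + 1/2) powr s * ?b m)"
          using U(1) by (rule summable_sums)
        show "real N powr s * (?b m - (if m \<in> {..<N} then ?b m else 0)) \<le> (real m + 1/2) powr s * ?b m" for m
        proof (cases "m < N")
          case False
          then have "real N powr s \<le> (real m + 1/2) powr s" using s by (intro powr_mono2) auto
          then show ?thesis using False by (simp add: mult_right_mono)
        qed simp
      qed
      moreover have "real N powr s * (Q / 2) \<le> real N powr s * (Q - (\<Sum>m<N. ?b m))"
        using lm Q by (intro mult_left_mono) auto
      moreover have "(\<epsilon> / 2 * En t) powr s * (Q / 2) \<le> real N powr s * (Q / 2)"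
        using N2 e E s Q by (intro mult_right_mono powr_mono2) auto
      moreover have "(\<epsilon> / 2 * En t) powr s * (Q / 2) = k * En t powr s"
      proof -
        have "(\<epsilon> / 2 * En t) powr s = (\<epsilon> / 2) powr s * En t powr s" using e E by (subst powr_mult) auto
        then show ?thesis by (simp add: k_def)
      qed
      ultimately show ?thesis using Q unfolding nQ by linarith
    qed
    then have "sqrt (k * En t powr s) \<le> Hs_norm s (u t)"
      unfolding Hs_norm_def by (rule real_sqrt_le_mono)
    then have lower: "sqrt k * En t powr (s/2) \<le> Hs_norm s (u t)"
      using half[of "En t"] E by (simp add: real_sqrt_mult)
    show ?thesis using inH lower upper by blast
  qed
  have "sqrt k > 0" "sqrt (D * X + Q) > 0" using k D X Q by (auto intro: add_nonneg_pos)
  then show ?thesis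
    by (intro exI[of _ "sqrt k"] conjI exI[of _ "sqrt (D * X + Q)"] allI impI) (use main in simp_all)
qed

subsection \<open>Reduction to a linear oscillator\<close>

lemma antiderivative_exists:
  fixes f :: "real \<Rightarrow> real"
  assumes f: "continuous_on {a..} f"
  shows "\<exists>F. F a = 0 \<and> (\<forall>t\<ge>a. (F has_real_derivative f t) (at t within {a..}))"
proof (intro exI[of _ "\<lambda>t. integral {a..t} f"] conjI allI impI)
  show "integral {a..a} f = 0" by simp
  fix t assume t: "t \<ge> a"
  have "((\<lambda>u. integral {a..u} f) has_vector_derivative f t) (at t within {a..t + 1})"
    using f t by (intro integral_has_vector_derivative) (auto intro: continuous_on_subset)
  moreover have "at t within {a..t + 1} = at t within {a..}"
    by (rule at_within_nhd[of t "{..<t + 1}"]) auto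
  ultimately show "((\<lambda>u. integral {a..u} f) has_real_derivative f t) (at t within {a..})"
    by (simp add: has_real_derivative_iff_has_vector_derivative)
qed

text \<open>The modulus of \<open>Y1 + \<i> Y2\<close> solves the Ermakov--Pinney equation.\<close>

lemma osc_from_solutions:
  fixes Y1 Y2 Z1 Z2 a :: "real \<Rightarrow> real"
  assumes d: "\<And>t. t \<ge> t0 \<Longrightarrow> (Y1 has_real_derivative Z1 t) (at t within {t0..})"
    "\<And>t. t \<ge> t0 \<Longrightarrow> (Y2 has_real_derivative Z2 t) (at t within {t0..})"
    "\<And>t. t \<ge> t0 \<Longrightarrow> (Z1 has_real_derivative - (1 + a t) * Y1 t) (at t within {t0..})"
    "\<And>t. t \<ge> t0 \<Longrightarrow> (Z2 has_real_derivative - (1 + a t) * Y2 t) (at t within {t0..})"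
    and W: "\<And>t. t \<ge> t0 \<Longrightarrow> Y1 t * Z2 t - Z1 t * Y2 t = 1"
    and init: "Y1 t0 = 1" "Z1 t0 = 0" "Y2 t0 = 0" "Z2 t0 = 1" and a: "continuous_on {t0..} a"
  shows "\<exists>\<rho> \<rho>' \<theta>. osc a \<rho> \<rho>' \<theta> t0 \<and> (\<forall>t\<ge>t0. (\<rho> t)\<^sup>2 + (\<rho>' t)\<^sup>2 + (1 / \<rho> t)\<^sup>2 = (Y1 t)\<^sup>2 + (Y2 t)\<^sup>2 + (Z1 t)\<^sup>2 + (Z2 t)\<^sup>2)"
proof -
  define \<rho> where "\<rho> t = sqrt ((Y1 t)\<^sup>2 + (Y2 t)\<^sup>2)" for t
  define M where "M t = Y1 t * Z1 t + Y2 t * Z2 t" for t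
  define \<rho>' where "\<rho>' t = M t / \<rho> t" for t
  \<comment> \<open>The unit Wronskian excludes a common zero of \<open>Y1\<close> and
    \<open>Y2\<close>.\<close>
  have pos: "(Y1 t)\<^sup>2 + (Y2 t)\<^sup>2 > 0" if "t \<ge> t0" for t
    using W[OF that] by (cases "Y1 t = 0 \<and> Y2 t = 0") (auto simp: sum_power2_gt_zero_iff)
  have r: "\<rho> t > 0" if "t \<ge> t0" for t using pos[OF that] by (simp add: \<rho>_def)
  have r2: "(\<rho> t)\<^sup>2 = (Y1 t)\<^sup>2 + (Y2 t)\<^sup>2" for t by (simp add: \<rho>_def)
  have dr: "(\<rho> has_real_derivative \<rho>' t) (at t within {t0..})" if t: "t \<ge> t0" for t
  proof -
    have "((\<lambda>t. (Y1 t)\<^sup>2 + (Y2 t)\<^sup>2) has_real_derivative 2 * M t) (at t within {t0..})"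
      by (rule DERIV_cong[OF DERIV_add[OF DERIV_power[OF d(1)[OF t]] DERIV_power[OF d(2)[OF t]]]]) (simp add: M_def)
    from DERIV_chain2[OF DERIV_real_sqrt[OF pos[OF t]] this]
    show ?thesis unfolding \<rho>_def[abs_def] \<rho>'_def by (simp add: field_simps)
  qed
  \<comment> \<open>Lagrange's identity for the vectors (Y1, Y2) and (Z1, Z2). The 1 is the squared
    Wronskian and is the source of the term 1 / \<rho>^3.\<close>
  have lagrange: "(\<rho> t)\<^sup>2 * ((Z1 t)\<^sup>2 + (Z2 t)\<^sup>2) = (M t)\<^sup>2 + 1" if t: "t \<ge> t0" for t
  proof -
    have "(\<rho> t)\<^sup>2 * ((Z1 t)\<^sup>2 + (Z2 t)\<^sup>2) = (M t)\<^sup>2 + (Y1 t * Z2 t - Z1 t * Y2 t)\<^sup>2"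
      unfolding r2 M_def by (simp add: power2_eq_square algebra_simps)
    then show ?thesis unfolding W[OF t] by simp
  qed
  have Z: "(Z1 t)\<^sup>2 + (Z2 t)\<^sup>2 = (\<rho>' t)\<^sup>2 + (1 / \<rho> t)\<^sup>2" if t: "t \<ge> t0" for t
  proof -
    have "(Z1 t)\<^sup>2 + (Z2 t)\<^sup>2 = ((\<rho> t)\<^sup>2 * ((Z1 t)\<^sup>2 + (Z2 t)\<^sup>2)) / (\<rho> t)\<^sup>2" using r[OF t] by simp
    then show ?thesis unfolding lagrange[OF t] by (simp add: \<rho>'_def power_divide add_divide_distrib)
  qed
  have dr': "(\<rho>' has_real_derivative 1 / (\<rho> t) ^ 3 - (1 + a t) * \<rho> t) (at t within {t0..})" if t: "t \<ge> t0" for t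
  proof -
    have "(M has_real_derivative (Z1 t)\<^sup>2 + (Z2 t)\<^sup>2 - (1 + a t) * (\<rho> t)\<^sup>2) (at t within {t0..})"
      unfolding M_def[abs_def] r2 
      by (rule DERIV_cong[OF DERIV_add[OF DERIV_mult[OF d(1)[OF t] d(3)[OF t]] DERIV_mult[OF d(2)[OF t] d(4)[OF t]]]])
         (simp add: power2_eq_square algebra_simps)
    from DERIV_divide[OF this dr[OF t]] r[OF t]
    have "(\<rho>' has_real_derivative (((Z1 t)\<^sup>2 + (Z2 t)\<^sup>2 - (1 + a t) * (\<rho> t)\<^sup>2) * \<rho> t - M t * \<rho>' t) / (\<rho> t * \<rho> t)) (at t within {t0..})"
      unfolding \<rho>'_def[abs_def] by simp
    moreover have "(((Z1 t)\<^sup>2 + (Z2 t)\<^sup>2 - (1 + a t) * (\<rho> t)\<^sup>2) * \<rho> t - M t * \<rho>' t) / (\<rho> t * \<rho> t) = 1 / (\<rho> t) ^ 3 - (1 + a t) * \<rho> t"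
    proof -
      have M: "M t = \<rho>' t * \<rho> t" using r[OF t] by (simp add: \<rho>'_def)
      have gen: "((x\<^sup>2 + (1 / y)\<^sup>2 - b * y\<^sup>2) * y - x * y * x) / (y * y) = 1 / y ^ 3 - b * y" if "y > 0" for x y b :: real
        using that by (simp add: field_simps power2_eq_square power3_eq_cube)
      show ?thesis unfolding Z[OF t] M by (rule gen[OF r[OF t]])
    qed
    ultimately show ?thesis by simp
  qed
  have "continuous_on {t0..} \<rho>" using dr by (auto intro!: DERIV_continuous_on)
  then have "continuous_on {t0..} (\<lambda>t. 1 / (\<rho> t)\<^sup>2)"
    using r by (intro continuous_intros) force+
  from antiderivative_exists[OF this] obtain \<theta> where th: "\<theta> t0 = 0" "\<forall>t\<ge>t0. (\<theta> has_real_derivative 1 / (\<rho> t)\<^sup>2) (at t within {t0..})"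
    by blast
  have "osc a \<rho> \<rho>' \<theta> t0"
    by unfold_locales (use r dr dr' th a init in \<open>auto simp: \<rho>_def \<rho>'_def M_def\<close>)
  moreover have "(\<rho> t)\<^sup>2 + (\<rho>' t)\<^sup>2 + (1 / \<rho> t)\<^sup>2 = (Y1 t)\<^sup>2 + (Y2 t)\<^sup>2 + (Z1 t)\<^sup>2 + (Z2 t)\<^sup>2" if "t \<ge> t0" for t
    using Z[OF that] unfolding r2 by linarith
  ultimately show ?thesis by blast
qed

subsection \<open>Real functions with a holomorphic extension\<close>

text \<open>A device for proving that \<open>phi\<close> is twice continuously differentiable
  without differentiating its long formula: holomorphic extensibility is closed under the operations
  that build it and under differentiation. The half-line t > 1 contains [e, \<infinity>) in its
  interior and keeps the logarithm positive.\<close>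

definition hx :: "(real \<Rightarrow> real) \<Rightarrow> bool" where
  "hx f \<longleftrightarrow> (\<exists>S F. open S \<and> (\<forall>t>1. of_real t \<in> S) \<and> F holomorphic_on S \<and> (\<forall>t>1. F (of_real t) = of_real (f t)))"

lemma hxI: "open S \<Longrightarrow> (\<And>t. t > 1 \<Longrightarrow> of_real t \<in> S) \<Longrightarrow> F holomorphic_on S \<Longrightarrow> (\<And>t. t > 1 \<Longrightarrow> F (of_real t) = of_real (f t)) \<Longrightarrow> hx f"
  unfolding hx_def by blast

lemma hxE:
  assumes "hx f"
  obtains S F where "open S" "\<forall>t>1. complex_of_real t \<in> S" "F holomorphic_on S" "\<forall>t>1. F (of_real t) = of_real (f t)"
  using assms unfolding hx_def by blast

lemma hx_const: "hx (\<lambda>t. c)"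
  by (rule hxI[of UNIV "\<lambda>z. of_real c"]) auto

lemma hx_id: "hx (\<lambda>t. t)"
  by (rule hxI[of UNIV "\<lambda>z. z"]) auto

lemma hx_add: assumes "hx f" "hx g" shows "hx (\<lambda>t. f t + g t)"
proof -
  obtain S F where "open S" "\<forall>t>1. complex_of_real t \<in> S" "F holomorphic_on S" "\<forall>t>1. F (of_real t) = of_real (f t)"
    using assms(1) by (rule hxE)
  note 1 = this(1) this(2)[rule_format] this(3) this(4)[rule_format]
  obtain T G where "open T" "\<forall>t>1. complex_of_real t \<in> T" "G holomorphic_on T" "\<forall>t>1. G (of_real t) = of_real (g t)"
    using assms(2) by (rule hxE)
  note 2 = this(1) this(2)[rule_format] this(3) this(4)[rule_format]
  have "(\<lambda>z. F z + G z) holomorphic_on S \<inter> T"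
    using 1(3) 2(3) by (intro holomorphic_on_add holomorphic_on_subset[OF 1(3)] holomorphic_on_subset[OF 2(3)]) auto
  then show ?thesis using 1 2 by (intro hxI[of "S \<inter> T" "\<lambda>z. F z + G z"]) auto
qed

lemma hx_mult: assumes "hx f" "hx g" shows "hx (\<lambda>t. f t * g t)"
proof -
  obtain S F where "open S" "\<forall>t>1. complex_of_real t \<in> S" "F holomorphic_on S" "\<forall>t>1. F (of_real t) = of_real (f t)"
    using assms(1) by (rule hxE)
  note 1 = this(1) this(2)[rule_format] this(3) this(4)[rule_format]
  obtain T G where "open T" "\<forall>t>1. complex_of_real t \<in> T" "G holomorphic_on T" "\<forall>t>1. G (of_real t) = of_real (g t)"
    using assms(2) by (rule hxE)
  note 2 = this(1) this(2)[rule_format] this(3) this(4)[rule_format]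
  have "(\<lambda>z. F z * G z) holomorphic_on S \<inter> T"
    using 1(3) 2(3) by (intro holomorphic_on_mult holomorphic_on_subset[OF 1(3)] holomorphic_on_subset[OF 2(3)]) auto
  then show ?thesis using 1 2 by (intro hxI[of "S \<inter> T" "\<lambda>z. F z * G z"]) auto
qed

lemma hx_compose:
  assumes "hx f" "G holomorphic_on T" "open T" "\<And>t. t > 1 \<Longrightarrow> complex_of_real (f t) \<in> T" "\<And>x. of_real x \<in> T \<Longrightarrow> G (of_real x) = of_real (g x)"
  shows "hx (\<lambda>t. g (f t))"
proof -
  obtain S F where "open S" "\<forall>t>1. complex_of_real t \<in> S" "F holomorphic_on S" "\<forall>t>1. F (of_real t) = of_real (f t)"
    using assms(1) by (rule hxE)
  note 1 = this(1) this(2)[rule_format] this(3) this(4)[rule_format]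
  have "open (S \<inter> F -` T)"
    using holomorphic_on_imp_continuous_on[OF 1(3)] 1(1) assms(3) by (rule continuous_open_preimage)
  then have o: "open (S \<inter> F -` T)" by (simp add: Int_commute)
  have h: "(\<lambda>z. G (F z)) holomorphic_on S \<inter> F -` T"
    using holomorphic_on_compose_gen[OF holomorphic_on_subset[OF 1(3), of "S \<inter> F -` T"] assms(2)] by (auto simp: o_def)
  show ?thesis
    by (rule hxI[OF o _ h]) (use 1 assms(4,5) in auto)
qed

lemma hx_uminus: "hx f \<Longrightarrow> hx (\<lambda>t. - f t)"
  using hx_mult[OF hx_const[of "-1"]] by simp

lemma hx_diff: "hx f \<Longrightarrow> hx g \<Longrightarrow> hx (\<lambda>t. f t - g t)"
  using hx_add[OF _ hx_uminus] by simp

lemma hx_power: "hx f \<Longrightarrow> hx (\<lambda>t. f t ^ n)"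
  by (induction n) (simp_all add: hx_const hx_mult)

lemma hx_divide:
  assumes "hx f" "hx g" "\<And>t. t > 1 \<Longrightarrow> g t \<noteq> 0" shows "hx (\<lambda>t. f t / g t)"
proof -
  have "hx (\<lambda>t. inverse (g t))"
    by (rule hx_compose[OF assms(2), of inverse "- {0}"]) (use assms(3) in \<open>auto intro!: holomorphic_intros\<close>)
  from hx_mult[OF assms(1) this] show ?thesis by (simp add: divide_inverse)
qed

lemma hx_sin: "hx f \<Longrightarrow> hx (\<lambda>t. sin (f t))"
  by (rule hx_compose[of f sin UNIV]) (auto intro!: holomorphic_intros simp: sin_of_real)

lemma hx_cos: "hx f \<Longrightarrow> hx (\<lambda>t. cos (f t))"
  by (rule hx_compose[of f cos UNIV]) (auto intro!: holomorphic_intros simp: cos_of_real)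

lemma open_slit: "open (- \<real>\<^sub>\<le>\<^sub>0 :: complex set)"
  by (simp add: closed_nonpos_Reals_complex open_Compl)

lemma hx_sqrt: "hx sqrt"
  by (rule hxI[of "- \<real>\<^sub>\<le>\<^sub>0" csqrt]) (auto intro!: holomorphic_on_csqrt open_slit simp: complex_nonpos_Reals_iff)

lemma hx_ln: "hx ln"
  by (rule hxI[of "- \<real>\<^sub>\<le>\<^sub>0" Ln]) (auto intro!: holomorphic_on_Ln open_slit simp: complex_nonpos_Reals_iff Ln_of_real)

text \<open>The complex derivative of the extension restricts to the real derivative. It is real on
  the axis because the imaginary part of the extension vanishes along it.\<close>

lemma hx_deriv:
  assumes "hx f" shows "\<exists>f'. hx f' \<and> (\<forall>t>1. (f has_real_derivative f' t) (at t))"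
proof -
  obtain S F where "open S" "\<forall>t>1. complex_of_real t \<in> S" "F holomorphic_on S" "\<forall>t>1. F (of_real t) = of_real (f t)"
    using assms(1) by (rule hxE)
  note 1 = this(1) this(2)[rule_format] this(3) this(4)[rule_format]
  have d: "((\<lambda>s. F (of_real s)) has_vector_derivative deriv F (of_real t)) (at t)" if "t > 1" for t
  proof -
    have "(F has_field_derivative deriv F (of_real t)) (at (of_real t))"
      using holomorphic_derivI[OF 1(3) 1(1) 1(2)[OF that]] .
    moreover have "(complex_of_real has_vector_derivative 1) (at t)"
      using has_vector_derivative_of_real[OF DERIV_ident] by simp
    ultimately show ?thesis
      using field_vector_diff_chain_at[of complex_of_real 1 t F "deriv F (of_real t)"] by (simp add: o_def)
  qed
  have ev: "\<forall>\<^sub>F s in nhds t. F (of_real s) = of_real (f s)" if "t > 1" for t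
    using eventually_nhds_in_open[of "{1<..}" t] that 1(4) by (auto elim!: eventually_mono)
  have r: "((\<lambda>s. Re (F (of_real s))) has_real_derivative Re (deriv F (of_real t))) (at t)"
    "((\<lambda>s. Im (F (of_real s))) has_real_derivative Im (deriv F (of_real t))) (at t)" if "t > 1" for t
    using d[OF that] unfolding has_vector_derivative_complex_iff by auto
  have re: "(f has_real_derivative Re (deriv F (of_real t))) (at t)" if "t > 1" for t
    by (rule DERIV_transfer_nhds[OF r(1)[OF that]]) (use ev[OF that] in \<open>auto elim!: eventually_mono\<close>)
  have im: "Im (deriv F (of_real t)) = 0" if "t > 1" for t
  proof (rule DERIV_unique)
    show "((\<lambda>s. 0) has_real_derivative Im (deriv F (of_real t))) (at t)"
      by (rule DERIV_transfer_nhds[OF r(2)[OF that]]) (use ev[OF that] in \<open>auto elim!: eventually_mono\<close>)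
  qed simp
  have "hx (\<lambda>t. Re (deriv F (of_real t)))"
    by (rule hxI[OF 1(1) 1(2) holomorphic_deriv[OF 1(3) 1(1)]]) (use im in \<open>auto simp: complex_eq_iff\<close>)
  then show ?thesis using re by blast
qed

subsection \<open>The perturbation with prescribed growth\<close>

text \<open>The chains \<open>sq0\<close> to \<open>sq3\<close> and \<open>g0\<close> to
  \<open>g3\<close> list successive derivatives. They are kept explicit because the estimates need
  the gain of 1 / sqrt t per derivative.\<close>

definition sq0 :: "real \<Rightarrow> real" where "sq0 t = (sin (sqrt t))\<^sup>2"
definition sq1 :: "real \<Rightarrow> real" where "sq1 t = sin (2 * sqrt t) / (2 * sqrt t)"
definition sq2 :: "real \<Rightarrow> real" where "sq2 t = cos (2 * sqrt t) / (2 * sqrt t ^ 2) - sin (2 * sqrt t) / (4 * sqrt t ^ 3)"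
definition sq3 :: "real \<Rightarrow> real" where
  "sq3 t = - sin (2 * sqrt t) / (2 * sqrt t ^ 3) - 3 * cos (2 * sqrt t) / (4 * sqrt t ^ 4) + 3 * sin (2 * sqrt t) / (8 * sqrt t ^ 5)"

definition g0 :: "real \<Rightarrow> real" where "g0 t = 1 + ln t * sq0 t"
definition g1 :: "real \<Rightarrow> real" where "g1 t = sq0 t / t + ln t * sq1 t"
definition g2 :: "real \<Rightarrow> real" where "g2 t = - sq0 t / t ^ 2 + 2 * sq1 t / t + ln t * sq2 t"
definition g3 :: "real \<Rightarrow> real" where "g3 t = 2 * sq0 t / t ^ 3 - 3 * sq1 t / t ^ 2 + 3 * sq2 t / t + ln t * sq3 t"

text \<open>\<open>lf\<close> is \<open>ln f_rate\<close>; \<open>h0\<close>, \<open>h1\<close>, \<open>h2\<close> are its first three derivatives.\<close>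

definition lf :: "real \<Rightarrow> real" where "lf t = ln t / 3 + ln (g0 t)"
definition h0 :: "real \<Rightarrow> real" where "h0 t = 1 / (3 * t) + g1 t / g0 t"
definition h1 :: "real \<Rightarrow> real" where "h1 t = - 1 / (3 * t ^ 2) + g2 t / g0 t - (g1 t / g0 t) ^ 2"
definition h2 :: "real \<Rightarrow> real" where
  "h2 t = 2 / (3 * t ^ 3) + g3 t / g0 t - 3 * (g1 t / g0 t) * (g2 t / g0 t) + 2 * (g1 t / g0 t) ^ 3"

text \<open>\<open>phi\<close> is read off from the ansatz \<open>y1 = amp * cos\<close>, namely \<open>phi = - 1 - y1'' / y1\<close>. The oscillating
  factor in \<open>amp\<close> makes the logarithmic derivative \<open>pf\<close> of \<open>amp\<close> a multiple of \<open>cos\<close>, so that this quotient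
  has no poles.\<close>

definition amp :: "real \<Rightarrow> real" where "amp t = exp (lf t / 2 + h0 t * sin (2 * t) / 4)"
definition qf :: "real \<Rightarrow> real" where "qf t = h0 t * cos t + h1 t * sin t / 2"
definition qf1 :: "real \<Rightarrow> real" where "qf1 t = 3 / 2 * h1 t * cos t + (h2 t / 2 - h0 t) * sin t"
definition pf :: "real \<Rightarrow> real" where "pf t = qf t * cos t"
definition pf1 :: "real \<Rightarrow> real" where "pf1 t = qf1 t * cos t - qf t * sin t"

definition phi :: "real \<Rightarrow> real" where "phi t = 2 * qf t * sin t - (pf t)\<^sup>2 - pf1 t"

section \<open>Derivatives of the building blocks and the first solution\<close>

lemma DERIV_sqrt_comp:
  assumes "t > 0" "(f has_real_derivative D) (at (sqrt t))"
  shows "((\<lambda>t. f (sqrt t)) has_real_derivative D / (2 * sqrt t)) (at t)"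
  using DERIV_chain2[OF assms(2) DERIV_real_sqrt[OF assms(1)]] by (simp add: field_simps)

lemma sq0_deriv: assumes "t > 0" shows "(sq0 has_real_derivative sq1 t) (at t)"
proof -
  have "((\<lambda>y. (sin y)\<^sup>2) has_real_derivative sin (2 * sqrt t)) (at (sqrt t))"
    by (auto intro!: derivative_eq_intros simp: sin_double)
  from DERIV_sqrt_comp[OF assms this] show ?thesis by (simp add: sq0_def[abs_def] sq1_def)
qed

lemma sq1_deriv: assumes "t > 0" shows "(sq1 has_real_derivative sq2 t) (at t)"
proof -
  have y: "sqrt t > 0" using assms by simp
  have "((\<lambda>y. sin (2 * y) / (2 * y)) has_real_derivative cos (2 * y) / y - sin (2 * y) / (2 * y ^ 2)) (at y)" if "y > 0" for y :: real
    using that by (auto intro!: derivative_eq_intros simp: field_simps power2_eq_square)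
  from DERIV_sqrt_comp[OF assms this[OF y]] show ?thesis
    unfolding sq1_def[abs_def] by (rule DERIV_cong) (use y in \<open>simp add: sq2_def field_simps power2_eq_square power3_eq_cube\<close>)
qed

lemma sq2_deriv: assumes "t > 0" shows "(sq2 has_real_derivative sq3 t) (at t)"
proof -
  have y: "sqrt t > 0" using assms by simp
  have "((\<lambda>y. cos (2 * y) / (2 * y ^ 2) - sin (2 * y) / (4 * y ^ 3)) has_real_derivative
      - sin (2 * y) / y ^ 2 - 3 * cos (2 * y) / (2 * y ^ 3) + 3 * sin (2 * y) / (4 * y ^ 4)) (at y)" if "y > 0" for y :: real
    using that by (auto intro!: derivative_eq_intros simp: field_simps power_numeral_reduce)
  from DERIV_sqrt_comp[OF assms this[OF y]] show ?thesis
    unfolding sq2_def[abs_def] by (rule DERIV_cong) (use y in \<open>simp add: sq3_def field_simps power_numeral_reduce\<close>)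
qed

lemma g0_ge_1: "t > 1 \<Longrightarrow> g0 t \<ge> 1"
  by (simp add: g0_def sq0_def)

lemma g0_deriv: "t > 1 \<Longrightarrow> (g0 has_real_derivative g1 t) (at t)"
  unfolding g0_def[abs_def] g1_def by (auto intro!: derivative_eq_intros sq0_deriv)

lemma g1_deriv: "t > 1 \<Longrightarrow> (g1 has_real_derivative g2 t) (at t)"
  unfolding g1_def[abs_def] g2_def
  by (auto intro!: derivative_eq_intros sq0_deriv sq1_deriv simp: field_simps power2_eq_square)

lemma g2_deriv: assumes t: "t > 1" shows "(g2 has_real_derivative g3 t) (at t)"
proof -
  have t0: "t > 0" using t by simp
  have 1: "((\<lambda>t. - sq0 t / t ^ 2) has_real_derivative - (sq1 t / t ^ 2) + 2 * sq0 t / t ^ 3) (at t)"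
    by (rule DERIV_cong[OF DERIV_divide[OF DERIV_minus[OF sq0_deriv[OF t0]] DERIV_pow]])
       (use t0 in \<open>simp_all add: field_simps power_numeral_reduce\<close>)
  have 2: "((\<lambda>t. 2 * sq1 t / t) has_real_derivative 2 * sq2 t / t - 2 * sq1 t / t ^ 2) (at t)"
    by (rule DERIV_cong[OF DERIV_divide[OF DERIV_cmult[OF sq1_deriv[OF t0]] DERIV_ident]])
       (use t0 in \<open>simp_all add: field_simps power2_eq_square\<close>)
  have 3: "((\<lambda>t. ln t * sq2 t) has_real_derivative sq2 t / t + ln t * sq3 t) (at t)"
    by (rule DERIV_cong[OF DERIV_mult[OF DERIV_ln sq2_deriv[OF t0]]]) (use t0 in \<open>simp_all add: divide_inverse\<close>)
  show ?thesis
    unfolding g2_def[abs_def]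
    by (rule DERIV_cong[OF DERIV_add[OF DERIV_add[OF 1 2] 3]]) (simp add: g3_def)
qed

lemma lf_deriv:
  assumes t: "t > 1" shows "(lf has_real_derivative h0 t) (at t)"
proof -
  have g: "g0 t > 0" using g0_ge_1[OF t] by simp
  have 1: "((\<lambda>t. ln t / 3) has_real_derivative 1 / (3 * t)) (at t)"
    by (rule DERIV_cong[OF DERIV_cdivide[OF DERIV_ln]]) (use t in \<open>simp_all add: field_simps\<close>)
  have 2: "((\<lambda>t. ln (g0 t)) has_real_derivative g1 t / g0 t) (at t)"
    by (rule DERIV_cong[OF DERIV_chain2[OF DERIV_ln[OF g] g0_deriv[OF t]]]) (simp add: divide_inverse mult.commute)
  show ?thesis unfolding lf_def[abs_def] h0_def by (rule DERIV_add[OF 1 2])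
qed

lemma gq_deriv:
  assumes t: "t > 1" shows "((\<lambda>t. g1 t / g0 t) has_real_derivative g2 t / g0 t - (g1 t / g0 t) ^ 2) (at t)"
    "((\<lambda>t. g2 t / g0 t) has_real_derivative g3 t / g0 t - (g1 t / g0 t) * (g2 t / g0 t)) (at t)"
proof -
  have g: "g0 t \<noteq> 0" using g0_ge_1[OF t] by simp
  show "((\<lambda>t. g1 t / g0 t) has_real_derivative g2 t / g0 t - (g1 t / g0 t) ^ 2) (at t)"
    by (rule DERIV_cong[OF DERIV_divide[OF g1_deriv[OF t] g0_deriv[OF t] g]]) (use g in \<open>simp add: field_simps power2_eq_square\<close>)
  show "((\<lambda>t. g2 t / g0 t) has_real_derivative g3 t / g0 t - (g1 t / g0 t) * (g2 t / g0 t)) (at t)"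
    by (rule DERIV_cong[OF DERIV_divide[OF g2_deriv[OF t] g0_deriv[OF t] g]]) (use g in \<open>simp add: field_simps\<close>)
qed

lemma h0_deriv:
  assumes t: "t > 1" shows "(h0 has_real_derivative h1 t) (at t)"
proof -
  have "((\<lambda>t. 1 / (3 * t)) has_real_derivative - 1 / (3 * t ^ 2)) (at t)"
    using t by (auto intro!: derivative_eq_intros simp: field_simps power2_eq_square)
  from DERIV_add[OF this gq_deriv(1)[OF t]] show ?thesis
    unfolding h0_def[abs_def] h1_def by (rule DERIV_cong) simp
qed

lemma h1_deriv:
  assumes t: "t > 1" shows "(h1 has_real_derivative h2 t) (at t)"
proof -
  have "((\<lambda>t. - 1 / (3 * t ^ 2)) has_real_derivative 2 / (3 * t ^ 3)) (at t)"
    using t by (auto intro!: derivative_eq_intros simp: field_simps power_numeral_reduce)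
  from DERIV_diff[OF DERIV_add[OF this gq_deriv(2)[OF t]] DERIV_power[OF gq_deriv(1)[OF t], of 2]] show ?thesis
    unfolding h1_def[abs_def] h2_def by (rule DERIV_cong) (simp add: algebra_simps power2_eq_square power3_eq_cube)
qed

lemma qf_deriv:
  assumes t: "t > 1" shows "(qf has_real_derivative qf1 t) (at t)"
  unfolding qf_def[abs_def]
  by (rule DERIV_cong[OF DERIV_add[OF DERIV_mult[OF h0_deriv[OF t] DERIV_cos] DERIV_cdivide[OF DERIV_mult[OF h1_deriv[OF t] DERIV_sin]]]])
     (simp add: qf1_def field_simps)

lemma pf_deriv:
  assumes t: "t > 1" shows "(pf has_real_derivative pf1 t) (at t)"
  unfolding pf_def[abs_def]
  by (rule DERIV_cong[OF DERIV_mult[OF qf_deriv[OF t] DERIV_cos]]) (simp add: pf1_def)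

lemma amp_pos: "amp t > 0" by (simp add: amp_def)

text \<open>The double-angle formulas reveal the factor cos t: h0/2 + h0 cos(2t)/2 is h0 cos^2 t,
  and h1 sin(2t)/4 is h1 sin t cos t / 2. This is the purpose of the oscillating term in the
  exponent of \<open>amp\<close>.\<close>

lemma amp_deriv:
  assumes t: "t > 1" shows "(amp has_real_derivative amp t * pf t) (at t)"
proof -
  have s: "((\<lambda>t. sin (2 * t)) has_real_derivative cos (2 * t) * 2) (at t)"
    by (auto intro!: derivative_eq_intros)
  have "(amp has_real_derivative amp t * (h0 t / 2 + (h1 t * sin (2 * t) + cos (2 * t) * 2 * h0 t) / 4)) (at t)"
    unfolding amp_def[abs_def]
    by (rule DERIV_chain2[OF DERIV_exp DERIV_add[OF DERIV_cdivide[OF lf_deriv[OF t]] DERIV_cdivide[OF DERIV_mult[OF h0_deriv[OF t] s]]]])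
  moreover have "h0 t / 2 + (h1 t * sin (2 * t) + cos (2 * t) * 2 * h0 t) / 4 = pf t"
    unfolding pf_def qf_def sin_double cos_double_cos by (simp add: field_simps power2_eq_square)
  ultimately show ?thesis by simp
qed

definition y1 :: "real \<Rightarrow> real" where "y1 t = amp t * cos t"
definition z1 :: "real \<Rightarrow> real" where "z1 t = amp t * (pf t * cos t - sin t)"

text \<open>In y1'' the only term without an evident factor cos t is -2 amp pf sin t; since
  \<open>pf\<close> is \<open>qf\<close> times cos t, it too is a multiple of \<open>y1\<close>, and
  no division by cos t takes place.\<close>

lemma y1_deriv:
  assumes t: "t > 1" shows "(y1 has_real_derivative z1 t) (at t)" "(z1 has_real_derivative - (1 + phi t) * y1 t) (at t)"
proof -
  show "(y1 has_real_derivative z1 t) (at t)"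
    unfolding y1_def[abs_def] by (rule DERIV_cong[OF DERIV_mult[OF amp_deriv[OF t] DERIV_cos]]) (simp add: z1_def algebra_simps)
  have p: "pf t = qf t * cos t" by (simp add: pf_def)
  show "(z1 has_real_derivative - (1 + phi t) * y1 t) (at t)"
    unfolding z1_def[abs_def]
    by (rule DERIV_cong[OF DERIV_mult[OF amp_deriv[OF t] DERIV_diff[OF DERIV_mult[OF pf_deriv[OF t] DERIV_cos] DERIV_sin]]])
       (simp add: y1_def phi_def p power2_eq_square algebra_simps)
qed

section \<open>The second solution by reduction of order\<close>

lemma second_solution_algebra3:
  fixes y z v C w s c p :: real
  shows "y * (z * v + C / w) - z * (y * v + s / w) = (y / w) * C - (z / w) * s"
    "c * (c + p * s) - (p * c - s) * s = s\<^sup>2 + c\<^sup>2"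
  by (simp_all add: algebra_simps power2_eq_square)

lemma second_solution_algebra:
  fixes w p q c s p1 :: real
  assumes w: "w \<noteq> 0" and p: "p = q * c"
  shows "w * c * (2 * q * s / w\<^sup>2) + (c * w - s * (w * p)) / (w * w) = (c + p * s) / w"
    "w * (p * c - s) * (2 * q * s / w\<^sup>2) + ((- s + (p1 * s + c * p)) * w - (c + p * s) * (w * p)) / (w * w)
      = - (1 + (2 * q * s - p\<^sup>2 - p1)) * (s / w)"
proof -
  have 1: "w * A * (B / w\<^sup>2) = A * B / w" for A B using w by (simp add: power2_eq_square)
  have 2: "(A * w - B * (w * p)) / (w * w) = (A - B * p) / w" for A B
  proof -
    have "(A * w - B * (w * p)) / (w * w) = (w * (A - B * p)) / (w * w)" by (simp add: algebra_simps)
    then show ?thesis using w by simp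
  qed
  have "c * (2 * q * s) + (c - s * p) = c + p * s" unfolding p by (simp add: algebra_simps)
  then show "w * c * (2 * q * s / w\<^sup>2) + (c * w - s * (w * p)) / (w * w) = (c + p * s) / w"
    unfolding 1 2 by (simp add: add_divide_distrib[symmetric])
  have "(p * c - s) * (2 * q * s) + ((- s + (p1 * s + c * p)) - (c + p * s) * p) = - (1 + (2 * q * s - p\<^sup>2 - p1)) * s"
    unfolding p by (simp add: algebra_simps power2_eq_square)
  then have "((p * c - s) * (2 * q * s) + ((- s + (p1 * s + c * p)) - (c + p * s) * p)) / w = - (1 + (2 * q * s - p\<^sup>2 - p1)) * s / w"
    by (rule arg_cong)
  then show "w * (p * c - s) * (2 * q * s / w\<^sup>2) + ((- s + (p1 * s + c * p)) * w - (c + p * s) * (w * p)) / (w * w)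
      = - (1 + (2 * q * s - p\<^sup>2 - p1)) * (s / w)"
    unfolding 1 2 by (simp only: add_divide_distrib times_divide_eq_right)
qed

text \<open>Reduction of order suggests y1 times an integral of 1 / y1^2, which is singular at the
  zeros of cos t. The singularity integrates explicitly: 1 / (amp cos t)^2 is the derivative of tan
  t / amp^2 plus 2 qf sin t / amp^2. The explicit part, multiplied by y1, is sin t / amp, and
  \<open>v\<close> is an antiderivative of the regular part.\<close>

lemma second_solution_deriv1:
  assumes t: "t > 1" and v: "(v has_real_derivative 2 * qf t * sin t / (amp t)\<^sup>2) (at t)"
  shows "((\<lambda>t. y1 t * v t + sin t / amp t) has_real_derivative z1 t * v t + (cos t + pf t * sin t) / amp t) (at t)"
proof -
  have w: "amp t \<noteq> 0" using amp_pos[of t] by simp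
  have p: "pf t = qf t * cos t" by (simp add: pf_def)
  have 1: "2 * qf t * sin t / (amp t)\<^sup>2 * y1 t + (cos t * amp t - sin t * (amp t * pf t)) / (amp t * amp t) = (cos t + pf t * sin t) / amp t"
    using second_solution_algebra(1)[OF w p, of "sin t"] by (simp only: y1_def mult.commute)
  show "((\<lambda>t. y1 t * v t + sin t / amp t) has_real_derivative z1 t * v t + (cos t + pf t * sin t) / amp t) (at t)"
    by (rule DERIV_cong[OF DERIV_add[OF DERIV_mult[OF y1_deriv(1)[OF t] v] DERIV_divide[OF DERIV_sin amp_deriv[OF t] w]]])
       (simp only: add.assoc 1)
qed

lemma second_solution_deriv2:
  assumes t: "t > 1" and v: "(v has_real_derivative 2 * qf t * sin t / (amp t)\<^sup>2) (at t)"
  shows "((\<lambda>t. z1 t * v t + (cos t + pf t * sin t) / amp t) has_real_derivative - (1 + phi t) * (y1 t * v t + sin t / amp t)) (at t)"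
proof -
  have w: "amp t \<noteq> 0" using amp_pos[of t] by simp
  have p: "pf t = qf t * cos t" by (simp add: pf_def)
  have "2 * qf t * sin t / (amp t)\<^sup>2 * z1 t + ((- sin t + (pf1 t * sin t + cos t * pf t)) * amp t - (cos t + pf t * sin t) * (amp t * pf t)) / (amp t * amp t)
      = - (1 + phi t) * (sin t / amp t)"
    using second_solution_algebra(2)[OF w p, of "sin t" "pf1 t"] unfolding phi_def by (simp only: z1_def mult.commute)
  note 2 = this[unfolded mult.assoc]
  show "((\<lambda>t. z1 t * v t + (cos t + pf t * sin t) / amp t) has_real_derivative - (1 + phi t) * (y1 t * v t + sin t / amp t)) (at t)"
    by (rule DERIV_cong[OF DERIV_add[OF DERIV_mult[OF y1_deriv(2)[OF t] v]
          DERIV_divide[OF DERIV_add[OF DERIV_cos DERIV_mult[OF pf_deriv[OF t] DERIV_sin]] amp_deriv[OF t] w]]])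
       (simp only: add.assoc distrib_left mult.assoc 2)
qed

text \<open>The terms with \<open>v\<close> cancel, so the Wronskian is 1 exactly, whatever constant
  of integration \<open>v\<close> has.\<close>

lemma second_solution_wronskian:
  shows "y1 t * (z1 t * v t + (cos t + pf t * sin t) / amp t) - z1 t * (y1 t * v t + sin t / amp t) = 1"
proof -
  have w: "amp t \<noteq> 0" using amp_pos[of t] by simp
  have y: "y1 t / amp t = cos t" using w by (simp add: y1_def)
  have z: "z1 t / amp t = pf t * cos t - sin t" using w by (simp add: z1_def)
  have "y1 t * (z1 t * v t + (cos t + pf t * sin t) / amp t) - z1 t * (y1 t * v t + sin t / amp t)
      = cos t * (cos t + pf t * sin t) - (pf t * cos t - sin t) * sin t"
    using second_solution_algebra3(1)[of "y1 t" "z1 t" "v t" "cos t + pf t * sin t" "amp t" "sin t"] unfolding y z .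
  then show "y1 t * (z1 t * v t + (cos t + pf t * sin t) / amp t) - z1 t * (y1 t * v t + sin t / amp t) = 1"
    unfolding second_solution_algebra3(2) sin_cos_squared_add .
qed

section \<open>Holomorphic extension of the perturbation\<close>

lemma hx_sq: "hx sq0" "hx sq1" "hx sq2" "hx sq3"
proof -
  have nz: "c * sqrt t ^ n \<noteq> 0" if "t > 1" "c \<noteq> 0" for c t and n :: nat using that by simp
  have a: "hx (\<lambda>t. c * f (2 * sqrt t) / (d * sqrt t ^ n))" if "hx (\<lambda>t. f (2 * sqrt t))" "d \<noteq> 0" for c d f and n :: nat
    by (rule hx_divide[OF hx_mult[OF hx_const that(1)] hx_mult[OF hx_const hx_power[OF hx_sqrt]] nz[OF _ that(2)]])
  have m: "hx (\<lambda>t. 2 * sqrt t)" by (rule hx_mult[OF hx_const hx_sqrt])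
  note s = a[of sin, OF hx_sin[OF m]] and c = a[of cos, OF hx_cos[OF m]]
  show "hx sq0" unfolding sq0_def[abs_def] by (rule hx_power[OF hx_sin[OF hx_sqrt]])
  show "hx sq1" using s[of 2 1 1] by (simp add: sq1_def[abs_def])
  show "hx sq2" using hx_diff[OF c[of 2 1 2] s[of 4 1 3]] by (simp add: sq2_def[abs_def])
  show "hx sq3" using hx_add[OF hx_diff[OF s[of 2 "-1" 3] c[of 4 3 4]] s[of 8 3 5]] by (simp add: sq3_def[abs_def])
qed

lemma hx_g: "hx g0" "hx g1" "hx g2" "hx g3"
proof -
  have d: "hx (\<lambda>t. c * f t / t ^ n)" if "hx f" for c f and n :: nat
    by (rule hx_divide[OF hx_mult[OF hx_const that] hx_power[OF hx_id]]) simp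
  show "hx g0" unfolding g0_def[abs_def] by (rule hx_add[OF hx_const hx_mult[OF hx_ln hx_sq(1)]])
  show "hx g1" using hx_add[OF d[OF hx_sq(1), of 1 1] hx_mult[OF hx_ln hx_sq(2)]] by (simp add: g1_def[abs_def])
  show "hx g2"
    using hx_add[OF hx_add[OF d[OF hx_sq(1), of "-1" 2] d[OF hx_sq(2), of 2 1]] hx_mult[OF hx_ln hx_sq(3)]]
    by (simp add: g2_def[abs_def])
  show "hx g3"
    using hx_add[OF hx_add[OF hx_diff[OF d[OF hx_sq(1), of 2 3] d[OF hx_sq(2), of 3 2]] d[OF hx_sq(3), of 3 1]] hx_mult[OF hx_ln hx_sq(4)]]
    by (simp add: g3_def[abs_def])
qed

lemma hx_h: "hx h0" "hx h1" "hx h2"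
proof -
  have d: "hx (\<lambda>t. c / (3 * t ^ n))" for c and n :: nat
    by (rule hx_divide[OF hx_const hx_mult[OF hx_const hx_power[OF hx_id]]]) simp
  have g: "g0 t \<noteq> 0" if "t > 1" for t using g0_ge_1[OF that] by simp
  note G = hx_divide[OF hx_g(2,1) g] hx_divide[OF hx_g(3,1) g] hx_divide[OF hx_g(4,1) g]
  show "hx h0" using hx_add[OF d[of 1 1] G(1)] by (simp add: h0_def[abs_def])
  show "hx h1" using hx_diff[OF hx_add[OF d[of "-1" 2] G(2)] hx_power[OF G(1), of 2]] by (simp only: h1_def[abs_def])
  show "hx h2" unfolding h2_def[abs_def]
    by (rule hx_add[OF hx_diff[OF hx_add[OF d G(3)] hx_mult[OF hx_mult[OF hx_const G(1)] G(2)]] hx_mult[OF hx_const hx_power[OF G(1)]]])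
qed

lemma hx_phi: "hx phi"
proof -
  note sc = hx_sin[OF hx_id] hx_cos[OF hx_id]
  have half: "hx f \<Longrightarrow> hx (\<lambda>t. f t / 2)" for f by (rule hx_divide[OF _ hx_const]) simp_all
  have q: "hx qf" unfolding qf_def[abs_def] by (rule hx_add[OF hx_mult[OF hx_h(1) sc(2)] half[OF hx_mult[OF hx_h(2) sc(1)]]])
  have q1: "hx qf1" unfolding qf1_def[abs_def]
    by (rule hx_add[OF hx_mult[OF hx_mult[OF hx_const hx_h(2)] sc(2)] hx_mult[OF hx_diff[OF half[OF hx_h(3)] hx_h(1)] sc(1)]])
  have p: "hx pf" unfolding pf_def[abs_def] by (rule hx_mult[OF q sc(2)])
  have p1: "hx pf1" unfolding pf1_def[abs_def] by (rule hx_diff[OF hx_mult[OF q1 sc(2)] hx_mult[OF q sc(1)]])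
  show ?thesis unfolding phi_def[abs_def]
    by (rule hx_diff[OF hx_diff[OF hx_mult[OF hx_mult[OF hx_const q] sc(1)] hx_power[OF p]] p1])
qed

section \<open>Decay estimates in powers of ln t / sqrt t\<close>

definition sm :: "real \<Rightarrow> real" where "sm t = ln t / sqrt t"

lemma exp1_gt_2: "exp 1 > (2::real)"
  using exp_lower_Taylor_quadratic[of 1] by simp

lemma exp1_bounds:
  assumes t: "t \<ge> exp (1::real)"
  shows "t > 2" "ln t \<ge> 1" "sqrt t \<ge> 1" "0 < 1 / sqrt t" "1 / sqrt t \<le> 1" "1 / sqrt t \<le> sm t" "sm t > 0" "sm t \<le> 2"
    "1 / t = (1 / sqrt t)\<^sup>2"
proof -
  show t2: "t > 2" using t exp1_gt_2 by linarith
  show l: "ln t \<ge> 1" using ln_mono[OF t] t2 by simp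
  show r: "sqrt t \<ge> 1" using t2 by simp
  then have r0: "sqrt t > 0" by linarith
  show "0 < 1 / sqrt t" using r0 by simp
  show "1 / sqrt t \<le> 1" using r r0 by (simp add: divide_le_eq)
  show e: "1 / sqrt t \<le> sm t" unfolding sm_def using l r0 by (intro divide_right_mono) auto
  show "sm t > 0" unfolding sm_def using l r0 by (intro divide_pos_pos) linarith+
  have "ln t = 2 * ln (sqrt t)" using t2 by (simp add: ln_sqrt)
  also have "\<dots> \<le> 2 * (sqrt t - 1)" using ln_le_minus_one[OF r0] by simp
  also have "\<dots> \<le> 2 * sqrt t" by simp
  finally have "ln t \<le> 2 * sqrt t" .
  then show "sm t \<le> 2" unfolding sm_def using r0 by (simp add: divide_le_eq)
  show "1 / t = (1 / sqrt t)\<^sup>2" using t2 by (simp add: power_divide)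
qed

lemma abs_mult_le: "\<bar>a\<bar> \<le> A \<Longrightarrow> \<bar>b\<bar> \<le> B \<Longrightarrow> \<bar>a * b\<bar> \<le> A * (B::real)"
  by (simp add: abs_mult mult_mono')

lemma abs_add_le: "\<bar>a\<bar> \<le> A \<Longrightarrow> \<bar>b\<bar> \<le> B \<Longrightarrow> \<bar>a + b\<bar> \<le> A + (B::real)"
  by linarith

lemma abs_diff_le: "\<bar>a\<bar> \<le> A \<Longrightarrow> \<bar>b\<bar> \<le> B \<Longrightarrow> \<bar>a - b\<bar> \<le> A + (B::real)"
  by linarith

lemma abs_power_le: "\<bar>a\<bar> \<le> A \<Longrightarrow> \<bar>a ^ n\<bar> \<le> (A::real) ^ n"
  by (simp add: power_abs power_mono)

lemma sq_bounds:
  assumes t: "t \<ge> exp 1"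
  shows "\<bar>sq0 t\<bar> \<le> 1" "\<bar>sq1 t\<bar> \<le> 1 / sqrt t" "\<bar>sq2 t\<bar> \<le> (1 / sqrt t) ^ 2" "\<bar>sq3 t\<bar> \<le> 2 * (1 / sqrt t) ^ 3"
proof -
  define e where "e = 1 / sqrt t"
  have e: "0 < e" "e \<le> 1" using exp1_bounds[OF t] by (auto simp: e_def)
  define s c where "s = sin (2 * sqrt t)" and "c = cos (2 * sqrt t)"
  have s: "\<bar>s\<bar> \<le> 1" and c: "\<bar>c\<bar> \<le> 1" by (simp_all add: s_def c_def)
  have k: "e ^ Suc n \<le> e ^ n" for n using power_Suc_le_self[of e n] e by simp
  have se: "\<bar>s * e ^ n\<bar> \<le> e ^ n" "\<bar>c * e ^ n\<bar> \<le> e ^ n" for n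
    using abs_mult_le[OF s, of "e ^ n" "e ^ n"] abs_mult_le[OF c, of "e ^ n" "e ^ n"] e by simp_all
  have p: "0 < e ^ n" for n using e by simp
  have "sqrt t > 0" using exp1_bounds(3)[OF t] by linarith
  then have 1: "sq1 t = (s * e ^ 1) / 2" "sq2 t = c * e ^ 2 / 2 - s * e ^ 3 / 4"
    "sq3 t = - (s * e ^ 3) / 2 - 3 * (c * e ^ 4) / 4 + 3 * (s * e ^ 5) / 8"
    by (simp_all add: sq1_def sq2_def sq3_def s_def c_def e_def power_divide)
  show "\<bar>sq0 t\<bar> \<le> 1" by (simp add: sq0_def power_le_one_iff abs_square_le_1)
  show "\<bar>sq1 t\<bar> \<le> 1 / sqrt t" unfolding e_def[symmetric] 1 using se(1)[of 1] e by simp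
  show "\<bar>sq2 t\<bar> \<le> (1 / sqrt t) ^ 2" unfolding e_def[symmetric] 1
    using se(2)[of 2] se(1)[of 3] k[of 2] p[of 2] p[of 3] by simp
  show "\<bar>sq3 t\<bar> \<le> 2 * (1 / sqrt t) ^ 3" unfolding e_def[symmetric] 1
    using se(1)[of 3] se(2)[of 4] se(1)[of 5] k[of 3] k[of 4] p[of 3] p[of 4] p[of 5] by simp
qed

text \<open>Every derivative of \<open>sq0\<close> gains 1 / sqrt t and differentiating the
  logarithm gains 1 / t. No term has more than one logarithm, so estimating by powers of
  \<open>sm\<close> is generous but keeps all orders in one parameter.\<close>

lemma g_bounds:
  assumes t: "t \<ge> exp 1"
  shows "\<bar>g1 t\<bar> \<le> 2 * sm t" "\<bar>g2 t\<bar> \<le> 4 * sm t ^ 2" "\<bar>g3 t\<bar> \<le> 10 * sm t ^ 3"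
proof -
  define e where "e = 1 / sqrt t"
  define X where "X = sm t"
  define L where "L = ln t"
  have e: "0 < e" "e \<le> 1" "e \<le> X" "0 < X" and L: "L \<ge> 1" and et: "1 / t = e ^ 2"
    using exp1_bounds[OF t] by (auto simp: e_def X_def L_def)
  have XL: "X = L * e" by (simp add: X_def sm_def L_def e_def)
  have q: "\<bar>sq0 t\<bar> \<le> 1" "\<bar>sq1 t\<bar> \<le> e" "\<bar>sq2 t\<bar> \<le> e ^ 2" "\<bar>sq3 t\<bar> \<le> 2 * e ^ 3"
    using sq_bounds[OF t] by (auto simp: e_def)
  have Lb: "\<bar>L\<bar> \<le> L" using L by simp
  have LL: "L \<le> L ^ 2" "L \<le> L ^ 3" using L power_increasing[of 1 2 L] power_increasing[of 1 3 L] by simp_all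
  have t1: "1 / t ^ n = (e ^ 2) ^ n" for n unfolding et[symmetric] by (simp add: power_divide)
  have em: "e ^ n \<le> e ^ m" if "m \<le> n" for n m using e that by (simp add: power_decreasing)
  have eX: "e ^ n \<le> X ^ n" for n using e by (simp add: power_mono)
  have ab: "\<bar>(e ^ 2) ^ n\<bar> \<le> (e ^ 2) ^ n" for n by simp
  have "g1 t = sq0 t * (e ^ 2) ^ 1 + L * sq1 t" using et by (simp add: g1_def L_def divide_inverse)
  then have "\<bar>g1 t\<bar> \<le> 1 * (e ^ 2) ^ 1 + L * e"
    by (simp only:) (intro abs_add_le abs_mult_le q Lb ab)
  also have "\<dots> \<le> 2 * X" unfolding XL[symmetric] using em[of 1 2] e(3) by simp
  finally show "\<bar>g1 t\<bar> \<le> 2 * sm t" by (simp add: X_def)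
  have "g2 t = 2 * (sq1 t * (e ^ 2) ^ 1) - sq0 t * (e ^ 2) ^ 2 + L * sq2 t"
    unfolding t1[symmetric] by (simp add: g2_def L_def)
  moreover have "\<bar>2 * (sq1 t * (e ^ 2) ^ 1) - sq0 t * (e ^ 2) ^ 2 + L * sq2 t\<bar> \<le> 2 * (e * (e ^ 2) ^ 1) + 1 * (e ^ 2) ^ 2 + L * e ^ 2"
    by (intro abs_add_le abs_diff_le abs_mult_le q Lb ab) simp
  moreover have "2 * (e * (e ^ 2) ^ 1) + 1 * (e ^ 2) ^ 2 \<le> 3 * X ^ 2"
    using em[of 2 3] em[of 2 4] eX[of 2] by (simp add: power_numeral_reduce)
  moreover have "L * e ^ 2 \<le> X ^ 2" unfolding XL power_mult_distrib by (intro mult_right_mono LL) auto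
  ultimately show "\<bar>g2 t\<bar> \<le> 4 * sm t ^ 2" unfolding X_def[symmetric] by linarith
  have "g3 t = 2 * (sq0 t * (e ^ 2) ^ 3) - 3 * (sq1 t * (e ^ 2) ^ 2) + 3 * (sq2 t * (e ^ 2) ^ 1) + L * sq3 t"
    unfolding t1[symmetric] by (simp add: g3_def L_def)
  moreover have "\<bar>2 * (sq0 t * (e ^ 2) ^ 3) - 3 * (sq1 t * (e ^ 2) ^ 2) + 3 * (sq2 t * (e ^ 2) ^ 1) + L * sq3 t\<bar>
      \<le> 2 * (1 * (e ^ 2) ^ 3) + 3 * (e * (e ^ 2) ^ 2) + 3 * (e ^ 2 * (e ^ 2) ^ 1) + L * (2 * e ^ 3)"
    by (intro abs_add_le abs_diff_le abs_mult_le q Lb ab) simp_all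
  moreover have "2 * (1 * (e ^ 2) ^ 3) + 3 * (e * (e ^ 2) ^ 2) + 3 * (e ^ 2 * (e ^ 2) ^ 1) \<le> 8 * X ^ 3"
    using em[of 3 6] em[of 3 5] em[of 3 4] eX[of 3] by (simp add: power_numeral_reduce)
  moreover have "L * e ^ 3 \<le> X ^ 3" unfolding XL power_mult_distrib using e by (intro mult_right_mono LL) auto
  ultimately show "\<bar>g3 t\<bar> \<le> 10 * sm t ^ 3" unfolding X_def[symmetric] by linarith
qed

lemma h_bounds:
  assumes t: "t \<ge> exp 1"
  shows "\<bar>h0 t\<bar> \<le> 3 * sm t" "\<bar>h1 t\<bar> \<le> 9 * sm t ^ 2" "\<bar>h2 t\<bar> \<le> 60 * sm t ^ 3"
proof -
  define X where "X = sm t"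
  have X: "X > 0" "1 / t \<le> X ^ 2" "X \<le> 2" and t2: "t > 2" and et: "1 / t \<le> X"
  proof -
    have a: "0 < 1 / sqrt t" "1 / sqrt t \<le> X" "1 / sqrt t \<le> 1" using exp1_bounds[OF t] by (auto simp: X_def)
    show "X > 0" "X \<le> 2" "t > 2" using exp1_bounds[OF t] by (auto simp: X_def)
    show "1 / t \<le> X ^ 2" unfolding exp1_bounds(9)[OF t] using a by (intro power_mono) auto
    have "(1 / sqrt t)\<^sup>2 \<le> 1 / sqrt t" using a power_decreasing[of 1 2 "1 / sqrt t"] by simp
    then show "1 / t \<le> X" unfolding exp1_bounds(9)[OF t] using a by linarith
  qed
  have g0: "g0 t \<ge> 1" using g0_ge_1[of t] t2 by simp
  have dv: "\<bar>a / g0 t\<bar> \<le> A" if "\<bar>a\<bar> \<le> A" for a A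
  proof -
    have "\<bar>a / g0 t\<bar> = \<bar>a\<bar> / g0 t" using g0 by simp
    also have "\<dots> \<le> \<bar>a\<bar> / 1" using g0 by (intro divide_left_mono) auto
    finally show ?thesis using that by simp
  qed
  have g: "\<bar>g1 t / g0 t\<bar> \<le> 2 * X" "\<bar>g2 t / g0 t\<bar> \<le> 4 * X ^ 2" "\<bar>g3 t / g0 t\<bar> \<le> 10 * X ^ 3"
    unfolding X_def by (rule dv, rule g_bounds[OF t])+
  have t0: "0 < 1 / t" using t2 by simp
  have ta: "\<bar>1 / t\<bar> \<le> X" "\<bar>1 / t\<bar> \<le> X ^ 2" using X et t0 by simp_all
  have tt: "\<bar>(1 / t) * (1 / t)\<bar> \<le> X ^ 2"
  proof -
    have "\<bar>(1 / t) * (1 / t)\<bar> \<le> 1 * X ^ 2" by (rule abs_mult_le[OF _ ta(2)]) (use t2 in simp)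
    then show ?thesis by simp
  qed
  have t3: "\<bar>(1 / t) * ((1 / t) * (1 / t))\<bar> \<le> X * X ^ 2" by (rule abs_mult_le[OF ta(1) tt])
  have "h0 t = (1 / 3) * (1 / t) + g1 t / g0 t" by (simp add: h0_def)
  moreover have "\<bar>(1 / 3) * (1 / t) + g1 t / g0 t\<bar> \<le> (1 / 3) * X + 2 * X"
    by (intro abs_add_le abs_mult_le g ta) simp
  ultimately show "\<bar>h0 t\<bar> \<le> 3 * sm t" using X unfolding X_def[symmetric] by linarith
  have "h1 t = - (1 / 3) * ((1 / t) * (1 / t)) + g2 t / g0 t - (g1 t / g0 t) ^ 2" by (simp add: h1_def power2_eq_square)
  moreover have "\<bar>- (1 / 3) * ((1 / t) * (1 / t)) + g2 t / g0 t - (g1 t / g0 t) ^ 2\<bar> \<le> (1 / 3) * X ^ 2 + 4 * X ^ 2 + (2 * X) ^ 2"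
    by (intro abs_add_le abs_diff_le abs_mult_le abs_power_le g tt) simp
  moreover have "(1 / 3) * X ^ 2 + 4 * X ^ 2 + (2 * X) ^ 2 \<le> 9 * X ^ 2" by (simp add: power_mult_distrib)
  ultimately show "\<bar>h1 t\<bar> \<le> 9 * sm t ^ 2" unfolding X_def[symmetric] by linarith
  have "h2 t = (2 / 3) * ((1 / t) * ((1 / t) * (1 / t))) + g3 t / g0 t - 3 * (g1 t / g0 t) * (g2 t / g0 t) + 2 * (g1 t / g0 t) ^ 3"
    by (simp add: h2_def power3_eq_cube)
  moreover have "\<bar>(2 / 3) * ((1 / t) * ((1 / t) * (1 / t))) + g3 t / g0 t - 3 * (g1 t / g0 t) * (g2 t / g0 t) + 2 * (g1 t / g0 t) ^ 3\<bar>
      \<le> (2 / 3) * (X * X ^ 2) + 10 * X ^ 3 + 3 * (2 * X) * (4 * X ^ 2) + 2 * (2 * X) ^ 3"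
    by (intro abs_add_le abs_diff_le abs_mult_le abs_power_le g t3) simp_all
  moreover have "(2 / 3) * (X * X ^ 2) + 10 * X ^ 3 + 3 * (2 * X) * (4 * X ^ 2) + 2 * (2 * X) ^ 3 \<le> 60 * X ^ 3"
    using X by (simp add: power_mult_distrib power3_eq_cube power2_eq_square)
  ultimately show "\<bar>h2 t\<bar> \<le> 60 * sm t ^ 3" unfolding X_def[symmetric] by linarith
qed

text \<open>Since \<open>sm\<close> is at most 2, higher powers reduce to multiples of
  \<open>sm\<close>, and 24 is twice 12. The numerical constants are crude on purpose; only the
  first order in \<open>sm\<close> and boundedness matter later.\<close>

lemma pq_bounds:
  assumes t: "t \<ge> exp 1"
  shows "\<bar>qf t\<bar> \<le> 12 * sm t" "\<bar>qf t\<bar> \<le> 24" "\<bar>pf t\<bar> \<le> 12 * sm t" "\<bar>pf t\<bar> \<le> 24" "\<bar>phi t\<bar> \<le> 1000 * sm t" "\<bar>h0 t\<bar> \<le> 6"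
proof -
  define X where "X = sm t"
  have X: "X > 0" "X \<le> 2" using exp1_bounds[OF t] by (auto simp: X_def)
  have X2: "X ^ 2 \<le> 2 * X" using X by (simp add: power2_eq_square)
  have "X ^ 3 = X * X ^ 2" by (simp add: power3_eq_cube power2_eq_square)
  also have "\<dots> \<le> 2 * (2 * X)" using X X2 by (intro mult_mono) auto
  finally have X3: "X ^ 3 \<le> 4 * X" by simp
  have h: "\<bar>h0 t\<bar> \<le> 3 * X" "\<bar>h1 t\<bar> \<le> 18 * X" "\<bar>h2 t\<bar> \<le> 240 * X"
    using h_bounds[OF t] X2 X3 unfolding X_def[symmetric] by linarith+
  have sc: "\<bar>sin t\<bar> \<le> 1" "\<bar>cos t\<bar> \<le> 1" by simp_all
  have "qf t = h0 t * cos t + (1 / 2) * (h1 t * sin t)" by (simp add: qf_def)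
  moreover have "\<bar>h0 t * cos t + (1 / 2) * (h1 t * sin t)\<bar> \<le> 3 * X * 1 + (1 / 2) * (18 * X * 1)"
    by (intro abs_add_le abs_mult_le h sc) simp
  ultimately have q: "\<bar>qf t\<bar> \<le> 12 * X" by linarith
  then show "\<bar>qf t\<bar> \<le> 12 * sm t" by (simp add: X_def)
  show q24: "\<bar>qf t\<bar> \<le> 24" using q X by linarith
  have "\<bar>qf t * cos t\<bar> \<le> 12 * X * 1" by (rule abs_mult_le[OF q sc(2)])
  then have p: "\<bar>pf t\<bar> \<le> 12 * X" by (simp add: pf_def)
  then show "\<bar>pf t\<bar> \<le> 12 * sm t" by (simp add: X_def)
  show p24: "\<bar>pf t\<bar> \<le> 24" using p X by linarith
  have "qf1 t = 3 / 2 * h1 t * cos t + ((1 / 2) * h2 t - h0 t) * sin t" by (simp add: qf1_def)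
  also have "\<bar>\<dots>\<bar> \<le> 3 / 2 * (18 * X) * 1 + ((1 / 2) * (240 * X) + 3 * X) * 1"
    by (intro abs_add_le abs_mult_le abs_diff_le h sc) simp_all
  also have "\<dots> = 150 * X" by simp
  finally have q1: "\<bar>qf1 t\<bar> \<le> 150 * X" .
  have "phi t = 2 * qf t * sin t - pf t * pf t - (qf1 t * cos t - qf t * sin t)" by (simp add: phi_def pf1_def power2_eq_square)
  moreover have "\<bar>2 * qf t * sin t - pf t * pf t - (qf1 t * cos t - qf t * sin t)\<bar>
      \<le> 2 * (12 * X) * 1 + 24 * (12 * X) + (150 * X * 1 + 12 * X * 1)"
    by (intro abs_add_le abs_mult_le abs_diff_le q q1 p p24 sc) simp
  ultimately show "\<bar>phi t\<bar> \<le> 1000 * sm t" using X unfolding X_def[symmetric] by linarith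
  show "\<bar>h0 t\<bar> \<le> 6" using h(1) X by linarith
qed

lemma phi_tendsto_0: "(phi \<longlongrightarrow> 0) at_top"
proof (rule Lim_null_comparison)
  show "\<forall>\<^sub>F t in at_top. norm (phi t) \<le> 1000 * sm t"
    using eventually_ge_at_top[of "exp 1"] by eventually_elim (use pq_bounds(5) in simp)
  show "((\<lambda>t. 1000 * sm t) \<longlongrightarrow> 0) at_top" unfolding sm_def by real_asymp
qed

lemma f_rate_eq_exp_lf: "t \<ge> exp 1 \<Longrightarrow> f_rate t = exp (lf t)"
proof -
  assume t: "t \<ge> exp 1"
  have "t > 0" "g0 t > 0" using exp1_bounds(1)[OF t] g0_ge_1[of t] by auto
  then show ?thesis by (simp add: f_rate_def lf_def exp_add powr_def g0_def sq0_def)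
qed

lemma f_rate_ge_powr:
  assumes t: "t \<ge> exp 1"
  shows "f_rate t \<ge> t powr (1/3)" "f_rate t \<ge> 1"
proof -
  have g: "1 + ln t * (sin (sqrt t))\<^sup>2 \<ge> 1" using exp1_bounds(2)[OF t] by simp
  have "t powr (1/3) * 1 \<le> t powr (1/3) * (1 + ln t * (sin (sqrt t))\<^sup>2)"
    by (intro mult_left_mono g) simp
  then show f: "f_rate t \<ge> t powr (1/3)" by (simp add: f_rate_def)
  have "t powr (1/3) \<ge> 1" using exp1_bounds(1)[OF t] by (intro ge_one_powr_ge_zero) auto
  then show "f_rate t \<ge> 1" using f by linarith
qed

text \<open>In amp^2 the oscillating correction of the exponent is h0 sin(2t)/2, bounded by 3
  because \<bar>h0\<bar> is at most 6. Hence amp^2 and \<open>f_rate\<close> agree up to the factor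
  exp 3. As \<open>f_rate\<close> is at least 1, the reciprocal of \<open>amp\<close> is then
  controlled by \<open>amp\<close>.\<close>

lemma amp_bounds:
  assumes t: "t \<ge> exp 1"
  shows "f_rate t \<le> exp 3 * (amp t)\<^sup>2" "(amp t)\<^sup>2 \<le> exp 3 * f_rate t" "1 / amp t \<le> exp 3 * amp t"
    "1 / (amp t)\<^sup>2 \<le> exp 3 / t powr (1/3)"
proof -
  have "\<bar>h0 t * sin (2 * t)\<bar> \<le> 6 * 1" by (intro abs_mult_le pq_bounds[OF t]) simp
  then have b: "\<bar>h0 t * sin (2 * t) / 2\<bar> \<le> 3" by simp
  have a: "(amp t)\<^sup>2 = exp (lf t + h0 t * sin (2 * t) / 2)"
    unfolding amp_def power2_eq_square exp_add[symmetric] by (simp add: field_simps)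
  have A0: "(amp t)\<^sup>2 > 0" using amp_pos[of t] by simp
  show 1: "f_rate t \<le> exp 3 * (amp t)\<^sup>2" unfolding f_rate_eq_exp_lf[OF t] a exp_add[symmetric] exp_le_cancel_iff using b by linarith
  show "(amp t)\<^sup>2 \<le> exp 3 * f_rate t" unfolding f_rate_eq_exp_lf[OF t] a exp_add[symmetric] exp_le_cancel_iff using b by linarith
  have "1 \<le> exp 3 * (amp t)\<^sup>2" using f_rate_ge_powr(2)[OF t] 1 by linarith
  then show "1 / amp t \<le> exp 3 * amp t" using amp_pos[of t] by (simp add: divide_le_eq power2_eq_square mult.assoc)
  have "t powr (1/3) \<le> exp 3 * (amp t)\<^sup>2" using f_rate_ge_powr(1)[OF t] 1 by linarith
  moreover have "t powr (1/3) > 0" using exp1_bounds(1)[OF t] by simp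
  ultimately show "1 / (amp t)\<^sup>2 \<le> exp 3 / t powr (1/3)" using A0 by (simp add: field_simps)
qed

text \<open>The quotient sm^2 is (ln t)^2 / t, whose integral diverges. Division by t^(1/3) and the
  estimate ln t \<le> 12 t^(1/12) bring the exponent to 1/6 - 1 - 1/3 = -7/6, which is
  integrable.\<close>

lemma ln_sq_le:
  assumes t: "t \<ge> exp 1"
  shows "sm t ^ 2 / t powr (1/3) \<le> 144 * t powr (-7/6)"
proof -
  have t0: "t > 0" using exp1_bounds(1)[OF t] by simp
  have "ln t = 12 * ln (t powr (1/12))" using t0 by (simp add: ln_powr)
  also have "\<dots> \<le> 12 * t powr (1/12)" using ln_le_minus_one[of "t powr (1/12)"] t0 by simp
  finally have "(ln t) ^ 2 \<le> (12 * t powr (1/12)) ^ 2" using exp1_bounds(2)[OF t] by (intro power_mono) auto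
  also have "\<dots> = 144 * (t powr (1/12) * t powr (1/12))" by (simp add: power2_eq_square)
  also have "\<dots> = 144 * t powr (1/6)" unfolding powr_add[symmetric] by simp
  finally have l: "(ln t) ^ 2 \<le> 144 * t powr (1/6)" .
  have a: "t powr (-1) = inverse t" "t powr (-1/3) = inverse (t powr (1/3))"
    using t0 powr_minus[of t 1] powr_minus[of t "1/3"] by simp_all
  have "sm t ^ 2 = (ln t) ^ 2 * inverse t" unfolding sm_def power_divide using t0 by (simp add: divide_inverse)
  then have "sm t ^ 2 / t powr (1/3) = (ln t) ^ 2 * (t powr (-1) * t powr (-1/3))"
    unfolding a by (simp only: divide_inverse mult.assoc)
  also have "\<dots> \<le> 144 * t powr (1/6) * (t powr (-1) * t powr (-1/3))" by (intro mult_right_mono l) auto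
  also have "\<dots> = 144 * t powr (-7/6)" unfolding mult.assoc powr_add[symmetric] by simp
  finally show ?thesis .
qed

section \<open>Boundedness of the reduction integral\<close>

lemma reduction_algebra:
  fixes w h k p s c d :: real
  shows "w \<noteq> 0 \<Longrightarrow> (k * w - h * (2 * p * w)) / (w * w) = (k - 2 * p * h) / w"
    "- (1/2) * (- (2 * s * c * 2) * (h / w) + (k - 2 * p * h) / w * d)
      = 2 * (h * c + k * s / 2) * s / w - (k * s\<^sup>2 + 1/2 * d * k - d * h * p) / w"
proof -
  assume w: "w \<noteq> 0"
  have "(k * w - h * (2 * p * w)) / (w * w) = (w * (k - 2 * p * h)) / (w * w)" by (simp add: algebra_simps)
  then show "(k * w - h * (2 * p * w)) / (w * w) = (k - 2 * p * h) / w" using w by simp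
next
  show "- (1/2) * (- (2 * s * c * 2) * (h / w) + (k - 2 * p * h) / w * d)
      = 2 * (h * c + k * s / 2) * s / w - (k * s\<^sup>2 + 1/2 * d * k - d * h * p) / w"
    unfolding divide_inverse[of _ w] by (simp add: algebra_simps power2_eq_square)
qed

text \<open>The integrand \<open>2 q sin / amp\<^sup>2\<close> is not integrable; it is the sum of the derivative of a bounded
  oscillating term and an integrable remainder.\<close>

lemma reduction_integral:
  obtains v V where "\<forall>t\<ge>exp 1. (v has_real_derivative 2 * qf t * sin t / (amp t)\<^sup>2) (at t)"
    "\<forall>t\<ge>exp 1. \<bar>v t\<bar> \<le> V" "V \<ge> 0"
proof -
  let ?k = "\<lambda>t. 2 * qf t * sin t / (amp t)\<^sup>2"
  have "isCont ?k t" if "t > 1" for t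
    using DERIV_isCont[OF qf_deriv[OF that]] DERIV_isCont[OF amp_deriv[OF that]] amp_pos[of t]
    by (intro continuous_intros) auto
  \<comment> \<open>The antiderivative starts at 2, which is below e, so that its derivative at e is
    two-sided.\<close>
  then have "continuous_on {2..} ?k" by (intro continuous_at_imp_continuous_on) auto
  from antiderivative_exists[OF this] obtain v where "\<forall>t\<ge>2. (v has_real_derivative ?k t) (at t within {2..})" by blast
  then have dv: "(v has_real_derivative ?k t) (at t)" if "t > 2" for t
  proof -
    have "at t within {2..} = at t" by (rule at_within_open_subset[of t "{2<..}"]) (use that in auto)
    then show ?thesis using \<open>\<forall>t\<ge>2. (v has_real_derivative ?k t) (at t within {2..})\<close>[rule_format, of t] that by simp
  qed
  \<comment> \<open>The leading part of the integrand is h0 sin(2t) / amp^2. Integrating only the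
    fast factor sin(2t) gives \<open>z\<close>, and the derivatives of the slow factors go into the
    remainder \<open>R\<close>.\<close>
  define z where "z t = - (1/2) * (cos (2 * t) * (h0 t / (amp t)\<^sup>2))" for t
  define R where "R t = (h1 t * (sin t)\<^sup>2 + 1/2 * cos (2 * t) * h1 t - cos (2 * t) * h0 t * pf t) / (amp t)\<^sup>2" for t
  have dz: "(z has_real_derivative ?k t - R t) (at t)" if t: "t > 2" for t
  proof -
    have t1: "t > 1" using t by simp
    have c: "((\<lambda>t. cos (2 * t)) has_real_derivative - (sin (2 * t) * 2)) (at t)"
      by (auto intro!: derivative_eq_intros)
    have A: "((\<lambda>t. (amp t)\<^sup>2) has_real_derivative 2 * pf t * (amp t)\<^sup>2) (at t)"
      by (rule DERIV_cong[OF DERIV_power[OF amp_deriv[OF t1]]]) (simp add: power2_eq_square)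
    have n: "(amp t)\<^sup>2 \<noteq> 0" using amp_pos[of t] by simp
    have hA: "((\<lambda>t. h0 t / (amp t)\<^sup>2) has_real_derivative (h1 t - 2 * pf t * h0 t) / (amp t)\<^sup>2) (at t)"
      by (rule DERIV_cong[OF DERIV_divide[OF h0_deriv[OF t1] A n]]) (rule reduction_algebra(1)[OF n])
    show ?thesis
      unfolding z_def[abs_def]
    proof (rule DERIV_cong[OF DERIV_cmult[OF DERIV_mult[OF c hA]]])
      show "- (1/2) * (- (sin (2 * t) * 2) * (h0 t / (amp t)\<^sup>2) + (h1 t - 2 * pf t * h0 t) / (amp t)\<^sup>2 * cos (2 * t)) = ?k t - R t"
        unfolding R_def qf_def sin_double by (rule reduction_algebra(2))
    qed
  qed
  define K where "K = 50 * exp 3 * (144::real)"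
  have K: "K \<ge> 0" by (simp add: K_def)
  have R: "\<bar>R t\<bar> \<le> K * t powr (-7/6)" if t: "t \<ge> exp 1" for t
  proof -
    define X where "X = sm t"
    have s: "\<bar>sin t * sin t\<bar> \<le> 1 * 1" by (intro abs_mult_le) simp_all
    have c: "\<bar>cos (2 * t)\<bar> \<le> 1" by simp
    have "\<bar>h1 t * (sin t * sin t) + 1/2 * cos (2 * t) * h1 t - cos (2 * t) * h0 t * pf t\<bar>
      \<le> 9 * X ^ 2 * (1 * 1) + 1/2 * 1 * (9 * X ^ 2) + 1 * (3 * X) * (12 * X)"
      unfolding X_def by (intro abs_add_le abs_diff_le abs_mult_le s c h_bounds[OF t] pq_bounds[OF t]) simp
    also have "\<dots> \<le> 50 * X ^ 2" by (simp add: power2_eq_square)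
    finally have b: "\<bar>h1 t * (sin t)\<^sup>2 + 1/2 * cos (2 * t) * h1 t - cos (2 * t) * h0 t * pf t\<bar> \<le> 50 * X ^ 2"
      by (simp only: power2_eq_square)
    have "\<bar>R t\<bar> \<le> (50 * X ^ 2) * (exp 3 / t powr (1/3))"
      unfolding R_def divide_inverse[of _ "(amp t)\<^sup>2"]
      by (rule abs_mult_le[OF b]) (use amp_bounds(4)[OF t] in \<open>simp add: inverse_eq_divide\<close>)
    also have "\<dots> = 50 * exp 3 * (X ^ 2 / t powr (1/3))" by simp
    also have "\<dots> \<le> 50 * exp 3 * (144 * t powr (-7/6))" unfolding X_def by (intro mult_left_mono ln_sq_le t) simp
    finally show ?thesis by (simp add: K_def)
  qed
  \<comment> \<open>An antiderivative of the majorant K t^(-7/6). Monotonicity of \<open>U\<close>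
    plus and minus v - z replaces an estimate of an improper integral.\<close>
  define U where "U t = - (6 * K) * t powr (-1/6)" for t :: real
  have dU: "(U has_real_derivative K * t powr (-7/6)) (at t)" if "t > 0" for t
    unfolding U_def[abs_def]
    by (rule DERIV_cong[OF DERIV_cmult[OF has_real_derivative_powr[OF that]]]) simp
  have dW: "((\<lambda>t. v t - z t) has_real_derivative R t) (at t)" if "t > 2" for t
    using DERIV_diff[OF dv[OF that] dz[OF that]] by simp
  have W: "\<bar>(v t - z t) - (v (exp 1) - z (exp 1))\<bar> \<le> 6 * K" if t: "t \<ge> exp 1" for t
  proof -
    have x: "x > 2" "x > 0" if "exp 1 \<le> x" for x :: real using exp1_bounds(1)[OF that] that by auto
    have "U (exp 1) + (v (exp 1) - z (exp 1)) \<le> U t + (v t - z t)"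
    proof (rule DERIV_nonneg_imp_nondecreasing[OF t])
      fix y assume y: "exp 1 \<le> y" "y \<le> t"
      have "((\<lambda>t. U t + (v t - z t)) has_real_derivative K * y powr (-7/6) + R y) (at y)"
        by (rule DERIV_add[OF dU[OF x(2)[OF y(1)]] dW[OF x(1)[OF y(1)]]])
      moreover have "K * y powr (-7/6) + R y \<ge> 0" using R[OF y(1)] unfolding abs_le_iff by (elim conjE) linarith
      ultimately show "\<exists>d. ((\<lambda>t. U t + (v t - z t)) has_real_derivative d) (at y) \<and> d \<ge> 0" by blast
    qed
    moreover have "U (exp 1) - (v (exp 1) - z (exp 1)) \<le> U t - (v t - z t)"
    proof (rule DERIV_nonneg_imp_nondecreasing[OF t])
      fix y assume y: "exp 1 \<le> y" "y \<le> t"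
      have "((\<lambda>t. U t - (v t - z t)) has_real_derivative K * y powr (-7/6) - R y) (at y)"
        by (rule DERIV_diff[OF dU[OF x(2)[OF y(1)]] dW[OF x(1)[OF y(1)]]])
      moreover have "K * y powr (-7/6) - R y \<ge> 0" using R[OF y(1)] unfolding abs_le_iff by (elim conjE) linarith
      ultimately show "\<exists>d. ((\<lambda>t. U t - (v t - z t)) has_real_derivative d) (at y) \<and> d \<ge> 0" by blast
    qed
    moreover have "U t \<le> 0" using K by (simp add: U_def)
    moreover have "U (exp 1) \<ge> - (6 * K)"
    proof -
      have "(exp (1::real)) powr (-1/6) \<le> 1" by (simp add: powr_def)
      from mult_left_mono[OF this, of "6 * K"] show ?thesis using K by (simp add: U_def)
    qed
    ultimately show ?thesis unfolding abs_le_iff by (intro conjI) linarith+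
  qed
  have zb: "\<bar>z t\<bar> \<le> 3 * exp 3" if t: "t \<ge> exp 1" for t
  proof -
    have t1: "t powr (1/3) \<ge> 1" using exp1_bounds(1)[OF t] by (intro ge_one_powr_ge_zero) auto
    have "exp 3 / t powr (1/3) \<le> exp 3 / 1" using t1 by (intro divide_left_mono) auto
    then have "1 / (amp t)\<^sup>2 \<le> exp 3" using amp_bounds(4)[OF t] by (simp only: div_by_1)
    then have A: "\<bar>inverse ((amp t)\<^sup>2)\<bar> \<le> exp 3" by (simp add: inverse_eq_divide)
    have "\<bar>z t\<bar> \<le> 1/2 * (1 * (6 * exp 3))"
      unfolding z_def divide_inverse[of _ "(amp t)\<^sup>2"] by (intro abs_mult_le pq_bounds(6)[OF t] A) simp_all
    then show ?thesis by simp
  qed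
  show ?thesis
  proof (rule that[of v "6 * K + \<bar>v (exp 1)\<bar> + 6 * exp 3"]; (intro allI impI)?)
    show "(v has_real_derivative ?k t) (at t)" if "t \<ge> exp 1" for t using dv[OF exp1_bounds(1)[OF that]] .
    show "\<bar>v t\<bar> \<le> 6 * K + \<bar>v (exp 1)\<bar> + 6 * exp 3" if "t \<ge> exp 1" for t
    proof -
      have "\<bar>((v t - z t) - (v (exp 1) - z (exp 1)) + z t) + (v (exp 1) - z (exp 1))\<bar> \<le> (6 * K + 3 * exp 3) + (\<bar>v (exp 1)\<bar> + 3 * exp 3)"
        by (intro abs_add_le abs_diff_le W zb that order_refl)
      then show ?thesis by simp
    qed
    show "6 * K + \<bar>v (exp 1)\<bar> + 6 * exp 3 \<ge> 0" using K by simp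
  qed
qed

lemma square_lincomb_le:
  fixes a b x y :: real
  shows "(a * x + b * y)\<^sup>2 \<le> (a\<^sup>2 + b\<^sup>2) * (x\<^sup>2 + y\<^sup>2)"
proof -
  have "(a\<^sup>2 + b\<^sup>2) * (x\<^sup>2 + y\<^sup>2) - (a * x + b * y)\<^sup>2 = (a * y - b * x)\<^sup>2"
    by (simp add: power2_eq_square algebra_simps)
  then show ?thesis using zero_le_power2[of "a * y - b * x"] by linarith
qed

lemma normalize_algebra:
  fixes a1 a2 b1 b2 y1 y2 z1 z2 :: real
  assumes w: "a1 * b2 - b1 * a2 = 1"
  shows "y1 * z2 - z1 * y2 = 1 \<Longrightarrow> (b2 * y1 - b1 * y2) * (a1 * z2 - a2 * z1) - (b2 * z1 - b1 * z2) * (a1 * y2 - a2 * y1) = 1"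
    "y1 = a1 * (b2 * y1 - b1 * y2) + b1 * (a1 * y2 - a2 * y1)"
proof -
  have "(b2 * y1 - b1 * y2) * (a1 * z2 - a2 * z1) - (b2 * z1 - b1 * z2) * (a1 * y2 - a2 * y1)
      = (a1 * b2 - b1 * a2) * (y1 * z2 - z1 * y2)" by (simp add: algebra_simps)
  then show "y1 * z2 - z1 * y2 = 1 \<Longrightarrow> (b2 * y1 - b1 * y2) * (a1 * z2 - a2 * z1) - (b2 * z1 - b1 * z2) * (a1 * y2 - a2 * y1) = 1"
    using w by simp
  have "a1 * (b2 * y1 - b1 * y2) + b1 * (a1 * y2 - a2 * y1) = y1 * (a1 * b2 - b1 * a2)" by (simp add: algebra_simps)
  then show "y1 = a1 * (b2 * y1 - b1 * y2) + b1 * (a1 * y2 - a2 * y1)" using w by simp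
qed

text \<open>The pair y1, y2 is normalised at e by the inverse of its initial matrix, whose
  determinant is the Wronskian 1. Upper bounds follow because y1 and y2 with their derivatives are
  O(amp). For the lower bound it suffices that y1 and z1 together determine \<open>amp\<close>,
  whatever y2 does.\<close>

lemma fundamental_solutions:
  obtains Y1 Y2 Z1 Z2 :: "real \<Rightarrow> real" and c C :: real where
    "\<forall>t\<ge>exp 1. (Y1 has_real_derivative Z1 t) (at t)"
    "\<forall>t\<ge>exp 1. (Y2 has_real_derivative Z2 t) (at t)"
    "\<forall>t\<ge>exp 1. (Z1 has_real_derivative - (1 + phi t) * Y1 t) (at t)"
    "\<forall>t\<ge>exp 1. (Z2 has_real_derivative - (1 + phi t) * Y2 t) (at t)"
    "\<forall>t\<ge>exp 1. Y1 t * Z2 t - Z1 t * Y2 t = 1"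
    "Y1 (exp 1) = 1" "Z1 (exp 1) = 0" "Y2 (exp 1) = 0" "Z2 (exp 1) = 1" "c > 0" "C > 0"
    "\<forall>t\<ge>exp 1. c * f_rate t \<le> (Y1 t)\<^sup>2 + (Y2 t)\<^sup>2 + (Z1 t)\<^sup>2 + (Z2 t)\<^sup>2"
    "\<forall>t\<ge>exp 1. (Y1 t)\<^sup>2 + (Y2 t)\<^sup>2 + (Z1 t)\<^sup>2 + (Z2 t)\<^sup>2 \<le> C * f_rate t"
proof -
  obtain v V where v': "\<forall>t\<ge>exp 1. (v has_real_derivative 2 * qf t * sin t / (amp t)\<^sup>2) (at t)"
    and V': "\<forall>t\<ge>exp 1. \<bar>v t\<bar> \<le> V" "V \<ge> 0" by (rule reduction_integral)
  note v = v'[rule_format] and V = V'(1)[rule_format] V'(2)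
  define y2 where "y2 t = y1 t * v t + sin t / amp t" for t
  define z2 where "z2 t = z1 t * v t + (cos t + pf t * sin t) / amp t" for t
  define a1 b1 a2 b2 where "a1 = y1 (exp 1)" and "b1 = z1 (exp 1)" and "a2 = y2 (exp 1)" and "b2 = z2 (exp 1)"
  define Y1 Y2 Z1 Z2 where "Y1 = (\<lambda>t. b2 * y1 t - b1 * y2 t)" and "Y2 = (\<lambda>t. a1 * y2 t - a2 * y1 t)"
    and "Z1 = (\<lambda>t. b2 * z1 t - b1 * z2 t)" and "Z2 = (\<lambda>t. a1 * z2 t - a2 * z1 t)"
  have t1: "t > 1" if "t \<ge> exp 1" for t :: real using exp1_bounds(1)[OF that] by simp
  have d2: "(y2 has_real_derivative z2 t) (at t)" "(z2 has_real_derivative - (1 + phi t) * y2 t) (at t)" if "t \<ge> exp 1" for t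
    using second_solution_deriv1[OF t1[OF that] v[OF that]] second_solution_deriv2[OF t1[OF that] v[OF that]]
    unfolding y2_def[abs_def] z2_def[abs_def] .
  have W: "y1 t * z2 t - z1 t * y2 t = 1" for t
    unfolding y2_def z2_def by (rule second_solution_wronskian)
  have ab: "a1 * b2 - b1 * a2 = 1" unfolding a1_def b1_def a2_def b2_def by (rule W)
  \<comment> \<open>The factor 25 is 1 + 24, where 24 bounds \<open>pf\<close>; the terms with
    \<open>V\<close> and \<open>exp 3\<close> come from \<open>v\<close> and from 1 / amp in the
    second solution.\<close>
  define N where "N = 25 * V + 25 * exp 3 + 25"
  have N: "N \<ge> 0" using V(2) by (simp add: N_def)
  have b: "\<bar>y1 t\<bar> \<le> N * amp t" "\<bar>z1 t\<bar> \<le> N * amp t" "\<bar>y2 t\<bar> \<le> N * amp t" "\<bar>z2 t\<bar> \<le> N * amp t" if t: "t \<ge> exp 1" for t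
  proof -
    have w: "amp t > 0" by (rule amp_pos)
    have wa: "\<bar>amp t\<bar> \<le> amp t" using w by simp
    have sc: "\<bar>sin t\<bar> \<le> 1" "\<bar>cos t\<bar> \<le> 1" by simp_all
    have p: "\<bar>pf t\<bar> \<le> 24" by (rule pq_bounds(4)[OF t])
    have iw: "\<bar>inverse (amp t)\<bar> \<le> exp 3 * amp t" using amp_bounds(3)[OF t] w by (simp add: inverse_eq_divide)
    have y: "\<bar>y1 t\<bar> \<le> amp t * 1" unfolding y1_def by (rule abs_mult_le[OF wa sc(2)])
    have z: "\<bar>z1 t\<bar> \<le> amp t * (24 * 1 + 1)" unfolding z1_def
      by (rule abs_mult_le[OF wa abs_diff_le[OF abs_mult_le[OF p sc(2)] sc(1)]])
    have y2b: "\<bar>y2 t\<bar> \<le> amp t * 1 * V + 1 * (exp 3 * amp t)" unfolding y2_def divide_inverse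
      by (rule abs_add_le[OF abs_mult_le[OF y V(1)[OF t]] abs_mult_le[OF sc(1) iw]])
    have z2b: "\<bar>z2 t\<bar> \<le> amp t * (24 * 1 + 1) * V + (1 + 24 * 1) * (exp 3 * amp t)" unfolding z2_def divide_inverse
      by (rule abs_add_le[OF abs_mult_le[OF z V(1)[OF t]] abs_mult_le[OF abs_add_le[OF sc(2) abs_mult_le[OF p sc(1)]] iw]])
    have nn: "V * amp t \<ge> 0" "exp 3 * amp t \<ge> 0" using V(2) w by simp_all
    have Nw: "N * amp t = 25 * (V * amp t) + 25 * (exp 3 * amp t) + 25 * amp t" by (simp add: N_def algebra_simps)
    show "\<bar>y1 t\<bar> \<le> N * amp t" unfolding Nw using nn w by (intro order_trans[OF y]) simp
    show "\<bar>z1 t\<bar> \<le> N * amp t" unfolding Nw using nn w by (intro order_trans[OF z]) simp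
    have "amp t * 1 * V + 1 * (exp 3 * amp t) = V * amp t + exp 3 * amp t" by simp
    also have "\<dots> \<le> N * amp t" unfolding Nw using nn w by linarith
    finally show "\<bar>y2 t\<bar> \<le> N * amp t" using y2b by (rule order_trans[rotated])
    have "amp t * (24 * 1 + 1) * V + (1 + 24 * 1) * (exp 3 * amp t) = 25 * (V * amp t) + 25 * (exp 3 * amp t)" by simp
    also have "\<dots> \<le> N * amp t" unfolding Nw using nn w by linarith
    finally show "\<bar>z2 t\<bar> \<le> N * amp t" using z2b by (rule order_trans[rotated])
  qed
  define S where "S = 2 * N\<^sup>2"
  define G where "G = a1\<^sup>2 + b1\<^sup>2 + a2\<^sup>2 + b2\<^sup>2 + 1"
  have S: "S \<ge> 0" by (simp add: S_def)
  have G: "G \<ge> 1" by (simp add: G_def)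
  have up: "(Y1 t)\<^sup>2 + (Y2 t)\<^sup>2 + (Z1 t)\<^sup>2 + (Z2 t)\<^sup>2 \<le> 4 * G * S * exp 3 * f_rate t" if t: "t \<ge> exp 1" for t
  proof -
    have sq: "x\<^sup>2 \<le> N\<^sup>2 * (amp t)\<^sup>2" if "\<bar>x\<bar> \<le> N * amp t" for x
      using power_mono[OF that abs_ge_zero, of 2] by (simp add: power_mult_distrib)
    have bb: "(\<alpha> * x + \<beta> * y)\<^sup>2 \<le> G * (S * (amp t)\<^sup>2)" if "\<bar>x\<bar> \<le> N * amp t" "\<bar>y\<bar> \<le> N * amp t" "\<alpha>\<^sup>2 + \<beta>\<^sup>2 \<le> G" for \<alpha> \<beta> x y
    proof -
      have "x\<^sup>2 + y\<^sup>2 \<le> S * (amp t)\<^sup>2" using sq[OF that(1)] sq[OF that(2)] by (simp add: S_def)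
      then have "(\<alpha>\<^sup>2 + \<beta>\<^sup>2) * (x\<^sup>2 + y\<^sup>2) \<le> G * (S * (amp t)\<^sup>2)" using that(3) G by (intro mult_mono) auto
      then show ?thesis using square_lincomb_le[of \<alpha> x \<beta> y] by linarith
    qed
    have g: "b2\<^sup>2 + (- b1)\<^sup>2 \<le> G" "(- a2)\<^sup>2 + a1\<^sup>2 \<le> G" by (simp_all add: G_def)
    have "(Y1 t)\<^sup>2 \<le> G * (S * (amp t)\<^sup>2)" using bb[OF b(1,3)[OF t] g(1)] by (simp add: Y1_def)
    moreover have "(Z1 t)\<^sup>2 \<le> G * (S * (amp t)\<^sup>2)" using bb[OF b(2,4)[OF t] g(1)] by (simp add: Z1_def)
    moreover have "(Y2 t)\<^sup>2 \<le> G * (S * (amp t)\<^sup>2)" using bb[OF b(1,3)[OF t] g(2)] by (simp add: Y2_def)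
    moreover have "(Z2 t)\<^sup>2 \<le> G * (S * (amp t)\<^sup>2)" using bb[OF b(2,4)[OF t] g(2)] by (simp add: Z2_def)
    ultimately have "(Y1 t)\<^sup>2 + (Y2 t)\<^sup>2 + (Z1 t)\<^sup>2 + (Z2 t)\<^sup>2 \<le> 4 * G * S * (amp t)\<^sup>2" by linarith
    also have "\<dots> \<le> 4 * G * S * (exp 3 * f_rate t)" using G S by (intro mult_left_mono amp_bounds t) auto
    finally show ?thesis by simp
  qed
  \<comment> \<open>The number 2000 is any bound above 1 + 577, and 577 = 24^2 + 1 comes from the
    Cauchy-Schwarz estimate of amp sin t below. \<open>G\<close> bounds the norm of the normalising
    matrix.\<close>
  define M where "M = exp 3 * (2000 * G)"
  have M: "M > 0" using G by (simp add: M_def)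
  have lo: "f_rate t \<le> M * ((Y1 t)\<^sup>2 + (Y2 t)\<^sup>2 + (Z1 t)\<^sup>2 + (Z2 t)\<^sup>2)" if t: "t \<ge> exp 1" for t
  proof -
    have "y1 t = a1 * Y1 t + b1 * Y2 t" "z1 t = a1 * Z1 t + b1 * Z2 t"
      unfolding Y1_def Y2_def Z1_def Z2_def by (rule normalize_algebra(2)[OF ab])+
    then have "(y1 t)\<^sup>2 \<le> (a1\<^sup>2 + b1\<^sup>2) * ((Y1 t)\<^sup>2 + (Y2 t)\<^sup>2)" "(z1 t)\<^sup>2 \<le> (a1\<^sup>2 + b1\<^sup>2) * ((Z1 t)\<^sup>2 + (Z2 t)\<^sup>2)"
      using square_lincomb_le[of a1 "Y1 t" b1 "Y2 t"] square_lincomb_le[of a1 "Z1 t" b1 "Z2 t"] by simp_all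
    then have "(y1 t)\<^sup>2 + (z1 t)\<^sup>2 \<le> (a1\<^sup>2 + b1\<^sup>2) * ((Y1 t)\<^sup>2 + (Y2 t)\<^sup>2 + (Z1 t)\<^sup>2 + (Z2 t)\<^sup>2)"
      by (simp add: distrib_left)
    also have "\<dots> \<le> G * ((Y1 t)\<^sup>2 + (Y2 t)\<^sup>2 + (Z1 t)\<^sup>2 + (Z2 t)\<^sup>2)" by (intro mult_right_mono) (auto simp: G_def)
    finally have yz: "(y1 t)\<^sup>2 + (z1 t)\<^sup>2 \<le> G * ((Y1 t)\<^sup>2 + (Y2 t)\<^sup>2 + (Z1 t)\<^sup>2 + (Z2 t)\<^sup>2)" .
    have "\<bar>pf t\<bar>\<^sup>2 \<le> 24\<^sup>2" by (rule power_mono[OF pq_bounds(4)[OF t]]) simp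
    then have p: "(pf t)\<^sup>2 + (- 1)\<^sup>2 \<le> 577" by simp
    \<comment> \<open>Together with y1 = amp cos t this recovers amp^2 from the first solution and
      its derivative, also near the zeros of cos t.\<close>
    have "amp t * sin t = pf t * y1 t + (- 1) * z1 t" by (simp add: y1_def z1_def algebra_simps)
    then have s: "(amp t * sin t)\<^sup>2 \<le> ((pf t)\<^sup>2 + (- 1)\<^sup>2) * ((y1 t)\<^sup>2 + (z1 t)\<^sup>2)"
      using square_lincomb_le[of "pf t" "y1 t" "-1" "z1 t"] by simp
    also have "\<dots> \<le> 577 * ((y1 t)\<^sup>2 + (z1 t)\<^sup>2)" by (rule mult_right_mono[OF p]) simp
    finally have s': "(amp t * sin t)\<^sup>2 \<le> 577 * ((y1 t)\<^sup>2 + (z1 t)\<^sup>2)" .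
    have "(amp t)\<^sup>2 = (amp t)\<^sup>2 * ((sin t)\<^sup>2 + (cos t)\<^sup>2)" by simp
    also have "\<dots> = (y1 t)\<^sup>2 + (amp t * sin t)\<^sup>2" unfolding y1_def power_mult_distrib distrib_left by (rule add.commute)
    finally have a: "(amp t)\<^sup>2 = (y1 t)\<^sup>2 + (amp t * sin t)\<^sup>2" .
    have "(y1 t)\<^sup>2 + 577 * ((y1 t)\<^sup>2 + (z1 t)\<^sup>2) \<le> 2000 * ((y1 t)\<^sup>2 + (z1 t)\<^sup>2)" by simp
    then have "(amp t)\<^sup>2 \<le> 2000 * ((y1 t)\<^sup>2 + (z1 t)\<^sup>2)" using a s' by linarith
    also have "\<dots> \<le> 2000 * (G * ((Y1 t)\<^sup>2 + (Y2 t)\<^sup>2 + (Z1 t)\<^sup>2 + (Z2 t)\<^sup>2))" by (intro mult_left_mono yz) simp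
    finally have "exp 3 * (amp t)\<^sup>2 \<le> exp 3 * (2000 * (G * ((Y1 t)\<^sup>2 + (Y2 t)\<^sup>2 + (Z1 t)\<^sup>2 + (Z2 t)\<^sup>2)))"
      by (intro mult_left_mono) auto
    then show ?thesis using amp_bounds(1)[OF t] unfolding M_def mult.assoc by linarith
  qed
  show ?thesis
  proof (rule that[of Y1 Z1 Y2 Z2 "1 / M" "4 * G * S * exp 3 + 1"]; (intro allI impI)?)
    fix t :: real assume t: "t \<ge> exp 1"
    note D = y1_deriv[OF t1[OF t]] d2[OF t]
    show "(Y1 has_real_derivative Z1 t) (at t)" unfolding Y1_def Z1_def
      by (rule DERIV_diff[OF DERIV_cmult[OF D(1)] DERIV_cmult[OF D(3)]])
    show "(Y2 has_real_derivative Z2 t) (at t)" unfolding Y2_def Z2_def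
      by (rule DERIV_diff[OF DERIV_cmult[OF D(3)] DERIV_cmult[OF D(1)]])
    have l: "r * (- k * x) - q * (- k * y) = - k * (r * x - q * y)" for r k x q y :: real by (simp add: algebra_simps)
    show "(Z1 has_real_derivative - (1 + phi t) * Y1 t) (at t)" unfolding Y1_def Z1_def
      by (rule DERIV_cong[OF DERIV_diff[OF DERIV_cmult[OF D(2)] DERIV_cmult[OF D(4)]] l])
    show "(Z2 has_real_derivative - (1 + phi t) * Y2 t) (at t)" unfolding Y2_def Z2_def
      by (rule DERIV_cong[OF DERIV_diff[OF DERIV_cmult[OF D(4)] DERIV_cmult[OF D(2)]] l])
    show "Y1 t * Z2 t - Z1 t * Y2 t = 1" unfolding Y1_def Z1_def Y2_def Z2_def
      by (rule normalize_algebra(1)[OF ab W])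
    show "1 / M * f_rate t \<le> (Y1 t)\<^sup>2 + (Y2 t)\<^sup>2 + (Z1 t)\<^sup>2 + (Z2 t)\<^sup>2"
      using lo[OF t] M by (simp add: divide_le_eq mult.commute)
    have "f_rate t \<ge> 0" using f_rate_ge_powr(2)[OF t] by simp
    then show "(Y1 t)\<^sup>2 + (Y2 t)\<^sup>2 + (Z1 t)\<^sup>2 + (Z2 t)\<^sup>2 \<le> (4 * G * S * exp 3 + 1) * f_rate t"
      using up[OF t] by (simp add: distrib_right)
  next
    show "Y1 (exp 1) = 1" using ab by (simp add: Y1_def a1_def b1_def a2_def b2_def mult.commute)
    show "Z2 (exp 1) = 1" using ab by (simp add: Z2_def a1_def b1_def a2_def b2_def mult.commute)
    show "Z1 (exp 1) = 0" by (simp add: Z1_def b1_def b2_def)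
    show "Y2 (exp 1) = 0" by (simp add: Y2_def a1_def a2_def)
    show "1 / M > 0" using M by simp
    show "4 * G * S * exp 3 + 1 > 0" using G S by (intro add_nonneg_pos mult_nonneg_nonneg) auto
  qed
qed

text \<open>A third derivative is extracted as well, only to make the second one continuous.\<close>

lemma phi_C2:
  "\<exists>\<phi>' \<phi>''. (\<forall>t\<ge>exp 1. (phi has_real_derivative \<phi>' t) (at t within {exp 1..}) \<and>
      (\<phi>' has_real_derivative \<phi>'' t) (at t within {exp 1..})) \<and> continuous_on {exp 1..} \<phi>''"
proof -
  from hx_deriv[OF hx_phi] obtain f1 where 1: "hx f1" "\<forall>t>1. (phi has_real_derivative f1 t) (at t)" by blast
  from hx_deriv[OF 1(1)] obtain f2 where 2: "hx f2" "\<forall>t>1. (f1 has_real_derivative f2 t) (at t)" by blast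
  from hx_deriv[OF 2(1)] obtain f3 where 3: "hx f3" "\<forall>t>1. (f2 has_real_derivative f3 t) (at t)" by blast
  have t: "t > 1" if "t \<ge> exp 1" for t :: real using exp1_bounds(1)[OF that] by simp
  have "isCont f2 t" if "t \<ge> exp 1" for t
    by (rule DERIV_isCont[OF 3(2)[rule_format, OF t[OF that]]])
  then have "continuous_on {exp 1..} f2" by (intro continuous_at_imp_continuous_on) auto
  then show ?thesis
    using 1(2) 2(2) t by (intro exI[of _ f1] exI[of _ f2] conjI allI impI) (auto intro: has_field_derivative_at_within)
qed

section \<open>From the energy to the growth rate of the norms\<close>

lemma exists_large_square:
  fixes T d :: real assumes d: "d \<ge> 0"
  shows "\<exists>n. (real n * pi + d)\<^sup>2 \<ge> T"
proof -
  obtain n where n: "max T 1 < real n" using reals_Archimedean2 by blast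
  have "real n * 1 \<le> real n * pi" using pi_gt3 by (intro mult_left_mono) auto
  then have x: "real n * pi + d \<ge> real n" using d by simp
  have "real n * pi + d \<le> (real n * pi + d) ^ 2" using power_increasing[of 1 2 "real n * pi + d"] x n by simp
  then show ?thesis using x n by (intro exI[of _ n]) simp
qed

text \<open>The energy \<open>En\<close> of the oscillator with perturbation \<open>phi\<close>
  equals the sum of squares of the fundamental system and is comparable to \<open>f_rate\<close>.
  The constants are fixed before the solution is, so they serve all weak solutions with the given
  datum.\<close>

lemma growth_two_sided:
  assumes s: "s > 0" and u0: "in_Hs s u0" "L2_norm_sq u0 \<noteq> 0"
  obtains k K where "k > 0" "K > 0" "\<exists>u. is_solution phi (exp 1) u0 u"
    "\<forall>u. is_solution phi (exp 1) u0 u \<longrightarrow> (\<forall>t\<ge>exp 1. in_Hs s (u t) \<and>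
      k * f_rate t powr (s/2) \<le> Hs_norm s (u t) \<and> Hs_norm s (u t) \<le> K * f_rate t powr (s/2))"
proof -
  obtain Y1 Y2 Z1 Z2 :: "real \<Rightarrow> real" and c C :: real where
    Y: "\<forall>t\<ge>exp 1. (Y1 has_real_derivative Z1 t) (at t)"
    "\<forall>t\<ge>exp 1. (Y2 has_real_derivative Z2 t) (at t)"
    "\<forall>t\<ge>exp 1. (Z1 has_real_derivative - (1 + phi t) * Y1 t) (at t)"
    "\<forall>t\<ge>exp 1. (Z2 has_real_derivative - (1 + phi t) * Y2 t) (at t)"
    "\<forall>t\<ge>exp 1. Y1 t * Z2 t - Z1 t * Y2 t = 1"
    "Y1 (exp 1) = 1" "Z1 (exp 1) = 0" "Y2 (exp 1) = 0" "Z2 (exp 1) = 1" and cC: "c > 0" "C > 0"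
    "\<forall>t\<ge>exp 1. c * f_rate t \<le> (Y1 t)\<^sup>2 + (Y2 t)\<^sup>2 + (Z1 t)\<^sup>2 + (Z2 t)\<^sup>2"
    "\<forall>t\<ge>exp 1. (Y1 t)\<^sup>2 + (Y2 t)\<^sup>2 + (Z1 t)\<^sup>2 + (Z2 t)\<^sup>2 \<le> C * f_rate t"
    by (rule fundamental_solutions)
  have cont: "continuous_on {exp 1..} phi"
  proof (rule continuous_at_imp_continuous_on, rule ballI)
    fix t :: real assume "t \<in> {exp 1..}"
    then have "t > 1" using exp1_bounds(1)[of t] by simp
    moreover from hx_deriv[OF hx_phi] obtain f1 where "\<forall>t>1. (phi has_real_derivative f1 t) (at t)" by blast
    ultimately show "isCont phi t" using DERIV_isCont by blast
  qed
  have "\<exists>\<rho> \<rho>' \<theta>. osc phi \<rho> \<rho>' \<theta> (exp 1) \<and> (\<forall>t\<ge>exp 1. (\<rho> t)\<^sup>2 + (\<rho>' t)\<^sup>2 + (1 / \<rho> t)\<^sup>2 = (Y1 t)\<^sup>2 + (Y2 t)\<^sup>2 + (Z1 t)\<^sup>2 + (Z2 t)\<^sup>2)"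
    by (rule osc_from_solutions) (use Y cont in \<open>auto intro: has_field_derivative_at_within\<close>)
  then obtain \<rho> \<rho>' \<theta> where o: "osc phi \<rho> \<rho>' \<theta> (exp 1)"
    and e: "\<forall>t\<ge>exp 1. (\<rho> t)\<^sup>2 + (\<rho>' t)\<^sup>2 + (1 / \<rho> t)\<^sup>2 = (Y1 t)\<^sup>2 + (Y2 t)\<^sup>2 + (Z1 t)\<^sup>2 + (Z2 t)\<^sup>2"
    by (elim exE conjE)
  interpret O: osc phi \<rho> \<rho>' \<theta> "exp 1" by (rule o)
  have En: "O.En t = (Y1 t)\<^sup>2 + (Y2 t)\<^sup>2 + (Z1 t)\<^sup>2 + (Z2 t)\<^sup>2" if "t \<ge> exp 1" for t
    unfolding O.En_def O.norm_mu_sq O.norm_nu_sq using e[rule_format, OF that] by (simp only: add.assoc)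
  from O.Hs_bounds[OF s u0] obtain \<kappa> D where kD: "\<kappa> > 0" "D > 0"
    "\<forall>u. is_solution phi (exp 1) u0 u \<longrightarrow> (\<forall>t\<ge>exp 1. in_Hs s (u t) \<and>
      \<kappa> * O.En t powr (s/2) \<le> Hs_norm s (u t) \<and> Hs_norm s (u t) \<le> D * O.En t powr (s/2))"
    by (elim exE conjE)
  have ex: "\<exists>u. is_solution phi (exp 1) u0 u" using u0(1) by (intro O.solution_exists) (simp add: in_Hs_def)
  have pb: "c powr (s/2) * f_rate t powr (s/2) \<le> O.En t powr (s/2)" "O.En t powr (s/2) \<le> C powr (s/2) * f_rate t powr (s/2)"
    if t: "t \<ge> exp 1" for t
  proof -
    have f: "f_rate t \<ge> 0" using f_rate_ge_powr(2)[OF t] by simp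
    have "(c * f_rate t) powr (s/2) \<le> O.En t powr (s/2)"
      unfolding En[OF t] using cC(3) t f cC(1) s by (intro powr_mono2) auto
    then show "c powr (s/2) * f_rate t powr (s/2) \<le> O.En t powr (s/2)" using f cC(1) by (simp add: powr_mult)
    have "O.En t powr (s/2) \<le> (C * f_rate t) powr (s/2)"
      using O.En_ge_1[OF t] s cC(4) t unfolding En[OF t] by (intro powr_mono2) auto
    then show "O.En t powr (s/2) \<le> C powr (s/2) * f_rate t powr (s/2)" using f cC(2) by (simp add: powr_mult)
  qed
  show ?thesis
  proof (rule that[of "\<kappa> * c powr (s/2)" "D * C powr (s/2)", OF _ _ ex]; (intro allI impI)?)
    fix u t assume u: "is_solution phi (exp 1) u0 u" and t: "t \<ge> exp (1::real)"
    note b = kD(3)[rule_format, OF u t]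
    have "\<kappa> * (c powr (s/2) * f_rate t powr (s/2)) \<le> \<kappa> * O.En t powr (s/2)"
      using kD(1) by (intro mult_left_mono pb t) auto
    moreover have "D * O.En t powr (s/2) \<le> D * (C powr (s/2) * f_rate t powr (s/2))"
      using kD(2) by (intro mult_left_mono pb t) auto
    ultimately show "in_Hs s (u t) \<and> \<kappa> * c powr (s/2) * f_rate t powr (s/2) \<le> Hs_norm s (u t) \<and> Hs_norm s (u t) \<le> D * C powr (s/2) * f_rate t powr (s/2)"
      using b unfolding mult.assoc by (intro conjI) (simp, linarith, linarith)
  qed (use kD cC in auto)
qed

lemma f_rate_powr:
  assumes "t \<ge> exp 1"
  shows "f_rate t powr (s/2) = t powr (s/6) * (1 + ln t * (sin (sqrt t))\<^sup>2) powr (s/2)"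
proof -
  have "1 + ln t * (sin (sqrt t))\<^sup>2 \<ge> 0" using exp1_bounds(2)[OF assms] by simp
  then show ?thesis unfolding f_rate_def by (simp add: powr_mult powr_powr)
qed

lemma Liminf_Limsup_rate:
  fixes N :: "real \<Rightarrow> real"
  assumes s: "s > 0" and c0: "c0 > 1"
    and N: "\<And>t. t \<ge> exp 1 \<Longrightarrow> f_rate t powr (s/2) / c0 \<le> N t \<and> N t \<le> c0 * f_rate t powr (s/2)"
  shows "Liminf at_top (\<lambda>t. ereal (N t / t powr (s/6))) \<in> {ereal (1/c0) .. ereal c0}"
    "Limsup at_top (\<lambda>t. ereal (N t / (t powr (s/6) * ln t powr (s/2)))) \<in> {ereal (1/c0) .. ereal c0}"
proof -
  define G where "G t = (1 + ln t * (sin (sqrt t))\<^sup>2) powr (s/2)" for t :: real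
  define l where "l t = ln t powr (s/2)" for t :: real
  have N1: "G t / c0 \<le> N t / t powr (s/6)" "N t / t powr (s/6) \<le> c0 * G t" if t: "t \<ge> exp 1" for t
  proof -
    have p: "t powr (s/6) > 0" using exp1_bounds(1)[OF t] by simp
    have f: "f_rate t powr (s/2) = t powr (s/6) * G t" unfolding G_def by (rule f_rate_powr[OF t])
    have n: "(t powr (s/6) * G t) / c0 \<le> N t" "N t \<le> c0 * (t powr (s/6) * G t)" using N[OF t] unfolding f by auto
    have "G t / c0 * t powr (s/6) \<le> N t" using n(1) by (simp add: mult.commute)
    then show "G t / c0 \<le> N t / t powr (s/6)" using p by (simp add: pos_le_divide_eq)
    have "N t \<le> c0 * G t * t powr (s/6)" using n(2) by (simp add: ac_simps)
    then show "N t / t powr (s/6) \<le> c0 * G t" using p by (simp add: pos_divide_le_eq)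
  qed
  have l: "l t > 0" if t: "t \<ge> exp 1" for t using exp1_bounds(2)[OF t] by (simp add: l_def)
  have N2: "(G t / c0) / l t \<le> N t / (t powr (s/6) * l t)" "N t / (t powr (s/6) * l t) \<le> (c0 * G t) / l t" if t: "t \<ge> exp 1" for t
    unfolding divide_divide_eq_left[symmetric, of "N t"]
    by (rule divide_right_mono[OF N1(1)[OF t] less_imp_le[OF l[OF t]]], rule divide_right_mono[OF N1(2)[OF t] less_imp_le[OF l[OF t]]])
  show "Liminf at_top (\<lambda>t. ereal (N t / t powr (s/6))) \<in> {ereal (1/c0) .. ereal c0}"
  proof (rule atLeastAtMost_iff[THEN iffD2], rule conjI)
    show "ereal (1/c0) \<le> Liminf at_top (\<lambda>t. ereal (N t / t powr (s/6)))"
    proof (rule Liminf_bounded)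
      show "\<forall>\<^sub>F t in at_top. ereal (1/c0) \<le> ereal (N t / t powr (s/6))"
        using eventually_ge_at_top[of "exp 1"]
      proof eventually_elim
        case (elim t)
        have "G t \<ge> 1" unfolding G_def using exp1_bounds(2)[OF elim] s by (intro ge_one_powr_ge_zero) auto
        then have "1 / c0 \<le> G t / c0" using c0 by (intro divide_right_mono) auto
        then show ?case using N1(1)[OF elim] by simp
      qed
    qed
    show "Liminf at_top (\<lambda>t. ereal (N t / t powr (s/6))) \<le> ereal c0"
    proof (rule ccontr)
      assume "\<not> ?thesis"
      then have "\<forall>\<^sub>F t in at_top. ereal c0 < ereal (N t / t powr (s/6))" by (intro less_LiminfD) simp
      then obtain T where T: "\<forall>t\<ge>T. ereal c0 < ereal (N t / t powr (s/6))" by (auto simp: eventually_at_top_linorder)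
      obtain n where n: "(real n * pi + 0)\<^sup>2 \<ge> max T (exp 1)" using exists_large_square[of 0] by blast
      define t where "t = (real n * pi)\<^sup>2"
      have t: "t \<ge> exp 1" "t \<ge> T" using n by (simp_all add: t_def)
      have "sin (sqrt t) = 0" by (simp add: t_def)
      then have "G t = 1" by (simp add: G_def)
      then show False using N1(2)[OF t(1)] T[rule_format, OF t(2)] by simp
    qed
  qed
  show "Limsup at_top (\<lambda>t. ereal (N t / (t powr (s/6) * ln t powr (s/2)))) \<in> {ereal (1/c0) .. ereal c0}"
    unfolding l_def[symmetric]
  proof (rule atLeastAtMost_iff[THEN iffD2], rule conjI)
    show "ereal (1/c0) \<le> Limsup at_top (\<lambda>t. ereal (N t / (t powr (s/6) * l t)))"
    proof (rule ccontr)
      assume "\<not> ?thesis"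
      then have "\<forall>\<^sub>F t in at_top. ereal (N t / (t powr (s/6) * l t)) < ereal (1/c0)" by (intro Limsup_lessD) simp
      then obtain T where T: "\<forall>t\<ge>T. ereal (N t / (t powr (s/6) * l t)) < ereal (1/c0)" by (auto simp: eventually_at_top_linorder)
      obtain n where n: "(real n * pi + pi / 2)\<^sup>2 \<ge> max T (exp 1)" using exists_large_square[of "pi / 2"] pi_gt_zero by (meson half_gt_zero less_imp_le)
      define t where "t = (real n * pi + pi / 2)\<^sup>2"
      have t: "t \<ge> exp 1" "t \<ge> T" using n by (simp_all add: t_def)
      have "sqrt t = real n * pi + pi / 2" unfolding t_def using pi_gt_zero by (simp add: real_sqrt_unique)
      then have "sin (sqrt t) = cos (real n * pi)" by (simp add: sin_add)
      then have "(sin (sqrt t))\<^sup>2 = 1" by (simp add: cos_npi power_mult[symmetric] mult.commute)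
      then have "G t = (1 + ln t) powr (s/2)" by (simp add: G_def)
      then have "G t \<ge> l t" unfolding l_def using exp1_bounds(2)[OF t(1)] s by (simp add: powr_mono2)
      then have "1 / c0 \<le> (G t / c0) / l t" using l[OF t(1)] c0 by (simp add: field_simps)
      then show False using N2(1)[OF t(1)] T[rule_format, OF t(2)] by simp
    qed
    \<comment> \<open>Pointwise the quotient exceeds the desired constant by the factor (1 + 1 / ln
      t)^(s/2). This factor tends to 1, so the limit superior is bounded by \<open>c0\<close> itself
      and not by a larger constant.\<close>
    have b: "\<forall>\<^sub>F t in at_top. ereal (N t / (t powr (s/6) * l t)) \<le> ereal (c0 * (1 + 1 / ln t) powr (s/2))"
      using eventually_ge_at_top[of "exp 1"]
    proof eventually_elim
      case (elim t)
      have L: "ln t \<ge> 1" by (rule exp1_bounds(2)[OF elim])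
      have "ln t * (sin (sqrt t))\<^sup>2 \<le> ln t * 1" using L by (intro mult_left_mono) (auto simp: abs_square_le_1)
      then have "G t \<le> (1 + ln t) powr (s/2)" unfolding G_def using L s by (intro powr_mono2) auto
      also have "1 + ln t = ln t * (1 + 1 / ln t)" using L by (simp add: field_simps)
      also have "(ln t * (1 + 1 / ln t)) powr (s/2) = l t * (1 + 1 / ln t) powr (s/2)" using L by (simp add: powr_mult l_def)
      finally have "c0 * G t / l t \<le> c0 * (1 + 1 / ln t) powr (s/2)" using l[OF elim] c0 by (simp add: pos_divide_le_eq mult.commute mult.left_commute)
      then show ?case using N2(2)[OF elim] by simp
    qed
    have "((\<lambda>t::real. 1 + 1 / ln t) \<longlongrightarrow> 1) at_top" by real_asymp
    then have "((\<lambda>t::real. (1 + 1 / ln t) powr (s/2)) \<longlongrightarrow> 1 powr (s/2)) at_top"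
      by (intro tendsto_powr tendsto_const) auto
    then have "((\<lambda>t. c0 * (1 + 1 / ln t) powr (s/2)) \<longlongrightarrow> c0 * 1) at_top" by (intro tendsto_mult tendsto_const) simp
    then have "((\<lambda>t. ereal (c0 * (1 + 1 / ln t) powr (s/2))) \<longlongrightarrow> ereal c0) at_top" by simp
    then have "Limsup at_top (\<lambda>t. ereal (c0 * (1 + 1 / ln t) powr (s/2))) = ereal c0"
      by (intro lim_imp_Limsup) auto
    then show "Limsup at_top (\<lambda>t. ereal (N t / (t powr (s/6) * l t))) \<le> ereal c0"
      using Limsup_mono[OF b] by simp
  qed
qed

theorem theorem1p5:
  shows "\<exists>\<phi> :: real \<Rightarrow> real.
     (\<exists>\<phi>' \<phi>''. (\<forall>t\<ge>exp 1. (\<phi> has_real_derivative \<phi>' t) (at t within {exp 1..}) \<and>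
                            (\<phi>' has_real_derivative \<phi>'' t) (at t within {exp 1..})) \<and>
                continuous_on {exp 1..} \<phi>'') \<and>
     (\<phi> \<longlongrightarrow> 0) at_top \<and>
     (\<forall>s>0. \<forall>u0. in_Hs s u0 \<and> L2_norm_sq u0 \<noteq> 0 \<longrightarrow>
        (\<exists>c0>1.
           (\<exists>u. is_solution \<phi> (exp 1) u0 u) \<and>
           (\<forall>u. is_solution \<phi> (exp 1) u0 u \<longrightarrow>
              (\<forall>t\<ge>exp 1. in_Hs s (u t) \<and>
                  f_rate t powr (s/2) / c0 \<le> Hs_norm s (u t) \<and>
                  Hs_norm s (u t) \<le> c0 * f_rate t powr (s/2)) \<and>
              Liminf at_top (\<lambda>t. ereal (Hs_norm s (u t) / t powr (s/6)))
                \<in> {ereal (1/c0) .. ereal c0} \<and>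
              Limsup at_top (\<lambda>t. ereal (Hs_norm s (u t) / (t powr (s/6) * ln t powr (s/2))))
                \<in> {ereal (1/c0) .. ereal c0})))"
proof (rule exI[of _ phi], intro conjI phi_C2 phi_tendsto_0 allI impI)
  fix s :: real and u0 assume s: "s > 0" and "in_Hs s u0 \<and> L2_norm_sq u0 \<noteq> 0"
  then obtain k K where k: "k > 0" "K > 0" and ex: "\<exists>u. is_solution phi (exp 1) u0 u"
    and b: "\<forall>u. is_solution phi (exp 1) u0 u \<longrightarrow> (\<forall>t\<ge>exp 1. in_Hs s (u t) \<and>
      k * f_rate t powr (s/2) \<le> Hs_norm s (u t) \<and> Hs_norm s (u t) \<le> K * f_rate t powr (s/2))"
    using growth_two_sided[of s u0] by metis
  \<comment> \<open>One constant for all bounds: 1/k makes its reciprocal at most k,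
    \<open>K\<close> covers the upper bound, and 2 keeps it above 1.\<close>
  define c0 where "c0 = 2 + 1 / k + K"
  have c0: "c0 > 1" "K \<le> c0" using k by (simp_all add: c0_def add_pos_pos less_imp_le)
  have "k * c0 = 2 * k + 1 + k * K" using k by (simp add: c0_def algebra_simps)
  then have "1 \<le> k * c0" using k by (simp add: add_nonneg_nonneg)
  then have c0k: "1 / c0 \<le> k" using c0 by (simp add: divide_le_eq)
  have main: "in_Hs s (u t) \<and> f_rate t powr (s/2) / c0 \<le> Hs_norm s (u t) \<and> Hs_norm s (u t) \<le> c0 * f_rate t powr (s/2)"
    if u: "is_solution phi (exp 1) u0 u" and t: "t \<ge> exp 1" for u t
  proof -
    have "1 / c0 * f_rate t powr (s/2) \<le> k * f_rate t powr (s/2)" "K * f_rate t powr (s/2) \<le> c0 * f_rate t powr (s/2)"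
      by (intro mult_right_mono c0k c0; simp)+
    then show ?thesis using b[rule_format, OF u t] by simp
  qed
  show "\<exists>c0>1. (\<exists>u. is_solution phi (exp 1) u0 u) \<and>
           (\<forall>u. is_solution phi (exp 1) u0 u \<longrightarrow>
              (\<forall>t\<ge>exp 1. in_Hs s (u t) \<and>
                  f_rate t powr (s/2) / c0 \<le> Hs_norm s (u t) \<and>
                  Hs_norm s (u t) \<le> c0 * f_rate t powr (s/2)) \<and>
              Liminf at_top (\<lambda>t. ereal (Hs_norm s (u t) / t powr (s/6)))
                \<in> {ereal (1/c0) .. ereal c0} \<and>
              Limsup at_top (\<lambda>t. ereal (Hs_norm s (u t) / (t powr (s/6) * ln t powr (s/2))))
                \<in> {ereal (1/c0) .. ereal c0})"
  proof (rule exI[of _ c0], intro conjI c0 ex allI impI)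
    fix u assume u: "is_solution phi (exp 1) u0 u"
    show "in_Hs s (u t)" "f_rate t powr (s/2) / c0 \<le> Hs_norm s (u t)" "Hs_norm s (u t) \<le> c0 * f_rate t powr (s/2)"
      if "t \<ge> exp 1" for t using main[OF u that] by auto
    have N: "f_rate t powr (s/2) / c0 \<le> Hs_norm s (u t) \<and> Hs_norm s (u t) \<le> c0 * f_rate t powr (s/2)" if "t \<ge> exp 1" for t
      using main[OF u that] by auto
    show "Liminf at_top (\<lambda>t. ereal (Hs_norm s (u t) / t powr (s/6))) \<in> {ereal (1/c0) .. ereal c0}"
      by (rule Liminf_Limsup_rate(1)[OF s c0(1) N])
    show "Limsup at_top (\<lambda>t. ereal (Hs_norm s (u t) / (t powr (s/6) * ln t powr (s/2)))) \<in> {ereal (1/c0) .. ereal c0}"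
      by (rule Liminf_Limsup_rate(2)[OF s c0(1) N])
  qed
qed

end
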